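(* Given $\beta>0$, $a,b>-1$, and $n\ge1$, let $\alpha_0,\ldots,\alpha_{n-1}$ be independent real random variables with $$\alpha_k\sim\begin{cases}B\left(\frac{\beta k}{4}+a+1,\frac{\beta k}{4}+b+1\right),&k\text{ even},\\ B\left(\frac{\beta(k-1)}{4}+a+b+2,\frac{\beta(k+1)}{4}\right),&k\text{ odd},\end{cases}\qquad 0\le k\le n-1.$$ Then the eigenvalues $z_1,\ldots,z_n$ of the CMV matrix $\mathcal{C}(\alpha_0,\ldots,\alpha_{n-1})$ are distributed in $\mathbb{D}$ with the joint law $$\frac{1}{P_n}\prod_{j,k=1}^n(1-z_j\bar z_k)^{\frac{\beta}{4}-\frac12}\prod_{j=1}^n(1-z_j)^{a+\frac12-\frac{\beta}{4}}(1+z_j)^{b+\frac12-\frac{\beta}{4}}\prod_{j<k}|z_k-z_j|\;|dz_1\wedge dz_2\wedge\cdots\wedge dz_n|,$$ where $$P_n=2^{n(a+b+1)+\frac{\beta}{4}n(n-1)}\prod_{j=0}^{\lfloor\frac{n-1}{2}\rfloor}\frac{\Gamma(a+1+\frac{\beta}{2}j)\,\Gamma(b+1+\frac{\beta}{2}j)}{\Gamma\left(a+b+2+\frac{\beta}{2}\left(\lfloor\frac n2\rfloor+j\right)\right)}\prod_{j=1}^{\lfloor\frac n2\rfloor}\Gamma\left(\tfrac{\beta}{2}j\right).$$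
   Context: $\mathbb{D}=\{z\in\mathbb{C}:|z|<1\}$. For $s,t>0$, $X\sim B(s,t)$ means that $X$ has density $\frac{2^{1-s-t}\Gamma(s+t)}{\Gamma(s)\Gamma(t)}(1-x)^{s-1}(1+x)^{t-1}$ on $(-1,1)$. CMV matrix: given $\alpha_0,\ldots,\alpha_{n-2}\in\mathbb{D}$ and $\alpha_{n-1}\in\overline{\mathbb{D}}$, let $\rho_k=\sqrt{1-|\alpha_k|^2}$, $\Xi_k=\begin{bmatrix}\bar\alpha_k&\rho_k\\\rho_k&-\alpha_k\end{bmatrix}$ for $0\le k\le n-2$, $\Xi_{-1}=[1]$, $\Xi_{n-1}=[\bar\alpha_{n-1}]$. With the $n\times n$ block-diagonal matrices $\mathcal{L}=\operatorname{diag}(\Xi_0,\Xi_2,\ldots)$, $\mathcal{M}=\operatorname{diag}(\Xi_{-1},\Xi_1,\Xi_3,\ldots)$, set $\mathcal{C}(\alpha_0,\ldots,\alpha_{n-1})=\mathcal{L}\mathcal{M}$. The reference measure: for $L,M\ge0$ with $L+2M=n$ let $D_{L,M}$ be the set of tuples $(x_1,\ldots,x_L,x_{L+1}\pm iy_{L+1},\ldots,x_{L+M}\pm iy_{L+M})\in\mathbb{D}^{n}$ with $-1<x_1<\cdots<x_L<1$, $-1<x_{L+1}<\cdots<x_{L+M}<1$ and $y_{L+1},\ldots,y_{L+M}>0$ (all entries in $\mathbb{D}$), and let $D=\bigcup_{L+2M=n}D_{L,M}$. For a function $f$ that is non-negative on $D$ and invariant under permutations of its $n$ arguments, $f(z_1,\ldots,z_n)|dz_1\wedge\cdots\wedge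 dz_n|$ denotes the measure on $D$ whose restriction to $D_{L,M}$ is $2^Mf(x_1,\ldots,x_L,x_{L+1}\pm iy_{L+1},\ldots,x_{L+M}\pm iy_{L+M})\,dx_1\cdots dx_{L+M}\,dy_{L+1}\cdots dy_{L+M}$. (So it is the law of the eigenvalues of a real-spectrum-symmetric matrix, listed as $L$ ordered real eigenvalues and $M$ ordered complex-conjugate pairs.) Powers are principal. *)

theory Defs
  imports
    "HOL-Probability.Probability"
    "Jordan_Normal_Form.Char_Poly"
begin

definition beta_density :: "real \<Rightarrow> real \<Rightarrow> real \<Rightarrow> real" where
  "beta_density s t x =
     (if -1 < x \<and> x < 1
      then 2 powr (1 - s - t) * Gamma (s + t) / (Gamma s * Gamma t)
             * (1 - x) powr (s - 1) * (1 + x) powr (t - 1)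
      else 0)"

definition has_beta_distribution ::
    "'w measure \<Rightarrow> ('w \<Rightarrow> real) \<Rightarrow> real \<Rightarrow> real \<Rightarrow> bool" where
  "has_beta_distribution M X s t \<longleftrightarrow> distributed M lborel X (\<lambda>x. ennreal (beta_density s t x))"

text \<open>The block \<open>\<Xi>\<^sub>k\<close> for \<open>k < n\<close>; the block \<open>\<Xi>\<^sub>-\<^sub>1 = [1]\<close> is the unit matrix
  in the definition of \<open>cmv_M\<close>.\<close>

definition cmv_block :: "nat \<Rightarrow> (nat \<Rightarrow> complex) \<Rightarrow> nat \<Rightarrow> complex mat" where
  "cmv_block n \<alpha> k =
     (if k = n - 1 then mat_of_rows_list 1 [[cnj (\<alpha> k)]]
      else let \<rho> = complex_of_real (sqrt (1 - (cmod (\<alpha> k))\<^sup>2))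
           in mat_of_rows_list 2 [[cnj (\<alpha> k), \<rho>], [\<rho>, - \<alpha> k]])"

definition cmv_L :: "nat \<Rightarrow> (nat \<Rightarrow> complex) \<Rightarrow> complex mat" where
  "cmv_L n \<alpha> = diag_block_mat (map (cmv_block n \<alpha>) (filter even [0..<n]))"

definition cmv_M :: "nat \<Rightarrow> (nat \<Rightarrow> complex) \<Rightarrow> complex mat" where
  "cmv_M n \<alpha> = diag_block_mat (1\<^sub>m 1 # map (cmv_block n \<alpha>) (filter odd [0..<n]))"

definition cmv :: "nat \<Rightarrow> (nat \<Rightarrow> complex) \<Rightarrow> complex mat" where
  "cmv n \<alpha> = cmv_L n \<alpha> * cmv_M n \<alpha>"

lemma cmv_carrier:
  assumes "n \<ge> 1"
  shows "cmv_L n \<alpha> \<in> carrier_mat n n" "cmv_M n \<alpha> \<in> carrier_mat n n" "cmv n \<alpha> \<in> carrier_mat n n"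
proof -
  obtain m where n: "n = Suc m"
    using assms by (cases n) auto
  have blk: "dim_row (cmv_block n \<alpha> k) = (if k = m then 1 else 2)"
    "dim_col (cmv_block n \<alpha> k) = (if k = m then 1 else 2)" for k
    by (auto simp: cmv_block_def n Let_def mat_of_rows_list_def)
  have ev: "(\<Sum>k\<leftarrow>filter even [0..<j]. if k = m then 1 else 2) = (if even j then j else Suc j)"
    and od: "(\<Sum>k\<leftarrow>filter odd [0..<j]. if k = m then 1 else 2) = (if odd j then j - 1 else j)"
    if "j \<le> m" for j :: nat
    using that by (induction j) auto
  have L: "dim_row (cmv_L n \<alpha>) = n" "dim_col (cmv_L n \<alpha>) = n"
    using ev[of m] by (auto simp: cmv_L_def dim_diag_block_mat comp_def blk[unfolded n] n)
  have M: "dim_row (cmv_M n \<alpha>) = n" "dim_col (cmv_M n \<alpha>) = n"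
    using od[of m] by (auto simp: cmv_M_def dim_diag_block_mat comp_def blk[unfolded n] n)
  show "cmv_L n \<alpha> \<in> carrier_mat n n" "cmv_M n \<alpha> \<in> carrier_mat n n" "cmv n \<alpha> \<in> carrier_mat n n"
    using L M by (auto simp: cmv_def)
qed

text \<open>Tuples \<open>(z\<^sub>1, \<dots>, z\<^sub>n)\<close> are extensional functions on \<open>{..<n}\<close>, with the Borel structure of
  \<open>\<complex>\<^sup>n\<close>; all indices start at 0.\<close>

abbreviation tuple_space :: "nat \<Rightarrow> (nat \<Rightarrow> complex) measure" where
  "tuple_space n \<equiv> Pi\<^sub>M {..<n} (\<lambda>_. borel)"

abbreviation param_lebesgue :: "nat \<Rightarrow> nat \<Rightarrow> ((nat \<Rightarrow> real) \<times> (nat \<Rightarrow> real)) measure" where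
  "param_lebesgue L M \<equiv> Pi\<^sub>M {..<L+M} (\<lambda>_. lborel) \<Otimes>\<^sub>M Pi\<^sub>M {L..<L+M} (\<lambda>_. lborel)"

definition param_domain :: "nat \<Rightarrow> nat \<Rightarrow> ((nat \<Rightarrow> real) \<times> (nat \<Rightarrow> real)) set" where
  "param_domain L M = {(x, y) \<in> space (param_lebesgue L M).
     (\<forall>i<L+M. -1 < x i \<and> x i < 1) \<and>
     strict_mono_on {..<L} x \<and> strict_mono_on {L..<L+M} x \<and>
     (\<forall>p\<in>{L..<L+M}. y p > 0 \<and> cmod (Complex (x p) (y p)) < 1)}"

text \<open>The tuple \<open>(x\<^sub>1, \<dots>, x\<^sub>L, x\<^bsub>L+1\<^esub> + i y\<^bsub>L+1\<^esub>, x\<^bsub>L+1\<^esub> - i y\<^bsub>L+1\<^esub>, x\<^bsub>L+2\<^esub> + i y\<^bsub>L+2\<^esub>, \<dots>)\<close>.\<close>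

definition param_tuple ::
    "nat \<Rightarrow> nat \<Rightarrow> (nat \<Rightarrow> real) \<times> (nat \<Rightarrow> real) \<Rightarrow> (nat \<Rightarrow> complex)" where
  "param_tuple L M = (\<lambda>(x, y). \<lambda>i\<in>{..<L+2*M}.
     if i < L then complex_of_real (x i)
     else let p = L + (i - L) div 2
          in if even (i - L) then Complex (x p) (y p) else Complex (x p) (- y p))"

definition D_component :: "nat \<Rightarrow> nat \<Rightarrow> (nat \<Rightarrow> complex) set" where
  "D_component L M = param_tuple L M ` param_domain L M"

definition D_domain :: "nat \<Rightarrow> (nat \<Rightarrow> complex) set" where
  "D_domain n = (\<Union>(L, M)\<in>{(L, M). L + 2 * M = n}. D_component L M)"

text \<open>The measure \<open>|dz\<^sub>1 \<and> \<cdots> \<and> dz\<^sub>n|\<close>, extended by zero from \<open>D\<close> to all of \<open>\<complex>\<^sup>n\<close>: the sum over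
  \<open>L + 2 M = n\<close> of the images of \<open>2\<^sup>M dx\<^sub>1 \<cdots> dx\<^bsub>L+M\<^esub> dy\<^bsub>L+1\<^esub> \<cdots> dy\<^bsub>L+M\<^esub>\<close> on \<open>D\<^bsub>L,M\<^esub>\<close>.
  The measure \<open>f(z\<^sub>1, \<dots>, z\<^sub>n) |dz\<^sub>1 \<and> \<cdots> \<and> dz\<^sub>n|\<close> is the one with density \<open>f\<close>
  with respect to it.\<close>

definition wedge_measure :: "nat \<Rightarrow> (nat \<Rightarrow> complex) measure" where
  "wedge_measure n = measure_of (space (tuple_space n)) (sets (tuple_space n))
     (\<lambda>A. \<Sum>(L, M)\<in>{(L, M). L + 2 * M = n}.
        2 ^ M * emeasure (param_lebesgue L M) {v \<in> param_domain L M. param_tuple L M v \<in> A})"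

lemma param_domain_sets: "param_domain L M \<in> sets (param_lebesgue L M)"
proof -
  let ?N = "param_lebesgue L M"
  have x: "(\<lambda>v. fst v i) \<in> borel_measurable ?N" if "i < L + M" for i
    using measurable_compose[OF measurable_fst measurable_component_singleton[of i "{..<L+M}" "\<lambda>_. lborel"]]
      that by simp
  have y: "(\<lambda>v. snd v p) \<in> borel_measurable ?N" if "p \<in> {L..<L+M}" for p
    using measurable_compose[OF measurable_snd measurable_component_singleton[of p "{L..<L+M}" "\<lambda>_. lborel"]]
      that by simp
  have eq: "param_domain L M = {v \<in> space ?N.
      (\<forall>i\<in>{..<L+M}. -1 < fst v i \<and> fst v i < 1) \<and>
      (\<forall>i\<in>{..<L}. \<forall>j\<in>{i<..<L}. fst v i < fst v j) \<and>
      (\<forall>i\<in>{L..<L+M}. \<forall>j\<in>{i<..<L+M}. fst v i < fst v j) \<and>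
      (\<forall>p\<in>{L..<L+M}. 0 < snd v p \<and> sqrt ((fst v p)\<^sup>2 + (snd v p)\<^sup>2) < 1)}"
    unfolding param_domain_def strict_mono_on_def by (auto simp: cmod_def Ball_def)
  have 1: "{v \<in> space ?N. -1 < fst v i \<and> fst v i < 1} \<in> sets ?N" if "i < L + M" for i
    using x[OF that] by measurable
  have 2: "{v \<in> space ?N. fst v i < fst v j} \<in> sets ?N" if "i < L + M" "j < L + M" for i j
    using x[OF that(1)] x[OF that(2)] by measurable
  have 3: "{v \<in> space ?N. 0 < snd v p \<and> sqrt ((fst v p)\<^sup>2 + (snd v p)\<^sup>2) < 1} \<in> sets ?N"
    if "p \<in> {L..<L+M}" for p
  proof -
    have "p < L + M" using that by simp
    from x[OF this] y[OF that] show ?thesis by measurable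
  qed
  show ?thesis
    unfolding eq by (intro sets.sets_Collect_conj sets.sets_Collect_finite_All 1 2 3) auto
qed

lemma param_tuple_measurable:
  "param_tuple L M \<in> param_lebesgue L M \<rightarrow>\<^sub>M tuple_space (L + 2 * M)"
proof -
  let ?N = "param_lebesgue L M"
  have x: "(\<lambda>v. fst v i) \<in> borel_measurable ?N" if "i < L + M" for i
    using measurable_compose[OF measurable_fst measurable_component_singleton[of i "{..<L+M}" "\<lambda>_. lborel"]]
      that by simp
  have y: "(\<lambda>v. snd v p) \<in> borel_measurable ?N" if "p \<in> {L..<L+M}" for p
    using measurable_compose[OF measurable_snd measurable_component_singleton[of p "{L..<L+M}" "\<lambda>_. lborel"]]
      that by simp
  have [measurable]: "(\<lambda>v. Complex (f v) (g v)) \<in> borel_measurable ?N"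
    if "f \<in> borel_measurable ?N" "g \<in> borel_measurable ?N" for f g
    unfolding Complex_eq using that by measurable
  show ?thesis
    unfolding param_tuple_def case_prod_beta
  proof (intro measurable_restrict)
    fix i assume i: "i \<in> {..<L + 2 * M}"
    show "(\<lambda>v. if i < L then complex_of_real (fst v i)
       else let p = L + (i - L) div 2
            in if even (i - L) then Complex (fst v p) (snd v p) else Complex (fst v p) (- snd v p))
       \<in> borel_measurable ?N"
    proof (cases "i < L")
      case True
      then show ?thesis using x[of i] by simp
    next
      case False
      define p where "p = L + (i - L) div 2"
      have p: "p < L + M" "p \<in> {L..<L+M}" using i False by (auto simp: p_def)
      have "(\<lambda>v. if even (i - L) then Complex (fst v p) (snd v p) else Complex (fst v p) (- snd v p))
         \<in> borel_measurable ?N"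
        using x[OF p(1)] y[OF p(2)] by (cases "even (i - L)") auto
      then show ?thesis using False by (simp only: Let_def p_def[symmetric] if_False)
    qed
  qed
qed

lemma
  shows space_wedge_measure: "space (wedge_measure n) = space (tuple_space n)"
    and sets_wedge_measure: "sets (wedge_measure n) = sets (tuple_space n)"
    and emeasure_wedge_measure: "A \<in> sets (tuple_space n) \<Longrightarrow>
      emeasure (wedge_measure n) A = (\<Sum>(L, M)\<in>{(L, M). L + 2 * M = n}.
        2 ^ M * emeasure (param_lebesgue L M) {v \<in> param_domain L M. param_tuple L M v \<in> A})"
proof -
  show sp: "space (wedge_measure n) = space (tuple_space n)"
    unfolding wedge_measure_def by (rule space_measure_of[OF sets.space_closed])
  show st: "sets (wedge_measure n) = sets (tuple_space n)"
    unfolding wedge_measure_def by (rule sets.sets_measure_of_eq)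
  let ?S = "{(L, M). L + 2 * M = n}"
  let ?\<mu> = "\<lambda>A. \<Sum>(L, M)\<in>?S.
        2 ^ M * emeasure (param_lebesgue L M) {v \<in> param_domain L M. param_tuple L M v \<in> A}"
  have pre: "{v \<in> param_domain L M. param_tuple L M v \<in> B} \<in> sets (param_lebesgue L M)"
    if "B \<in> sets (tuple_space n)" "L + 2 * M = n" for B L M
  proof -
    have "param_tuple L M -` B \<inter> space (param_lebesgue L M) \<in> sets (param_lebesgue L M)"
      using param_tuple_measurable[of L M] that by (auto intro: measurable_sets)
    from sets.Int[OF param_domain_sets this] show ?thesis
      by (rule back_subst[where P = "\<lambda>X. X \<in> sets (param_lebesgue L M)"])
        (auto simp: param_domain_def)
  qed
  have "countably_additive (sets (tuple_space n)) ?\<mu>"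
  proof (rule countably_additiveI)
    fix F :: "nat \<Rightarrow> (nat \<Rightarrow> complex) set"
    assume F: "range F \<subseteq> sets (tuple_space n)" "disjoint_family F"
      "(\<Union>i. F i) \<in> sets (tuple_space n)"
    have comp: "(\<Sum>i. 2 ^ M * emeasure (param_lebesgue L M) {v \<in> param_domain L M. param_tuple L M v \<in> F i})
       = 2 ^ M * emeasure (param_lebesgue L M) {v \<in> param_domain L M. param_tuple L M v \<in> (\<Union>i. F i)}"
      if "L + 2 * M = n" for L M
    proof -
      have "(\<Sum>i. emeasure (param_lebesgue L M) {v \<in> param_domain L M. param_tuple L M v \<in> F i})
        = emeasure (param_lebesgue L M) (\<Union>i. {v \<in> param_domain L M. param_tuple L M v \<in> F i})"
        using F pre that by (intro suminf_emeasure) (auto simp: disjoint_family_on_def)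
      also have "(\<Union>i. {v \<in> param_domain L M. param_tuple L M v \<in> F i})
          = {v \<in> param_domain L M. param_tuple L M v \<in> (\<Union>i. F i)}"
        by auto
      finally show ?thesis by (subst ennreal_suminf_cmult) simp
    qed
    show "(\<Sum>i. ?\<mu> (F i)) = ?\<mu> (\<Union>i. F i)"
      by (subst suminf_sum) (auto intro!: sum.cong simp: comp[simplified] case_prod_beta)
  qed
  moreover have "positive (sets (tuple_space n)) ?\<mu>"
    by (simp add: positive_def case_prod_beta)
  ultimately show "emeasure (wedge_measure n) A = ?\<mu> A" if "A \<in> sets (tuple_space n)"
    using that unfolding wedge_measure_def by (intro emeasure_measure_of_sigma sets.sigma_algebra_axioms)
qed

definition lists_eigenvalues :: "nat \<Rightarrow> complex mat \<Rightarrow> (nat \<Rightarrow> complex) \<Rightarrow> bool" where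
  "lists_eigenvalues n A z \<longleftrightarrow> char_poly A = (\<Prod>i<n. [:- z i, 1:])"

text \<open>The eigenvalues of \<open>A\<close>, with algebraic multiplicity, in the order used in \<open>D\<close>. The value
  \<open>(0, \<dots>, 0)\<close> is a dummy for matrices whose eigenvalues do not form a point of \<open>D\<close>.\<close>

definition eigenvalue_tuple :: "nat \<Rightarrow> complex mat \<Rightarrow> (nat \<Rightarrow> complex)" where
  "eigenvalue_tuple n A =
     (if \<exists>z\<in>D_domain n. lists_eigenvalues n A z
      then THE z. z \<in> D_domain n \<and> lists_eigenvalues n A z
      else (\<lambda>i\<in>{..<n}. 0))"

definition P_const :: "real \<Rightarrow> real \<Rightarrow> real \<Rightarrow> nat \<Rightarrow> real" where
  "P_const \<beta> a b n =
     2 powr (real n * (a + b + 1) + \<beta> / 4 * real n * (real n - 1))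
     * (\<Prod>j = 0..(n - 1) div 2. Gamma (a + 1 + \<beta> / 2 * real j) * Gamma (b + 1 + \<beta> / 2 * real j)
          / Gamma (a + b + 2 + \<beta> / 2 * (real (n div 2) + real j)))
     * (\<Prod>j = 1..n div 2. Gamma (\<beta> / 2 * real j))"

definition joint_density ::
    "real \<Rightarrow> real \<Rightarrow> real \<Rightarrow> nat \<Rightarrow> (nat \<Rightarrow> complex) \<Rightarrow> complex" where
  "joint_density \<beta> a b n z =
     1 / complex_of_real (P_const \<beta> a b n)
     * (\<Prod>j<n. \<Prod>k<n. (1 - z j * cnj (z k)) powr complex_of_real (\<beta> / 4 - 1 / 2))
     * (\<Prod>j<n. (1 - z j) powr complex_of_real (a + 1 / 2 - \<beta> / 4)
               * (1 + z j) powr complex_of_real (b + 1 / 2 - \<beta> / 4))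
     * complex_of_real (\<Prod>k<n. \<Prod>j<k. cmod (z k - z j))"

end

theory Submission
  imports Defs "HOL-Complex_Analysis.Cauchy_Integral_Theorem"
begin


(* @@@ d1/A *)

lemma nn_integral_injective_change_of_variables:
  fixes \<phi> :: "'a::euclidean_space \<Rightarrow> 'a" and J :: "'a \<Rightarrow> real"
  assumes [measurable]: "S \<in> sets borel" "T \<in> sets borel"
    "\<phi> \<in> borel_measurable borel" "J \<in> borel_measurable borel" "F \<in> borel_measurable borel"
    and sub: "\<phi> ` S \<subseteq> T" and neg: "negligible (T - \<phi> ` S)"
    and cov: "\<And>X m. X \<in> sets lebesgue \<Longrightarrow> X \<subseteq> S \<Longrightarrow>
      \<phi> ` X \<in> lmeasurable \<and> measure lebesgue (\<phi> ` X) = m \<longleftrightarrow> ((\<lambda>x. \<bar>J x\<bar>) has_integral m) X"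
  shows "(\<integral>\<^sup>+x. F (\<phi> x) * ennreal \<bar>J x\<bar> * indicator S x \<partial>lborel) = (\<integral>\<^sup>+v. F v * indicator T v \<partial>lborel)"
proof -
  let ?\<mu> = "distr (density lborel (\<lambda>x. ennreal \<bar>J x\<bar> * indicator S x)) borel \<phi>"
  let ?\<nu> = "density lborel (indicator T :: 'a \<Rightarrow> ennreal)"
  have bdd: "emeasure ?\<mu> A = emeasure ?\<nu> A" if A[measurable]: "A \<in> sets borel" "bounded A" for A
  proof -
    define X where "X = S \<inter> \<phi> -` A"
    have X[measurable]: "X \<in> sets borel"
      unfolding X_def using measurable_sets[of \<phi> borel borel A] by simp
    have im: "\<phi> ` X = \<phi> ` S \<inter> A" unfolding X_def by auto
    have eq: "\<phi> ` X = (T \<inter> A) - (T - \<phi> ` S)" unfolding im using sub by auto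
    have bT: "bounded (T \<inter> A)" using A by (meson Int_lower2 bounded_subset)
    have lm: "T \<inter> A \<in> lmeasurable"
      using bT A by (intro bounded_set_imp_lmeasurable) auto
    have nl: "negligible ((T - \<phi> ` S) \<inter> A)"
      using neg by (rule negligible_subset) auto
    have "(T \<inter> A) - ((T - \<phi> ` S) \<inter> A) \<in> lmeasurable"
      using lm nl by (intro fmeasurable_Diff) (auto simp: negligible_iff_null_sets null_setsD2)
    moreover have "(T \<inter> A) - ((T - \<phi> ` S) \<inter> A) = \<phi> ` X" using eq by auto
    ultimately have lmX: "\<phi> ` X \<in> lmeasurable" by simp
    have nd: "negligible ((T \<inter> A - \<phi> ` X) \<union> (\<phi> ` X - T \<inter> A))"
      using nl by (rule negligible_subset) (auto simp: eq)
    have "measure lebesgue (T \<inter> A) = measure lebesgue (\<phi> ` X)"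
      using lm nd by (rule measure_negligible_symdiff[symmetric])
    then have mX: "measure lebesgue (\<phi> ` X) = measure lborel (T \<inter> A)"
      by (simp add: measure_completion)
    have "((\<lambda>x. \<bar>J x\<bar>) has_integral measure lebesgue (\<phi> ` X)) X"
      using cov[of X "measure lebesgue (\<phi> ` X)"] lmX by (auto simp: X_def[symmetric]) (auto simp: X_def)
    from nn_integral_has_integral_lebesgue'[OF _ this]
    have "(\<integral>\<^sup>+x. ennreal \<bar>J x\<bar> * indicator X x \<partial>lborel) = ennreal (measure lborel (T \<inter> A))"
      using mX by simp
    also have "\<dots> = emeasure lborel (T \<inter> A)"
      using emeasure_bounded_finite[OF bT] by (subst emeasure_eq_ennreal_measure) (auto simp: less_top)
    also have "\<dots> = (\<integral>\<^sup>+x. indicator (T \<inter> A) x \<partial>lborel)"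
      by (rule nn_integral_indicator[symmetric]) auto
    also have "\<dots> = emeasure ?\<nu> A"
      by (subst emeasure_density) (simp, simp, rule nn_integral_cong, simp add: indicator_def)
    finally have "emeasure ?\<nu> A = (\<integral>\<^sup>+x. ennreal \<bar>J x\<bar> * indicator X x \<partial>lborel)" by simp
    moreover have "emeasure ?\<mu> A = (\<integral>\<^sup>+x. ennreal \<bar>J x\<bar> * indicator X x \<partial>lborel)"
      by (subst emeasure_distr, simp, simp, subst emeasure_density) (use measurable_sets[of \<phi> borel borel A] in \<open>auto simp: X_def indicator_def intro!: nn_integral_cong\<close>)
    ultimately show ?thesis by simp
  qed
  have "?\<mu> = ?\<nu>"
  proof (rule measure_eqI_generator_eq[where \<Omega> = UNIV and E = "range (\<lambda>(a, b). box a b)" and A = "\<lambda>n. box (- (real n *\<^sub>R One)) (real n *\<^sub>R One)"])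
    show "Int_stable (range (\<lambda>(a, b). box a b :: 'a set))"
      unfolding Int_stable_def box_Int_box by (clarsimp simp: box_Int_box) blast
    show "sets ?\<mu> = sigma_sets UNIV (range (\<lambda>(a, b). box a b))"
      "sets ?\<nu> = sigma_sets UNIV (range (\<lambda>(a, b). box a b))"
      by (simp_all add: borel_eq_box)
    show "(\<Union>i. box (- (real i *\<^sub>R One)) (real i *\<^sub>R One) :: 'a set) = UNIV"
      by (rule UN_box_eq_UNIV)
    fix i
    let ?B = "box (- (real i *\<^sub>R One)) (real i *\<^sub>R One) :: 'a set"
    have "emeasure ?\<nu> ?B = (\<integral>\<^sup>+x. indicator T x * indicator ?B x \<partial>lborel)"
      by (subst emeasure_density) auto
    also have "\<dots> \<le> (\<integral>\<^sup>+x. indicator ?B x \<partial>lborel)"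
      by (intro nn_integral_mono) (auto simp: indicator_def)
    also have "\<dots> = emeasure lborel ?B" by (rule nn_integral_indicator) auto
    also have "\<dots> < \<infinity>"
      by (intro emeasure_bounded_finite bounded_box)
    finally show "emeasure ?\<mu> ?B \<noteq> \<infinity>"
      by (subst bdd) (auto simp: bounded_box)
  qed (auto intro!: bdd bounded_box)
  then have "(\<integral>\<^sup>+v. F v \<partial>?\<mu>) = (\<integral>\<^sup>+v. F v \<partial>?\<nu>)" by simp
  then show ?thesis
    by (simp add: nn_integral_distr nn_integral_density mult_ac)
qed


lemma nn_integral_injective_substitution_real:
  fixes \<phi> J :: "real \<Rightarrow> real"
  assumes "S \<in> sets borel" "T \<in> sets borel"
    "\<phi> \<in> borel_measurable borel" "J \<in> borel_measurable borel" "F \<in> borel_measurable borel"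
    and "\<phi> ` S \<subseteq> T" "negligible (T - \<phi> ` S)"
    and inj: "inj_on \<phi> S" and der: "\<And>x. x \<in> S \<Longrightarrow> (\<phi> has_field_derivative J x) (at x)"
  shows "(\<integral>\<^sup>+x. F (\<phi> x) * ennreal \<bar>J x\<bar> * indicator S x \<partial>lborel) = (\<integral>\<^sup>+v. F v * indicator T v \<partial>lborel)"
proof (rule nn_integral_injective_change_of_variables)
  fix X :: "real set" and m :: real assume X: "X \<in> sets lebesgue" "X \<subseteq> S"
  have "(\<lambda>x. \<bar>J x\<bar> *\<^sub>R (1::real)) absolutely_integrable_on X \<and> integral X (\<lambda>x. \<bar>J x\<bar> *\<^sub>R (1::real)) = m
     \<longleftrightarrow> (\<lambda>_. 1::real) absolutely_integrable_on (\<phi> ` X) \<and> integral (\<phi> ` X) (\<lambda>_. 1::real) = m"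
    using X der inj by (intro has_absolute_integral_change_of_variables_real)
      (auto intro: inj_on_subset has_field_derivative_at_within)
  moreover have "(\<lambda>x. \<bar>J x\<bar> *\<^sub>R (1::real)) absolutely_integrable_on X \<longleftrightarrow> (\<lambda>x. \<bar>J x\<bar>) integrable_on X"
    by (subst absolutely_integrable_on_iff_nonneg) auto
  moreover have "(\<lambda>_. 1::real) absolutely_integrable_on (\<phi> ` X) \<longleftrightarrow> \<phi> ` X \<in> lmeasurable"
    by (subst absolutely_integrable_on_iff_nonneg) (auto simp: lmeasurable_iff_integrable_on)
  ultimately show "\<phi> ` X \<in> lmeasurable \<and> measure lebesgue (\<phi> ` X) = m \<longleftrightarrow> ((\<lambda>x. \<bar>J x\<bar>) has_integral m) X"
    by (auto simp: has_integral_iff lmeasure_integral)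
qed (use assms in auto)

abbreviation vec2 :: "real \<Rightarrow> real \<Rightarrow> real^2" where
  "vec2 s t \<equiv> vector [s, t]"

abbreviation cx :: "real^2 \<Rightarrow> real" where "cx p \<equiv> vec_nth p 1"

abbreviation cy :: "real^2 \<Rightarrow> real" where "cy p \<equiv> vec_nth p 2"

lemma vec2_eq_axis: "vec2 s t = s *\<^sub>R axis 1 1 + t *\<^sub>R axis 2 1"
  by (simp add: Finite_Cartesian_Product.vec_eq_iff forall_2 axis_def)

lemma nn_integral_vec2:
  fixes h :: "real^2 \<Rightarrow> ennreal"
  assumes [measurable]: "h \<in> borel_measurable borel"
  shows "(\<integral>\<^sup>+x. h x \<partial>lborel) = (\<integral>\<^sup>+s. \<integral>\<^sup>+t. h (vec2 s t) \<partial>lborel \<partial>lborel)"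
proof -
  have cont: "continuous_on UNIV (\<lambda>p::real\<times>real. vec2 (fst p) (snd p))"
    unfolding vec2_eq_axis by (intro continuous_intros)
  have m[measurable]: "(\<lambda>p::real\<times>real. vec2 (fst p) (snd p)) \<in> borel_measurable borel"
    by (rule borel_measurable_continuous_onI[OF cont])
  have "lborel = distr (lborel :: (real\<times>real) measure) borel (\<lambda>p. vec2 (fst p) (snd p))"
  proof (rule lborel_eqI)
    fix l u :: "real^2" assume lu: "\<And>b. b \<in> Basis \<Longrightarrow> l \<bullet> b \<le> u \<bullet> b"
    have vm: "(\<lambda>p. vec2 (fst p) (snd p)) -` box l u = box (cx l) (cx u) \<times> box (cy l) (cy u)"
      by (auto simp: mem_box_cart forall_2)
    have le: "cx l \<le> cx u" "cy l \<le> cy u" 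
      using lu[of "axis 1 1"] lu[of "axis 2 1"] by (auto simp: Basis_vec_def inner_axis)
    have B: "Basis = {axis 1 1, axis 2 1 :: real^2}" by (auto simp: Basis_vec_def UNIV_2)
    have ne: "axis 1 1 \<noteq> (axis 2 1 :: real^2)" by (simp add: axis_eq_axis)
    show "emeasure (distr lborel borel (\<lambda>p. vec2 (fst p) (snd p))) (box l u) = (\<Prod>b\<in>Basis. (u - l) \<bullet> b)"
    proof -
      have "emeasure (distr lborel borel (\<lambda>p. vec2 (fst p) (snd p))) (box l u)
        = emeasure (lborel \<Otimes>\<^sub>M lborel) (box (cx l) (cx u) \<times> box (cy l) (cy u))"
        by (subst emeasure_distr) (simp_all add: vm lborel_prod)
      also have "\<dots> = (\<Prod>b\<in>Basis. (u - l) \<bullet> b)"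
        using le ne by (simp add: lborel.emeasure_pair_measure_Times B inner_axis ennreal_mult')
      finally show ?thesis .
    qed
  qed simp
  then have "(\<integral>\<^sup>+x. h x \<partial>lborel) = (\<integral>\<^sup>+x. h x \<partial>distr (lborel :: (real\<times>real) measure) borel (\<lambda>p. vec2 (fst p) (snd p)))"
    by simp
  also have "\<dots> = (\<integral>\<^sup>+p. h (vec2 (fst p) (snd p)) \<partial>(lborel :: (real\<times>real) measure))"
    by (subst nn_integral_distr) auto
  also have "\<dots> = (\<integral>\<^sup>+p. h (vec2 (fst p) (snd p)) \<partial>(lborel \<Otimes>\<^sub>M lborel))"
    by (simp add: lborel_prod)
  also have "\<dots> = (\<integral>\<^sup>+s. \<integral>\<^sup>+t. h (vec2 s t) \<partial>lborel \<partial>lborel)"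
    by (subst lborel.nn_integral_fst[symmetric]) (auto simp: lborel_prod)
  finally show ?thesis .
qed

text \<open>2D\<close>
lemma nn_integral_injective_substitution_plane:
  fixes \<psi>1 \<psi>2 J :: "real \<Rightarrow> real \<Rightarrow> real" and F :: "real \<Rightarrow> real \<Rightarrow> ennreal"
    and a11 a12 a21 a22 :: "real \<Rightarrow> real \<Rightarrow> real"
  assumes S[measurable]: "Measurable.pred borel (\<lambda>p. S (fst p) (snd p))" and T[measurable]: "Measurable.pred borel (\<lambda>p. T (fst p) (snd p))"
    and [measurable]: "(\<lambda>p. \<psi>1 (fst p) (snd p)) \<in> borel_measurable borel"
      "(\<lambda>p. \<psi>2 (fst p) (snd p)) \<in> borel_measurable borel" "(\<lambda>p. J (fst p) (snd p)) \<in> borel_measurable borel"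
      "(\<lambda>p. F (fst p) (snd p)) \<in> borel_measurable borel"
    and sub: "\<And>s t. S s t \<Longrightarrow> T (\<psi>1 s t) (\<psi>2 s t)"
    and N: "negligible {p. N (cx p) (cy p)}"
    and sup: "\<And>u v. T u v \<Longrightarrow> \<exists>s t. (S s t \<or> N s t \<and> D s t) \<and> u = \<psi>1 s t \<and> v = \<psi>2 s t"
    and inj: "\<And>s t s' t'. S s t \<Longrightarrow> S s' t' \<Longrightarrow> \<psi>1 s t = \<psi>1 s' t' \<Longrightarrow> \<psi>2 s t = \<psi>2 s' t' \<Longrightarrow> s = s' \<and> t = t'"
    and SD: "\<And>s t. S s t \<Longrightarrow> D s t"
    and der1: "\<And>s t. D s t \<Longrightarrow> ((\<lambda>p. \<psi>1 (fst p) (snd p)) has_derivative (\<lambda>h. a11 s t * fst h + a12 s t * snd h)) (at (s, t))"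
    and der2: "\<And>s t. D s t \<Longrightarrow> ((\<lambda>p. \<psi>2 (fst p) (snd p)) has_derivative (\<lambda>h. a21 s t * fst h + a22 s t * snd h)) (at (s, t))"
    and J: "\<And>s t. S s t \<Longrightarrow> J s t = a11 s t * a22 s t - a12 s t * a21 s t"
  shows "(\<integral>\<^sup>+s. \<integral>\<^sup>+t. F (\<psi>1 s t) (\<psi>2 s t) * ennreal \<bar>J s t\<bar> * indicator {p. S (fst p) (snd p)} (s, t) \<partial>lborel \<partial>lborel)
    = (\<integral>\<^sup>+u. \<integral>\<^sup>+v. F u v * indicator {p. T (fst p) (snd p)} (u, v) \<partial>lborel \<partial>lborel)"
proof -
  define \<phi> where "\<phi> = (\<lambda>p::real^2. vec2 (\<psi>1 (cx p) (cy p)) (\<psi>2 (cx p) (cy p)))"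
  define \<phi>' where "\<phi>' = (\<lambda>(p::real^2) (h::real^2). vec2 (a11 (cx p) (cy p) * cx h + a12 (cx p) (cy p) * cy h) (a21 (cx p) (cy p) * cx h + a22 (cx p) (cy p) * cy h))"
  define pr where "pr = (\<lambda>p::real^2. (cx p, cy p))"
  have pr[measurable]: "pr \<in> borel_measurable borel"
    unfolding pr_def by (intro borel_measurable_continuous_onI continuous_intros)
  have m2: "(\<lambda>p::real\<times>real. vec2 (fst p) (snd p)) \<in> borel_measurable borel"
    unfolding vec2_eq_axis by (intro borel_measurable_continuous_onI continuous_intros)
  have comp: "(\<lambda>p::real^2. g (cx p) (cy p)) \<in> borel \<rightarrow>\<^sub>M M" if "(\<lambda>p. g (fst p) (snd p)) \<in> borel \<rightarrow>\<^sub>M M" for g :: "real \<Rightarrow> real \<Rightarrow> 'x" and M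
    using measurable_compose[OF pr that] by (simp add: pr_def)
  have [measurable]: "\<phi> \<in> borel_measurable borel"
  proof -
    have "(\<lambda>p::real^2. (\<psi>1 (cx p) (cy p), \<psi>2 (cx p) (cy p))) \<in> borel_measurable borel"
      by (intro borel_measurable_Pair comp) auto
    from measurable_compose[OF this m2] show ?thesis by (simp add: \<phi>_def)
  qed
  have der: "(\<phi> has_derivative \<phi>' p) (at p)" if "D (cx p) (cy p)" for p
  proof -
    have prd: "(pr has_derivative pr) (at p)"
      unfolding pr_def by (auto intro!: derivative_eq_intros bounded_linear.has_derivative[OF bounded_linear_vec_nth])
    have 1: "((\<lambda>p::real^2. \<psi>1 (cx p) (cy p)) has_derivative (\<lambda>h. a11 (cx p) (cy p) * cx h + a12 (cx p) (cy p) * cy h)) (at p)"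
      using has_derivative_compose[OF prd[unfolded pr_def] der1[OF that]] by simp
    have 2: "((\<lambda>p::real^2. \<psi>2 (cx p) (cy p)) has_derivative (\<lambda>h. a21 (cx p) (cy p) * cx h + a22 (cx p) (cy p) * cy h)) (at p)"
      using has_derivative_compose[OF prd[unfolded pr_def] der2[OF that]] by simp
    show ?thesis unfolding \<phi>_def \<phi>'_def vec2_eq_axis
      by (intro derivative_intros 1 2)
  qed
  have "(\<integral>\<^sup>+p. F (cx (\<phi> p)) (cy (\<phi> p)) * ennreal \<bar>J (cx p) (cy p)\<bar> * indicator {p. S (cx p) (cy p)} p \<partial>lborel)
     = (\<integral>\<^sup>+p. F (cx p) (cy p) * indicator {p. T (cx p) (cy p)} p \<partial>lborel)"
  proof (rule nn_integral_injective_change_of_variables)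
    show "{p::real^2. S (cx p) (cy p)} \<in> sets borel" "{p::real^2. T (cx p) (cy p)} \<in> sets borel"
      using comp[OF S] comp[OF T] by (simp_all add: pred_def)
    show "(\<lambda>p::real^2. J (cx p) (cy p)) \<in> borel_measurable borel" "(\<lambda>p::real^2. F (cx p) (cy p)) \<in> borel_measurable borel"
      by (rule comp; measurable)+
    show "\<phi> ` {p. S (cx p) (cy p)} \<subseteq> {p. T (cx p) (cy p)}"
      using sub by (auto simp: \<phi>_def)
    show "negligible ({p. T (cx p) (cy p)} - \<phi> ` {p. S (cx p) (cy p)})"
    proof (rule negligible_subset)
      show "negligible (\<phi> ` {p. N (cx p) (cy p) \<and> D (cx p) (cy p)})"
      proof (rule negligible_differentiable_image_negligible)
        show "negligible {p::real^2. N (cx p) (cy p) \<and> D (cx p) (cy p)}"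
          by (rule negligible_subset[OF N]) auto
        show "\<phi> differentiable_on {p. N (cx p) (cy p) \<and> D (cx p) (cy p)}"
          using der by (auto simp: differentiable_on_def differentiable_def intro: has_derivative_at_withinI)
      qed simp
      show "{p. T (cx p) (cy p)} - \<phi> ` {p. S (cx p) (cy p)} \<subseteq> \<phi> ` {p. N (cx p) (cy p) \<and> D (cx p) (cy p)}"
      proof
        fix p assume p: "p \<in> {p. T (cx p) (cy p)} - \<phi> ` {p. S (cx p) (cy p)}"
        then obtain s t where st: "S s t \<or> N s t \<and> D s t" "cx p = \<psi>1 s t" "cy p = \<psi>2 s t" using sup by blast
        then have "p = \<phi> (vec2 s t)" by (simp add: \<phi>_def Finite_Cartesian_Product.vec_eq_iff forall_2)
        then show "p \<in> \<phi> ` {p. N (cx p) (cy p) \<and> D (cx p) (cy p)}"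
          using p st by force
      qed
    qed
    fix X :: "(real^2) set" and m :: real assume X: "X \<in> sets lebesgue" "X \<subseteq> {p. S (cx p) (cy p)}"
    have "\<phi> ` X \<in> lmeasurable \<and> measure lebesgue (\<phi> ` X) = m
      \<longleftrightarrow> ((\<lambda>x. \<bar>Determinants.det (matrix (\<phi>' x))\<bar>) has_integral m) X"
    proof (rule has_measure_differentiable_image[OF X(1)])
      show "(\<phi> has_derivative \<phi>' x) (at x within X)" if "x \<in> X" for x
        using der[of x] SD X that by (auto intro: has_derivative_at_withinI)
      show "inj_on \<phi> X"
      proof (rule inj_onI)
        fix p q assume pq: "p \<in> X" "q \<in> X" "\<phi> p = \<phi> q"
        then have "\<psi>1 (cx p) (cy p) = \<psi>1 (cx q) (cy q)" "\<psi>2 (cx p) (cy p) = \<psi>2 (cx q) (cy q)"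
          by (auto simp: \<phi>_def Finite_Cartesian_Product.vec_eq_iff forall_2)
        with pq X inj[of "cx p" "cy p" "cx q" "cy q"] show "p = q"
          by (auto simp: Finite_Cartesian_Product.vec_eq_iff forall_2)
      qed
    qed
    also have "\<dots> \<longleftrightarrow> ((\<lambda>x. \<bar>J (cx x) (cy x)\<bar>) has_integral m) X"
    proof (rule has_integral_cong)
      fix x assume "x \<in> X"
      then have "S (cx x) (cy x)" using X by auto
      then show "\<bar>Determinants.det (matrix (\<phi>' x))\<bar> = \<bar>J (cx x) (cy x)\<bar>"
        by (simp add: J Determinants.det_2 matrix_def \<phi>'_def axis_def)
    qed
    finally show "\<phi> ` X \<in> lmeasurable \<and> measure lebesgue (\<phi> ` X) = m
      \<longleftrightarrow> ((\<lambda>x. \<bar>J (cx x) (cy x)\<bar>) has_integral m) X" .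
  qed simp
  moreover have "(\<lambda>p. F (cx (\<phi> p)) (cy (\<phi> p)) * ennreal \<bar>J (cx p) (cy p)\<bar> * indicator {p. S (cx p) (cy p)} p) \<in> borel_measurable borel"
  proof -
    have "(\<lambda>p::real^2. F (cx (\<phi> p)) (cy (\<phi> p))) \<in> borel_measurable borel"
      by (rule measurable_compose[OF _ comp, of \<phi> borel]) measurable
    moreover have "(\<lambda>p::real^2. J (cx p) (cy p)) \<in> borel_measurable borel" by (rule comp) measurable
    moreover have "{p::real^2. S (cx p) (cy p)} \<in> sets borel" using comp[OF S] by (simp add: pred_def)
    ultimately show ?thesis by measurable
  qed
  moreover have "(\<lambda>p::real^2. F (cx p) (cy p) * indicator {p. T (cx p) (cy p)} p) \<in> borel_measurable borel"
  proof -
    have "(\<lambda>p::real^2. F (cx p) (cy p)) \<in> borel_measurable borel" by (rule comp) measurable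
    moreover have "{p::real^2. T (cx p) (cy p)} \<in> sets borel" using comp[OF T] by (simp add: pred_def)
    ultimately show ?thesis by measurable
  qed
  ultimately show ?thesis
    by (simp add: nn_integral_vec2 \<phi>_def indicator_def)
qed

(* @@@ d1/A2 *)

abbreviation leb :: "nat set \<Rightarrow> (nat \<Rightarrow> real) measure" where
  "leb I \<equiv> Pi\<^sub>M I (\<lambda>_. lborel)"

interpretation lebesgue_product: product_sigma_finite "\<lambda>_::nat. lborel :: real measure"
  by standard

lemma sigma_finite_leb: "finite I \<Longrightarrow> sigma_finite_measure (leb I)"
  by (rule lebesgue_product.sigma_finite)

lemma pair_sigma_finite_leb: "finite I \<Longrightarrow> pair_sigma_finite (leb I) (lborel :: real measure)"
  unfolding pair_sigma_finite_def using sigma_finite_leb sigma_finite_lborel by blast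

lemma measurable_leb_upd [measurable (raw)]:
  assumes "f \<in> N \<rightarrow>\<^sub>M leb {..<n}" "g \<in> borel_measurable N"
  shows "(\<lambda>x. (f x)(n := g x)) \<in> N \<rightarrow>\<^sub>M leb {..<Suc n}"
  by (rule measurable_fun_upd[where J = "{..<n}"]) (use assms in \<open>auto simp: lessThan_Suc\<close>)

lemma measurable_leb_component:
  assumes "f \<in> N \<rightarrow>\<^sub>M leb I" "i \<in> I"
  shows "(\<lambda>x. f x i) \<in> borel_measurable N"
  using measurable_compose[OF assms(1) measurable_component_singleton[OF assms(2)]] by simp

lemma component_measurable_leb: "i \<in> I \<Longrightarrow> (\<lambda>a. a i) \<in> borel_measurable (leb I)"
  using measurable_component_singleton[of i I "\<lambda>_. lborel :: real measure"] by simp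

lemma nn_integral_leb_empty: "(\<integral>\<^sup>+a. F a \<partial>leb {}) = F (\<lambda>_. undefined)"
  by (rule lebesgue_product.nn_integral_empty) simp

lemma space_leb_undefined: "a \<in> space (leb I) \<Longrightarrow> i \<notin> I \<Longrightarrow> a i = undefined"
  by (auto simp: space_PiM PiE_def extensional_def)

lemma nn_integral_leb_Suc:
  assumes "F \<in> borel_measurable (leb {..<Suc n})"
  shows "(\<integral>\<^sup>+a. F a \<partial>leb {..<Suc n}) = (\<integral>\<^sup>+a. \<integral>\<^sup>+y. F (a(n := y)) \<partial>lborel \<partial>leb {..<n})"
  using assms unfolding lessThan_Suc by (intro lebesgue_product.product_nn_integral_insert) auto

lemma nn_integral_lborel_shift:
  fixes t :: real
  assumes "f \<in> borel_measurable borel"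
  shows "(\<integral>\<^sup>+x. f (x + t) \<partial>lborel) = (\<integral>\<^sup>+x. f x \<partial>lborel)"
  using nn_integral_real_affine[OF assms, of 1 t] by (simp add: add.commute)

lemma nn_integral_unitriangular:
  assumes "F \<in> borel_measurable (leb {..<n})"
    and u: "\<And>i m. i \<le> m \<Longrightarrow> u i \<in> borel_measurable (leb {..<m})"
    and dep: "\<And>i a b. (\<And>j. j < i \<Longrightarrow> a j = b j) \<Longrightarrow> u i a = u i b"
  shows "(\<integral>\<^sup>+a. F (\<lambda>i\<in>{..<n}. a i + u i a) \<partial>leb {..<n}) = (\<integral>\<^sup>+a. F a \<partial>leb {..<n})"
  using assms(1)
proof (induction n arbitrary: F)
  case 0
  then show ?case by (simp add: nn_integral_leb_empty restrict_def del: nn_integral_const)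
next
  case (Suc n)
  note [measurable] = Suc.prems u
  have T[measurable]: "(\<lambda>a. \<lambda>i\<in>{..<m}. a i + u i a) \<in> leb {..<m} \<rightarrow>\<^sub>M leb {..<m}" for m
    by (rule measurable_restrict) (auto intro!: borel_measurable_add u component_measurable_leb)
  have "(\<integral>\<^sup>+a. F (\<lambda>i\<in>{..<Suc n}. a i + u i a) \<partial>leb {..<Suc n})
      = (\<integral>\<^sup>+a. \<integral>\<^sup>+y. F (\<lambda>i\<in>{..<Suc n}. (a(n := y)) i + u i (a(n := y))) \<partial>lborel \<partial>leb {..<n})"
    by (rule nn_integral_leb_Suc) measurable
  also have "\<dots> = (\<integral>\<^sup>+a. \<integral>\<^sup>+y. F ((\<lambda>i\<in>{..<n}. a i + u i a)(n := y + u n a)) \<partial>lborel \<partial>leb {..<n})"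
  proof (intro nn_integral_cong arg_cong[where f = F] ext)
    fix a y i
    have "u i (a(n := y)) = u i a" if "i \<le> n" for i
      using that by (intro dep) auto
    then show "(\<lambda>i\<in>{..<Suc n}. (a(n := y)) i + u i (a(n := y))) i = ((\<lambda>i\<in>{..<n}. a i + u i a)(n := y + u n a)) i"
      by (auto simp: restrict_def less_Suc_eq)
  qed
  also have "\<dots> = (\<integral>\<^sup>+a. \<integral>\<^sup>+y. F ((\<lambda>i\<in>{..<n}. a i + u i a)(n := y)) \<partial>lborel \<partial>leb {..<n})"
  proof (rule nn_integral_cong)
    fix a assume "a \<in> space (leb {..<n})"
    then have "(\<lambda>i\<in>{..<n}. a i + u i a) \<in> space (leb {..<n})" by (auto simp: space_PiM)
    then have "(\<lambda>y. F ((\<lambda>i\<in>{..<n}. a i + u i a)(n := y))) \<in> borel_measurable borel"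
      by measurable
    from nn_integral_lborel_shift[OF this, of "u n a"]
    show "(\<integral>\<^sup>+y. F ((\<lambda>i\<in>{..<n}. a i + u i a)(n := y + u n a)) \<partial>lborel)
      = (\<integral>\<^sup>+y. F ((\<lambda>i\<in>{..<n}. a i + u i a)(n := y)) \<partial>lborel)" .
  qed
  also have "\<dots> = (\<integral>\<^sup>+a. \<integral>\<^sup>+y. F (a(n := y)) \<partial>lborel \<partial>leb {..<n})"
    by (rule Suc.IH) measurable
  also have "\<dots> = (\<integral>\<^sup>+a. F a \<partial>leb {..<Suc n})"
    by (rule nn_integral_leb_Suc[symmetric]) measurable
  finally show ?case .
qed

lemma nn_integral_plane_reflection_shear:
  fixes \<alpha> :: real
  assumes [measurable]: "(\<lambda>p. G (fst p) (snd p)) \<in> borel_measurable (borel \<Otimes>\<^sub>M borel)" and "\<bar>\<alpha>\<bar> < 1"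
  shows "(\<integral>\<^sup>+z. \<integral>\<^sup>+y. G (z - \<alpha> * y) (y - \<alpha> * z) \<partial>lborel \<partial>lborel) * ennreal (1 - \<alpha>\<^sup>2)
    = (\<integral>\<^sup>+z. \<integral>\<^sup>+y. G z y \<partial>lborel \<partial>lborel)"
proof -
  have pos: "1 - \<alpha>\<^sup>2 > 0" using \<open>\<bar>\<alpha>\<bar> < 1\<close> by (simp add: abs_square_less_1)
  have G[measurable (raw)]: "(\<lambda>x. G (f x) (g x)) \<in> borel_measurable M"
    if "f \<in> borel_measurable M" "g \<in> borel_measurable M" for f g and M :: "'x measure"
    using measurable_compose[OF measurable_Pair[OF that] assms(1)] by simp
  have "(\<integral>\<^sup>+z. \<integral>\<^sup>+y. G (z - \<alpha> * y) (y - \<alpha> * z) \<partial>lborel \<partial>lborel)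
     = (\<integral>\<^sup>+z. \<integral>\<^sup>+s. G (z - \<alpha> * (s + \<alpha> * z)) (s + \<alpha> * z - \<alpha> * z) \<partial>lborel \<partial>lborel)"
    by (intro nn_integral_cong nn_integral_lborel_shift[symmetric]) measurable
  also have "\<dots> = (\<integral>\<^sup>+z. \<integral>\<^sup>+s. G (- \<alpha> * s + (1 - \<alpha>\<^sup>2) * z) s \<partial>lborel \<partial>lborel)"
    by (simp add: algebra_simps power2_eq_square)
  also have "\<dots> = (\<integral>\<^sup>+s. \<integral>\<^sup>+z. G (- \<alpha> * s + (1 - \<alpha>\<^sup>2) * z) s \<partial>lborel \<partial>lborel)"
    by (rule lborel_pair.Fubini') measurable
  also have "\<dots> * ennreal (1 - \<alpha>\<^sup>2) = (\<integral>\<^sup>+s. ennreal (1 - \<alpha>\<^sup>2) * (\<integral>\<^sup>+z. G (- \<alpha> * s + (1 - \<alpha>\<^sup>2) * z) s \<partial>lborel) \<partial>lborel)"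
    by (subst mult.commute, rule nn_integral_cmult[symmetric]) measurable
  also have "\<dots> = (\<integral>\<^sup>+s. \<integral>\<^sup>+z. G z s \<partial>lborel \<partial>lborel)"
  proof (intro nn_integral_cong)
    fix s
    have "(\<lambda>z. G z s) \<in> borel_measurable borel" by measurable
    from nn_integral_real_affine[OF this, of "1 - \<alpha>\<^sup>2" "- \<alpha> * s"] pos
    show "ennreal (1 - \<alpha>\<^sup>2) * (\<integral>\<^sup>+z. G (- \<alpha> * s + (1 - \<alpha>\<^sup>2) * z) s \<partial>lborel) = (\<integral>\<^sup>+z. G z s \<partial>lborel)"
      by simp
  qed
  also have "\<dots> = (\<integral>\<^sup>+z. \<integral>\<^sup>+y. G z y \<partial>lborel \<partial>lborel)"
    by (rule lborel_pair.Fubini') measurable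
  finally show ?thesis .
qed

definition shear_jacobian :: "nat \<Rightarrow> real \<Rightarrow> real" where
  "shear_jacobian k \<alpha> = (1 - \<alpha>\<^sup>2) ^ (k div 2) * (1 - \<alpha>) ^ (k mod 2)"

lemma nn_integral_reflection_shear:
  fixes \<alpha> :: real
  assumes "F \<in> borel_measurable (leb {l..<l + k})" and \<alpha>: "\<bar>\<alpha>\<bar> < 1"
  shows "(\<integral>\<^sup>+a. F (\<lambda>i\<in>{l..<l + k}. a i - \<alpha> * a (2 * l + k - 1 - i)) \<partial>leb {l..<l + k}) * ennreal (shear_jacobian k \<alpha>)
    = (\<integral>\<^sup>+a. F a \<partial>leb {l..<l + k})"
  using assms(1)
proof (induction k arbitrary: l F rule: nat_induct2)
  case 0
  have "(\<lambda>i\<in>{l..<l + 0}. a i - \<alpha> * a (2 * l + 0 - 1 - i)) = (\<lambda>_. undefined)" for a :: "nat \<Rightarrow> real"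
    by auto
  then show ?case unfolding shear_jacobian_def by (simp add: nn_integral_leb_empty del: nn_integral_const)
next
  case 1
  note [measurable] = 1
  have I: "{l..<l + 1} = {l}" by auto
  define f where "f = (\<lambda>y. F (\<lambda>i\<in>{l}. y))"
  have f[measurable]: "f \<in> borel_measurable borel"
    unfolding f_def using 1 unfolding I by measurable
  have cong: "a = (\<lambda>i\<in>{l}. a l)" if "a \<in> space (leb {l})" for a
    using that by (auto simp: space_PiM fun_eq_iff restrict_def extensional_def)
  have ps: "1 - \<alpha> > 0" using \<alpha> by auto
  have "(\<integral>\<^sup>+a. F (\<lambda>i\<in>{l..<l + 1}. a i - \<alpha> * a (2 * l + 1 - 1 - i)) \<partial>leb {l..<l + 1})
     = (\<integral>\<^sup>+a. f (a l - \<alpha> * a l) \<partial>leb {l})"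
    unfolding I f_def by (intro nn_integral_cong arg_cong[where f = F]) (auto simp: fun_eq_iff)
  also have "\<dots> = (\<integral>\<^sup>+y. f (0 + (1 - \<alpha>) * y) \<partial>lborel)"
    by (subst lebesgue_product.product_nn_integral_singleton[where f = "\<lambda>y. f (y - \<alpha> * y)"])
       (simp_all add: algebra_simps)
  finally have e: "(\<integral>\<^sup>+a. F (\<lambda>i\<in>{l..<l + 1}. a i - \<alpha> * a (2 * l + 1 - 1 - i)) \<partial>leb {l..<l + 1})
      = (\<integral>\<^sup>+y. f (0 + (1 - \<alpha>) * y) \<partial>lborel)" .
  have "(\<integral>\<^sup>+y. f y \<partial>lborel) = ennreal \<bar>1 - \<alpha>\<bar> * (\<integral>\<^sup>+y. f (0 + (1 - \<alpha>) * y) \<partial>lborel)"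
    using ps by (intro nn_integral_real_affine f) auto
  then have "(\<integral>\<^sup>+a. F (\<lambda>i\<in>{l..<l + 1}. a i - \<alpha> * a (2 * l + 1 - 1 - i)) \<partial>leb {l..<l + 1}) * ennreal (1 - \<alpha>)
      = (\<integral>\<^sup>+y. f y \<partial>lborel)"
    unfolding e using ps by (metis abs_of_pos mult.commute)
  also have "\<dots> = (\<integral>\<^sup>+a. f (a l) \<partial>leb {l})"
    by (rule lebesgue_product.product_nn_integral_singleton[symmetric]) simp
  also have "\<dots> = (\<integral>\<^sup>+a. F a \<partial>leb {l..<l + 1})"
    unfolding I f_def using cong by (intro nn_integral_cong) (auto intro!: arg_cong[where f = F])
  finally have "(\<integral>\<^sup>+a. F (\<lambda>i\<in>{l..<l + 1}. a i - \<alpha> * a (2 * l + 1 - 1 - i)) \<partial>leb {l..<l + 1}) * ennreal (1 - \<alpha>)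
      = (\<integral>\<^sup>+a. F a \<partial>leb {l..<l + 1})" .
  moreover have "shear_jacobian 1 \<alpha> = 1 - \<alpha>" by (simp add: shear_jacobian_def)
  ultimately show ?case by (simp only:)
next
  case (step k)
  let ?I = "{Suc l..<Suc l + k}" and ?r = "Suc (l + k)"
  have I: "{l..<l + (k + 2)} = insert l (insert ?r ?I)" by auto
  define S where "S = (\<lambda>a::nat\<Rightarrow>real. \<lambda>i\<in>?I. a i - \<alpha> * a (2 * Suc l + k - 1 - i))"
  have upd: "(\<lambda>x. (f x)(?r := g x, l := h x)) \<in> N \<rightarrow>\<^sub>M leb (insert l (insert ?r ?I))"
    if "f \<in> N \<rightarrow>\<^sub>M leb ?I" "g \<in> borel_measurable N" "h \<in> borel_measurable N" for f g h and N :: "'x measure"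
    by (intro measurable_fun_upd[where J = "insert ?r ?I"] measurable_fun_upd[where J = ?I])
       (use that in auto)
  have F[measurable]: "F \<in> borel_measurable (leb (insert l (insert ?r ?I)))"
    using step(2) unfolding I .
  have S[measurable]: "S \<in> leb ?I \<rightarrow>\<^sub>M leb ?I"
    unfolding S_def by (intro measurable_restrict) (auto intro!: borel_measurable_diff borel_measurable_times component_measurable_leb)
  have ins: "(\<integral>\<^sup>+a. H a \<partial>leb (insert l (insert ?r ?I))) = (\<integral>\<^sup>+a. \<integral>\<^sup>+z. \<integral>\<^sup>+y. H (a(?r := z, l := y)) \<partial>lborel \<partial>lborel \<partial>leb ?I)"
    if H: "H \<in> borel_measurable (leb (insert l (insert ?r ?I)))" for H
  proof -
    have "(\<lambda>p. H ((fst p)(l := snd p))) \<in> borel_measurable (leb (insert ?r ?I) \<Otimes>\<^sub>M lborel)"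
      using measurable_compose[OF measurable_add_dim[of l "insert ?r ?I" "\<lambda>_. lborel"] H] unfolding case_prod_beta .
    from lborel.borel_measurable_nn_integral_fst[OF this]
    have m: "(\<lambda>a. \<integral>\<^sup>+y. H (a(l := y)) \<partial>lborel) \<in> borel_measurable (leb (insert ?r ?I))" unfolding fst_conv snd_conv .
    have "(\<integral>\<^sup>+a. H a \<partial>leb (insert l (insert ?r ?I))) = (\<integral>\<^sup>+a. \<integral>\<^sup>+y. H (a(l := y)) \<partial>lborel \<partial>leb (insert ?r ?I))"
      by (rule lebesgue_product.product_nn_integral_insert[OF _ _ H]) simp_all
    also have "\<dots> = (\<integral>\<^sup>+a. \<integral>\<^sup>+z. \<integral>\<^sup>+y. H (a(?r := z, l := y)) \<partial>lborel \<partial>lborel \<partial>leb ?I)"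
      by (rule lebesgue_product.product_nn_integral_insert[OF _ _ m]) simp_all
    finally show ?thesis .
  qed
  have jac: "ennreal (shear_jacobian (k + 2) \<alpha>) = ennreal (1 - \<alpha>\<^sup>2) * ennreal (shear_jacobian k \<alpha>)"
  proof -
    have "shear_jacobian (k + 2) \<alpha> = (1 - \<alpha>\<^sup>2) * shear_jacobian k \<alpha>"
      by (simp add: shear_jacobian_def)
    then show ?thesis using \<alpha> by (simp add: ennreal_mult' abs_square_le_1)
  qed
  have mG: "(\<lambda>b. \<integral>\<^sup>+z. \<integral>\<^sup>+y. F (b(?r := z - \<beta> * y, l := y - \<beta> * z)) \<partial>lborel \<partial>lborel) \<in> borel_measurable (leb ?I)" for \<beta>
  proof -
    let ?N = "(leb ?I \<Otimes>\<^sub>M (lborel :: real measure)) \<Otimes>\<^sub>M (lborel :: real measure)"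
    have 1: "(\<lambda>p. fst (fst p)) \<in> ?N \<rightarrow>\<^sub>M leb ?I" by measurable
    have 2: "(\<lambda>p. snd (fst p) - \<beta> * snd p) \<in> borel_measurable ?N" by measurable
    have 3: "(\<lambda>p. snd p - \<beta> * snd (fst p)) \<in> borel_measurable ?N" by measurable
    from lborel.borel_measurable_nn_integral_fst[OF lborel.borel_measurable_nn_integral_fst[OF measurable_compose[OF upd[OF 1 2 3] F]]]
    show ?thesis by simp
  qed
  define G where "G = (\<lambda>\<beta> b. \<integral>\<^sup>+z. \<integral>\<^sup>+y. F (b(?r := z - \<beta> * y, l := y - \<beta> * z)) \<partial>lborel \<partial>lborel)"
  have mG': "G \<beta> \<in> borel_measurable (leb ?I)" for \<beta>
    unfolding G_def by (rule mG)
  have mS: "(\<lambda>a. \<lambda>i\<in>{l..<l + (k + 2)}. a i - \<alpha> * a (2 * l + (k + 2) - 1 - i)) \<in> leb (insert l (insert ?r ?I)) \<rightarrow>\<^sub>M leb (insert l (insert ?r ?I))"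
    unfolding I
    by (rule measurable_restrict) (auto intro!: borel_measurable_diff borel_measurable_times component_measurable_leb)
  have S_upd: "(\<lambda>i\<in>{l..<l + (k + 2)}. (a(?r := z, l := y)) i - \<alpha> * (a(?r := z, l := y)) (2 * l + (k + 2) - 1 - i))
      = (S a)(?r := z - \<alpha> * y, l := y - \<alpha> * z)" (is "?lhs = ?rhs") for a z y
  proof
    fix i
    have x1: "2 * l + (k + 2) - 1 - l = ?r" and x2: "2 * l + (k + 2) - 1 - ?r = l"
      and x3: "2 * l + (k + 2) - 1 = 2 * Suc l + k - 1" and ne: "?r \<noteq> l" by simp_all
    consider "i = l" | "i = ?r" | "i \<in> ?I" | "i \<noteq> l" "i \<noteq> ?r" "i \<notin> ?I" by blast
    then show "?lhs i = ?rhs i"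
    proof cases
      case 3
      then have "2 * Suc l + k - 1 - i \<noteq> l" "2 * Suc l + k - 1 - i \<noteq> ?r" "i \<noteq> l" "i \<noteq> ?r" "i \<in> {l..<l + (k + 2)}" by auto
      then show ?thesis using \<open>i \<in> ?I\<close> unfolding S_def x3
        by (simp only: fun_upd_apply restrict_apply if_True if_False simp_thms)
    next
      case 4
      then have "i \<notin> {l..<l + (k + 2)}" by auto
      then show ?thesis using 4 unfolding S_def by (simp only: fun_upd_apply restrict_apply if_True if_False simp_thms)
    next
      case 1
      have "l \<in> {l..<l + (k + 2)}" by simp
      then show ?thesis using ne
        unfolding 1 by (simp only: x1 fun_upd_apply restrict_apply if_True if_False simp_thms)
    next
      case 2
      have "?r \<in> {l..<l + (k + 2)}" by simp
      then show ?thesis using ne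
        unfolding 2 by (simp only: x2 fun_upd_apply restrict_apply if_True if_False simp_thms)
    qed
  qed
  have pt: "G \<alpha> b * ennreal (1 - \<alpha>\<^sup>2) = G 0 b" if "b \<in> space (leb ?I)" for b
  proof -
    from that have 1: "(\<lambda>p. b) \<in> borel \<Otimes>\<^sub>M borel \<rightarrow>\<^sub>M leb ?I" by simp
    have "(\<lambda>p. F (b(?r := fst p, l := snd p))) \<in> borel_measurable (borel \<Otimes>\<^sub>M borel)"
      by (rule measurable_compose[OF upd[OF 1 measurable_fst measurable_snd] F])
    from nn_integral_plane_reflection_shear[of "\<lambda>z y. F (b(?r := z, l := y))", OF this \<alpha>]
    show ?thesis unfolding G_def mult_zero_left diff_zero .
  qed
  have "(\<integral>\<^sup>+a. F (\<lambda>i\<in>{l..<l + (k + 2)}. a i - \<alpha> * a (2 * l + (k + 2) - 1 - i)) \<partial>leb {l..<l + (k + 2)})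
      = (\<integral>\<^sup>+a. G \<alpha> (S a) \<partial>leb ?I)"
    unfolding I(1) ins[OF measurable_compose[OF mS F], unfolded I] G_def S_upd[unfolded I] ..
  also have "\<dots> * ennreal (1 - \<alpha>\<^sup>2) = (\<integral>\<^sup>+a. G \<alpha> (S a) * ennreal (1 - \<alpha>\<^sup>2) \<partial>leb ?I)"
    by (rule nn_integral_multc[symmetric]) (rule measurable_compose[OF S mG'])
  also have "\<dots> = (\<integral>\<^sup>+a. G 0 (S a) \<partial>leb ?I)"
    by (rule nn_integral_cong) (rule pt, rule measurable_space[OF S])
  also have "\<dots> * ennreal (shear_jacobian k \<alpha>) = (\<integral>\<^sup>+a. G 0 a \<partial>leb ?I)"
    unfolding S_def by (rule step(1)) (rule mG')
  also have "\<dots> = (\<integral>\<^sup>+a. F a \<partial>leb (insert l (insert ?r ?I)))"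
    unfolding ins[OF F] G_def mult_zero_left diff_zero ..
  finally show ?case unfolding jac I mult.assoc .
qed

lemma measurable_ex_zero_compact:
  fixes h :: "'w \<Rightarrow> 'z::euclidean_space \<Rightarrow> real"
  assumes K: "compact K" and cont: "\<And>w. w \<in> space M \<Longrightarrow> continuous_on K (h w)"
    and meas: "\<And>z. (\<lambda>w. h w z) \<in> borel_measurable M"
  shows "Measurable.pred M (\<lambda>w. \<exists>z\<in>K. h w z = 0)"
proof -
  obtain D where D: "countable D" "D \<subseteq> K" "K \<subseteq> closure D"
    using separable by blast
  have "(\<exists>z\<in>K. h w z = 0) \<longleftrightarrow> (\<forall>n::nat. \<exists>z\<in>D. \<bar>h w z\<bar> < 1 / real (Suc n))" if w: "w \<in> space M" for w
  proof
    assume "\<exists>z\<in>K. h w z = 0"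
    then obtain z where z: "z \<in> K" "h w z = 0" by blast
    show "\<forall>n::nat. \<exists>z\<in>D. \<bar>h w z\<bar> < 1 / real (Suc n)"
    proof
      fix n :: nat
      obtain d where d: "d > 0" "\<And>z'. z' \<in> K \<Longrightarrow> dist z' z < d \<Longrightarrow> dist (h w z') (h w z) < 1 / real (Suc n)"
        using cont[OF w] z unfolding continuous_on_iff by (metis of_nat_0_less_iff zero_less_Suc zero_less_divide_1_iff)
      obtain z' where "z' \<in> D" "dist z' z < d"
        using D z d(1) closure_approachable by blast
      then show "\<exists>z\<in>D. \<bar>h w z\<bar> < 1 / real (Suc n)"
        using d(2)[of z'] D z by (auto simp: dist_real_def)
    qed
  next
    assume *: "\<forall>n::nat. \<exists>z\<in>D. \<bar>h w z\<bar> < 1 / real (Suc n)"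
    then have ne: "K \<noteq> {}" using D by auto
    have "continuous_on K (\<lambda>z. \<bar>h w z\<bar>)" using cont[OF w] by (intro continuous_intros)
    from continuous_attains_inf[OF K ne this] obtain z where z: "z \<in> K" "\<And>y. y \<in> K \<Longrightarrow> \<bar>h w z\<bar> \<le> \<bar>h w y\<bar>" by blast
    have "h w z = 0"
    proof (rule ccontr)
      assume "h w z \<noteq> 0"
      then obtain n where "1 / real (Suc n) < \<bar>h w z\<bar>"
        using reals_Archimedean[of "\<bar>h w z\<bar>"] by (auto simp: inverse_eq_divide)
      moreover obtain y where "y \<in> D" "\<bar>h w y\<bar> < 1 / real (Suc n)" using * by blast
      ultimately show False using z(2)[of y] D by force
    qed
    then show "\<exists>z\<in>K. h w z = 0" using z by blast
  qed
  moreover have "Measurable.pred M (\<lambda>w. \<forall>n::nat. \<exists>z\<in>D. \<bar>h w z\<bar> < 1 / real (Suc n))"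
    using D(1) meas by measurable
  ultimately show ?thesis
    by (subst measurable_cong) auto
qed

lemma measurable_ex_zero_sigma_compact:
  fixes h :: "'w \<Rightarrow> 'z::euclidean_space \<Rightarrow> real"
  assumes "\<And>m::nat. compact (K m)" and "\<And>w. w \<in> space M \<Longrightarrow> continuous_on UNIV (h w)"
    and "\<And>z. (\<lambda>w. h w z) \<in> borel_measurable M"
  shows "Measurable.pred M (\<lambda>w. \<exists>z\<in>(\<Union>m. K m). h w z = 0)"
proof -
  have "Measurable.pred M (\<lambda>w. \<exists>z\<in>K m. h w z = 0)" for m
    using assms by (intro measurable_ex_zero_compact) (auto intro: continuous_on_subset)
  then have "Measurable.pred M (\<lambda>w. \<exists>m. \<exists>z\<in>K m. h w z = 0)" by measurable
  then show ?thesis by (rule back_subst[where P = "Measurable.pred M"]) auto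
qed

(* @@@ d2/B *)

primrec monic_eval :: "nat \<Rightarrow> (nat \<Rightarrow> real) \<Rightarrow> 'a::real_field \<Rightarrow> 'a" where
  "monic_eval 0 a z = 1"
| "monic_eval (Suc n) a z = z * monic_eval n a z + of_real (a n)"

primrec monic_poly :: "nat \<Rightarrow> (nat \<Rightarrow> real) \<Rightarrow> complex poly" where
  "monic_poly 0 a = 1"
| "monic_poly (Suc n) a = pCons (of_real (a n)) (monic_poly n a)"

primrec reversed_eval :: "nat \<Rightarrow> (nat \<Rightarrow> real) \<Rightarrow> 'a::real_field \<Rightarrow> 'a" where
  "reversed_eval 0 a z = 1"
| "reversed_eval (Suc n) a z = reversed_eval n a z + of_real (a n) * z ^ Suc n"

lemma poly_monic_poly [simp]: "poly (monic_poly n a) z = monic_eval n a z"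
  by (induction n) (auto simp: algebra_simps)

lemma monic_poly_nonzero [simp]: "monic_poly n a \<noteq> 0"
  by (induction n) auto

lemma degree_monic_poly [simp]: "degree (monic_poly n a) = n"
  by (induction n) (auto simp: degree_pCons_eq)

lemma coeff_monic_poly_top [simp]: "coeff (monic_poly n a) n = 1"
  by (induction n) auto

lemma lead_coeff_monic_poly: "lead_coeff (monic_poly n a) = 1"
  by simp

lemma coeff_monic_poly: "j < n \<Longrightarrow> coeff (monic_poly n a) j = of_real (a (n - 1 - j))"
proof (induction n arbitrary: j)
  case (Suc n)
  then show ?case by (cases j) auto
qed simp

lemma monic_poly_cong: "(\<And>i. i < n \<Longrightarrow> a i = b i) \<Longrightarrow> monic_poly n a = monic_poly n b"
  by (induction n) auto

lemma monic_eval_cong: "(\<And>i. i < n \<Longrightarrow> a i = b i) \<Longrightarrow> monic_eval n a z = monic_eval n b z"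
  by (induction n) auto

lemma reversed_eval_cong: "(\<And>i. i < n \<Longrightarrow> a i = b i) \<Longrightarrow> reversed_eval n a z = reversed_eval n b z"
  by (induction n) auto

lemma monic_poly_inject: "monic_poly n a = monic_poly n b \<Longrightarrow> i < n \<Longrightarrow> a i = b i"
  using coeff_monic_poly[of "n - 1 - i" n a] coeff_monic_poly[of "n - 1 - i" n b] by simp

lemma monic_eval_of_real: "monic_eval n a (of_real s :: complex) = of_real (monic_eval n a s)"
  by (induction n) auto

lemma monic_eval_cnj: "monic_eval n a (cnj z) = cnj (monic_eval n a z)"
  by (induction n) auto

lemma reversed_eval_cnj: "reversed_eval n a (cnj z) = cnj (reversed_eval n a z)"
  by (induction n) auto

lemma reversed_eval_eq: "z \<noteq> 0 \<Longrightarrow> reversed_eval n a z = z ^ n * monic_eval n a (1 / z)"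
  by (induction n) (auto simp: algebra_simps)

lemma monic_eval_sum: "monic_eval n a z = z ^ n + (\<Sum>i<n. of_real (a i) * z ^ (n - Suc i))"
proof (induction n)
  case (Suc n)
  have "z * (\<Sum>i<n. of_real (a i) * z ^ (n - Suc i)) = (\<Sum>i<n. of_real (a i) * z ^ (n - i))"
    by (subst sum_distrib_left, rule sum.cong) (auto simp: mult_ac Suc_diff_Suc simp flip: power_Suc)
  then show ?case using Suc by (simp add: algebra_simps)
qed simp

lemma reversed_eval_sum: "reversed_eval n a z = 1 + (\<Sum>i<n. of_real (a i) * z ^ Suc i)"
  by (induction n) auto

lemma monic_poly_factorization:
  obtains z where "monic_poly n a = (\<Prod>i<n. [:- z i, 1:])"
proof -
  obtain as where as: "Polynomial.smult (coeff (monic_poly n a) (degree (monic_poly n a))) (\<Prod>a\<leftarrow>as. [:- a, 1:]) = monic_poly n a"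
    "length as = degree (monic_poly n a)"
    using fundamental_theorem_algebra_factorized by blast
  then have "monic_poly n a = (\<Prod>a\<leftarrow>as. [:- a, 1:])" "length as = n" by simp_all
  then have "monic_poly n a = (\<Prod>i<n. [:- (as ! i), 1:])"
    by (simp add: prod.list_conv_set_nth atLeast0LessThan)
  then show ?thesis using that by blast
qed

lemma monic_eval_factorization:
  assumes "monic_poly n a = (\<Prod>i<n. [:- z i, 1:])"
  shows "monic_eval n a w = (\<Prod>i<n. w - z i)"
  unfolding poly_monic_poly[symmetric] assms by (simp add: poly_prod)

lemma reversed_eval_factorization:
  assumes "monic_poly n a = (\<Prod>i<n. [:- z i, 1:])"
  shows "reversed_eval n a w = (\<Prod>i<n. 1 - z i * w)"
proof (cases "w = 0")
  case True
  then show ?thesis by (simp add: reversed_eval_sum)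
next
  case False
  have "reversed_eval n a w = w ^ n * (\<Prod>i<n. 1 / w - z i)"
    using False by (simp add: reversed_eval_eq monic_eval_factorization[OF assms])
  also have "\<dots> = (\<Prod>i<n. w * (1 / w - z i))"
    by (simp add: prod.distrib)
  finally show ?thesis using False by (simp add: algebra_simps)
qed

definition szego_step :: "nat \<Rightarrow> real \<Rightarrow> (nat \<Rightarrow> real) \<Rightarrow> nat \<Rightarrow> real" where
  "szego_step n t a = (\<lambda>i\<in>{..<n}. a i - t * a (n - 1 - i))(n := - t)"

primrec szego_coeffs :: "nat \<Rightarrow> (nat \<Rightarrow> real) \<Rightarrow> nat \<Rightarrow> real" where
  "szego_coeffs 0 \<alpha> = (\<lambda>_. undefined)"
| "szego_coeffs (Suc n) \<alpha> = szego_step n (\<alpha> n) (szego_coeffs n \<alpha>)"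

lemma
  fixes z :: "'a::real_field"
  shows monic_eval_szego_step:
      "monic_eval (Suc n) (szego_step n t a) z = z * monic_eval n a z - of_real t * reversed_eval n a z"
    and reversed_eval_szego_step:
      "reversed_eval (Suc n) (szego_step n t a) z = reversed_eval n a z - of_real t * z * monic_eval n a z"
proof -
  let ?b = "\<lambda>i. a i - t * a (n - 1 - i)"
  have b: "i < n \<Longrightarrow> szego_step n t a i = ?b i" for i by (simp add: szego_step_def)
  have 1: "(\<Sum>i<n. of_real (a (n - 1 - i)) * z ^ (n - Suc i)) = (\<Sum>i<n. of_real (a i) * z ^ i)"
    by (subst sum.nat_diff_reindex[symmetric], rule sum.cong) auto
  have M: "monic_eval n ?b z = monic_eval n a z - of_real t * (\<Sum>i<n. of_real (a i) * z ^ i)"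
    by (simp only: monic_eval_sum of_real_diff of_real_mult left_diff_distrib sum_subtractf mult.assoc sum_distrib_left[symmetric] 1) simp
  have R: "reversed_eval n a z = 1 + z * (\<Sum>i<n. of_real (a i) * z ^ i)"
    by (simp add: reversed_eval_sum sum_distrib_left mult_ac)
  have "monic_eval (Suc n) (szego_step n t a) z = z * monic_eval n ?b z - of_real t"
    using monic_eval_cong[of n "szego_step n t a" ?b z] b by (simp add: szego_step_def del: restrict_upd)
  then show "monic_eval (Suc n) (szego_step n t a) z = z * monic_eval n a z - of_real t * reversed_eval n a z"
    unfolding M R by (simp add: algebra_simps)
  have 2: "(\<Sum>i<n. of_real (a (n - 1 - i)) * z ^ Suc i) = (\<Sum>i<n. of_real (a i) * z ^ (n - i))"
    by (subst sum.nat_diff_reindex[symmetric], rule sum.cong) (auto simp: Suc_diff_Suc)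
  have "reversed_eval n ?b z = reversed_eval n a z - of_real t * (\<Sum>i<n. of_real (a i) * z ^ (n - i))"
    by (simp only: reversed_eval_sum of_real_diff of_real_mult left_diff_distrib sum_subtractf mult.assoc sum_distrib_left[symmetric] 2) simp
  moreover have "z * monic_eval n a z = z ^ Suc n + (\<Sum>i<n. of_real (a i) * z ^ (n - i))"
  proof -
    have "z * (\<Sum>i<n. of_real (a i) * z ^ (n - Suc i)) = (\<Sum>i<n. of_real (a i) * z ^ (n - i))"
      by (subst sum_distrib_left, rule sum.cong) (auto simp: mult_ac Suc_diff_Suc simp flip: power_Suc)
    then show ?thesis by (simp add: monic_eval_sum algebra_simps)
  qed
  ultimately have "reversed_eval n ?b z - of_real t * z ^ Suc n = reversed_eval n a z - of_real t * (z * monic_eval n a z)"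
    by (simp add: algebra_simps)
  then show "reversed_eval (Suc n) (szego_step n t a) z = reversed_eval n a z - of_real t * z * monic_eval n a z"
    using reversed_eval_cong[of n "szego_step n t a" ?b z] b by (simp add: szego_step_def algebra_simps del: restrict_upd)
qed

definition schur_stable :: "nat \<Rightarrow> (nat \<Rightarrow> real) \<Rightarrow> bool" where
  "schur_stable n a \<longleftrightarrow> (\<forall>z::complex. monic_eval n a z = 0 \<longrightarrow> cmod z < 1)"

lemma schur_stable_reversed_le:
  assumes "schur_stable n a" "cmod w \<ge> 1"
  shows "monic_eval n a w \<noteq> 0" "cmod (reversed_eval n a w) \<le> cmod (monic_eval n a w)"
proof -
  show "monic_eval n a w \<noteq> 0" using assms by (force simp: schur_stable_def)
  obtain z where z: "monic_poly n a = (\<Prod>i<n. [:- z i, 1:])" by (rule monic_poly_factorization)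
  have root: "cmod (z i) < 1" if "i < n" for i
    using assms(1) that unfolding schur_stable_def monic_eval_factorization[OF z] by auto
  have "cmod (reversed_eval n a w) = cmod (reversed_eval n a (cnj w))"
    by (simp add: reversed_eval_cnj)
  also have "\<dots> = (\<Prod>i<n. cmod (1 - z i * cnj w))"
    by (simp add: reversed_eval_factorization[OF z] prod_norm)
  also have "\<dots> \<le> (\<Prod>i<n. cmod (w - z i))"
  proof (rule prod_mono, safe)
    fix i assume "i < n"
    have "(cmod (w - z i))\<^sup>2 - (cmod (1 - z i * cnj w))\<^sup>2 = ((cmod w)\<^sup>2 - 1) * (1 - (cmod (z i))\<^sup>2)"
      unfolding cmod_power2 by (simp add: algebra_simps power2_eq_square)
    moreover have "\<dots> \<ge> 0"
      using root[OF \<open>i < n\<close>] assms(2) by (intro mult_nonneg_nonneg) (auto simp: abs_square_le_1)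
    ultimately have "(cmod (1 - z i * cnj w))\<^sup>2 \<le> (cmod (w - z i))\<^sup>2" by linarith
    then show "cmod (1 - z i * cnj w) \<le> cmod (w - z i)" by (rule power2_le_imp_le) simp
  qed simp
  also have "\<dots> = cmod (monic_eval n a w)"
    by (simp add: monic_eval_factorization[OF z] prod_norm)
  finally show "cmod (reversed_eval n a w) \<le> cmod (monic_eval n a w)" .
qed

lemma schur_stable_constant_term:
  assumes "schur_stable (Suc n) a"
  shows "\<bar>a n\<bar> < 1"
proof -
  obtain z where z: "monic_poly (Suc n) a = (\<Prod>i<Suc n. [:- z i, 1:])"
    by (rule monic_poly_factorization)
  have root: "cmod (z i) < 1" if "i < Suc n" for i
    using assms that unfolding schur_stable_def monic_eval_factorization[OF z] by (auto simp del: prod.lessThan_Suc)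
  have "\<bar>a n\<bar> = cmod (monic_eval (Suc n) a 0)" by simp
  also have "\<dots> = (\<Prod>i<Suc n. cmod (z i))"
    unfolding monic_eval_factorization[OF z] by (simp only: prod_norm[symmetric] diff_0 norm_minus_cancel)
  also have "\<dots> = cmod (z n) * (\<Prod>i<n. cmod (z i))" by simp
  also have "\<dots> \<le> cmod (z n) * 1"
    using root by (intro mult_left_mono prod_le_1) (auto simp: less_imp_le)
  finally show ?thesis using root[of n] by simp
qed

lemma schur_stable_szego_step:
  "schur_stable (Suc n) (szego_step n t a) \<longleftrightarrow> \<bar>t\<bar> < 1 \<and> schur_stable n a"
proof safe
  assume t: "\<bar>t\<bar> < 1" and st: "schur_stable n a"
  show "schur_stable (Suc n) (szego_step n t a)"
    unfolding schur_stable_def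
  proof (safe, rule ccontr)
    fix z :: complex assume z: "monic_eval (Suc n) (szego_step n t a) z = 0" "\<not> cmod z < 1"
    note * = schur_stable_reversed_le[OF st, of z]
    have "cmod z * cmod (monic_eval n a z) = \<bar>t\<bar> * cmod (reversed_eval n a z)"
      using z(1) unfolding monic_eval_szego_step by (metis eq_iff_diff_eq_0 norm_mult norm_of_real)
    moreover have "1 * cmod (monic_eval n a z) \<le> cmod z * cmod (monic_eval n a z)"
      using z(2) by (intro mult_right_mono) auto
    moreover have "\<bar>t\<bar> * cmod (reversed_eval n a z) \<le> \<bar>t\<bar> * cmod (monic_eval n a z)"
      using z(2) * by (intro mult_left_mono) auto
    moreover have "\<bar>t\<bar> * cmod (monic_eval n a z) < 1 * cmod (monic_eval n a z)"
      using t * z(2) by (intro mult_strict_right_mono) auto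
    ultimately show False by linarith
  qed
next
  assume st: "schur_stable (Suc n) (szego_step n t a)"
  show t: "\<bar>t\<bar> < 1"
    using schur_stable_constant_term[OF st] by (simp add: szego_step_def)
  show "schur_stable n a"
    unfolding schur_stable_def
  proof (safe, rule ccontr)
    fix w :: complex assume w: "monic_eval n a w = 0" "\<not> cmod w < 1"
    note * = schur_stable_reversed_le[OF st, of w]
    have "cmod (monic_eval (Suc n) (szego_step n t a) w) = \<bar>t\<bar> * cmod (reversed_eval (Suc n) (szego_step n t a) w)"
      unfolding monic_eval_szego_step reversed_eval_szego_step using w(1) by (simp add: norm_mult)
    also have "\<dots> \<le> \<bar>t\<bar> * cmod (monic_eval (Suc n) (szego_step n t a) w)"
      using w(2) * by (intro mult_left_mono) auto
    also have "\<dots> < 1 * cmod (monic_eval (Suc n) (szego_step n t a) w)"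
      using t * w(2) by (intro mult_strict_right_mono) auto
    finally show False by simp
  qed
qed

lemma schur_stable_cong: "(\<And>i. i < n \<Longrightarrow> a i = b i) \<Longrightarrow> schur_stable n a = schur_stable n b"
  unfolding schur_stable_def by (subst monic_eval_cong[of n a b]) auto

lemma measurable_monic_eval:
  fixes z :: "'a::{real_normed_field, second_countable_topology}"
  assumes "n \<le> m" shows "(\<lambda>a. monic_eval n a z) \<in> borel_measurable (leb {..<m})"
  using assms
proof (induction n)
  case (Suc n)
  have "(\<lambda>a. a n) \<in> borel_measurable (leb {..<m})"
    using Suc.prems by (intro component_measurable_leb) auto
  then have "(\<lambda>a. of_real (a n) :: 'a) \<in> borel_measurable (leb {..<m})"
    by (rule measurable_compose) (intro borel_measurable_continuous_onI continuous_intros)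
  then show ?case unfolding monic_eval.simps using Suc by (intro borel_measurable_add borel_measurable_times) auto
qed simp

lemma continuous_monic_eval: "continuous_on S (\<lambda>z::'a::real_normed_field. monic_eval n a z)"
  by (induction n) (auto intro!: continuous_intros)

lemma measurable_schur_stable: "Measurable.pred (leb {..<n}) (schur_stable n)"
proof -
  define K where "K m = cball 0 (real m) - ball (0::complex) 1" for m :: nat
  have "compact (K m)" for m unfolding K_def by (rule compact_diff) auto
  then have "Measurable.pred (leb {..<n}) (\<lambda>a. \<exists>z\<in>(\<Union>m. K m). cmod (monic_eval n a z) = 0)"
    using measurable_compose[OF measurable_monic_eval[of n n, OF order_refl] borel_measurable_norm]
    by (intro measurable_ex_zero_sigma_compact) (auto intro!: continuous_intros continuous_monic_eval)
  moreover have "(\<Union>m. K m) = {z. 1 \<le> cmod z}"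
    unfolding K_def by (auto intro: real_arch_simple simp: not_less)
  ultimately have "Measurable.pred (leb {..<n}) (\<lambda>a. \<exists>z\<in>{z. 1 \<le> cmod z}. cmod (monic_eval n a z) = 0)"
    by (simp only:)
  then have "Measurable.pred (leb {..<n}) (\<lambda>a. \<not> (\<exists>z\<in>{z. 1 \<le> cmod z}. cmod (monic_eval n a z) = 0))"
    by measurable
  then show ?thesis
    by (rule back_subst[where P = "Measurable.pred _"]) (auto simp: schur_stable_def fun_eq_iff not_le)
qed

lemma szego_coeffs_cong: "(\<And>k. k < n \<Longrightarrow> \<alpha> k = \<alpha>' k) \<Longrightarrow> szego_coeffs n \<alpha> = szego_coeffs n \<alpha>'"
  by (induction n) auto

lemma measurable_szego_step:
  "(\<lambda>p. szego_step n (snd p) (fst p)) \<in> leb {..<n} \<Otimes>\<^sub>M lborel \<rightarrow>\<^sub>M leb {..<Suc n}"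
  unfolding szego_step_def
  by (intro measurable_leb_upd measurable_restrict)
     (auto intro!: borel_measurable_diff borel_measurable_times borel_measurable_uminus measurable_compose[OF measurable_fst component_measurable_leb])

lemma measurable_szego_coeffs: "szego_coeffs n \<in> leb {..<n} \<rightarrow>\<^sub>M leb {..<n}"
proof (induction n)
  case (Suc n)
  have 1: "(\<lambda>\<alpha>. restrict \<alpha> {..<n}) \<in> leb {..<Suc n} \<rightarrow>\<^sub>M leb {..<n}"
    by (rule measurable_restrict_subset) auto
  have eq: "szego_coeffs (Suc n) = (\<lambda>\<alpha>. szego_step n (snd (szego_coeffs n (restrict \<alpha> {..<n}), \<alpha> n)) (fst (szego_coeffs n (restrict \<alpha> {..<n}), \<alpha> n)))"
  proof
    fix \<alpha> :: "nat \<Rightarrow> real"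
    have "szego_coeffs n (restrict \<alpha> {..<n}) = szego_coeffs n \<alpha>" by (rule szego_coeffs_cong) simp
    then show "szego_coeffs (Suc n) \<alpha> = szego_step n (snd (szego_coeffs n (restrict \<alpha> {..<n}), \<alpha> n)) (fst (szego_coeffs n (restrict \<alpha> {..<n}), \<alpha> n))"
      by simp
  qed
  have m: "(\<lambda>\<alpha>. (szego_coeffs n (restrict \<alpha> {..<n}), \<alpha> n)) \<in> leb {..<Suc n} \<rightarrow>\<^sub>M leb {..<n} \<Otimes>\<^sub>M lborel"
    using component_measurable_leb[of n "{..<Suc n}"]
    by (intro measurable_Pair measurable_compose[OF 1 Suc.IH]) auto
  show ?case unfolding eq by (rule measurable_compose[OF m measurable_szego_step])
qed (simp add: space_PiM)


lemma nn_integral_szego_coeffs: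
  assumes "G \<in> borel_measurable (leb {..<n})"
  shows "(\<integral>\<^sup>+\<alpha>. G (szego_coeffs n \<alpha>) * ennreal (\<Prod>k<n. shear_jacobian k (\<alpha> k))
            * indicator {\<alpha>. \<forall>k<n. \<bar>\<alpha> k\<bar> < 1} \<alpha> \<partial>leb {..<n})
       = (\<integral>\<^sup>+a. G a * indicator {a. schur_stable n a} a \<partial>leb {..<n})"
  using assms
proof (induction n arbitrary: G)
  case 0
  then show ?case by (simp add: nn_integral_leb_empty schur_stable_def del: nn_integral_const)
next
  case (Suc n)
  note G = Suc.prems
  let ?D = "{t::real. \<bar>t\<bar> < 1}"
  let ?J = "\<lambda>n \<alpha>. ennreal (\<Prod>k<n. shear_jacobian k (\<alpha> k))"
  let ?C = "\<lambda>n. {\<alpha>::nat\<Rightarrow>real. \<forall>k<n. \<bar>\<alpha> k\<bar> < 1}"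
  have jac_m: "(\<lambda>t. shear_jacobian k t) \<in> borel_measurable borel" for k
    unfolding shear_jacobian_def by measurable
  have jac_nn: "shear_jacobian k t \<ge> 0" if "\<bar>t\<bar> < 1" for k t
    using that unfolding shear_jacobian_def by (auto intro!: mult_nonneg_nonneg simp: abs_square_le_1)
  have J_m: "?J n \<in> borel_measurable (leb {..<m})" if "n \<le> m" for m n
    using that by (intro measurable_compose[OF _ measurable_ennreal] borel_measurable_prod measurable_compose[OF _ jac_m])
      (auto intro!: component_measurable_leb)
  have C_m: "Measurable.pred (leb {..<m}) (\<lambda>\<alpha>. \<forall>k<n. \<bar>\<alpha> k\<bar> < 1)" if "n \<le> m" for m n
  proof -
    have [measurable]: "(\<lambda>\<alpha>. \<alpha> k) \<in> borel_measurable (leb {..<m})" if "k \<in> {..<n}" for k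
      using that \<open>n \<le> m\<close> by (intro component_measurable_leb) auto
    have "Measurable.pred (leb {..<m}) (\<lambda>\<alpha>. \<forall>k\<in>{..<n}. \<bar>\<alpha> k\<bar> < 1)"
      by measurable
    then show ?thesis by (simp add: Ball_def)
  qed
  have "(\<lambda>\<alpha>. indicator (?C (Suc n)) \<alpha> :: ennreal) \<in> borel_measurable (leb {..<Suc n})"
    using C_m[of "Suc n" "Suc n"] by (intro borel_measurable_indicator') (simp add: pred_def)
  then have F_m: "(\<lambda>\<alpha>. G (szego_coeffs (Suc n) \<alpha>) * ?J (Suc n) \<alpha> * indicator (?C (Suc n)) \<alpha>) \<in> borel_measurable (leb {..<Suc n})"
    by (intro borel_measurable_times_ennreal measurable_compose[OF measurable_szego_coeffs G] J_m) auto
  have up: "szego_coeffs n (\<alpha>(n := t)) = szego_coeffs n \<alpha>" "?J n (\<alpha>(n := t)) = ?J n \<alpha>" for \<alpha> t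
    by (auto intro!: szego_coeffs_cong arg_cong[where f = ennreal] prod.cong)
  have pt: "G (szego_coeffs (Suc n) (\<alpha>(n := t))) * ?J (Suc n) (\<alpha>(n := t)) * indicator (?C (Suc n)) (\<alpha>(n := t))
      = G (szego_step n t (szego_coeffs n \<alpha>)) * ?J n \<alpha> * indicator (?C n) \<alpha> * (ennreal (shear_jacobian n t) * indicator ?D t)" for \<alpha> t
  proof (cases "\<bar>t\<bar> < 1 \<and> \<alpha> \<in> ?C n")
    case True
    then have "\<alpha>(n := t) \<in> ?C (Suc n)" by (auto simp: less_Suc_eq)
    moreover have "?J (Suc n) (\<alpha>(n := t)) = ?J n \<alpha> * ennreal (shear_jacobian n t)"
      using True up(2)[of \<alpha> t] jac_nn by (simp add: ennreal_mult'' )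
    ultimately show ?thesis using True up(1)[of \<alpha> t] by (simp add: mult_ac)
  next
    case False
    then have "\<alpha>(n := t) \<notin> ?C (Suc n)" by (auto simp: less_Suc_eq split: if_splits)
    then show ?thesis using False by (auto simp: indicator_def)
  qed
  define H where "H = (\<lambda>p. G (szego_step n (snd p) (fst p)))"
  have H: "H \<in> borel_measurable (leb {..<n} \<Otimes>\<^sub>M lborel)"
    unfolding H_def by (rule measurable_compose[OF measurable_szego_step G])
  have Ht: "(\<lambda>a. H (a, t)) \<in> borel_measurable (leb {..<n})" for t
    by (rule measurable_compose[OF measurable_Pair H]) auto
  have stm: "(\<lambda>a. indicator {a. schur_stable m a} a :: ennreal) \<in> borel_measurable (leb {..<m})" for m
    using measurable_schur_stable[of m] by (intro borel_measurable_indicator') (simp add: pred_def)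
  define E where "E = (\<lambda>b. G b * indicator {a. schur_stable (Suc n) a} b)"
  have E: "E \<in> borel_measurable (leb {..<Suc n})"
    unfolding E_def using G stm by (intro borel_measurable_times_ennreal) auto
  have E_upd: "(\<lambda>p. E ((fst p)(n := snd p))) \<in> borel_measurable (leb {..<n} \<Otimes>\<^sub>M lborel)"
    by (rule measurable_compose[OF measurable_leb_upd E]) auto
  have E_supp: "E (a(n := t)) = 0" if "\<not> \<bar>t\<bar> < 1" for a t
  proof -
    have "\<not> schur_stable (Suc n) (a(n := t))"
      using schur_stable_constant_term[of n "a(n := t)"] that by auto
    then show ?thesis by (simp add: E_def)
  qed
  have inner: "(\<integral>\<^sup>+\<alpha>. G (szego_step n t (szego_coeffs n \<alpha>)) * ?J n \<alpha> * indicator (?C n) \<alpha> \<partial>leb {..<n}) * ennreal (shear_jacobian n t)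
      = (\<integral>\<^sup>+a. E (a(n := - t)) \<partial>leb {..<n})" if t: "\<bar>t\<bar> < 1" for t
  proof -
    have "(\<integral>\<^sup>+\<alpha>. G (szego_step n t (szego_coeffs n \<alpha>)) * ?J n \<alpha> * indicator (?C n) \<alpha> \<partial>leb {..<n})
       = (\<integral>\<^sup>+a. G (szego_step n t a) * indicator {a. schur_stable n a} a \<partial>leb {..<n})"
      using Suc.IH[OF Ht[of t]] by (simp add: H_def)
    also have "\<dots> = (\<integral>\<^sup>+a. E ((\<lambda>i\<in>{..<n}. a i - t * a (n - 1 - i))(n := - t)) \<partial>leb {..<n})"
      unfolding szego_step_def[symmetric]
      by (intro nn_integral_cong) (simp add: E_def schur_stable_szego_step t indicator_def)
    also have "\<dots> * ennreal (shear_jacobian n t) = (\<integral>\<^sup>+a. E (a(n := - t)) \<partial>leb {..<n})"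
    proof -
      have "(\<lambda>a. E (a(n := - t))) \<in> borel_measurable (leb {..<n})"
        by (rule measurable_compose[OF measurable_leb_upd E]) auto
      then show ?thesis
        using nn_integral_reflection_shear[of "\<lambda>a. E (a(n := - t))" 0 n t] t
        by (simp only: atLeast0LessThan add_0 mult_0_right)
    qed
    finally show ?thesis .
  qed
  have J_t: "(\<lambda>t. ennreal (shear_jacobian n t) * indicator ?D t) \<in> borel_measurable borel"
    using jac_m[of n] by measurable
  have W: "(\<lambda>\<alpha>. ?J n \<alpha> * indicator (?C n) \<alpha>) \<in> borel_measurable (leb {..<n})"
    using C_m[of n n] J_m[of n n] by (intro borel_measurable_times_ennreal borel_measurable_indicator') (auto simp: pred_def)
  have GV: "(\<lambda>\<alpha>. G (szego_step n t (szego_coeffs n \<alpha>)) * ?J n \<alpha> * indicator (?C n) \<alpha>) \<in> borel_measurable (leb {..<n})" for t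
    using measurable_compose[OF measurable_szego_coeffs Ht[of t]] W
    by (simp only: H_def fst_conv snd_conv mult.assoc) (rule borel_measurable_times_ennreal)
  have GW: "(\<lambda>p. G (szego_step n (snd p) (szego_coeffs n (fst p))) * ?J n (fst p) * indicator (?C n) (fst p)
      * (ennreal (shear_jacobian n (snd p)) * indicator ?D (snd p))) \<in> borel_measurable (leb {..<n} \<Otimes>\<^sub>M lborel)"
  proof -
    have "(\<lambda>p. (szego_coeffs n (fst p), snd p)) \<in> leb {..<n} \<Otimes>\<^sub>M lborel \<rightarrow>\<^sub>M leb {..<n} \<Otimes>\<^sub>M (lborel :: real measure)"
      by (intro measurable_Pair measurable_compose[OF measurable_fst measurable_szego_coeffs] measurable_snd)
    from measurable_compose[OF this H]
    have 1: "(\<lambda>p. G (szego_step n (snd p) (szego_coeffs n (fst p)))) \<in> borel_measurable (leb {..<n} \<Otimes>\<^sub>M lborel)"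
      by (simp add: H_def)
    have 2: "(\<lambda>p. ?J n (fst p) * indicator (?C n) (fst p)) \<in> borel_measurable (leb {..<n} \<Otimes>\<^sub>M lborel)"
      by (rule measurable_compose[OF measurable_fst W])
    have 3: "(\<lambda>p. ennreal (shear_jacobian n (snd p)) * indicator ?D (snd p)) \<in> borel_measurable (leb {..<n} \<Otimes>\<^sub>M lborel)"
      by (rule measurable_compose[OF measurable_snd]) (use J_t in simp)
    from borel_measurable_times_ennreal[OF borel_measurable_times_ennreal[OF 1 2] 3]
    show ?thesis by (simp only: mult.assoc)
  qed
  interpret P: pair_sigma_finite "leb {..<n}" "lborel :: real measure"
    by (rule pair_sigma_finite_leb) simp
  have "(\<integral>\<^sup>+\<alpha>. G (szego_coeffs (Suc n) \<alpha>) * ?J (Suc n) \<alpha> * indicator (?C (Suc n)) \<alpha> \<partial>leb {..<Suc n})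
     = (\<integral>\<^sup>+\<alpha>. \<integral>\<^sup>+t. G (szego_step n t (szego_coeffs n \<alpha>)) * ?J n \<alpha> * indicator (?C n) \<alpha> * (ennreal (shear_jacobian n t) * indicator ?D t) \<partial>lborel \<partial>leb {..<n})"
    unfolding nn_integral_leb_Suc[OF F_m] pt ..
  also have "\<dots> = (\<integral>\<^sup>+t. \<integral>\<^sup>+\<alpha>. G (szego_step n t (szego_coeffs n \<alpha>)) * ?J n \<alpha> * indicator (?C n) \<alpha> * (ennreal (shear_jacobian n t) * indicator ?D t) \<partial>leb {..<n} \<partial>lborel)"
    using P.Fubini[OF GW] by (simp only: fst_conv snd_conv)
  also have "\<dots> = (\<integral>\<^sup>+t. (\<integral>\<^sup>+\<alpha>. G (szego_step n t (szego_coeffs n \<alpha>)) * ?J n \<alpha> * indicator (?C n) \<alpha> \<partial>leb {..<n}) * (ennreal (shear_jacobian n t) * indicator ?D t) \<partial>lborel)"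
    by (intro nn_integral_cong nn_integral_multc GV)
  also have "\<dots> = (\<integral>\<^sup>+t. (\<integral>\<^sup>+a. E (a(n := - t)) \<partial>leb {..<n}) \<partial>lborel)"
  proof (rule nn_integral_cong)
    fix t :: real
    show "(\<integral>\<^sup>+\<alpha>. G (szego_step n t (szego_coeffs n \<alpha>)) * ?J n \<alpha> * indicator (?C n) \<alpha> \<partial>leb {..<n}) * (ennreal (shear_jacobian n t) * indicator ?D t)
      = (\<integral>\<^sup>+a. E (a(n := - t)) \<partial>leb {..<n})"
    proof (cases "\<bar>t\<bar> < 1")
      case True
      then have i: "indicator ?D t = (1::ennreal)" by simp
      show ?thesis unfolding i mult_1_right by (rule inner[OF True])
    next
      case False
      then have i: "indicator ?D t = (0::ennreal)" by simp
      have "E (a(n := - t)) = 0" for a by (rule E_supp) (use False in simp)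
      then show ?thesis unfolding i by simp
    qed
  qed
  also have "\<dots> = (\<integral>\<^sup>+t. (\<integral>\<^sup>+a. E (a(n := t)) \<partial>leb {..<n}) \<partial>lborel)"
  proof -
    have m: "(\<lambda>t. \<integral>\<^sup>+a. E (a(n := t)) \<partial>leb {..<n}) \<in> borel_measurable borel"
      using P.M1.borel_measurable_nn_integral_fst[OF measurable_pair_swap[OF E_upd]] by (simp add: case_prod_beta)
    show ?thesis using nn_integral_real_affine[OF m, of "-1" 0] by simp
  qed
  also have "\<dots> = (\<integral>\<^sup>+a. (\<integral>\<^sup>+t. E (a(n := t)) \<partial>lborel) \<partial>leb {..<n})"
    using P.Fubini[OF E_upd] by (simp only: fst_conv snd_conv)
  also have "\<dots> = (\<integral>\<^sup>+a. E a \<partial>leb {..<Suc n})"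
    by (rule nn_integral_leb_Suc[OF E, symmetric])
  finally show ?case unfolding E_def .
qed

(* @@@ d2/C *)

definition shifted_coeffs :: "nat \<Rightarrow> (nat \<Rightarrow> real) \<Rightarrow> nat \<Rightarrow> real" where
  "shifted_coeffs n g i = (case i of 0 \<Rightarrow> 1 | Suc j \<Rightarrow> if j < n then g j else 0)"

definition mult_linear :: "nat \<Rightarrow> real \<Rightarrow> (nat \<Rightarrow> real) \<Rightarrow> nat \<Rightarrow> real" where
  "mult_linear n s g = (\<lambda>i\<in>{..<Suc n}. shifted_coeffs n g (Suc i) - s * shifted_coeffs n g i)"

definition mult_quadratic :: "nat \<Rightarrow> real \<Rightarrow> real \<Rightarrow> (nat \<Rightarrow> real) \<Rightarrow> nat \<Rightarrow> real" where
  "mult_quadratic n s t g = (\<lambda>i\<in>{..<Suc (Suc n)}. shifted_coeffs n g (Suc i) - 2 * s * shifted_coeffs n g i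
      + (s\<^sup>2 + t\<^sup>2) * (case i of 0 \<Rightarrow> 0 | Suc j \<Rightarrow> shifted_coeffs n g j))"

definition linear_quotient :: "nat \<Rightarrow> (nat \<Rightarrow> real) \<Rightarrow> real \<Rightarrow> nat \<Rightarrow> real" where
  "linear_quotient n a s = (\<lambda>i\<in>{..<n}. monic_eval (Suc i) a s)"

definition quadratic_quotient :: "nat \<Rightarrow> (nat \<Rightarrow> real) \<Rightarrow> real \<Rightarrow> real \<Rightarrow> nat \<Rightarrow> real" where
  "quadratic_quotient n a s t = (\<lambda>i\<in>{..<n}. Im (Complex s t * monic_eval (Suc i) a (Complex s t)) / t)"

lemma monic_eval_mult_linear:
  "monic_eval (Suc n) (mult_linear n s g) z = (z - of_real s) * monic_eval n g z"
proof -
  let ?h = "\<lambda>i. shifted_coeffs n g (Suc i) - s * shifted_coeffs n g i"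
  have "monic_eval (Suc m) ?h z = (z - of_real s) * monic_eval m g z + of_real (shifted_coeffs n g (Suc m))"
    if "m \<le> n" for m
    using that
  proof (induction m)
    case 0
    then show ?case by (simp add: shifted_coeffs_def)
  next
    case (Suc m)
    have sh: "shifted_coeffs n g (Suc m) = g m" using Suc.prems by (simp add: shifted_coeffs_def)
    have "monic_eval (Suc (Suc m)) ?h z = z * ((z - of_real s) * monic_eval m g z + of_real (shifted_coeffs n g (Suc m))) + of_real (?h (Suc m))"
      using Suc by simp
    also have "\<dots> = (z - of_real s) * (z * monic_eval m g z + of_real (shifted_coeffs n g (Suc m))) + of_real (shifted_coeffs n g (Suc (Suc m)))"
      by (simp add: algebra_simps)
    finally show ?case unfolding sh by simp
  qed
  from this[of n] have "monic_eval (Suc n) ?h z = (z - of_real s) * monic_eval n g z"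
    by (simp add: shifted_coeffs_def)
  moreover have "monic_eval (Suc n) (mult_linear n s g) z = monic_eval (Suc n) ?h z"
    by (rule monic_eval_cong) (simp add: mult_linear_def)
  ultimately show ?thesis by simp
qed

lemma monic_eval_mult_quadratic:
  "monic_eval (Suc (Suc n)) (mult_quadratic n s t g) z = (z\<^sup>2 - 2 * of_real s * z + of_real (s\<^sup>2 + t\<^sup>2)) * monic_eval n g z"
proof -
  let ?h = "\<lambda>i. shifted_coeffs n g (Suc i) - 2 * s * shifted_coeffs n g i + (s\<^sup>2 + t\<^sup>2) * (case i of 0 \<Rightarrow> 0 | Suc j \<Rightarrow> shifted_coeffs n g j)"
  have "monic_eval (Suc (Suc m)) ?h z = (z\<^sup>2 - 2 * of_real s * z + of_real (s\<^sup>2 + t\<^sup>2)) * monic_eval m g z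
      + (z - 2 * of_real s) * of_real (shifted_coeffs n g (Suc m)) + of_real (shifted_coeffs n g (Suc (Suc m)))"
    if "m \<le> n" for m
    using that
  proof (induction m)
    case 0
    then show ?case by (simp add: shifted_coeffs_def algebra_simps power2_eq_square)
  next
    case (Suc m)
    have sh: "shifted_coeffs n g (Suc m) = g m" using Suc.prems by (simp add: shifted_coeffs_def)
    have "monic_eval (Suc (Suc (Suc m))) ?h z = z * monic_eval (Suc (Suc m)) ?h z + of_real (?h (Suc (Suc m)))"
      by simp
    also have "\<dots> = z * ((z\<^sup>2 - 2 * of_real s * z + of_real (s\<^sup>2 + t\<^sup>2)) * monic_eval m g z
      + (z - 2 * of_real s) * of_real (shifted_coeffs n g (Suc m)) + of_real (shifted_coeffs n g (Suc (Suc m)))) + of_real (?h (Suc (Suc m)))"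
      using Suc by simp
    also have "\<dots> = (z\<^sup>2 - 2 * of_real s * z + of_real (s\<^sup>2 + t\<^sup>2)) * (z * monic_eval m g z + of_real (shifted_coeffs n g (Suc m)))
      + (z - 2 * of_real s) * of_real (shifted_coeffs n g (Suc (Suc m))) + of_real (shifted_coeffs n g (Suc (Suc (Suc m))))"
      by (simp add: algebra_simps power2_eq_square)
    also have "\<dots> = (z\<^sup>2 - 2 * of_real s * z + of_real (s\<^sup>2 + t\<^sup>2)) * monic_eval (Suc m) g z
      + (z - 2 * of_real s) * of_real (shifted_coeffs n g (Suc (Suc m))) + of_real (shifted_coeffs n g (Suc (Suc (Suc m))))"
      unfolding sh by simp
    finally show ?case .
  qed
  from this[of n] have "monic_eval (Suc (Suc n)) ?h z = (z\<^sup>2 - 2 * of_real s * z + of_real (s\<^sup>2 + t\<^sup>2)) * monic_eval n g z"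
    by (simp add: shifted_coeffs_def)
  moreover have "monic_eval (Suc (Suc n)) (mult_quadratic n s t g) z = monic_eval (Suc (Suc n)) ?h z"
    by (rule monic_eval_cong) (simp add: mult_quadratic_def)
  ultimately show ?thesis by simp
qed

lemma quadratic_factors:
  fixes z :: complex
  shows "z\<^sup>2 - 2 * of_real s * z + of_real (s\<^sup>2 + t\<^sup>2) = (z - Complex s t) * (z - Complex s (- t))"
  by (simp add: complex_eq_iff power2_eq_square algebra_simps)

lemma monic_eval_mult_quadratic_complex:
  fixes z :: complex
  shows "monic_eval (Suc (Suc n)) (mult_quadratic n s t g) z
    = (z - Complex s t) * (z - Complex s (- t)) * monic_eval n g z"
  unfolding monic_eval_mult_quadratic quadratic_factors ..

lemma mult_linear_quotient:
  assumes "a \<in> space (leb {..<n})"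
  shows "mult_linear n s (linear_quotient n a s) = a(n := - s * monic_eval n a s)"
proof
  fix i
  have sh: "shifted_coeffs n (linear_quotient n a s) i = (if i \<le> n then monic_eval i a s else 0)" for i
    by (auto simp: shifted_coeffs_def linear_quotient_def split: nat.split)
  show "mult_linear n s (linear_quotient n a s) i = (a(n := - s * monic_eval n a s)) i"
    using space_leb_undefined[OF assms, of i] by (auto simp: mult_linear_def sh)
qed

lemma mult_quadratic_quotient:
  fixes s t :: real
  assumes "a \<in> space (leb {..<n})" "t \<noteq> 0"
  defines "w \<equiv> Complex s t"
  shows "mult_quadratic n s t (quadratic_quotient n a s t) =
    a(n := - Im (w\<^sup>2 * monic_eval n a w) / t, Suc n := (s\<^sup>2 + t\<^sup>2) * Im (w * monic_eval n a w) / t)"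
proof
  fix i
  have sh: "shifted_coeffs n (quadratic_quotient n a s t) i = (if i \<le> n then Im (w * monic_eval i a w) / t else 0)" for i
    using assms(2) by (auto simp: shifted_coeffs_def quadratic_quotient_def w_def split: nat.split)
  have key: "Im (w * monic_eval (Suc j) a w) - 2 * s * Im (w * monic_eval j a w)
      + (case j of 0 \<Rightarrow> 0 | Suc k \<Rightarrow> (s\<^sup>2 + t\<^sup>2) * Im (w * monic_eval k a w)) = t * a j" for j
    by (cases j) (simp_all add: w_def algebra_simps power2_eq_square)
  have key2: "- 2 * s * Im (w * monic_eval j a w)
      + (case j of 0 \<Rightarrow> 0 | Suc k \<Rightarrow> (s\<^sup>2 + t\<^sup>2) * Im (w * monic_eval k a w)) = - Im (w\<^sup>2 * monic_eval j a w)" for j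
    by (cases j) (simp_all add: w_def algebra_simps power2_eq_square)
  consider "i < n" | "i = n" | "i = Suc n" | "i > Suc n" by linarith
  then show "mult_quadratic n s t (quadratic_quotient n a s t) i =
    (a(n := - Im (w\<^sup>2 * monic_eval n a w) / t, Suc n := (s\<^sup>2 + t\<^sup>2) * Im (w * monic_eval n a w) / t)) i"
  proof cases
    case 1
    have "mult_quadratic n s t (quadratic_quotient n a s t) i
      = (Im (w * monic_eval (Suc i) a w) - 2 * s * Im (w * monic_eval i a w)
        + (case i of 0 \<Rightarrow> 0 | Suc k \<Rightarrow> (s\<^sup>2 + t\<^sup>2) * Im (w * monic_eval k a w))) / t"
      using 1 assms(2) by (cases i) (simp_all add: mult_quadratic_def sh field_simps del: monic_eval.simps times_complex.sel)
    also have "\<dots> = a i" unfolding key using assms(2) by simp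
    finally show ?thesis using 1 by simp
  next
    case 2
    then have "i \<le> n" by simp
    have c: "(case i of 0 \<Rightarrow> 0 | Suc j \<Rightarrow> shifted_coeffs n (quadratic_quotient n a s t) j)
        = (case i of 0 \<Rightarrow> 0 | Suc k \<Rightarrow> Im (w * monic_eval k a w)) / t"
      using \<open>i \<le> n\<close> by (auto simp add: sh simp del: monic_eval.simps times_complex.sel split: nat.split)
    have shi: "shifted_coeffs n (quadratic_quotient n a s t) i = Im (w * monic_eval i a w) / t"
      "shifted_coeffs n (quadratic_quotient n a s t) (Suc i) = 0" "i \<in> {..<Suc (Suc n)}"
      using 2 by (simp_all add: sh del: monic_eval.simps times_complex.sel)
    have "mult_quadratic n s t (quadratic_quotient n a s t) i
      = 0 - 2 * s * (Im (w * monic_eval i a w) / t) + (s\<^sup>2 + t\<^sup>2) * ((case i of 0 \<Rightarrow> 0 | Suc k \<Rightarrow> Im (w * monic_eval k a w)) / t)"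
      unfolding mult_quadratic_def by (simp only: restrict_apply c shi if_True)
    also have "\<dots> = (- 2 * s * Im (w * monic_eval i a w)
        + (case i of 0 \<Rightarrow> 0 | Suc k \<Rightarrow> (s\<^sup>2 + t\<^sup>2) * Im (w * monic_eval k a w))) / t"
      using assms(2) by (cases i) (simp_all add: field_simps del: monic_eval.simps times_complex.sel)
    also have "\<dots> = - Im (w\<^sup>2 * monic_eval i a w) / t" unfolding key2 ..
    finally show ?thesis using 2 by simp
  next
    case 3
    then show ?thesis by (simp add: mult_quadratic_def sh)
  next
    case 4
    then show ?thesis using space_leb_undefined[OF assms(1), of i] by (simp add: mult_quadratic_def)
  qed
qed

lemma linear_quotient_unitriangular:
  "linear_quotient n a s = (\<lambda>i\<in>{..<n}. a i + s * monic_eval i a s)"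
  by (simp add: linear_quotient_def add.commute)

lemma quadratic_quotient_unitriangular:
  "t \<noteq> 0 \<Longrightarrow> quadratic_quotient n a s t = (\<lambda>i\<in>{..<n}. a i + Im ((Complex s t)\<^sup>2 * monic_eval i a (Complex s t)) / t)"
  by (auto simp: quadratic_quotient_def fun_eq_iff field_simps power2_eq_square)

lemma measurable_monic_eval_comp:
  fixes Z :: "'x \<Rightarrow> 'a::{real_normed_field, second_countable_topology}"
  assumes A: "A \<in> N \<rightarrow>\<^sub>M leb {..<m}" and Z: "Z \<in> borel_measurable N" and "n \<le> m"
  shows "(\<lambda>x. monic_eval n (A x) (Z x)) \<in> borel_measurable N"
  using \<open>n \<le> m\<close>
proof (induction n)
  case (Suc n)
  have "(\<lambda>x. A x n) \<in> borel_measurable N"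
    using Suc.prems by (intro measurable_leb_component[OF A]) auto
  then have "(\<lambda>x. of_real (A x n) :: 'a) \<in> borel_measurable N"
    by (rule measurable_compose) (intro borel_measurable_continuous_onI continuous_intros)
  then show ?case unfolding monic_eval.simps using Suc Z by (intro borel_measurable_add borel_measurable_times) auto
qed simp

lemma measurable_Complex:
  assumes [measurable]: "f \<in> borel_measurable N" "g \<in> borel_measurable N"
  shows "(\<lambda>x. Complex (f x) (g x)) \<in> borel_measurable N"
  unfolding Complex_eq by measurable

lemma measurable_shifted_coeffs:
  assumes "G \<in> N \<rightarrow>\<^sub>M leb {..<n}"
  shows "(\<lambda>x. shifted_coeffs n (G x) i) \<in> borel_measurable N"
  using measurable_leb_component[OF assms] by (cases i; cases "i \<le> n") (auto simp: shifted_coeffs_def)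

lemma measurable_mult_linear:
  assumes "G \<in> N \<rightarrow>\<^sub>M leb {..<n}" "S \<in> borel_measurable N"
  shows "(\<lambda>x. mult_linear n (S x) (G x)) \<in> N \<rightarrow>\<^sub>M leb {..<Suc n}"
  unfolding mult_linear_def using measurable_shifted_coeffs[OF assms(1)] assms(2)
  by (intro measurable_restrict) simp

lemma measurable_mult_quadratic:
  assumes "G \<in> N \<rightarrow>\<^sub>M leb {..<n}" and [measurable]: "S \<in> borel_measurable N" "T \<in> borel_measurable N"
  shows "(\<lambda>x. mult_quadratic n (S x) (T x) (G x)) \<in> N \<rightarrow>\<^sub>M leb {..<Suc (Suc n)}"
proof -
  note [measurable] = measurable_shifted_coeffs[OF assms(1)]
  have "(\<lambda>x. case i of 0 \<Rightarrow> 0 | Suc j \<Rightarrow> shifted_coeffs n (G x) j) \<in> borel_measurable N" for i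
    by (cases i) auto
  note [measurable] = this
  show ?thesis unfolding mult_quadratic_def by (intro measurable_restrict) simp
qed

lemma measurable_linear_quotient:
  assumes "A \<in> N \<rightarrow>\<^sub>M leb {..<m}" "S \<in> borel_measurable N" "n \<le> m"
  shows "(\<lambda>x. linear_quotient n (A x) (S x)) \<in> N \<rightarrow>\<^sub>M leb {..<n}"
  unfolding linear_quotient_def using measurable_monic_eval_comp[OF assms(1,2)] assms(3)
  by (intro measurable_restrict) (simp del: monic_eval.simps)

lemma measurable_quadratic_quotient:
  assumes "A \<in> N \<rightarrow>\<^sub>M leb {..<m}" and [measurable]: "S \<in> borel_measurable N" "T \<in> borel_measurable N" and "n \<le> m"
  shows "(\<lambda>x. quadratic_quotient n (A x) (S x) (T x)) \<in> N \<rightarrow>\<^sub>M leb {..<n}"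
  unfolding quadratic_quotient_def
proof (intro measurable_restrict)
  fix i assume "i \<in> {..<n}"
  have [measurable]: "(\<lambda>x. Complex (S x) (T x)) \<in> borel_measurable N" by (intro measurable_Complex) measurable
  have [measurable]: "(\<lambda>x. monic_eval (Suc i) (A x) (Complex (S x) (T x))) \<in> borel_measurable N"
    using \<open>i \<in> {..<n}\<close> \<open>n \<le> m\<close> by (intro measurable_monic_eval_comp[OF assms(1)]) auto
  show "(\<lambda>x. Im (Complex (S x) (T x) * monic_eval (Suc i) (A x) (Complex (S x) (T x))) / T x) \<in> N \<rightarrow>\<^sub>M lborel"
    unfolding measurable_lborel1 by (simp del: monic_eval.simps)
qed

definition has_upper_root :: "nat \<Rightarrow> (nat \<Rightarrow> real) \<Rightarrow> bool" where
  "has_upper_root n a \<longleftrightarrow> (\<exists>z::complex. Im z > 0 \<and> monic_eval n a z = 0)"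

definition upper_roots_left_of :: "nat \<Rightarrow> (nat \<Rightarrow> real) \<Rightarrow> real \<Rightarrow> bool" where
  "upper_roots_left_of n a s \<longleftrightarrow> (\<forall>z::complex. Im z > 0 \<longrightarrow> Re z \<ge> s \<longrightarrow> monic_eval n a z \<noteq> 0)"

definition upper_root_above :: "nat \<Rightarrow> (nat \<Rightarrow> real) \<Rightarrow> real \<Rightarrow> bool" where
  "upper_root_above n a s \<longleftrightarrow> (\<exists>z::complex. Im z > 0 \<and> Re z = s \<and> monic_eval n a z = 0)"

definition real_roots_left_of :: "nat \<Rightarrow> (nat \<Rightarrow> real) \<Rightarrow> real \<Rightarrow> bool" where
  "real_roots_left_of n a s \<longleftrightarrow> (\<forall>x::real. x \<ge> s \<longrightarrow> monic_eval n a x \<noteq> 0)"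

lemma upper_half_plane_sigma_compact:
  obtains K :: "nat \<Rightarrow> complex set" where "\<And>m. compact (K m)" "(\<Union>m. K m) = {z. Im z > 0}"
proof
  let ?K = "\<lambda>m. cball 0 (real m) \<inter> {z. Im z \<ge> 1 / real (Suc m)}"
  show "compact (?K m)" for m
    by (intro closed_Int_compact compact_Int_closed closed_halfspace_Im_ge) auto
  show "(\<Union>m. ?K m) = {z. Im z > 0}"
  proof safe
    fix z :: complex assume "Im z > 0"
    then obtain k where k: "1 / real (Suc k) < Im z"
      using reals_Archimedean[of "Im z"] by (auto simp: inverse_eq_divide)
    obtain l where l: "cmod z \<le> real l" using real_arch_simple by blast
    have "1 / real (Suc (max k l)) \<le> 1 / real (Suc k)" by (simp add: field_simps)
    then have "z \<in> ?K (max k l)" using k l by auto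
    then show "z \<in> (\<Union>m. ?K m)" by blast
  next
    fix z m assume "1 / real (Suc m) \<le> Im z"
    moreover have "0 < 1 / real (Suc m)" by simp
    ultimately show "0 < Im z" by linarith
  qed
qed

lemma measurable_ex_upper:
  fixes h :: "'x \<Rightarrow> complex \<Rightarrow> real"
  assumes "\<And>x. x \<in> space N \<Longrightarrow> continuous_on UNIV (h x)" "\<And>z. (\<lambda>x. h x z) \<in> borel_measurable N"
  shows "Measurable.pred N (\<lambda>x. \<exists>z. Im z > 0 \<and> h x z = 0)"
proof -
  obtain K :: "nat \<Rightarrow> complex set" where K: "\<And>m. compact (K m)" "(\<Union>m. K m) = {z. Im z > 0}"
    by (rule upper_half_plane_sigma_compact) blast
  have "Measurable.pred N (\<lambda>x. \<exists>z\<in>(\<Union>m. K m). h x z = 0)"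
    using assms K(1) by (intro measurable_ex_zero_sigma_compact) auto
  then show ?thesis unfolding K(2) by (simp add: Bex_def)
qed

lemma measurable_has_upper_root:
  assumes A: "A \<in> N \<rightarrow>\<^sub>M leb {..<n}"
  shows "Measurable.pred N (\<lambda>x. has_upper_root n (A x))"
proof -
  have "Measurable.pred N (\<lambda>x. \<exists>z::complex. Im z > 0 \<and> cmod (monic_eval n (A x) z) = 0)"
    by (rule measurable_ex_upper)
       (auto intro!: continuous_intros continuous_monic_eval measurable_compose[OF measurable_monic_eval_comp[OF A _ order_refl] borel_measurable_norm])
  then show ?thesis by (simp add: has_upper_root_def)
qed

lemma measurable_upper_root_above:
  assumes A: "A \<in> N \<rightarrow>\<^sub>M leb {..<n}" and [measurable]: "S \<in> borel_measurable N"
  shows "Measurable.pred N (\<lambda>x. upper_root_above n (A x) (S x))"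
proof -
  have [measurable]: "(\<lambda>x. cmod (monic_eval n (A x) z)) \<in> borel_measurable N" for z
    by (rule measurable_compose[OF measurable_monic_eval_comp[OF A _ order_refl] borel_measurable_norm]) simp
  have "Measurable.pred N (\<lambda>x. \<exists>z::complex. Im z > 0 \<and> cmod (monic_eval n (A x) z) + \<bar>Re z - S x\<bar> = 0)"
    by (rule measurable_ex_upper) (auto intro!: continuous_intros continuous_monic_eval)
  then show ?thesis by (simp add: upper_root_above_def add_nonneg_eq_0_iff conj_commute)
qed

lemma measurable_upper_roots_left_of:
  assumes A: "A \<in> N \<rightarrow>\<^sub>M leb {..<n}" and [measurable]: "S \<in> borel_measurable N"
  shows "Measurable.pred N (\<lambda>x. upper_roots_left_of n (A x) (S x))"
proof -
  have [measurable]: "(\<lambda>x. cmod (monic_eval n (A x) z)) \<in> borel_measurable N" for z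
    by (rule measurable_compose[OF measurable_monic_eval_comp[OF A _ order_refl] borel_measurable_norm]) simp
  have "Measurable.pred N (\<lambda>x. \<exists>z::complex. Im z > 0 \<and> cmod (monic_eval n (A x) z) + max 0 (S x - Re z) = 0)"
    by (rule measurable_ex_upper) (auto intro!: continuous_intros continuous_monic_eval)
  then have "Measurable.pred N (\<lambda>x. \<not> (\<exists>z::complex. Im z > 0 \<and> cmod (monic_eval n (A x) z) + max 0 (S x - Re z) = 0))"
    by measurable
  moreover have "(\<not> (\<exists>z::complex. Im z > 0 \<and> cmod (monic_eval n a z) + max 0 (s - Re z) = 0)) \<longleftrightarrow> upper_roots_left_of n a s" for a s
    unfolding upper_roots_left_of_def by (subst add_nonneg_eq_0_iff) auto
  ultimately show ?thesis by simp
qed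

lemma measurable_real_roots_left_of:
  assumes A: "A \<in> N \<rightarrow>\<^sub>M leb {..<n}" and [measurable]: "S \<in> borel_measurable N"
  shows "Measurable.pred N (\<lambda>x. real_roots_left_of n (A x) (S x))"
proof -
  have [measurable]: "(\<lambda>x. \<bar>monic_eval n (A x) z\<bar>) \<in> borel_measurable N" for z :: real
    using measurable_monic_eval_comp[OF A _ order_refl, of "\<lambda>_. z"] by simp
  have U: "(\<Union>m. cball 0 (real m)) = (UNIV :: real set)"
    by (auto simp: dist_real_def intro: real_arch_simple)
  have "Measurable.pred N (\<lambda>x. \<exists>z\<in>(\<Union>m. cball 0 (real m)). \<bar>monic_eval n (A x) z\<bar> + max 0 (S x - z) = 0)"
    by (rule measurable_ex_zero_sigma_compact) (auto intro!: continuous_intros continuous_monic_eval)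
  then have [measurable]: "Measurable.pred N (\<lambda>x. \<exists>z. \<bar>monic_eval n (A x) z\<bar> + max 0 (S x - z) = 0)"
    unfolding U by simp
  have "Measurable.pred N (\<lambda>x. \<not> (\<exists>z. \<bar>monic_eval n (A x) z\<bar> + max 0 (S x - z) = 0))"
    by measurable
  moreover have "(\<not> (\<exists>z. \<bar>monic_eval n a z\<bar> + max 0 (s - z) = 0)) \<longleftrightarrow> real_roots_left_of n a s" for a s
    unfolding real_roots_left_of_def by (subst add_nonneg_eq_0_iff) auto
  ultimately show ?thesis by simp
qed

lemma finite_roots_monic_eval: "finite {z::complex. monic_eval n a z = 0}"
  using poly_roots_finite[of "monic_poly n a"] by simp

lemma finite_real_roots_monic_eval: "finite {x::real. monic_eval n a x = 0}"
proof (rule finite_imageD)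
  show "inj_on complex_of_real {x::real. monic_eval n a x = 0}" by (auto simp: inj_on_def)
  show "finite (complex_of_real ` {x::real. monic_eval n a x = 0})"
    by (rule finite_subset[OF _ finite_roots_monic_eval[of n a]]) (auto simp: monic_eval_of_real)
qed

(* @@@ d2/C2 *)

lemma monic_eval_upd [simp]: "k \<le> i \<Longrightarrow> monic_eval k (a(i := v)) z = monic_eval k a z"
  by (rule monic_eval_cong) auto


lemma monic_eval_linear_quotient:
  assumes "a \<in> space (leb {..<n})"
  shows "monic_eval (Suc n) (a(n := - s * monic_eval n a s)) z = (z - of_real s) * monic_eval n (linear_quotient n a s) z"
  unfolding mult_linear_quotient[OF assms, symmetric] by (rule monic_eval_mult_linear)

lemma nn_integral_linear_quotient:
  assumes "H \<in> borel_measurable (leb {..<n})"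
  shows "(\<integral>\<^sup>+a. H (linear_quotient n a s) \<partial>leb {..<n}) = (\<integral>\<^sup>+g. H g \<partial>leb {..<n})"
  unfolding linear_quotient_unitriangular
proof (rule nn_integral_unitriangular[OF assms])
  show "(\<lambda>a. s * monic_eval i a s) \<in> borel_measurable (leb {..<m})" if "i \<le> m" for i m
    using measurable_monic_eval[OF that, of s] by simp
  show "s * monic_eval i a s = s * monic_eval i b s" if "\<And>j. j < i \<Longrightarrow> a j = b j" for i a b
    using monic_eval_cong[of i a b s] that by simp
qed

lemma real_root_if_no_upper_root:
  assumes "\<not> has_upper_root n a" "monic_eval n a z = 0"
  shows "Im z = 0"
proof (rule ccontr)
  assume "Im z \<noteq> 0"
  then consider "Im z > 0" | "Im (cnj z) > 0" by force
  then show False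
  proof cases
    case 1
    then show False using assms by (auto simp: has_upper_root_def)
  next
    case 2
    have "monic_eval n a (cnj z) = 0" using assms(2) by (simp add: monic_eval_cnj)
    then show False using 2 assms(1) by (auto simp: has_upper_root_def)
  qed
qed

lemma monic_eval_has_root: "\<exists>z::complex. monic_eval (Suc n) a z = 0"
proof -
  obtain z where z: "monic_poly (Suc n) a = (\<Prod>i<Suc n. [:- z i, 1:])" by (rule monic_poly_factorization)
  have "monic_eval (Suc n) a (z n) = 0" unfolding monic_eval_factorization[OF z] by simp
  then show ?thesis by blast
qed

lemma greatest_real_root:
  assumes "\<not> has_upper_root (Suc n) a"
  obtains s :: real where "monic_eval (Suc n) a s = 0" "\<And>x. monic_eval (Suc n) a x = 0 \<Longrightarrow> x \<le> s"
proof -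
  let ?R = "{x::real. monic_eval (Suc n) a x = 0}"
  obtain z :: complex where z: "monic_eval (Suc n) a z = 0" using monic_eval_has_root by blast
  then have "Im z = 0" by (rule real_root_if_no_upper_root[OF assms])
  then have "z = of_real (Re z)" by (simp add: complex_eq_iff)
  then have "of_real (monic_eval (Suc n) a (Re z)) = (0::complex)"
    using z monic_eval_of_real[of "Suc n" a "Re z"] by metis
  then have "?R \<noteq> {}" by (auto simp del: monic_eval.simps)
  then have "Max ?R \<in> ?R" "\<And>x. x \<in> ?R \<Longrightarrow> x \<le> Max ?R"
    using Max_in[OF finite_real_roots_monic_eval[of "Suc n" a]] Max_ge[OF finite_real_roots_monic_eval[of "Suc n" a]] by blast+
  then show ?thesis using that[of "Max ?R"] by blast
qed

lemma finite_double_roots: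
  assumes a: "a \<in> space (leb {..<n})"
  shows "finite {s. monic_eval n (linear_quotient n a s) s = 0}"
proof -
  define p where "p = pderiv (monic_poly (Suc n) a)"
  have "p \<noteq> 0" unfolding p_def by (simp add: pderiv_eq_0_iff del: monic_poly.simps)
  then have fin: "finite {z. poly p z = 0}" by (rule poly_roots_finite)
  have ev: "poly p (of_real s) = of_real (monic_eval n (linear_quotient n a s) s)" for s
  proof -
    let ?g = "linear_quotient n a s"
    let ?b = "a(n := - s * monic_eval n a s)"
    have "poly (monic_poly (Suc n) ?b) z = poly ([:- of_real s, 1:] * monic_poly n ?g) z" for z
      unfolding poly_monic_poly monic_eval_linear_quotient[OF a] by (simp add: algebra_simps)
    then have "monic_poly (Suc n) ?b = [:- of_real s, 1:] * monic_poly n ?g"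
      by (simp only: poly_eq_poly_eq_iff[symmetric] fun_eq_iff) blast
    moreover have "pderiv (monic_poly (Suc n) ?b) = p"
      unfolding p_def using monic_poly_cong[of n ?b a] by (simp add: pderiv_pCons)
    ultimately have "p = pderiv ([:- of_real s, 1:] * monic_poly n ?g)" by simp
    then show ?thesis by (simp only: pderiv_mult poly_add poly_mult) (simp add: pderiv_pCons monic_eval_of_real)
  qed
  have "finite (complex_of_real ` {s. monic_eval n (linear_quotient n a s) s = 0})"
    by (rule finite_subset[OF _ fin]) (auto simp: ev)
  then show ?thesis by (rule finite_imageD) (auto simp: inj_on_def)
qed

lemma nn_integral_real_root_fiber:
  assumes a: "a \<in> space (leb {..<n})" and F: "F \<in> borel_measurable (leb {..<Suc n})"
  shows "(\<integral>\<^sup>+s. F (a(n := - s * monic_eval n a s)) * ennreal \<bar>- monic_eval n (linear_quotient n a s) s\<bar>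
        * indicator {s. \<not> has_upper_root n (linear_quotient n a s) \<and> real_roots_left_of n (linear_quotient n a s) s} s \<partial>lborel)
      = (\<integral>\<^sup>+v. F (a(n := v)) * indicator {v. \<not> has_upper_root (Suc n) (a(n := v))} v \<partial>lborel)"
proof -
  let ?q = "linear_quotient n a"
  let ?\<phi> = "\<lambda>s::real. - s * monic_eval n a s"
  let ?S = "{s. \<not> has_upper_root n (?q s) \<and> real_roots_left_of n (?q s) s}"
  let ?T = "{v. \<not> has_upper_root (Suc n) (a(n := v))}"
  have A: "(\<lambda>_. a) \<in> borel \<rightarrow>\<^sub>M leb {..<n}" using a by simp
  have fe: "monic_eval (Suc n) (a(n := ?\<phi> s)) z = (z - of_real s) * monic_eval n (?q s) z" for s and z :: complex
    by (rule monic_eval_linear_quotient[OF a])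
  have fr: "monic_eval (Suc n) (a(n := ?\<phi> s)) x = (x - s) * monic_eval n (?q s) x" for s and x :: real
    using monic_eval_linear_quotient[OF a, of s x] by simp
  have root: "v = ?\<phi> s" if "monic_eval (Suc n) (a(n := v)) s = 0" for v s :: real
    using that by simp
  have Q: "?q \<in> borel \<rightarrow>\<^sub>M leb {..<n}"
    using measurable_linear_quotient[OF A _ order_refl, of "\<lambda>s. s"] by simp
  have upd: "(\<lambda>v. a(n := v)) \<in> borel \<rightarrow>\<^sub>M leb {..<Suc n}"
    by (rule measurable_leb_upd[OF A]) simp
  show ?thesis
  proof (rule nn_integral_injective_substitution_real)
    have "Measurable.pred borel (\<lambda>s. \<not> has_upper_root n (?q s) \<and> real_roots_left_of n (?q s) s)"
      using measurable_has_upper_root[OF Q] measurable_real_roots_left_of[OF Q, of "\<lambda>s. s"] by simp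
    then show "?S \<in> sets borel" by (simp add: pred_def)
    have "Measurable.pred borel (\<lambda>v. \<not> has_upper_root (Suc n) (a(n := v)))"
      using measurable_has_upper_root[OF upd] by simp
    then show "?T \<in> sets borel" by (simp add: pred_def)
    show "?\<phi> \<in> borel_measurable borel"
    proof -
      have h: "(\<lambda>s::real. monic_eval n a s) \<in> borel_measurable borel"
        by (rule measurable_monic_eval_comp[OF A _ order_refl]) simp
      show ?thesis by (intro borel_measurable_times h) simp
    qed
    show "(\<lambda>s. - monic_eval n (?q s) s) \<in> borel_measurable borel"
      using measurable_monic_eval_comp[OF Q _ order_refl, of "\<lambda>s. s"] by simp
    show "(\<lambda>v. F (a(n := v))) \<in> borel_measurable borel"
      by (rule measurable_compose[OF upd F])
    show "?\<phi> ` ?S \<subseteq> ?T"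
    proof safe
      fix s assume s: "\<not> has_upper_root n (?q s)" and "has_upper_root (Suc n) (a(n := ?\<phi> s))"
      then obtain z :: complex where "Im z > 0" "(z - of_real s) * monic_eval n (?q s) z = 0"
        unfolding has_upper_root_def fe by blast
      then show False using s by (auto simp: has_upper_root_def)
    qed
    show "inj_on ?\<phi> ?S"
    proof (rule inj_onI)
      have le: "s' \<le> s" if "s \<in> ?S" "?\<phi> s = ?\<phi> s'" for s s'
      proof (rule ccontr)
        assume "\<not> s' \<le> s"
        moreover have "(s' - s) * monic_eval n (?q s) s' = 0"
          using fr[of s s'] that(2) by simp
        ultimately show False using that(1) by (auto simp: real_roots_left_of_def)
      qed
      fix s s' assume "s \<in> ?S" "s' \<in> ?S" "?\<phi> s = ?\<phi> s'"
      then show "s = s'" using le[of s s'] le[of s' s] by simp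
    qed
    show "(?\<phi> has_field_derivative - monic_eval n (?q s) s) (at s)" for s
      unfolding CARAT_DERIV
    proof (intro exI conjI allI)
      fix x
      have "monic_eval (Suc n) (a(n := ?\<phi> s)) x = x * monic_eval n a x + ?\<phi> s"
        by simp
      then show "?\<phi> x - ?\<phi> s = - monic_eval n (?q s) x * (x - s)"
        using fr[of s x] by (simp add: algebra_simps)
    next
      have "isCont (\<lambda>x. monic_eval n (?q s) x) s"
        using continuous_monic_eval[of "UNIV :: real set" n "?q s"] by (simp add: continuous_on_eq_continuous_at)
      then show "isCont (\<lambda>x. - monic_eval n (?q s) x) s" by (rule continuous_minus)
    qed simp
    show "negligible (?T - ?\<phi> ` ?S)"
    proof (rule negligible_subset)
      show "negligible (?\<phi> ` {s. monic_eval n (?q s) s = 0})"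
        by (intro negligible_finite finite_imageI finite_double_roots[OF a])
      show "?T - ?\<phi> ` ?S \<subseteq> ?\<phi> ` {s. monic_eval n (?q s) s = 0}"
      proof
        fix v assume v: "v \<in> ?T - ?\<phi> ` ?S"
        then obtain s :: real where s: "monic_eval (Suc n) (a(n := v)) s = 0" and
          max: "\<And>x. monic_eval (Suc n) (a(n := v)) x = 0 \<Longrightarrow> x \<le> s"
          using greatest_real_root[of n "a(n := v)"] by blast
        have vs: "v = ?\<phi> s" by (rule root[OF s])
        have "\<not> has_upper_root n (?q s)"
        proof
          assume "has_upper_root n (?q s)"
          then have "has_upper_root (Suc n) (a(n := ?\<phi> s))" unfolding has_upper_root_def fe by auto
          then show False using v vs by auto
        qed
        then have "\<not> real_roots_left_of n (?q s) s" using v vs by auto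
        then obtain x where x: "x \<ge> s" "monic_eval n (?q s) x = 0" by (auto simp: real_roots_left_of_def)
        then have "x \<le> s" by (intro max) (simp only: vs fr)
        then have "monic_eval n (?q s) s = 0" using x by simp
        then show "v \<in> ?\<phi> ` {s. monic_eval n (?q s) s = 0}" using vs by blast
      qed
    qed
  qed
qed

lemma nn_integral_extract_real_root:
  assumes F: "F \<in> borel_measurable (leb {..<Suc n})"
  shows "(\<integral>\<^sup>+c. F c * indicator {c. \<not> has_upper_root (Suc n) c} c \<partial>leb {..<Suc n})
    = (\<integral>\<^sup>+s. \<integral>\<^sup>+g. F (mult_linear n s g) * ennreal \<bar>monic_eval n g s\<bar>
         * indicator {g. \<not> has_upper_root n g \<and> real_roots_left_of n g s} g \<partial>leb {..<n} \<partial>lborel)"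
proof -
  define W where "W = (\<lambda>p. ennreal \<bar>monic_eval n (fst p) (snd p)\<bar>
      * indicator {p. \<not> has_upper_root n (fst p) \<and> real_roots_left_of n (fst p) (snd p)} p)"
  let ?N = "leb {..<n} \<Otimes>\<^sub>M (lborel :: real measure)"
  have W: "W \<in> borel_measurable ?N"
  proof -
    have "Measurable.pred ?N (\<lambda>p. \<not> has_upper_root n (fst p) \<and> real_roots_left_of n (fst p) (snd p))"
      using measurable_has_upper_root[of fst ?N n] measurable_real_roots_left_of[of fst ?N n snd] by simp
    then have "(\<lambda>p. indicator {p. \<not> has_upper_root n (fst p) \<and> real_roots_left_of n (fst p) (snd p)} p :: ennreal) \<in> borel_measurable ?N"
      by (intro borel_measurable_indicator') (simp add: pred_def)
    moreover have "(\<lambda>p. monic_eval n (fst p) (snd p)) \<in> borel_measurable ?N"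
      by (rule measurable_monic_eval_comp[OF measurable_fst _ order_refl]) simp
    then have "(\<lambda>p. ennreal \<bar>monic_eval n (fst p) (snd p)\<bar>) \<in> borel_measurable ?N" by measurable
    ultimately show ?thesis unfolding W_def by (intro borel_measurable_times_ennreal)
  qed
  define H where "H = (\<lambda>p. F (mult_linear n (snd p) (fst p)) * W p)"
  have H: "H \<in> borel_measurable ?N"
    unfolding H_def using W by (intro borel_measurable_times_ennreal measurable_compose[OF measurable_mult_linear F]) auto
  have Q: "(\<lambda>p. (linear_quotient n (fst p) (snd p), snd p)) \<in> ?N \<rightarrow>\<^sub>M ?N"
    by (intro measurable_Pair measurable_linear_quotient[OF measurable_fst _ order_refl]) auto
  interpret P: pair_sigma_finite "leb {..<n}" "lborel :: real measure"
    by (rule pair_sigma_finite_leb) simp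
  have "(\<integral>\<^sup>+s. \<integral>\<^sup>+g. F (mult_linear n s g) * ennreal \<bar>monic_eval n g s\<bar>
         * indicator {g. \<not> has_upper_root n g \<and> real_roots_left_of n g s} g \<partial>leb {..<n} \<partial>lborel)
      = (\<integral>\<^sup>+s. \<integral>\<^sup>+g. H (g, s) \<partial>leb {..<n} \<partial>lborel)"
    by (intro nn_integral_cong) (simp add: H_def W_def indicator_def mult_ac)
  also have "\<dots> = (\<integral>\<^sup>+s. \<integral>\<^sup>+a. H (linear_quotient n a s, s) \<partial>leb {..<n} \<partial>lborel)"
    by (intro nn_integral_cong nn_integral_linear_quotient[symmetric] measurable_compose[OF _ H]) auto
  also have "\<dots> = (\<integral>\<^sup>+a. \<integral>\<^sup>+s. H (linear_quotient n a s, s) \<partial>lborel \<partial>leb {..<n})"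
    using P.Fubini[OF measurable_compose[OF Q H]] by (simp only: fst_conv snd_conv)
  also have "\<dots> = (\<integral>\<^sup>+a. \<integral>\<^sup>+v. F (a(n := v)) * indicator {v. \<not> has_upper_root (Suc n) (a(n := v))} v \<partial>lborel \<partial>leb {..<n})"
  proof (rule nn_integral_cong)
    fix a assume a: "a \<in> space (leb {..<n})"
    show "(\<integral>\<^sup>+s. H (linear_quotient n a s, s) \<partial>lborel)
      = (\<integral>\<^sup>+v. F (a(n := v)) * indicator {v. \<not> has_upper_root (Suc n) (a(n := v))} v \<partial>lborel)"
      unfolding nn_integral_real_root_fiber[OF a F, symmetric] H_def W_def fst_conv snd_conv mult_linear_quotient[OF a]
      by (intro nn_integral_cong) (simp add: indicator_def mult_ac)
  qed
  also have "\<dots> = (\<integral>\<^sup>+a. \<integral>\<^sup>+v. F (a(n := v)) * indicator {c. \<not> has_upper_root (Suc n) c} (a(n := v)) \<partial>lborel \<partial>leb {..<n})"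
    by (intro nn_integral_cong) (simp add: indicator_def)
  also have "\<dots> = (\<integral>\<^sup>+c. F c * indicator {c. \<not> has_upper_root (Suc n) c} c \<partial>leb {..<Suc n})"
  proof (rule nn_integral_leb_Suc[symmetric])
    have "Measurable.pred (leb {..<Suc n}) (\<lambda>c. \<not> has_upper_root (Suc n) c)"
      using measurable_has_upper_root[of "\<lambda>c. c" "leb {..<Suc n}" "Suc n"] by simp
    then show "(\<lambda>c. F c * indicator {c. \<not> has_upper_root (Suc n) c} c) \<in> borel_measurable (leb {..<Suc n})"
      using F by (intro borel_measurable_times_ennreal borel_measurable_indicator') (auto simp: pred_def)
  qed
  finally show ?thesis by (rule sym)
qed


lemma monic_eval_quadratic_quotient:
  fixes s t :: real
  assumes "a \<in> space (leb {..<n})" "t \<noteq> 0"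
  defines "w \<equiv> Complex s t"
  shows "monic_eval (Suc (Suc n)) (a(n := - Im (w\<^sup>2 * monic_eval n a w) / t, Suc n := (s\<^sup>2 + t\<^sup>2) * Im (w * monic_eval n a w) / t)) z
    = (z - w) * (z - cnj w) * monic_eval n (quadratic_quotient n a s t) z"
proof -
  have "cnj w = Complex s (- t)" by (simp add: w_def complex_eq_iff)
  then show ?thesis
    using mult_quadratic_quotient[OF assms(1,2), of s] monic_eval_mult_quadratic_complex[of n s t "quadratic_quotient n a s t" z]
    by (simp only: w_def)
qed

lemma nn_integral_quadratic_quotient:
  assumes "H \<in> borel_measurable (leb {..<n})" "t \<noteq> 0"
  shows "(\<integral>\<^sup>+a. H (quadratic_quotient n a s t) \<partial>leb {..<n}) = (\<integral>\<^sup>+g. H g \<partial>leb {..<n})"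
  unfolding quadratic_quotient_unitriangular[OF assms(2)]
proof (rule nn_integral_unitriangular[OF assms(1)])
  show "(\<lambda>a. Im ((Complex s t)\<^sup>2 * monic_eval i a (Complex s t)) / t) \<in> borel_measurable (leb {..<m})" if "i \<le> m" for i m
  proof -
    have [measurable]: "(\<lambda>a. monic_eval i a (Complex s t)) \<in> borel_measurable (leb {..<m})"
      by (rule measurable_monic_eval[OF that])
    show ?thesis by measurable
  qed
  show "Im ((Complex s t)\<^sup>2 * monic_eval i a (Complex s t)) / t = Im ((Complex s t)\<^sup>2 * monic_eval i b (Complex s t)) / t"
    if "\<And>j. j < i \<Longrightarrow> a j = b j" for i a b
    using monic_eval_cong[of i a b "Complex s t"] that by simp
qed

lemma rightmost_upper_root:
  assumes "has_upper_root n a"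
  obtains w :: complex where "Im w > 0" "monic_eval n a w = 0"
    "\<And>z. Im z > 0 \<Longrightarrow> monic_eval n a z = 0 \<Longrightarrow> Re z \<le> Re w"
proof -
  let ?R = "{z::complex. Im z > 0 \<and> monic_eval n a z = 0}"
  have fin: "finite (Re ` ?R)"
    by (intro finite_imageI finite_subset[OF _ finite_roots_monic_eval[of n a]]) auto
  have ne: "Re ` ?R \<noteq> {}" using assms by (auto simp: has_upper_root_def)
  obtain w where w: "w \<in> ?R" "Max (Re ` ?R) = Re w" using Max_in[OF fin ne] by auto
  show ?thesis
  proof (rule that[of w])
    fix z :: complex assume "Im z > 0" "monic_eval n a z = 0"
    then have "Re z \<in> Re ` ?R" by auto
    then show "Re z \<le> Re w" using Max_ge[OF fin] w(2) by metis
  qed (use w in auto)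
qed

lemma has_derivative_pair_coeffs:
  fixes a :: "nat \<Rightarrow> real" and s t :: real
  assumes a: "a \<in> space (leb {..<n})" and t: "t > 0"
  defines "w \<equiv> \<lambda>p. Complex (fst p) (snd p)"
    and "c \<equiv> 2 * \<i> * of_real t * monic_eval n (quadratic_quotient n a s t) (Complex s t)"
  shows "((\<lambda>p. - Im ((w p)\<^sup>2 * monic_eval n a (w p)) / snd p) has_derivative
      (\<lambda>h. (- Im c / t) * fst h + (- Re c / t) * snd h)) (at (s, t))" (is ?d1)
    and "((\<lambda>p. ((fst p)\<^sup>2 + (snd p)\<^sup>2) * Im (w p * monic_eval n a (w p)) / snd p) has_derivative
      (\<lambda>h. (- Re c + s * Im c / t) * fst h + (Im c + s * Re c / t) * snd h)) (at (s, t))" (is ?d2)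
proof -
  let ?w0 = "Complex s t"
  let ?g = "quadratic_quotient n a s t"
  let ?\<psi>1 = "\<lambda>p. - Im ((w p)\<^sup>2 * monic_eval n a (w p)) / snd p"
  let ?\<psi>2 = "\<lambda>p. ((fst p)\<^sup>2 + (snd p)\<^sup>2) * Im (w p * monic_eval n a (w p)) / snd p"
  define E where "E = (\<lambda>z. (z - ?w0) * (z - cnj ?w0) * monic_eval n ?g z)"
  have E0: "E ?w0 = 0" by (simp add: E_def)
  have "(E has_field_derivative c) (at ?w0)"
    unfolding CARAT_DERIV
  proof (intro exI conjI allI)
    show "E z - E ?w0 = (z - cnj ?w0) * monic_eval n ?g z * (z - ?w0)" for z
      by (simp add: E_def)
    have "isCont (\<lambda>z. monic_eval n ?g z) ?w0"
      using continuous_monic_eval[of "UNIV :: complex set" n ?g] by (simp add: continuous_on_eq_continuous_at)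
    then show "isCont (\<lambda>z. (z - cnj ?w0) * monic_eval n ?g z) ?w0" by (intro continuous_intros)
    have "?w0 - cnj ?w0 = 2 * \<i> * of_real t" by (simp add: complex_eq_iff)
    then show "(?w0 - cnj ?w0) * monic_eval n ?g ?w0 = c" by (simp only: c_def)
  qed
  then have Ed: "(E has_derivative (\<lambda>h. c * h)) (at (w (s, t)))"
    by (simp add: has_field_derivative_def w_def)
  have bl: "bounded_linear (\<lambda>p::real\<times>real. of_real (fst p) + \<i> * of_real (snd p))"
    by (intro bounded_linear_add bounded_linear_compose[OF bounded_linear_of_real bounded_linear_fst]
        bounded_linear_compose[OF bounded_linear_mult_right] bounded_linear_compose[OF bounded_linear_of_real bounded_linear_snd])
  have weq: "w = (\<lambda>p. of_real (fst p) + \<i> * of_real (snd p))" by (simp add: w_def Complex_eq)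
  have wd: "(w has_derivative w) (at (s, t))"
    unfolding weq by (rule bounded_linear_imp_has_derivative[OF bl])
  have EW: "((\<lambda>p. E (w p)) has_derivative (\<lambda>h. c * w h)) (at (s, t))"
    by (rule has_derivative_compose[OF wd Ed])
  have key: "?\<psi>1 p = ?\<psi>1 (s, t) - Im (E (w p)) / snd p"
       "?\<psi>2 p = ?\<psi>2 (s, t) - Re (E (w p)) + fst p * (Im (E (w p)) / snd p)" if "snd p \<noteq> 0" for p
  proof -
    have "monic_eval (Suc (Suc n)) (a(n := ?\<psi>1 (s, t), Suc n := ?\<psi>2 (s, t))) (w p) = E (w p)"
      using monic_eval_quadratic_quotient[OF a, of t s "w p"] t unfolding E_def w_def by (simp del: monic_eval.simps)
    then have 1: "(w p)\<^sup>2 * monic_eval n a (w p) + w p * of_real (?\<psi>1 (s, t)) + of_real (?\<psi>2 (s, t)) = E (w p)"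
      by (simp add: power2_eq_square algebra_simps)
    have im: "Im (E (w p)) = Im ((w p)\<^sup>2 * monic_eval n a (w p)) + snd p * ?\<psi>1 (s, t)"
      unfolding 1[symmetric] by (simp add: w_def)
    have re: "Re (E (w p)) = Re ((w p)\<^sup>2 * monic_eval n a (w p)) + fst p * ?\<psi>1 (s, t) + ?\<psi>2 (s, t)"
      unfolding 1[symmetric] by (simp add: w_def)
    show e1: "?\<psi>1 p = ?\<psi>1 (s, t) - Im (E (w p)) / snd p"
      unfolding im using that by (simp add: field_simps)
    have "?\<psi>2 p = - Re ((w p)\<^sup>2 * monic_eval n a (w p)) - fst p * ?\<psi>1 p"
      using that by (simp add: w_def power2_eq_square field_simps)
    then show "?\<psi>2 p = ?\<psi>2 (s, t) - Re (E (w p)) + fst p * (Im (E (w p)) / snd p)"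
      unfolding e1 re by (simp add: algebra_simps)
  qed
  have op: "open {p::real\<times>real. snd p \<noteq> 0}" "(s, t) \<in> {p. snd p \<noteq> 0}"
    using t by (auto intro!: open_Collect_neq continuous_intros)
  have ImE: "((\<lambda>p. Im (E (w p)) / snd p) has_derivative (\<lambda>h. Im (c * w h) / t)) (at (s, t))"
  proof -
    have "((\<lambda>p. Im (E (w p))) has_derivative (\<lambda>h. Im (c * w h))) (at (s, t))"
      by (rule bounded_linear.has_derivative[OF bounded_linear_Im EW])
    moreover have "(snd has_derivative snd) (at (s, t))"
      by (rule bounded_linear_imp_has_derivative[OF bounded_linear_snd])
    ultimately have "((\<lambda>p. Im (E (w p)) / snd p) has_derivative
        (\<lambda>h. (Im (c * w h) * snd (s, t) - Im (E (w (s, t))) * snd h) / (snd (s, t) * snd (s, t)))) (at (s, t))"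
      using t by (intro has_derivative_divide') auto
    moreover have "(\<lambda>h. (Im (c * w h) * snd (s, t) - Im (E (w (s, t))) * snd h) / (snd (s, t) * snd (s, t))) = (\<lambda>h. Im (c * w h) / t)"
      using t E0 by (simp add: w_def)
    ultimately show ?thesis by (simp only:)
  qed
  have ReE: "((\<lambda>p. Re (E (w p))) has_derivative (\<lambda>h. Re (c * w h))) (at (s, t))"
    by (rule bounded_linear.has_derivative[OF bounded_linear_Re EW])
  have "((\<lambda>p. ?\<psi>1 (s, t) - Im (E (w p)) / snd p) has_derivative (\<lambda>h. 0 - Im (c * w h) / t)) (at (s, t))"
    by (intro has_derivative_diff has_derivative_const ImE)
  moreover have "(\<lambda>h. 0 - Im (c * w h) / t) = (\<lambda>h. (- Im c / t) * fst h + (- Re c / t) * snd h)"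
    using t by (simp add: w_def fun_eq_iff field_simps)
  ultimately have "((\<lambda>p. ?\<psi>1 (s, t) - Im (E (w p)) / snd p) has_derivative (\<lambda>h. (- Im c / t) * fst h + (- Re c / t) * snd h)) (at (s, t))"
    by (simp only:)
  then show ?d1
    by (rule has_derivative_transform_within_open[OF _ op]) (rule key(1)[symmetric], simp)
  have "((\<lambda>p. ?\<psi>2 (s, t) - Re (E (w p)) + fst p * (Im (E (w p)) / snd p)) has_derivative
      (\<lambda>h. 0 - Re (c * w h) + (fst (s, t) * (Im (c * w h) / t) + fst h * (Im (E (w (s, t))) / snd (s, t))))) (at (s, t))"
    by (intro has_derivative_diff has_derivative_add has_derivative_mult has_derivative_const ImE ReE has_derivative_fst has_derivative_ident)
  moreover have "(\<lambda>h. 0 - Re (c * w h) + (fst (s, t) * (Im (c * w h) / t) + fst h * (Im (E (w (s, t))) / snd (s, t))))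
      = (\<lambda>h. (- Re c + s * Im c / t) * fst h + (Im c + s * Re c / t) * snd h)"
    using t E0 by (simp add: w_def fun_eq_iff field_simps)
  ultimately have "((\<lambda>p. ?\<psi>2 (s, t) - Re (E (w p)) + fst p * (Im (E (w p)) / snd p)) has_derivative
      (\<lambda>h. (- Re c + s * Im c / t) * fst h + (Im c + s * Re c / t) * snd h)) (at (s, t))"
    by (simp only:)
  then show ?d2
    by (rule has_derivative_transform_within_open[OF _ op]) (rule key(2)[symmetric], simp)
qed


lemma nn_integral_upper_root_fiber:
  assumes a: "a \<in> space (leb {..<n})" and F: "F \<in> borel_measurable (leb {..<Suc (Suc n)})"
    and tie: "negligible {p. 0 < cy p \<and> upper_root_above n (quadratic_quotient n a (cx p) (cy p)) (cx p)}"
  shows "(\<integral>\<^sup>+s. \<integral>\<^sup>+t. F (mult_quadratic n s t (quadratic_quotient n a s t))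
        * ennreal \<bar>4 * t * (cmod (monic_eval n (quadratic_quotient n a s t) (Complex s t)))\<^sup>2\<bar>
        * indicator {p. 0 < snd p \<and> upper_roots_left_of n (quadratic_quotient n a (fst p) (snd p)) (fst p)} (s, t) \<partial>lborel \<partial>lborel)
      = (\<integral>\<^sup>+u. \<integral>\<^sup>+v. F (a(n := u, Suc n := v))
        * indicator {p. has_upper_root (Suc (Suc n)) (a(n := fst p, Suc n := snd p))} (u, v) \<partial>lborel \<partial>lborel)"
proof -
  let ?q = "quadratic_quotient n a"
  let ?w = "\<lambda>s t. Complex s t"
  define \<psi>1 where "\<psi>1 = (\<lambda>s t. - Im ((?w s t)\<^sup>2 * monic_eval n a (?w s t)) / t)"
  define \<psi>2 where "\<psi>2 = (\<lambda>s t. (s\<^sup>2 + t\<^sup>2) * Im (?w s t * monic_eval n a (?w s t)) / t)"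
  define J where "J = (\<lambda>s t. 4 * t * (cmod (monic_eval n (?q s t) (?w s t)))\<^sup>2)"
  define c where "c = (\<lambda>s t. 2 * \<i> * of_real t * monic_eval n (?q s t) (?w s t))"
  define S where "S = (\<lambda>s t. 0 < t \<and> upper_roots_left_of n (?q s t) s)"
  define T where "T = (\<lambda>u v. has_upper_root (Suc (Suc n)) (a(n := u, Suc n := v)))"
  let ?B = "borel :: (real \<times> real) measure"
  have A: "(\<lambda>_. a) \<in> ?B \<rightarrow>\<^sub>M leb {..<n}" using a by simp
  have fs: "fst \<in> borel_measurable ?B" and sn[measurable]: "snd \<in> borel_measurable ?B"
    by (intro borel_measurable_continuous_onI continuous_intros)+
  note [measurable] = fs
  have Q: "(\<lambda>p. ?q (fst p) (snd p)) \<in> ?B \<rightarrow>\<^sub>M leb {..<n}"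
    by (rule measurable_quadratic_quotient[OF A fs sn order_refl])
  have W[measurable]: "(\<lambda>p. ?w (fst p) (snd p)) \<in> borel_measurable ?B"
    by (rule measurable_Complex[OF fs sn])
  have MA[measurable]: "(\<lambda>p. monic_eval n a (?w (fst p) (snd p))) \<in> borel_measurable ?B"
    by (rule measurable_monic_eval_comp[OF A W order_refl])
  have MQ[measurable]: "(\<lambda>p. monic_eval n (?q (fst p) (snd p)) (?w (fst p) (snd p))) \<in> borel_measurable ?B"
    by (rule measurable_monic_eval_comp[OF Q W order_refl])
  have upd: "(\<lambda>p. a(n := fst p, Suc n := snd p)) \<in> ?B \<rightarrow>\<^sub>M leb {..<Suc (Suc n)}"
    by (rule measurable_leb_upd[OF measurable_leb_upd[OF A fs] sn])
  have fe: "monic_eval (Suc (Suc n)) (a(n := \<psi>1 s t, Suc n := \<psi>2 s t)) z = (z - ?w s t) * (z - cnj (?w s t)) * monic_eval n (?q s t) z"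
    if "t > 0" for s t and z :: complex
    unfolding \<psi>1_def \<psi>2_def using that by (intro monic_eval_quadratic_quotient[OF a]) simp
  have mult: "mult_quadratic n s t (?q s t) = a(n := \<psi>1 s t, Suc n := \<psi>2 s t)" if "t > 0" for s t
    unfolding \<psi>1_def \<psi>2_def using that by (intro mult_quadratic_quotient[OF a]) simp
  have root: "u = \<psi>1 s t \<and> v = \<psi>2 s t" if "monic_eval (Suc (Suc n)) (a(n := u, Suc n := v)) (?w s t) = 0" "t > 0" for u v s t
  proof -
    let ?z = "?w s t"
    have 0: "?z\<^sup>2 * monic_eval n a ?z + ?z * of_real u + of_real v = 0"
      using that(1) by (simp add: power2_eq_square algebra_simps)
    have im: "Im (?z\<^sup>2 * monic_eval n a ?z) + t * u = 0"
      using arg_cong[OF 0, of Im] by simp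
    have re: "Re (?z\<^sup>2 * monic_eval n a ?z) + s * u + v = 0"
      using arg_cong[OF 0, of Re] by simp
    have u: "u = \<psi>1 s t" unfolding \<psi>1_def using im that(2) by (simp add: field_simps)
    have "\<psi>2 s t = - Re (?z\<^sup>2 * monic_eval n a ?z) - s * \<psi>1 s t"
      unfolding \<psi>1_def \<psi>2_def using that(2) by (simp add: power2_eq_square field_simps)
    then show ?thesis using u re by simp
  qed
  have "(\<integral>\<^sup>+s. \<integral>\<^sup>+t. F (a(n := \<psi>1 s t, Suc n := \<psi>2 s t)) * ennreal \<bar>J s t\<bar> * indicator {p. S (fst p) (snd p)} (s, t) \<partial>lborel \<partial>lborel)
    = (\<integral>\<^sup>+u. \<integral>\<^sup>+v. F (a(n := u, Suc n := v)) * indicator {p. T (fst p) (snd p)} (u, v) \<partial>lborel \<partial>lborel)"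
  proof (rule nn_integral_injective_substitution_plane[where J = "\<lambda>s t. - J s t" and D = "\<lambda>s t. 0 < t"
        and N = "\<lambda>s t. 0 < t \<and> upper_root_above n (?q s t) s"
        and ?\<psi>1.0 = \<psi>1 and ?\<psi>2.0 = \<psi>2 and S = S and T = T and F = "\<lambda>u v. F (a(n := u, Suc n := v))"
        and ?a11.0 = "\<lambda>s t. - Im (c s t) / t" and ?a12.0 = "\<lambda>s t. - Re (c s t) / t"
        and ?a21.0 = "\<lambda>s t. - Re (c s t) + s * Im (c s t) / t" and ?a22.0 = "\<lambda>s t. Im (c s t) + s * Re (c s t) / t",
        unfolded abs_minus_cancel])
    show "Measurable.pred ?B (\<lambda>p. S (fst p) (snd p))"
    proof -
      have [measurable]: "Measurable.pred ?B (\<lambda>p. upper_roots_left_of n (?q (fst p) (snd p)) (fst p))"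
        by (rule measurable_upper_roots_left_of[OF Q fs])
      show ?thesis unfolding S_def by measurable
    qed
    show "Measurable.pred ?B (\<lambda>p. T (fst p) (snd p))"
      unfolding T_def by (rule measurable_has_upper_root[OF upd])
    show "(\<lambda>p. \<psi>1 (fst p) (snd p)) \<in> borel_measurable ?B" unfolding \<psi>1_def by measurable
    show "(\<lambda>p. \<psi>2 (fst p) (snd p)) \<in> borel_measurable ?B" unfolding \<psi>2_def by measurable
    show "(\<lambda>p. - J (fst p) (snd p)) \<in> borel_measurable ?B" unfolding J_def by measurable
    show "(\<lambda>p. F (a(n := fst p, Suc n := snd p))) \<in> borel_measurable ?B"
      by (rule measurable_compose[OF upd F])
    show "T (\<psi>1 s t) (\<psi>2 s t)" if "S s t" for s t
      unfolding T_def has_upper_root_def using that fe[of t s "?w s t"]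
      by (intro exI[of _ "?w s t"]) (simp add: S_def del: monic_eval.simps)
    show "negligible {p. 0 < cy p \<and> upper_root_above n (?q (cx p) (cy p)) (cx p)}" by (rule tie)
    show "\<exists>s t. (S s t \<or> (0 < t \<and> upper_root_above n (?q s t) s) \<and> 0 < t) \<and> u = \<psi>1 s t \<and> v = \<psi>2 s t" if Tuv: "T u v" for u v
    proof -
      obtain z :: complex where z: "Im z > 0" "monic_eval (Suc (Suc n)) (a(n := u, Suc n := v)) z = 0"
        "\<And>y. Im y > 0 \<Longrightarrow> monic_eval (Suc (Suc n)) (a(n := u, Suc n := v)) y = 0 \<Longrightarrow> Re y \<le> Re z"
        using rightmost_upper_root[OF Tuv[unfolded T_def]] by blast
      define s t where "s = Re z" and "t = Im z"
      have zw: "z = ?w s t" and t: "t > 0" using z(1) by (simp_all add: s_def t_def)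
      have uv: "u = \<psi>1 s t" "v = \<psi>2 s t" using root[of u v s t] z(2) t zw by auto
      have "S s t \<or> upper_root_above n (?q s t) s"
      proof (rule disjCI)
        assume na: "\<not> upper_root_above n (?q s t) s"
        show "S s t" unfolding S_def upper_roots_left_of_def
        proof (intro conjI allI impI notI)
          fix y :: complex assume y: "Im y > 0" "s \<le> Re y" "monic_eval n (?q s t) y = 0"
          then have "Re y \<le> s" using z(3)[of y] fe[OF t, of s y] uv by (simp add: s_def del: monic_eval.simps)
          then show False using y na by (auto simp: upper_root_above_def)
        qed (rule t)
      qed
      then show ?thesis using uv t by blast
    qed
    show "s = s' \<and> t = t'" if "S s t" "S s' t'" "\<psi>1 s t = \<psi>1 s' t'" "\<psi>2 s t = \<psi>2 s' t'" for s t s' t'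
    proof -
      have step: "s' < s \<or> (s' = s \<and> t' = t)" if "S s t" "S s' t'" "\<psi>1 s t = \<psi>1 s' t'" "\<psi>2 s t = \<psi>2 s' t'" for s t s' t'
      proof -
        have "(?w s' t' - ?w s t) * (?w s' t' - cnj (?w s t)) * monic_eval n (?q s t) (?w s' t') = 0"
          using that fe[of t s "?w s' t'"] fe[of t' s' "?w s' t'"] by (simp add: S_def del: monic_eval.simps)
        then consider "?w s' t' = ?w s t" | "?w s' t' = cnj (?w s t)" | "monic_eval n (?q s t) (?w s' t') = 0"
          by (simp only: mult_eq_0_iff right_minus_eq) blast
        then show ?thesis
        proof cases
          case 1
          then show ?thesis by simp
        next
          case 2
          then have "t' = - t" by (simp add: complex_eq_iff)
          then show ?thesis using that by (simp add: S_def)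
        next
          case 3
          then have "\<not> s \<le> s'" using that unfolding S_def upper_roots_left_of_def by fastforce
          then show ?thesis by simp
        qed
      qed
      show ?thesis using step[OF that] step[of s' t' s t] that by auto
    qed
    show "0 < t" if "S s t" for s t using that by (simp add: S_def)
    show "((\<lambda>p. \<psi>1 (fst p) (snd p)) has_derivative (\<lambda>h. - Im (c s t) / t * fst h + - Re (c s t) / t * snd h)) (at (s, t))"
      if "0 < t" for s t
      using has_derivative_pair_coeffs(1)[OF a that, of s] unfolding \<psi>1_def c_def .
    show "((\<lambda>p. \<psi>2 (fst p) (snd p)) has_derivative
        (\<lambda>h. (- Re (c s t) + s * Im (c s t) / t) * fst h + (Im (c s t) + s * Re (c s t) / t) * snd h)) (at (s, t))"
      if "0 < t" for s t
      using has_derivative_pair_coeffs(2)[OF a that, of s] unfolding \<psi>2_def c_def .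
    show "- J s t = - Im (c s t) / t * (Im (c s t) + s * Re (c s t) / t) - - Re (c s t) / t * (- Re (c s t) + s * Im (c s t) / t)"
      if "S s t" for s t
    proof -
      have t: "t > 0" using that by (simp add: S_def)
      have "(cmod (c s t))\<^sup>2 = 4 * t\<^sup>2 * (cmod (monic_eval n (?q s t) (?w s t)))\<^sup>2"
        by (simp add: c_def norm_mult power_mult_distrib)
      then have "J s t = (cmod (c s t))\<^sup>2 / t" using t by (simp add: J_def power2_eq_square)
      also have "\<dots> = ((Re (c s t))\<^sup>2 + (Im (c s t))\<^sup>2) / t" by (simp only: cmod_power2)
      finally show ?thesis using t by (simp add: field_simps power2_eq_square)
    qed
  qed
  moreover have "F (mult_quadratic n s t (?q s t)) * ennreal \<bar>4 * t * (cmod (monic_eval n (?q s t) (?w s t)))\<^sup>2\<bar>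
        * indicator {p. 0 < snd p \<and> upper_roots_left_of n (?q (fst p) (snd p)) (fst p)} (s, t)
      = F (a(n := \<psi>1 s t, Suc n := \<psi>2 s t)) * ennreal \<bar>J s t\<bar> * indicator {p. S (fst p) (snd p)} (s, t)" for s t
    by (cases "t > 0") (simp_all add: mult J_def S_def)
  ultimately show ?thesis unfolding T_def by simp
qed


lemma nn_integral_extract_upper_root:
  assumes F: "F \<in> borel_measurable (leb {..<Suc (Suc n)})"
  shows "(\<integral>\<^sup>+c. F c * indicator {c. has_upper_root (Suc (Suc n)) c} c \<partial>leb {..<Suc (Suc n)})
    = (\<integral>\<^sup>+s. \<integral>\<^sup>+t. \<integral>\<^sup>+g. F (mult_quadratic n s t g) * ennreal (4 * t * (cmod (monic_eval n g (Complex s t)))\<^sup>2)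
         * indicator {g. 0 < t \<and> upper_roots_left_of n g s} g \<partial>leb {..<n} \<partial>lborel \<partial>lborel)"
proof -
  let ?L = "lborel \<Otimes>\<^sub>M lborel :: (real \<times> real) measure"
  let ?N = "leb {..<n} \<Otimes>\<^sub>M ?L"
  interpret L: sigma_finite_measure "leb {..<n}" by (rule sigma_finite_leb) simp
  have sf: "sigma_finite_measure ?L" by (simp add: lborel_prod sigma_finite_lborel)
  interpret P: pair_sigma_finite "leb {..<n}" ?L
    by (intro pair_sigma_finite.intro L.sigma_finite_measure_axioms sf)
  have s1: "(\<lambda>p. fst (snd p)) \<in> borel_measurable ?N" and s2: "(\<lambda>p. snd (snd p)) \<in> borel_measurable ?N"
    by simp_all
  define V where "V = (\<lambda>p. ennreal \<bar>4 * snd (snd p) * (cmod (monic_eval n (fst p) (Complex (fst (snd p)) (snd (snd p)))))\<^sup>2\<bar>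
      * indicator {p. 0 < snd (snd p) \<and> upper_roots_left_of n (fst p) (fst (snd p))} p)"
  have V: "V \<in> borel_measurable ?N"
  proof -
    have [measurable]: "Measurable.pred ?N (\<lambda>p. upper_roots_left_of n (fst p) (fst (snd p)))"
      by (rule measurable_upper_roots_left_of[OF measurable_fst s1])
    have [measurable]: "(\<lambda>p. monic_eval n (fst p) (Complex (fst (snd p)) (snd (snd p)))) \<in> borel_measurable ?N"
      by (rule measurable_monic_eval_comp[OF measurable_fst measurable_Complex[OF s1 s2] order_refl])
    show ?thesis unfolding V_def by measurable
  qed
  define H where "H = (\<lambda>p. F (mult_quadratic n (fst (snd p)) (snd (snd p)) (fst p)) * V p)"
  have H: "H \<in> borel_measurable ?N"
    unfolding H_def by (intro borel_measurable_times_ennreal V measurable_compose[OF measurable_mult_quadratic[OF measurable_fst s1 s2] F])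
  have Q: "(\<lambda>p. (quadratic_quotient n (fst p) (fst (snd p)) (snd (snd p)), snd p)) \<in> ?N \<rightarrow>\<^sub>M ?N"
    by (intro measurable_Pair measurable_quadratic_quotient[OF measurable_fst s1 s2 order_refl]) simp
  have swap: "(\<integral>\<^sup>+s. \<integral>\<^sup>+t. \<integral>\<^sup>+g. K (g, (s, t)) \<partial>leb {..<n} \<partial>lborel \<partial>lborel)
      = (\<integral>\<^sup>+g. \<integral>\<^sup>+s. \<integral>\<^sup>+t. K (g, (s, t)) \<partial>lborel \<partial>lborel \<partial>leb {..<n})" if K: "K \<in> borel_measurable ?N" for K
  proof -
    have "(\<integral>\<^sup>+s. \<integral>\<^sup>+t. \<integral>\<^sup>+g. K (g, (s, t)) \<partial>leb {..<n} \<partial>lborel \<partial>lborel) = (\<integral>\<^sup>+p. \<integral>\<^sup>+g. K (g, p) \<partial>leb {..<n} \<partial>?L)"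
    proof (rule lborel.nn_integral_fst)
      show "(\<lambda>p. \<integral>\<^sup>+g. K (g, p) \<partial>leb {..<n}) \<in> borel_measurable ?L"
        using L.borel_measurable_nn_integral_fst[OF measurable_pair_swap[OF K]] by (simp add: case_prod_beta)
    qed
    also have "\<dots> = (\<integral>\<^sup>+g. \<integral>\<^sup>+p. K (g, p) \<partial>?L \<partial>leb {..<n})" by (rule P.Fubini[OF K])
    also have "\<dots> = (\<integral>\<^sup>+g. \<integral>\<^sup>+s. \<integral>\<^sup>+t. K (g, (s, t)) \<partial>lborel \<partial>lborel \<partial>leb {..<n})"
    proof (rule nn_integral_cong)
      fix g assume g: "g \<in> space (leb {..<n})"
      show "(\<integral>\<^sup>+p. K (g, p) \<partial>?L) = (\<integral>\<^sup>+s. \<integral>\<^sup>+t. K (g, (s, t)) \<partial>lborel \<partial>lborel)"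
        by (rule lborel.nn_integral_fst[symmetric], rule measurable_compose[OF _ K]) (use g in simp)
    qed
    finally show ?thesis .
  qed
  have tie: "AE a in leb {..<n}. negligible {p. 0 < cy p \<and> upper_root_above n (quadratic_quotient n a (cx p) (cy p)) (cx p)}"
  proof -
    define U where "U = (\<lambda>p :: (nat \<Rightarrow> real) \<times> real \<times> real. indicator {p. 0 < snd (snd p) \<and> upper_root_above n (fst p) (fst (snd p))} p :: ennreal)"
    have U: "U \<in> borel_measurable ?N"
    proof -
      have [measurable]: "Measurable.pred ?N (\<lambda>p. upper_root_above n (fst p) (fst (snd p)))"
        by (rule measurable_upper_root_above[OF measurable_fst s1])
      show ?thesis unfolding U_def by measurable
    qed
    have UQ: "(\<lambda>p. U (quadratic_quotient n (fst p) (fst (snd p)) (snd (snd p)), snd p)) \<in> borel_measurable ?N"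
      by (rule measurable_compose[OF Q U])
    have "(\<integral>\<^sup>+a. \<integral>\<^sup>+s. \<integral>\<^sup>+t. U (quadratic_quotient n a s t, (s, t)) \<partial>lborel \<partial>lborel \<partial>leb {..<n})
        = (\<integral>\<^sup>+s. \<integral>\<^sup>+t. \<integral>\<^sup>+a. U (quadratic_quotient n a s t, (s, t)) \<partial>leb {..<n} \<partial>lborel \<partial>lborel)"
      using swap[OF UQ] by simp
    also have "\<dots> = (\<integral>\<^sup>+s. \<integral>\<^sup>+t. \<integral>\<^sup>+g. U (g, (s, t)) \<partial>leb {..<n} \<partial>lborel \<partial>lborel)"
    proof (rule nn_integral_cong, rule nn_integral_cong)
      fix s t :: real
      show "(\<integral>\<^sup>+a. U (quadratic_quotient n a s t, (s, t)) \<partial>leb {..<n}) = (\<integral>\<^sup>+g. U (g, (s, t)) \<partial>leb {..<n})"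
      proof (cases "t > 0")
        case True
        have "(\<lambda>g. U (g, (s, t))) \<in> borel_measurable (leb {..<n})" by (rule measurable_compose[OF _ U]) simp
        from nn_integral_quadratic_quotient[OF this, of t s] True show ?thesis by simp
      qed (simp add: U_def)
    qed
    also have "\<dots> = (\<integral>\<^sup>+g. \<integral>\<^sup>+s. \<integral>\<^sup>+t. U (g, (s, t)) \<partial>lborel \<partial>lborel \<partial>leb {..<n})"
      by (rule swap[OF U])
    also have "\<dots> = (\<integral>\<^sup>+g. 0 \<partial>leb {..<n})"
    proof (rule nn_integral_cong)
      fix g assume "g \<in> space (leb {..<n})"
      have "{s. upper_root_above n g s} \<subseteq> Re ` {z. monic_eval n g z = 0}" by (auto simp: upper_root_above_def)
      then have "finite {s. upper_root_above n g s}"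
        by (rule finite_subset) (intro finite_imageI finite_roots_monic_eval)
      then have "{s. upper_root_above n g s} \<in> null_sets lborel"
        by (rule finite_imp_null_set_lborel)
      then have "AE s in lborel. \<not> upper_root_above n g s" by (auto dest: AE_not_in)
      then have "AE s in lborel. (\<integral>\<^sup>+t. U (g, (s, t)) \<partial>lborel) = 0"
        by eventually_elim (simp add: U_def)
      then have "(\<integral>\<^sup>+s. \<integral>\<^sup>+t. U (g, (s, t)) \<partial>lborel \<partial>lborel) = (\<integral>\<^sup>+s. 0 \<partial>(lborel :: real measure))"
        by (rule nn_integral_cong_AE)
      then show "(\<integral>\<^sup>+s. \<integral>\<^sup>+t. U (g, (s, t)) \<partial>lborel \<partial>lborel) = 0" by simp
    qed
    finally have zero: "(\<integral>\<^sup>+a. \<integral>\<^sup>+s. \<integral>\<^sup>+t. U (quadratic_quotient n a s t, (s, t)) \<partial>lborel \<partial>lborel \<partial>leb {..<n}) = 0" by simp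
    have m1: "(\<lambda>a. \<integral>\<^sup>+s. \<integral>\<^sup>+t. U (quadratic_quotient n a s t, (s, t)) \<partial>lborel \<partial>lborel) \<in> borel_measurable (leb {..<n})"
    proof -
      have "(\<lambda>a. \<integral>\<^sup>+p. U (quadratic_quotient n a (fst p) (snd p), p) \<partial>?L) \<in> borel_measurable (leb {..<n})"
        using sigma_finite_measure.borel_measurable_nn_integral_fst[OF sf UQ] by simp
      moreover have "(\<integral>\<^sup>+p. U (quadratic_quotient n a (fst p) (snd p), p) \<partial>?L) = (\<integral>\<^sup>+s. \<integral>\<^sup>+t. U (quadratic_quotient n a s t, (s, t)) \<partial>lborel \<partial>lborel)"
        if "a \<in> space (leb {..<n})" for a
      proof -
        have "(\<lambda>p. U (quadratic_quotient n a (fst p) (snd p), p)) \<in> borel_measurable ?L"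
          using measurable_compose[OF measurable_Pair[OF measurable_const[OF that] measurable_ident] UQ] by simp
        from lborel.nn_integral_fst[OF this] show ?thesis by simp
      qed
      ultimately show ?thesis by (subst measurable_cong) auto
    qed
    have "AE a in leb {..<n}. (\<integral>\<^sup>+s. \<integral>\<^sup>+t. U (quadratic_quotient n a s t, (s, t)) \<partial>lborel \<partial>lborel) = 0"
      using zero nn_integral_0_iff_AE[OF m1] by simp
    then show ?thesis
    proof (rule AE_mp, intro AE_I2 impI)
      fix a assume a: "a \<in> space (leb {..<n})" and z: "(\<integral>\<^sup>+s. \<integral>\<^sup>+t. U (quadratic_quotient n a s t, (s, t)) \<partial>lborel \<partial>lborel) = 0"
      let ?Z = "{p. 0 < cy p \<and> upper_root_above n (quadratic_quotient n a (cx p) (cy p)) (cx p)}"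
      have c1: "cx \<in> borel_measurable borel" and c2[measurable]: "cy \<in> borel_measurable borel"
        by (intro borel_measurable_continuous_onI continuous_intros)+
      have A: "(\<lambda>_. a) \<in> borel \<rightarrow>\<^sub>M leb {..<n}" using a by simp
      have [measurable]: "Measurable.pred borel (\<lambda>p. upper_root_above n (quadratic_quotient n a (cx p) (cy p)) (cx p))"
        by (rule measurable_upper_root_above[OF measurable_quadratic_quotient[OF A c1 c2 order_refl] c1])
      have "Measurable.pred borel (\<lambda>p. 0 < cy p \<and> upper_root_above n (quadratic_quotient n a (cx p) (cy p)) (cx p))"
        by measurable
      then have Z: "?Z \<in> sets borel" by (simp add: pred_def)
      have "emeasure lborel ?Z = (\<integral>\<^sup>+p. indicator ?Z p \<partial>lborel)" using Z by simp
      also have "\<dots> = (\<integral>\<^sup>+s. \<integral>\<^sup>+t. indicator ?Z (vec2 s t) \<partial>lborel \<partial>lborel)"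
        using Z by (intro nn_integral_vec2) simp
      also have "\<dots> = (\<integral>\<^sup>+s. \<integral>\<^sup>+t. U (quadratic_quotient n a s t, (s, t)) \<partial>lborel \<partial>lborel)"
        by (intro nn_integral_cong) (simp add: U_def indicator_def)
      finally have "?Z \<in> null_sets lborel" using z Z by (simp add: null_sets_def)
      then show "negligible ?Z" by (simp add: negligible_iff_null_sets null_sets_completionI)
    qed
  qed
  have "(\<integral>\<^sup>+s. \<integral>\<^sup>+t. \<integral>\<^sup>+g. F (mult_quadratic n s t g) * ennreal (4 * t * (cmod (monic_eval n g (Complex s t)))\<^sup>2)
         * indicator {g. 0 < t \<and> upper_roots_left_of n g s} g \<partial>leb {..<n} \<partial>lborel \<partial>lborel)
      = (\<integral>\<^sup>+s. \<integral>\<^sup>+t. \<integral>\<^sup>+g. H (g, (s, t)) \<partial>leb {..<n} \<partial>lborel \<partial>lborel)"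
    by (intro nn_integral_cong) (simp add: H_def V_def indicator_def mult_ac)
  also have "\<dots> = (\<integral>\<^sup>+s. \<integral>\<^sup>+t. \<integral>\<^sup>+a. H (quadratic_quotient n a s t, (s, t)) \<partial>leb {..<n} \<partial>lborel \<partial>lborel)"
  proof (rule nn_integral_cong, rule nn_integral_cong)
    fix s t :: real
    show "(\<integral>\<^sup>+g. H (g, (s, t)) \<partial>leb {..<n}) = (\<integral>\<^sup>+a. H (quadratic_quotient n a s t, (s, t)) \<partial>leb {..<n})"
    proof (cases "t > 0")
      case True
      have "(\<lambda>g. H (g, (s, t))) \<in> borel_measurable (leb {..<n})" by (rule measurable_compose[OF _ H]) simp
      from nn_integral_quadratic_quotient[OF this, of t s] True show ?thesis by simp
    qed (simp add: H_def V_def)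
  qed
  also have "\<dots> = (\<integral>\<^sup>+a. \<integral>\<^sup>+s. \<integral>\<^sup>+t. H (quadratic_quotient n a s t, (s, t)) \<partial>lborel \<partial>lborel \<partial>leb {..<n})"
    using swap[OF measurable_compose[OF Q H]] by simp
  also have "\<dots> = (\<integral>\<^sup>+a. \<integral>\<^sup>+u. \<integral>\<^sup>+v. F (a(n := u, Suc n := v)) * indicator {c. has_upper_root (Suc (Suc n)) c} (a(n := u, Suc n := v)) \<partial>lborel \<partial>lborel \<partial>leb {..<n})"
  proof (rule nn_integral_cong_AE, rule AE_mp[OF tie], intro AE_I2 impI)
    fix a assume a: "a \<in> space (leb {..<n})"
      and n: "negligible {p. 0 < cy p \<and> upper_root_above n (quadratic_quotient n a (cx p) (cy p)) (cx p)}"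
    show "(\<integral>\<^sup>+s. \<integral>\<^sup>+t. H (quadratic_quotient n a s t, (s, t)) \<partial>lborel \<partial>lborel)
      = (\<integral>\<^sup>+u. \<integral>\<^sup>+v. F (a(n := u, Suc n := v)) * indicator {c. has_upper_root (Suc (Suc n)) c} (a(n := u, Suc n := v)) \<partial>lborel \<partial>lborel)"
      using nn_integral_upper_root_fiber[OF a F n] by (simp add: H_def V_def indicator_def mult_ac)
  qed
  also have "\<dots> = (\<integral>\<^sup>+c. F c * indicator {c. has_upper_root (Suc (Suc n)) c} c \<partial>leb {..<Suc (Suc n)})"
  proof -
    have "Measurable.pred (leb {..<Suc (Suc n)}) (\<lambda>c. has_upper_root (Suc (Suc n)) c)"
      using measurable_has_upper_root[of "\<lambda>c. c" "leb {..<Suc (Suc n)}" "Suc (Suc n)"] by simp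
    then have FI: "(\<lambda>c. F c * indicator {c. has_upper_root (Suc (Suc n)) c} c) \<in> borel_measurable (leb {..<Suc (Suc n)})"
      using F by (intro borel_measurable_times_ennreal borel_measurable_indicator') (auto simp: pred_def)
    have "(\<lambda>p. F ((fst p)(Suc n := snd p)) * indicator {c. has_upper_root (Suc (Suc n)) c} ((fst p)(Suc n := snd p))) \<in> borel_measurable (leb {..<Suc n} \<Otimes>\<^sub>M lborel)"
      by (rule measurable_compose[OF measurable_leb_upd FI]) simp_all
    from lborel.borel_measurable_nn_integral_fst[OF this]
    have m: "(\<lambda>a. \<integral>\<^sup>+v. F (a(Suc n := v)) * indicator {c. has_upper_root (Suc (Suc n)) c} (a(Suc n := v)) \<partial>lborel) \<in> borel_measurable (leb {..<Suc n})"
      by (simp only: fst_conv snd_conv)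
    show ?thesis unfolding nn_integral_leb_Suc[OF FI] nn_integral_leb_Suc[OF m] ..
  qed
  finally show ?thesis by (rule sym)
qed

(* @@@ d2/C3 *)

definition root_coeffs :: "nat \<Rightarrow> (nat \<Rightarrow> complex) \<Rightarrow> nat \<Rightarrow> real" where
  "root_coeffs n z = (\<lambda>i\<in>{..<n}. Re (coeff (\<Prod>j<n. [:- z j, 1:]) (n - 1 - i)))"

definition vandermonde :: "nat \<Rightarrow> (nat \<Rightarrow> complex) \<Rightarrow> real" where
  "vandermonde n z = (\<Prod>k<n. \<Prod>j<k. cmod (z k - z j))"

definition ordered_params :: "nat \<Rightarrow> nat \<Rightarrow> ((nat \<Rightarrow> real) \<times> (nat \<Rightarrow> real)) set" where
  "ordered_params L M = {(x, y) \<in> space (param_lebesgue L M).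
     strict_mono_on {..<L} x \<and> strict_mono_on {L..<L+M} x \<and> (\<forall>p\<in>{L..<L+M}. y p > 0)}"

lemma root_coeffs_eqI:
  assumes "monic_poly n a = (\<Prod>j<n. [:- z j, 1:])" "\<And>i. i \<ge> n \<Longrightarrow> a i = undefined"
  shows "root_coeffs n z = a"
proof
  fix i
  show "root_coeffs n z i = a i"
  proof (cases "i < n")
    case True
    then show ?thesis
      using coeff_monic_poly[of "n - 1 - i" n a] by (simp add: root_coeffs_def assms(1)[symmetric])
  next
    case False
    then show ?thesis using assms(2)[of i] by (simp add: root_coeffs_def)
  qed
qed

lemma monic_poly_mult_linear:
  "monic_poly (Suc n) (mult_linear n s g) = [:- of_real s, 1:] * monic_poly n g"
proof -
  have "poly (monic_poly (Suc n) (mult_linear n s g)) z = poly ([:- of_real s, 1:] * monic_poly n g) z" for z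
    unfolding poly_monic_poly monic_eval_mult_linear by (simp add: algebra_simps)
  then show ?thesis by (simp only: poly_eq_poly_eq_iff[symmetric] fun_eq_iff) blast
qed

lemma monic_poly_mult_quadratic:
  "monic_poly (Suc (Suc n)) (mult_quadratic n s t g)
    = monic_poly n g * [:- Complex s t, 1:] * [:- Complex s (- t), 1:]"
proof -
  have "poly (monic_poly (Suc (Suc n)) (mult_quadratic n s t g)) z
      = poly (monic_poly n g * [:- Complex s t, 1:] * [:- Complex s (- t), 1:]) z" for z
    unfolding poly_monic_poly monic_eval_mult_quadratic_complex poly_mult by (simp add: algebra_simps)
  then show ?thesis by (simp only: poly_eq_poly_eq_iff[symmetric] fun_eq_iff) blast
qed

lemma param_tuple_Suc_pair:
  "param_tuple L (Suc M) (x, y) = (param_tuple L M (x, y))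
     (L + 2 * M := Complex (x (L + M)) (y (L + M)), Suc (L + 2 * M) := Complex (x (L + M)) (- y (L + M)))"
proof
  fix i
  consider "i < L + 2 * M" | "i = L + 2 * M" | "i = Suc (L + 2 * M)" | "i > Suc (L + 2 * M)" by linarith
  then show "param_tuple L (Suc M) (x, y) i = ((param_tuple L M (x, y))
     (L + 2 * M := Complex (x (L + M)) (y (L + M)), Suc (L + 2 * M) := Complex (x (L + M)) (- y (L + M)))) i"
    by cases (simp_all add: param_tuple_def Let_def)
qed

lemma param_tuple_Suc_real:
  "param_tuple (Suc L) 0 (x, y) = (param_tuple L 0 (x, y))(L := of_real (x L))"
  by (auto simp: param_tuple_def fun_eq_iff)

lemma param_tuple_cong:
  assumes "\<And>i. i < L + M \<Longrightarrow> x i = x' i" "\<And>i. i \<in> {L..<L + M} \<Longrightarrow> y i = y' i"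
  shows "param_tuple L M (x, y) = param_tuple L M (x', y')"
proof
  fix i
  show "param_tuple L M (x, y) i = param_tuple L M (x', y') i"
  proof (cases "i < L")
    case True then show ?thesis using assms(1)[of i] by (simp add: param_tuple_def)
  next
    case False
    then have "L + (i - L) div 2 < L + M" if "i < L + 2 * M" using that by auto
    then show ?thesis using False assms(1)[of "L + (i - L) div 2"] assms(2)[of "L + (i - L) div 2"]
      by (auto simp: param_tuple_def Let_def)
  qed
qed

lemma param_tuple_undefined: "i \<ge> L + 2 * M \<Longrightarrow> param_tuple L M v i = undefined"
  by (cases v) (simp add: param_tuple_def)

lemma prod_linear_factors_cong: "(\<And>j. j < n \<Longrightarrow> z j = z' j) \<Longrightarrow> (\<Prod>j<n. [:- z j, 1:]) = (\<Prod>j<n. [:- z' j, 1:])"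
  by (rule prod.cong) auto

lemma monic_poly_root_coeffs_param:
  "monic_poly (L + 2 * M) (root_coeffs (L + 2 * M) (param_tuple L M (x, y))) = (\<Prod>j<L + 2 * M. [:- param_tuple L M (x, y) j, 1:])"
proof -
  have "\<exists>a. monic_poly (L + 2 * M) a = (\<Prod>j<L + 2 * M. [:- param_tuple L M (x, y) j, 1:]) \<and> (\<forall>i\<ge>L + 2 * M. a i = undefined)"
  proof (induction M)
    case 0
    show ?case
    proof (induction L)
      case 0
      then show ?case by (intro exI[of _ "\<lambda>_. undefined"]) simp
    next
      case (Suc L)
      then obtain a where a: "monic_poly L a = (\<Prod>j<L. [:- param_tuple L 0 (x, y) j, 1:])" by auto
      have "monic_poly (Suc L) (mult_linear L (x L) a) = (\<Prod>j<Suc L. [:- param_tuple (Suc L) 0 (x, y) j, 1:])"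
        unfolding monic_poly_mult_linear a param_tuple_Suc_real prod.lessThan_Suc
        using prod_linear_factors_cong[of L "(param_tuple L 0 (x, y))(L := complex_of_real (x L))" "param_tuple L 0 (x, y)"]
        by (simp only: mult.commute fun_upd_same) simp
      moreover have "mult_linear L (x L) a i = undefined" if "i \<ge> Suc L" for i
        using that by (simp add: mult_linear_def)
      ultimately show ?case by auto
    qed
  next
    case (Suc M)
    let ?n = "L + 2 * M"
    obtain a where a: "monic_poly ?n a = (\<Prod>j<?n. [:- param_tuple L M (x, y) j, 1:])" using Suc by auto
    have e: "L + 2 * Suc M = Suc (Suc ?n)" by simp
    have "monic_poly (Suc (Suc ?n)) (mult_quadratic ?n (x (L + M)) (y (L + M)) a) = (\<Prod>j<Suc (Suc ?n). [:- param_tuple L (Suc M) (x, y) j, 1:])"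
      unfolding monic_poly_mult_quadratic a param_tuple_Suc_pair prod.lessThan_Suc by simp
    moreover have "mult_quadratic ?n (x (L + M)) (y (L + M)) a i = undefined" if "i \<ge> Suc (Suc ?n)" for i
      using that by (simp add: mult_quadratic_def)
    ultimately show ?case unfolding e by blast
  qed
  then show ?thesis using root_coeffs_eqI by metis
qed

lemma root_coeffs_Suc_pair:
  "root_coeffs (Suc (Suc (L + 2 * M))) (param_tuple L (Suc M) (x, y))
    = mult_quadratic (L + 2 * M) (x (L + M)) (y (L + M)) (root_coeffs (L + 2 * M) (param_tuple L M (x, y)))"
proof (rule root_coeffs_eqI)
  show "monic_poly (Suc (Suc (L + 2 * M))) (mult_quadratic (L + 2 * M) (x (L + M)) (y (L + M)) (root_coeffs (L + 2 * M) (param_tuple L M (x, y))))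
    = (\<Prod>j<Suc (Suc (L + 2 * M)). [:- param_tuple L (Suc M) (x, y) j, 1:])"
    unfolding monic_poly_mult_quadratic monic_poly_root_coeffs_param param_tuple_Suc_pair prod.lessThan_Suc by simp
qed (simp add: mult_quadratic_def)

lemma root_coeffs_Suc_real:
  "root_coeffs (Suc L) (param_tuple (Suc L) 0 (x, y)) = mult_linear L (x L) (root_coeffs L (param_tuple L 0 (x, y)))"
proof (rule root_coeffs_eqI)
  show "monic_poly (Suc L) (mult_linear L (x L) (root_coeffs L (param_tuple L 0 (x, y)))) = (\<Prod>j<Suc L. [:- param_tuple (Suc L) 0 (x, y) j, 1:])"
    using monic_poly_root_coeffs_param[of L 0 x y]
    unfolding monic_poly_mult_linear param_tuple_Suc_real prod.lessThan_Suc by (simp add: mult.commute)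
qed (simp add: mult_linear_def)

lemma vandermonde_Suc: "vandermonde (Suc n) z = vandermonde n z * (\<Prod>j<n. cmod (z n - z j))"
  by (simp add: vandermonde_def)

lemma vandermonde_nonneg: "vandermonde n z \<ge> 0"
  unfolding vandermonde_def by (intro prod_nonneg) auto

lemma vandermonde_cong: "(\<And>j. j < n \<Longrightarrow> z j = z' j) \<Longrightarrow> vandermonde n z = vandermonde n z'"
  unfolding vandermonde_def by (intro prod.cong refl) auto

lemma vandermonde_Suc_real:
  "vandermonde (Suc L) (param_tuple (Suc L) 0 (x, y))
    = vandermonde L (param_tuple L 0 (x, y)) * \<bar>monic_eval L (root_coeffs L (param_tuple L 0 (x, y))) (x L)\<bar>"
proof -
  let ?z = "param_tuple L 0 (x, y)" and ?g = "root_coeffs L (param_tuple L 0 (x, y))"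
  have "\<bar>monic_eval L ?g (x L)\<bar> = cmod (monic_eval L ?g (of_real (x L)))"
    by (simp add: monic_eval_of_real)
  also have "\<dots> = (\<Prod>j<L. cmod (of_real (x L) - ?z j))"
    using monic_eval_factorization[OF monic_poly_root_coeffs_param[of L 0 x y, unfolded mult_0_right add_0_right]] by (simp add: prod_norm)
  finally have e: "\<bar>monic_eval L ?g (x L)\<bar> = (\<Prod>j<L. cmod (of_real (x L) - ?z j))" .
  show ?thesis unfolding e vandermonde_Suc param_tuple_Suc_real
    using vandermonde_cong[of L "?z(L := of_real (x L))" ?z] by simp
qed

lemma vandermonde_Suc_pair:
  fixes x y :: "nat \<Rightarrow> real"
  assumes "y (L + M) > 0"
  shows "vandermonde (Suc (Suc (L + 2 * M))) (param_tuple L (Suc M) (x, y))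
    = vandermonde (L + 2 * M) (param_tuple L M (x, y)) * (2 * y (L + M)
      * (cmod (monic_eval (L + 2 * M) (root_coeffs (L + 2 * M) (param_tuple L M (x, y))) (Complex (x (L + M)) (y (L + M)))))\<^sup>2)"
proof -
  let ?n = "L + 2 * M"
  let ?z = "param_tuple L M (x, y)" and ?g = "root_coeffs (L + 2 * M) (param_tuple L M (x, y))"
  let ?w = "Complex (x (L + M)) (y (L + M))" and ?w' = "Complex (x (L + M)) (- y (L + M))"
  have cm: "cmod (monic_eval ?n ?g u) = (\<Prod>j<?n. cmod (u - ?z j))" for u
    using monic_eval_factorization[OF monic_poly_root_coeffs_param[of L M x y]] by (simp add: prod_norm)
  have "?w' = cnj ?w" by (simp add: complex_eq_iff)
  then have 1: "(\<Prod>j<?n. cmod (?w' - ?z j)) = (\<Prod>j<?n. cmod (?w - ?z j))"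
    by (simp only: cm[symmetric] monic_eval_cnj complex_mod_cnj)
  have 2: "cmod (?w' - ?w) = 2 * y (L + M)"
    using assms by (simp add: cmod_def real_sqrt_mult)
  show ?thesis
    unfolding vandermonde_Suc param_tuple_Suc_pair cm
    using vandermonde_cong[of ?n "?z(?n := ?w, Suc ?n := ?w')" ?z] 1 2
    by (simp add: power2_eq_square)
qed

lemma ordered_params_Suc_real:
  assumes "(x, y) \<in> space (param_lebesgue L 0)"
  shows "(x(L := s), y) \<in> ordered_params (Suc L) 0 \<longleftrightarrow> (x, y) \<in> ordered_params L 0 \<and> (\<forall>i<L. x i < s)"
proof -
  have sp: "(x(L := s), y) \<in> space (param_lebesgue (Suc L) 0)"
    using assms by (auto simp: space_pair_measure space_PiM PiE_def extensional_def)
  have "strict_mono_on {..<Suc L} (x(L := s)) \<longleftrightarrow> strict_mono_on {..<L} x \<and> (\<forall>i<L. x i < s)"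
    unfolding strict_mono_on_def by (auto simp: less_Suc_eq)
  then show ?thesis using sp assms by (auto simp: ordered_params_def)
qed

lemma ordered_params_Suc_pair:
  assumes "(x, y) \<in> space (param_lebesgue L M)"
  shows "(x(L + M := s), y(L + M := t)) \<in> ordered_params L (Suc M)
    \<longleftrightarrow> (x, y) \<in> ordered_params L M \<and> 0 < t \<and> (\<forall>i\<in>{L..<L + M}. x i < s)"
proof -
  have sp: "(x(L + M := s), y(L + M := t)) \<in> space (param_lebesgue L (Suc M))"
    using assms by (auto simp: space_pair_measure space_PiM PiE_def extensional_def)
  have 1: "strict_mono_on {..<L} (x(L + M := s)) \<longleftrightarrow> strict_mono_on {..<L} x"
    unfolding strict_mono_on_def by auto
  have 2: "strict_mono_on {L..<L + Suc M} (x(L + M := s)) \<longleftrightarrow> strict_mono_on {L..<L + M} x \<and> (\<forall>i\<in>{L..<L + M}. x i < s)"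
    unfolding strict_mono_on_def by (auto simp: less_Suc_eq)
  have 3: "(\<forall>p\<in>{L..<L + Suc M}. (y(L + M := t)) p > 0) \<longleftrightarrow> (\<forall>p\<in>{L..<L + M}. y p > 0) \<and> t > 0"
    by (auto simp: less_Suc_eq)
  show ?thesis using sp assms unfolding ordered_params_def by (simp only: mem_Collect_eq case_prod_conv 1 2 3 conj_commute) blast
qed

lemma monic_eval_root_coeffs_param:
  "monic_eval (L + 2 * M) (root_coeffs (L + 2 * M) (param_tuple L M (x, y))) u = (\<Prod>j<L + 2 * M. u - param_tuple L M (x, y) j)"
  by (rule monic_eval_factorization[OF monic_poly_root_coeffs_param])

lemma param_tuple_upper:
  assumes "(x, y) \<in> ordered_params L M" "j < L + 2 * M" "Im (param_tuple L M (x, y) j) > 0"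
  shows "\<exists>p\<in>{L..<L + M}. param_tuple L M (x, y) j = Complex (x p) (y p)"
proof -
  have "\<not> j < L" using assms(3) by (auto simp: param_tuple_def)
  moreover have "even (j - L)"
  proof (rule ccontr)
    assume o: "odd (j - L)"
    have "L + (j - L) div 2 \<in> {L..<L + M}" using assms(2) \<open>\<not> j < L\<close> by auto
    then have "y (L + (j - L) div 2) > 0" using assms(1) by (auto simp: ordered_params_def)
    then show False using assms(2,3) o \<open>\<not> j < L\<close> by (simp add: param_tuple_def Let_def)
  qed
  ultimately show ?thesis using assms(2)
    by (intro bexI[of _ "L + (j - L) div 2"]) (auto simp: param_tuple_def Let_def)
qed

lemma param_tuple_pair:
  assumes "p \<in> {L..<L + M}"
  shows "L + 2 * (p - L) < L + 2 * M" "param_tuple L M (x, y) (L + 2 * (p - L)) = Complex (x p) (y p)"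
    "Suc (L + 2 * (p - L)) < L + 2 * M" "param_tuple L M (x, y) (Suc (L + 2 * (p - L))) = Complex (x p) (- y p)"
  using assms by (auto simp: param_tuple_def Let_def)

lemma upper_roots_left_of_param:
  assumes "(x, y) \<in> ordered_params L M"
  shows "upper_roots_left_of (L + 2 * M) (root_coeffs (L + 2 * M) (param_tuple L M (x, y))) s
    \<longleftrightarrow> (\<forall>p\<in>{L..<L + M}. x p < s)"
proof
  assume l: "upper_roots_left_of (L + 2 * M) (root_coeffs (L + 2 * M) (param_tuple L M (x, y))) s"
  show "\<forall>p\<in>{L..<L + M}. x p < s"
  proof
    fix p assume p: "p \<in> {L..<L + M}"
    then have "y p > 0" using assms by (auto simp: ordered_params_def)
    moreover have "(\<Prod>j<L + 2 * M. Complex (x p) (y p) - param_tuple L M (x, y) j) = 0"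
      using param_tuple_pair(1)[OF p] param_tuple_pair(2)[OF p, of x y]
      by (intro prod_zero bexI[of _ "L + 2 * (p - L)"]) simp_all
    ultimately show "x p < s"
      using l[unfolded upper_roots_left_of_def monic_eval_root_coeffs_param, rule_format, of "Complex (x p) (y p)"]
      by (metis complex.sel not_le)
  qed
next
  assume r: "\<forall>p\<in>{L..<L + M}. x p < s"
  show "upper_roots_left_of (L + 2 * M) (root_coeffs (L + 2 * M) (param_tuple L M (x, y))) s"
    unfolding upper_roots_left_of_def monic_eval_root_coeffs_param
  proof (intro allI impI notI)
    fix z :: complex assume z: "0 < Im z" "s \<le> Re z" "(\<Prod>j<L + 2 * M. z - param_tuple L M (x, y) j) = 0"
    then obtain j where j: "j < L + 2 * M" "z = param_tuple L M (x, y) j" by auto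
    then obtain p where "p \<in> {L..<L + M}" "z = Complex (x p) (y p)"
      using param_tuple_upper[OF assms j(1)] z(1) by auto
    then have "x p < s" "Re z = x p" using r by auto
    then show False using z(2) by simp
  qed
qed

lemma has_upper_root_param:
  assumes "(x, y) \<in> ordered_params L M"
  shows "has_upper_root (L + 2 * M) (root_coeffs (L + 2 * M) (param_tuple L M (x, y))) \<longleftrightarrow> M > 0"
proof
  assume "has_upper_root (L + 2 * M) (root_coeffs (L + 2 * M) (param_tuple L M (x, y)))"
  then obtain z :: complex where z: "Im z > 0" "(\<Prod>j<L + 2 * M. z - param_tuple L M (x, y) j) = 0"
    unfolding has_upper_root_def monic_eval_root_coeffs_param by blast
  then obtain j where j: "j < L + 2 * M" "z = param_tuple L M (x, y) j" by auto
  then obtain p where "p \<in> {L..<L + M}" using param_tuple_upper[OF assms j(1)] z(1) by auto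
  then show "M > 0" by auto
next
  assume "M > 0"
  then have p: "L \<in> {L..<L + M}" by simp
  then have "y L > 0" using assms by (auto simp: ordered_params_def)
  moreover have "(\<Prod>j<L + 2 * M. Complex (x L) (y L) - param_tuple L M (x, y) j) = 0"
    using param_tuple_pair(1)[OF p] param_tuple_pair(2)[OF p, of x y]
    by (intro prod_zero bexI[of _ L]) simp_all
  ultimately show "has_upper_root (L + 2 * M) (root_coeffs (L + 2 * M) (param_tuple L M (x, y)))"
    unfolding has_upper_root_def monic_eval_root_coeffs_param by (intro exI[of _ "Complex (x L) (y L)"]) simp
qed

lemma real_roots_left_of_param:
  "real_roots_left_of L (root_coeffs L (param_tuple L 0 (x, y))) s \<longleftrightarrow> (\<forall>i<L. x i < s)"
proof -
  have e: "monic_eval L (root_coeffs L (param_tuple L 0 (x, y))) u = 0 \<longleftrightarrow> (\<exists>i<L. u = x i)" for u :: real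
  proof -
    have "monic_eval L (root_coeffs L (param_tuple L 0 (x, y))) u = 0
       \<longleftrightarrow> monic_eval L (root_coeffs L (param_tuple L 0 (x, y))) (complex_of_real u) = 0"
      by (simp add: monic_eval_of_real)
    also have "\<dots> \<longleftrightarrow> (\<Prod>j<L. complex_of_real u - param_tuple L 0 (x, y) j) = 0"
      using monic_eval_root_coeffs_param[of L 0 x y] by simp
    also have "\<dots> \<longleftrightarrow> (\<exists>i<L. u = x i)" by (auto simp: param_tuple_def)
    finally show ?thesis .
  qed
  show ?thesis unfolding real_roots_left_of_def e by (metis leD leI)
qed


lemma measurable_coeff_prod_linear:
  fixes f :: "nat \<Rightarrow> 'x \<Rightarrow> complex"
  assumes "\<And>j. j < n \<Longrightarrow> f j \<in> borel_measurable N"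
  shows "(\<lambda>x. coeff (\<Prod>j<n. [:- f j x, 1:]) i :: complex) \<in> borel_measurable N"
  using assms
proof (induction n arbitrary: i)
  case (Suc n)
  have IH[measurable]: "(\<lambda>x. coeff (\<Prod>j<n. [:- f j x, 1:]) i) \<in> borel_measurable N" for i
    using Suc by simp
  have [measurable]: "f n \<in> borel_measurable N" using Suc.prems by simp
  have e: "coeff (\<Prod>j<Suc n. [:- f j x, 1:]) i = - f n x * coeff (\<Prod>j<n. [:- f j x, 1:]) i
      + (case i of 0 \<Rightarrow> 0 | Suc k \<Rightarrow> coeff (\<Prod>j<n. [:- f j x, 1:]) k)" for x
    by (cases i) (simp_all add: algebra_simps)
  have "(\<lambda>x. case i of 0 \<Rightarrow> 0 | Suc k \<Rightarrow> coeff (\<Prod>j<n. [:- f j x, 1:]) k) \<in> borel_measurable N"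
    by (cases i) simp_all
  then show ?case unfolding e by measurable
qed simp

lemma measurable_root_coeffs: "root_coeffs n \<in> tuple_space n \<rightarrow>\<^sub>M leb {..<n}"
proof -
  have "(\<lambda>z. coeff (\<Prod>j<n. [:- z j, 1:]) i) \<in> borel_measurable (tuple_space n)" for i
    by (rule measurable_coeff_prod_linear) (auto intro: measurable_component_singleton)
  note [measurable] = this
  show ?thesis unfolding root_coeffs_def
    by (intro measurable_restrict) simp
qed

lemma measurable_vandermonde: "vandermonde n \<in> borel_measurable (tuple_space n)"
proof -
  have [measurable]: "(\<lambda>z. z k) \<in> borel_measurable (tuple_space n)" if "k < n" for k
    using that by (intro measurable_component_singleton) simp
  have "(\<lambda>z. z k - z j) \<in> borel_measurable (tuple_space n)" if "k \<in> {..<n}" "j \<in> {..<k}" for k j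
    using that by (intro borel_measurable_diff) (auto intro!: measurable_component_singleton)
  then show ?thesis unfolding vandermonde_def
    by (intro borel_measurable_prod measurable_compose[OF _ borel_measurable_norm]) auto
qed

lemma ordered_params_sets: "ordered_params L M \<in> sets (param_lebesgue L M)"
proof -
  let ?N = "param_lebesgue L M"
  have x: "(\<lambda>v. fst v i) \<in> borel_measurable ?N" if "i < L + M" for i
    using measurable_compose[OF measurable_fst component_measurable_leb] that by simp
  have y: "(\<lambda>v. snd v p) \<in> borel_measurable ?N" if "p \<in> {L..<L+M}" for p
    using measurable_compose[OF measurable_snd component_measurable_leb] that by simp
  have eq: "ordered_params L M = {v \<in> space ?N.
      (\<forall>i\<in>{..<L}. \<forall>j\<in>{i<..<L}. fst v i < fst v j) \<and>
      (\<forall>i\<in>{L..<L+M}. \<forall>j\<in>{i<..<L+M}. fst v i < fst v j) \<and> (\<forall>p\<in>{L..<L+M}. 0 < snd v p)}"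
    unfolding ordered_params_def strict_mono_on_def by (auto simp: Ball_def)
  have 2: "{v \<in> space ?N. fst v i < fst v j} \<in> sets ?N" if "i < L + M" "j < L + M" for i j
    using x[OF that(1)] x[OF that(2)] by measurable
  have 3: "{v \<in> space ?N. 0 < snd v p} \<in> sets ?N" if "p \<in> {L..<L+M}" for p
    using y[OF that] by measurable
  show ?thesis
    unfolding eq by (intro sets.sets_Collect_conj sets.sets_Collect_finite_All 2 3) auto
qed

lemma sigma_finite_param: "sigma_finite_measure (param_lebesgue L M)"
proof -
  interpret A: sigma_finite_measure "leb {..<L + M}" by (rule sigma_finite_leb) simp
  interpret B: sigma_finite_measure "leb {L..<L + M}" by (rule sigma_finite_leb) simp
  interpret P: pair_sigma_finite "leb {..<L + M}" "leb {L..<L + M}" ..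
  show ?thesis by (rule P.sigma_finite_measure_axioms)
qed

lemma nn_integral_param:
  assumes "G \<in> borel_measurable (param_lebesgue L M)"
  shows "(\<integral>\<^sup>+v. G v \<partial>param_lebesgue L M) = (\<integral>\<^sup>+x. \<integral>\<^sup>+y. G (x, y) \<partial>leb {L..<L + M} \<partial>leb {..<L + M})"
  using sigma_finite_measure.nn_integral_fst[OF sigma_finite_leb assms] by simp

lemma measurable_param_upd_real:
  "(\<lambda>p. ((fst (snd p))(L := fst p), snd (snd p))) \<in> lborel \<Otimes>\<^sub>M param_lebesgue L 0 \<rightarrow>\<^sub>M param_lebesgue (Suc L) 0"
proof -
  have "(\<lambda>p. (fst (snd p))(L := fst p)) \<in> lborel \<Otimes>\<^sub>M param_lebesgue L 0 \<rightarrow>\<^sub>M leb {..<Suc L}"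
    by (rule measurable_leb_upd) simp_all
  then show ?thesis by simp
qed

lemma nn_integral_param_Suc_real:
  assumes G: "G \<in> borel_measurable (param_lebesgue (Suc L) 0)"
  shows "(\<integral>\<^sup>+v. G v \<partial>param_lebesgue (Suc L) 0) = (\<integral>\<^sup>+s. \<integral>\<^sup>+v. G ((fst v)(L := s), snd v) \<partial>param_lebesgue L 0 \<partial>lborel)"
proof -
  have e: "(\<integral>\<^sup>+v. G v \<partial>param_lebesgue (Suc L) 0) = (\<integral>\<^sup>+x. G (x, \<lambda>_. undefined) \<partial>leb {..<Suc L})"
    unfolding nn_integral_param[OF G] by (simp add: nn_integral_leb_empty del: nn_integral_const)
  have m: "(\<lambda>x. G (x, \<lambda>_. undefined)) \<in> borel_measurable (leb {..<Suc L})"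
    by (rule measurable_compose[OF _ G]) (simp add: space_PiM)
  have "(\<integral>\<^sup>+x. G (x, \<lambda>_. undefined) \<partial>leb {..<Suc L}) = (\<integral>\<^sup>+s. \<integral>\<^sup>+x. G (x(L := s), \<lambda>_. undefined) \<partial>leb {..<L} \<partial>lborel)"
    using m unfolding lessThan_Suc by (intro lebesgue_product.product_nn_integral_insert_rev) auto
  also have "\<dots> = (\<integral>\<^sup>+s. \<integral>\<^sup>+v. G ((fst v)(L := s), snd v) \<partial>param_lebesgue L 0 \<partial>lborel)"
  proof (rule nn_integral_cong)
    fix s :: real
    have "(\<lambda>v. G ((fst v)(L := s), snd v)) \<in> borel_measurable (param_lebesgue L 0)"
      using measurable_compose[OF measurable_Pair[OF measurable_const[of s lborel] measurable_ident] measurable_compose[OF measurable_param_upd_real G]]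
      by simp
    from nn_integral_param[OF this]
    show "(\<integral>\<^sup>+x. G (x(L := s), \<lambda>_. undefined) \<partial>leb {..<L}) = (\<integral>\<^sup>+v. G ((fst v)(L := s), snd v) \<partial>param_lebesgue L 0)"
      by (simp add: nn_integral_leb_empty del: nn_integral_const)
  qed
  finally show ?thesis using e by simp
qed

lemma measurable_param_upd_pair:
  "(\<lambda>p. ((fst (snd p))(L + M := fst (fst p)), (snd (snd p))(L + M := snd (fst p))))
    \<in> (lborel \<Otimes>\<^sub>M lborel) \<Otimes>\<^sub>M param_lebesgue L M \<rightarrow>\<^sub>M param_lebesgue L (Suc M)"
proof (rule measurable_Pair)
  let ?N = "(lborel \<Otimes>\<^sub>M lborel :: (real \<times> real) measure) \<Otimes>\<^sub>M param_lebesgue L M"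
  have "(\<lambda>p. (fst (snd p))(L + M := fst (fst p))) \<in> ?N \<rightarrow>\<^sub>M leb {..<Suc (L + M)}"
    by (rule measurable_leb_upd) simp_all
  then show "(\<lambda>p. (fst (snd p))(L + M := fst (fst p))) \<in> ?N \<rightarrow>\<^sub>M leb {..<L + Suc M}" by simp
  show "(\<lambda>p. (snd (snd p))(L + M := snd (fst p))) \<in> ?N \<rightarrow>\<^sub>M leb {L..<L + Suc M}"
    by (rule measurable_fun_upd[where J = "{L..<L + M}"]) auto
qed

lemma nn_integral_param_Suc_pair:
  assumes G: "G \<in> borel_measurable (param_lebesgue L (Suc M))"
  shows "(\<integral>\<^sup>+v. G v \<partial>param_lebesgue L (Suc M))
    = (\<integral>\<^sup>+s. \<integral>\<^sup>+t. \<integral>\<^sup>+v. G ((fst v)(L + M := s), (snd v)(L + M := t)) \<partial>param_lebesgue L M \<partial>lborel \<partial>lborel)"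
proof -
  let ?k = "L + M" and ?X = "leb {..<L + M}" and ?Y = "leb {L..<L + M}"
  have GU: "(\<lambda>p. G ((fst (snd p))(?k := fst (fst p)), (snd (snd p))(?k := snd (fst p)))) \<in> borel_measurable ((lborel \<Otimes>\<^sub>M lborel) \<Otimes>\<^sub>M param_lebesgue L M)"
    by (rule measurable_compose[OF measurable_param_upd_pair G])
  have Ix: "{..<L + Suc M} = insert ?k {..<?k}" and Iy: "{L..<L + Suc M} = insert ?k {L..<?k}" by auto
  have sfY: "sigma_finite_measure (leb {L..<L + Suc M})" by (rule sigma_finite_leb) simp
  have m1: "(\<lambda>x. \<integral>\<^sup>+y. G (x, y) \<partial>leb {L..<L + Suc M}) \<in> borel_measurable (leb {..<L + Suc M})"
    using sigma_finite_measure.borel_measurable_nn_integral_fst[OF sfY G] .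
  have "(\<integral>\<^sup>+v. G v \<partial>param_lebesgue L (Suc M)) = (\<integral>\<^sup>+x. \<integral>\<^sup>+y. G (x, y) \<partial>leb {L..<L + Suc M} \<partial>leb {..<L + Suc M})"
    by (rule nn_integral_param[OF G])
  also have "\<dots> = (\<integral>\<^sup>+s. \<integral>\<^sup>+x. \<integral>\<^sup>+y. G (x(?k := s), y) \<partial>leb {L..<L + Suc M} \<partial>?X \<partial>lborel)"
    using m1 unfolding Ix by (intro lebesgue_product.product_nn_integral_insert_rev) auto
  also have "\<dots> = (\<integral>\<^sup>+s. \<integral>\<^sup>+t. \<integral>\<^sup>+v. G ((fst v)(?k := s), (snd v)(?k := t)) \<partial>param_lebesgue L M \<partial>lborel \<partial>lborel)"
  proof (rule nn_integral_cong)
    fix s :: real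
    interpret P: pair_sigma_finite ?X "lborel :: real measure" by (rule pair_sigma_finite_leb) simp
    have "(\<integral>\<^sup>+x. \<integral>\<^sup>+y. G (x(?k := s), y) \<partial>leb {L..<L + Suc M} \<partial>?X)
        = (\<integral>\<^sup>+x. \<integral>\<^sup>+t. \<integral>\<^sup>+y. G (x(?k := s), y(?k := t)) \<partial>?Y \<partial>lborel \<partial>?X)"
    proof (rule nn_integral_cong)
      fix x assume x: "x \<in> space ?X"
      then have xs: "x(?k := s) \<in> space (leb {..<L + Suc M})" by (auto simp: space_PiM PiE_def extensional_def)
      have "(\<lambda>y. G (x(?k := s), y)) \<in> borel_measurable (leb {L..<L + Suc M})"
        by (rule measurable_compose[OF _ G]) (use xs in simp)
      then show "(\<integral>\<^sup>+y. G (x(?k := s), y) \<partial>leb {L..<L + Suc M}) = (\<integral>\<^sup>+t. \<integral>\<^sup>+y. G (x(?k := s), y(?k := t)) \<partial>?Y \<partial>lborel)"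
        unfolding Iy by (intro lebesgue_product.product_nn_integral_insert_rev) auto
    qed
    also have "\<dots> = (\<integral>\<^sup>+t. \<integral>\<^sup>+x. \<integral>\<^sup>+y. G (x(?k := s), y(?k := t)) \<partial>?Y \<partial>?X \<partial>lborel)"
    proof -
      have "(\<lambda>p. ((s, snd (fst p)), (fst (fst p), snd p))) \<in> (?X \<Otimes>\<^sub>M lborel) \<Otimes>\<^sub>M ?Y \<rightarrow>\<^sub>M (lborel \<Otimes>\<^sub>M lborel) \<Otimes>\<^sub>M param_lebesgue L M"
        by (intro measurable_Pair) simp_all
      from measurable_compose[OF this GU]
      have "(\<lambda>p. G ((fst (fst p))(?k := s), (snd p)(?k := snd (fst p)))) \<in> borel_measurable ((?X \<Otimes>\<^sub>M lborel) \<Otimes>\<^sub>M ?Y)"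
        by (simp only: fst_conv snd_conv)
      from sigma_finite_measure.borel_measurable_nn_integral_fst[OF sigma_finite_leb this]
      have "(\<lambda>p. \<integral>\<^sup>+y. G ((fst p)(?k := s), y(?k := snd p)) \<partial>?Y) \<in> borel_measurable (?X \<Otimes>\<^sub>M lborel)"
        by (simp only: fst_conv snd_conv finite_atLeastLessThan)
      from P.Fubini[OF this] show ?thesis by (simp only: fst_conv snd_conv)
    qed
    also have "\<dots> = (\<integral>\<^sup>+t. \<integral>\<^sup>+v. G ((fst v)(?k := s), (snd v)(?k := t)) \<partial>param_lebesgue L M \<partial>lborel)"
    proof (rule nn_integral_cong)
      fix t :: real
      have "(\<lambda>v. ((s, t), v)) \<in> param_lebesgue L M \<rightarrow>\<^sub>M (lborel \<Otimes>\<^sub>M lborel) \<Otimes>\<^sub>M param_lebesgue L M"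
        by (intro measurable_Pair) simp_all
      from measurable_compose[OF this GU]
      have "(\<lambda>v. G ((fst v)(?k := s), (snd v)(?k := t))) \<in> borel_measurable (param_lebesgue L M)"
        by (simp only: fst_conv snd_conv)
      from nn_integral_param[OF this]
      show "(\<integral>\<^sup>+x. \<integral>\<^sup>+y. G (x(?k := s), y(?k := t)) \<partial>?Y \<partial>?X) = (\<integral>\<^sup>+v. G ((fst v)(?k := s), (snd v)(?k := t)) \<partial>param_lebesgue L M)"
        by (simp only: fst_conv snd_conv)
    qed
    finally show "(\<integral>\<^sup>+x. \<integral>\<^sup>+y. G (x(?k := s), y) \<partial>leb {L..<L + Suc M} \<partial>?X)
      = (\<integral>\<^sup>+t. \<integral>\<^sup>+v. G ((fst v)(?k := s), (snd v)(?k := t)) \<partial>param_lebesgue L M \<partial>lborel)" .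
  qed
  finally show ?thesis .
qed

(* @@@ d3/C4 *)

definition root_integral :: "nat \<Rightarrow> nat \<Rightarrow> ((nat \<Rightarrow> real) \<Rightarrow> ennreal) \<Rightarrow> ennreal" where
  "root_integral L M F = (\<integral>\<^sup>+v. F (root_coeffs (L + 2 * M) (param_tuple L M v))
      * ennreal (vandermonde (L + 2 * M) (param_tuple L M v)) * indicator (ordered_params L M) v \<partial>param_lebesgue L M)"

lemma measurable_root_integrand:
  assumes F: "F \<in> borel_measurable (leb {..<L + 2 * M})"
  shows "(\<lambda>v. F (root_coeffs (L + 2 * M) (param_tuple L M v))
      * ennreal (vandermonde (L + 2 * M) (param_tuple L M v)) * indicator (ordered_params L M) v) \<in> borel_measurable (param_lebesgue L M)"
proof -
  have 1: "(\<lambda>v. F (root_coeffs (L + 2 * M) (param_tuple L M v))) \<in> borel_measurable (param_lebesgue L M)"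
    using measurable_compose[OF measurable_compose[OF param_tuple_measurable[of L M] measurable_root_coeffs] F] .
  have 2: "(\<lambda>v. ennreal (vandermonde (L + 2 * M) (param_tuple L M v))) \<in> borel_measurable (param_lebesgue L M)"
    using measurable_compose[OF measurable_compose[OF param_tuple_measurable[of L M] measurable_vandermonde] measurable_ennreal] .
  have 3: "(\<lambda>v. indicator (ordered_params L M) v :: ennreal) \<in> borel_measurable (param_lebesgue L M)"
    by (rule borel_measurable_indicator[OF ordered_params_sets])
  show ?thesis
    using borel_measurable_times_ennreal[OF borel_measurable_times_ennreal[OF 1 2] 3] .
qed

lemma root_integral_Suc_real:
  assumes F: "F \<in> borel_measurable (leb {..<Suc L})"
  shows "root_integral (Suc L) 0 F = (\<integral>\<^sup>+s. root_integral L 0 (\<lambda>g. F (mult_linear L s g) * ennreal \<bar>monic_eval L g s\<bar>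
         * indicator {g. \<not> has_upper_root L g \<and> real_roots_left_of L g s} g) \<partial>lborel)"
proof -
  have "root_integral (Suc L) 0 F = (\<integral>\<^sup>+s. \<integral>\<^sup>+v. F (root_coeffs (Suc L) (param_tuple (Suc L) 0 ((fst v)(L := s), snd v)))
      * ennreal (vandermonde (Suc L) (param_tuple (Suc L) 0 ((fst v)(L := s), snd v))) * indicator (ordered_params (Suc L) 0) ((fst v)(L := s), snd v)
      \<partial>param_lebesgue L 0 \<partial>lborel)"
    unfolding root_integral_def using nn_integral_param_Suc_real[OF measurable_root_integrand[of F "Suc L" 0]] F by simp
  also have "\<dots> = (\<integral>\<^sup>+s. root_integral L 0 (\<lambda>g. F (mult_linear L s g) * ennreal \<bar>monic_eval L g s\<bar>
         * indicator {g. \<not> has_upper_root L g \<and> real_roots_left_of L g s} g) \<partial>lborel)"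
    unfolding root_integral_def
  proof (rule nn_integral_cong, rule nn_integral_cong)
    fix s :: real and v :: "(nat \<Rightarrow> real) \<times> (nat \<Rightarrow> real)" assume v: "v \<in> space (param_lebesgue L 0)"
    obtain x y where xy: "v = (x, y)" by (cases v)
    let ?g = "root_coeffs L (param_tuple L 0 (x, y))"
    have pt: "param_tuple L 0 (x(L := s), y) = param_tuple L 0 (x, y)" by (rule param_tuple_cong) auto
    have rc: "root_coeffs (Suc L) (param_tuple (Suc L) 0 (x(L := s), y)) = mult_linear L s ?g"
      using root_coeffs_Suc_real[of L "x(L := s)" y] pt by simp
    have vd: "vandermonde (Suc L) (param_tuple (Suc L) 0 (x(L := s), y)) = vandermonde L (param_tuple L 0 (x, y)) * \<bar>monic_eval L ?g s\<bar>"
      using vandermonde_Suc_real[of L "x(L := s)" y] pt by simp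
    have od: "(x(L := s), y) \<in> ordered_params (Suc L) 0 \<longleftrightarrow> (x, y) \<in> ordered_params L 0 \<and> (\<not> has_upper_root L ?g \<and> real_roots_left_of L ?g s)"
      unfolding ordered_params_Suc_real[OF v[unfolded xy]] real_roots_left_of_param
      using has_upper_root_param[of x y L 0] by auto
    show "F (root_coeffs (Suc L) (param_tuple (Suc L) 0 ((fst v)(L := s), snd v)))
      * ennreal (vandermonde (Suc L) (param_tuple (Suc L) 0 ((fst v)(L := s), snd v))) * indicator (ordered_params (Suc L) 0) ((fst v)(L := s), snd v)
      = F (mult_linear L s (root_coeffs (L + 2 * 0) (param_tuple L 0 v))) * ennreal \<bar>monic_eval L (root_coeffs (L + 2 * 0) (param_tuple L 0 v)) s\<bar>
         * indicator {g. \<not> has_upper_root L g \<and> real_roots_left_of L g s} (root_coeffs (L + 2 * 0) (param_tuple L 0 v))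
         * ennreal (vandermonde (L + 2 * 0) (param_tuple L 0 v)) * indicator (ordered_params L 0) v"
      unfolding mult_0_right add_0_right xy fst_conv snd_conv rc vd ennreal_mult'[OF vandermonde_nonneg]
      using od by (simp add: indicator_def mult_ac)
  qed
  finally show ?thesis .
qed

lemma root_integral_Suc_pair:
  assumes F: "F \<in> borel_measurable (leb {..<Suc (Suc (L + 2 * M))})"
  defines "H \<equiv> \<lambda>s t g. F (mult_quadratic (L + 2 * M) s t g) * ennreal (4 * t * (cmod (monic_eval (L + 2 * M) g (Complex s t)))\<^sup>2)
         * indicator {g. 0 < t \<and> upper_roots_left_of (L + 2 * M) g s} g"
  shows "2 * root_integral L (Suc M) F = (\<integral>\<^sup>+s. \<integral>\<^sup>+t. root_integral L M (H s t) \<partial>lborel \<partial>lborel)" (is ?eq)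
    and "(\<lambda>p. root_integral L M (H (fst p) (snd p))) \<in> borel_measurable (lborel \<Otimes>\<^sub>M lborel)" (is ?meas)
proof -
  let ?n = "L + 2 * M" and ?k = "L + M"
  let ?G = "\<lambda>v. 2 * (F (root_coeffs (Suc (Suc ?n)) (param_tuple L (Suc M) v))
      * ennreal (vandermonde (Suc (Suc ?n)) (param_tuple L (Suc M) v)) * indicator (ordered_params L (Suc M)) v)"
  have G0: "(\<lambda>v. F (root_coeffs (Suc (Suc ?n)) (param_tuple L (Suc M) v))
      * ennreal (vandermonde (Suc (Suc ?n)) (param_tuple L (Suc M) v)) * indicator (ordered_params L (Suc M)) v) \<in> borel_measurable (param_lebesgue L (Suc M))"
    using measurable_root_integrand[of F L "Suc M"] F by simp
  have G: "?G \<in> borel_measurable (param_lebesgue L (Suc M))"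
    by (rule borel_measurable_times_ennreal[OF borel_measurable_const G0])
  have pt: "H s t (root_coeffs ?n (param_tuple L M v)) * ennreal (vandermonde ?n (param_tuple L M v)) * indicator (ordered_params L M) v
      = ?G ((fst v)(?k := s), (snd v)(?k := t))" if v: "v \<in> space (param_lebesgue L M)" for s t v
  proof -
    obtain x y where xy: "v = (x, y)" by (cases v)
    let ?g = "root_coeffs ?n (param_tuple L M (x, y))"
    have pt: "param_tuple L M (x(?k := s), y(?k := t)) = param_tuple L M (x, y)" by (rule param_tuple_cong) auto
    have rc: "root_coeffs (Suc (Suc ?n)) (param_tuple L (Suc M) (x(?k := s), y(?k := t))) = mult_quadratic ?n s t ?g"
      using root_coeffs_Suc_pair[of L M "x(?k := s)" "y(?k := t)"] pt by simp
    have od: "(x(?k := s), y(?k := t)) \<in> ordered_params L (Suc M) \<longleftrightarrow> (x, y) \<in> ordered_params L M \<and> (0 < t \<and> upper_roots_left_of ?n ?g s)"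
      unfolding ordered_params_Suc_pair[OF v[unfolded xy]] using upper_roots_left_of_param[of x y L M s] by auto
    show ?thesis
    proof (cases "t > 0")
      case True
      have vd: "2 * ennreal (vandermonde (Suc (Suc ?n)) (param_tuple L (Suc M) (x(?k := s), y(?k := t))))
          = ennreal (vandermonde ?n (param_tuple L M (x, y))) * ennreal (4 * t * (cmod (monic_eval ?n ?g (Complex s t)))\<^sup>2)"
      proof -
        have "2 * vandermonde (Suc (Suc ?n)) (param_tuple L (Suc M) (x(?k := s), y(?k := t)))
          = vandermonde ?n (param_tuple L M (x, y)) * (4 * t * (cmod (monic_eval ?n ?g (Complex s t)))\<^sup>2)"
          using vandermonde_Suc_pair[of "y(?k := t)" L M "x(?k := s)"] pt True by simp
        then have e: "ennreal (2 * vandermonde (Suc (Suc ?n)) (param_tuple L (Suc M) (x(?k := s), y(?k := t))))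
          = ennreal (vandermonde ?n (param_tuple L M (x, y)) * (4 * t * (cmod (monic_eval ?n ?g (Complex s t)))\<^sup>2))" by (simp only:)
        show ?thesis
          unfolding ennreal_mult'[OF vandermonde_nonneg, symmetric] e[symmetric] by (simp add: ennreal_mult')
      qed
      have "?G (x(?k := s), y(?k := t)) = F (mult_quadratic ?n s t ?g)
         * (2 * ennreal (vandermonde (Suc (Suc ?n)) (param_tuple L (Suc M) (x(?k := s), y(?k := t)))))
         * indicator (ordered_params L (Suc M)) (x(?k := s), y(?k := t))"
        unfolding rc by (simp only: mult_ac)
      also have "\<dots> = H s t ?g * ennreal (vandermonde ?n (param_tuple L M (x, y))) * indicator (ordered_params L M) (x, y)"
        unfolding vd H_def using od by (simp add: indicator_def mult_ac)
      finally show ?thesis unfolding xy by simp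
    next
      case False
      then show ?thesis using od unfolding xy by (simp add: H_def indicator_def)
    qed
  qed
  have ri: "root_integral L M (H s t) = (\<integral>\<^sup>+v. ?G ((fst v)(?k := s), (snd v)(?k := t)) \<partial>param_lebesgue L M)" for s t
    unfolding root_integral_def by (rule nn_integral_cong) (rule pt)
  have "2 * root_integral L (Suc M) F = (\<integral>\<^sup>+v. ?G v \<partial>param_lebesgue L (Suc M))"
    unfolding root_integral_def using nn_integral_cmult[OF G0, of 2] by simp
  also have "\<dots> = (\<integral>\<^sup>+s. \<integral>\<^sup>+t. root_integral L M (H s t) \<partial>lborel \<partial>lborel)"
    unfolding ri by (rule nn_integral_param_Suc_pair[OF G])
  finally show ?eq .
  from sigma_finite_measure.borel_measurable_nn_integral_fst[OF sigma_finite_param measurable_compose[OF measurable_param_upd_pair G]]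
  show ?meas unfolding ri by (simp only: fst_conv snd_conv)
qed

abbreviation root_types :: "nat \<Rightarrow> (nat \<times> nat) set" where
  "root_types n \<equiv> {(L, M). L + 2 * M = n}"

lemma finite_root_types: "finite (root_types n)"
  by (rule finite_subset[of _ "{..n} \<times> {..n}"]) auto

lemma root_types_Suc_Suc:
  "root_types (Suc (Suc n)) = insert (Suc (Suc n), 0) ((\<lambda>(L, M). (L, Suc M)) ` root_types n)"
proof safe
  fix L M assume *: "L + 2 * M = Suc (Suc n)" "(L, M) \<notin> (\<lambda>(L, M). (L, Suc M)) ` root_types n"
  show "L = Suc (Suc n)" "M = 0"
  proof -
    have "M = 0"
    proof (rule ccontr)
      assume "M \<noteq> 0"
      then obtain M' where M': "M = Suc M'" by (cases M) auto
      then have "(L, M) = (\<lambda>(L, M). (L, Suc M)) (L, M')" "(L, M') \<in> root_types n" using *(1) by auto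
      then show False using *(2) by blast
    qed
    then show "M = 0" "L = Suc (Suc n)" using *(1) by auto
  qed
qed auto

lemma sum_root_types_Suc_Suc:
  "(\<Sum>(L, M)\<in>root_types (Suc (Suc n)). f L M) = f (Suc (Suc n)) 0 + (\<Sum>(L, M)\<in>root_types n. f L (Suc M))"
proof -
  have "(Suc (Suc n), 0) \<notin> (\<lambda>(L, M). (L, Suc M)) ` root_types n" by auto
  moreover have "inj_on (\<lambda>(L, M). (L, Suc M)) (root_types n)" by (auto simp: inj_on_def)
  then have "(\<Sum>(L, M)\<in>(\<lambda>(L, M). (L, Suc M)) ` root_types n. f L M) = (\<Sum>(L, M)\<in>root_types n. f L (Suc M))"
    by (subst sum.reindex) (auto intro!: sum.cong)
  ultimately show ?thesis
    unfolding root_types_Suc_Suc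
    by (subst sum.insert) (simp_all add: finite_root_types del: image_iff)
qed

lemma sum_root_types_no_upper:
  assumes "\<And>g. has_upper_root n g \<Longrightarrow> F g = 0"
  shows "(\<Sum>(L, M)\<in>root_types n. 2 ^ M * root_integral L M F) = root_integral n 0 F"
proof -
  have "root_integral L M F = 0" if "L + 2 * M = n" "M > 0" for L M
  proof -
    have "root_integral L M F = (\<integral>\<^sup>+v. 0 \<partial>param_lebesgue L M)"
      unfolding root_integral_def
    proof (rule nn_integral_cong)
      fix v :: "(nat \<Rightarrow> real) \<times> (nat \<Rightarrow> real)"
      obtain x y where xy: "v = (x, y)" by (cases v)
      have "v \<in> ordered_params L M \<Longrightarrow> F (root_coeffs (L + 2 * M) (param_tuple L M v)) = 0"
        unfolding xy using assms has_upper_root_param[of x y L M] that by auto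
      then show "F (root_coeffs (L + 2 * M) (param_tuple L M v)) * ennreal (vandermonde (L + 2 * M) (param_tuple L M v)) * indicator (ordered_params L M) v = 0"
        by (auto simp: indicator_def)
    qed
    then show ?thesis by simp
  qed
  then have "(\<Sum>(L, M)\<in>root_types n. 2 ^ M * root_integral L M F) = (\<Sum>(L, M)\<in>{(n, 0)}. 2 ^ M * root_integral L M F)"
    by (intro sum.mono_neutral_right finite_root_types) (auto, (metis neq0_conv)+)
  then show ?thesis by simp
qed

lemma not_has_upper_root_low: "\<not> has_upper_root 0 a" "\<not> has_upper_root (Suc 0) a"
proof -
  show "\<not> has_upper_root 0 a" by (simp add: has_upper_root_def)
  show "\<not> has_upper_root (Suc 0) a" unfolding has_upper_root_def
  proof safe
    fix z :: complex assume "0 < Im z" "monic_eval (Suc 0) a z = 0"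
    then have "Im (z + of_real (a 0)) = 0" by simp
    then show False using \<open>0 < Im z\<close> by simp
  qed
qed

theorem nn_integral_coeffs_eq_roots:
  assumes "F \<in> borel_measurable (leb {..<n})"
  shows "(\<integral>\<^sup>+c. F c \<partial>leb {..<n}) = (\<Sum>(L, M)\<in>root_types n. 2 ^ M * root_integral L M F)"
  using assms
proof (induction n arbitrary: F rule: less_induct)
  case (less n)
  show ?case
  proof (cases n)
    case 0
    have "root_types 0 = {(0, 0)}" by auto
    moreover have "root_integral 0 0 F = F (\<lambda>_. undefined)"
    proof -
      have sp: "space (param_lebesgue 0 0) = {(\<lambda>_. undefined, \<lambda>_. undefined)}"
        by (auto simp: space_pair_measure space_PiM)
      have od: "ordered_params 0 0 = space (param_lebesgue 0 0)"
        by (auto simp: ordered_params_def strict_mono_on_def)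
      have rc: "root_coeffs 0 z = (\<lambda>_. undefined)" for z by (auto simp: root_coeffs_def)
      have "root_integral 0 0 F = (\<integral>\<^sup>+v. F (\<lambda>_. undefined) \<partial>param_lebesgue 0 0)"
        unfolding root_integral_def
        by (rule nn_integral_cong) (simp add: od rc vandermonde_def)
      also have "\<dots> = (\<integral>\<^sup>+x. \<integral>\<^sup>+y. F (\<lambda>_. undefined) \<partial>leb {0..<0 + 0} \<partial>leb {..<0 + 0})"
        by (rule nn_integral_param) simp
      finally show ?thesis by (simp add: nn_integral_leb_empty del: nn_integral_const)
    qed
    ultimately show ?thesis using 0 by (simp add: nn_integral_leb_empty del: nn_integral_const)
  next
    case (Suc m)
    note F = less.prems[unfolded Suc]
    have "Measurable.pred (leb {..<Suc m}) (has_upper_root (Suc m))"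
      using measurable_has_upper_root[of "\<lambda>c. c" "leb {..<Suc m}" "Suc m"] by simp
    then have I: "(\<lambda>c. F c * indicator {c. has_upper_root (Suc m) c} c) \<in> borel_measurable (leb {..<Suc m})"
      "(\<lambda>c. F c * indicator {c. \<not> has_upper_root (Suc m) c} c) \<in> borel_measurable (leb {..<Suc m})"
      using F by (auto intro!: borel_measurable_times_ennreal borel_measurable_indicator' simp: pred_def)
    have split: "(\<integral>\<^sup>+c. F c \<partial>leb {..<Suc m}) = (\<integral>\<^sup>+c. F c * indicator {c. has_upper_root (Suc m) c} c \<partial>leb {..<Suc m})
        + (\<integral>\<^sup>+c. F c * indicator {c. \<not> has_upper_root (Suc m) c} c \<partial>leb {..<Suc m})"
      unfolding nn_integral_add[OF I, symmetric] by (rule nn_integral_cong) (simp add: indicator_def)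
    have real: "(\<integral>\<^sup>+c. F c * indicator {c. \<not> has_upper_root (Suc m) c} c \<partial>leb {..<Suc m}) = root_integral (Suc m) 0 F"
    proof -
      define H where "H = (\<lambda>s g. F (mult_linear m s g) * ennreal \<bar>monic_eval m g s\<bar>
         * indicator {g. \<not> has_upper_root m g \<and> real_roots_left_of m g s} g)"
      have Hm: "H s \<in> borel_measurable (leb {..<m})" for s
      proof -
        have "Measurable.pred (leb {..<m}) (\<lambda>g. \<not> has_upper_root m g \<and> real_roots_left_of m g s)"
          using measurable_has_upper_root[of "\<lambda>c. c" "leb {..<m}" m] measurable_real_roots_left_of[of "\<lambda>c. c" "leb {..<m}" m "\<lambda>_. s"] by simp
        moreover have "(\<lambda>g. monic_eval m g s) \<in> borel_measurable (leb {..<m})" by (rule measurable_monic_eval) simp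
        ultimately show ?thesis unfolding H_def
          by (intro borel_measurable_times_ennreal measurable_compose[OF measurable_mult_linear F] borel_measurable_indicator' measurable_compose[OF borel_measurable_abs measurable_ennreal])
            (auto simp: pred_def)
      qed
      have "(\<integral>\<^sup>+c. F c * indicator {c. \<not> has_upper_root (Suc m) c} c \<partial>leb {..<Suc m}) = (\<integral>\<^sup>+s. \<integral>\<^sup>+g. H s g \<partial>leb {..<m} \<partial>lborel)"
        unfolding H_def by (rule nn_integral_extract_real_root[OF F])
      also have "\<dots> = (\<integral>\<^sup>+s. root_integral m 0 (H s) \<partial>lborel)"
      proof (rule nn_integral_cong)
        fix s :: real
        have "(\<integral>\<^sup>+g. H s g \<partial>leb {..<m}) = (\<Sum>(L, M)\<in>root_types m. 2 ^ M * root_integral L M (H s))"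
          by (rule less.IH) (use Suc Hm in auto)
        also have "\<dots> = root_integral m 0 (H s)"
          by (rule sum_root_types_no_upper) (simp add: H_def)
        finally show "(\<integral>\<^sup>+g. H s g \<partial>leb {..<m}) = root_integral m 0 (H s)" .
      qed
      also have "\<dots> = root_integral (Suc m) 0 F"
        unfolding H_def by (rule root_integral_Suc_real[OF F, symmetric])
      finally show ?thesis .
    qed
    show ?thesis
    proof (cases m)
      case 0
      have "root_types (Suc 0) = {(Suc 0, 0)}" by (auto; presburger)
      moreover have "(\<integral>\<^sup>+c. F c * indicator {c. has_upper_root (Suc m) c} c \<partial>leb {..<Suc m}) = 0"
        using 0 not_has_upper_root_low(2) by simp
      ultimately show ?thesis using split real Suc 0 by simp
    next
      case (Suc k)
      note F2 = F[unfolded Suc]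
      define H where "H = (\<lambda>s t g. F (mult_quadratic k s t g) * ennreal (4 * t * (cmod (monic_eval k g (Complex s t)))\<^sup>2)
         * indicator {g. 0 < t \<and> upper_roots_left_of k g s} g)"
      have Hm: "H s t \<in> borel_measurable (leb {..<k})" for s t
      proof -
        have "Measurable.pred (leb {..<k}) (\<lambda>g. upper_roots_left_of k g s)"
          by (rule measurable_upper_roots_left_of[OF measurable_ident_sets[OF refl] borel_measurable_const])
        then have "{g \<in> space (leb {..<k}). upper_roots_left_of k g s} \<in> sets (leb {..<k})" by (rule predE)
        from borel_measurable_indicator[OF this]
        have 0: "(\<lambda>g. indicator {g \<in> space (leb {..<k}). upper_roots_left_of k g s} g :: ennreal) \<in> borel_measurable (leb {..<k})" .
        have 1: "(\<lambda>g. indicator {g. 0 < t \<and> upper_roots_left_of k g s} g :: ennreal) \<in> borel_measurable (leb {..<k})"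
        proof (cases "0 < t")
          case True
          show ?thesis by (rule measurable_cong[THEN iffD1, OF _ 0]) (simp add: True indicator_def)
        qed simp
        have [measurable]: "(\<lambda>g. monic_eval k g (Complex s t)) \<in> borel_measurable (leb {..<k})" by (rule measurable_monic_eval) simp
        have 2: "(\<lambda>g. ennreal (4 * t * (cmod (monic_eval k g (Complex s t)))\<^sup>2)) \<in> borel_measurable (leb {..<k})"
          by measurable
        have 3: "(\<lambda>g. F (mult_quadratic k s t g)) \<in> borel_measurable (leb {..<k})"
          by (rule measurable_compose[OF measurable_mult_quadratic F2]) simp_all
        show ?thesis unfolding H_def by (intro borel_measurable_times_ennreal 1 2 3)
      qed
      have pair: "2 * root_integral L (Suc M) F = (\<integral>\<^sup>+s. \<integral>\<^sup>+t. root_integral L M (H s t) \<partial>lborel \<partial>lborel)"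
        and pm: "(\<lambda>p. root_integral L M (H (fst p) (snd p))) \<in> borel_measurable (lborel \<Otimes>\<^sub>M lborel)"
        if "(L, M) \<in> root_types k" for L M
      proof -
        have k: "k = L + 2 * M" using that by simp
        show "2 * root_integral L (Suc M) F = (\<integral>\<^sup>+s. \<integral>\<^sup>+t. root_integral L M (H s t) \<partial>lborel \<partial>lborel)"
          unfolding H_def k by (rule root_integral_Suc_pair(1)) (use F2 k in simp)
        show "(\<lambda>p. root_integral L M (H (fst p) (snd p))) \<in> borel_measurable (lborel \<Otimes>\<^sub>M lborel)"
          unfolding H_def k by (rule root_integral_Suc_pair(2)) (use F2 k in simp)
      qed
      have m1: "(\<lambda>t. root_integral L M (H s t)) \<in> borel_measurable lborel" if "(L, M) \<in> root_types k" for L M s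
        using measurable_compose[OF measurable_Pair[OF measurable_const[of s lborel] measurable_ident] pm[OF that]] by simp
      have m2: "(\<lambda>s. \<integral>\<^sup>+t. root_integral L M (H s t) \<partial>lborel) \<in> borel_measurable lborel" if "(L, M) \<in> root_types k" for L M
        using lborel.borel_measurable_nn_integral_fst[OF pm[OF that]] by simp
      have m1': "(\<lambda>t. root_integral (fst i) (snd i) (H s t)) \<in> borel_measurable lborel" if "i \<in> root_types k" for i s
        by (rule m1) (use that in simp)
      have m2': "(\<lambda>s. \<integral>\<^sup>+t. root_integral (fst i) (snd i) (H s t) \<partial>lborel) \<in> borel_measurable lborel" if "i \<in> root_types k" for i
        by (rule m2) (use that in simp)
      have "(\<integral>\<^sup>+c. F c * indicator {c. has_upper_root (Suc m) c} c \<partial>leb {..<Suc m})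
          = (\<integral>\<^sup>+s. \<integral>\<^sup>+t. \<integral>\<^sup>+g. H s t g \<partial>leb {..<k} \<partial>lborel \<partial>lborel)"
        unfolding H_def Suc by (rule nn_integral_extract_upper_root[OF F2])
      also have "\<dots> = (\<integral>\<^sup>+s. \<integral>\<^sup>+t. (\<Sum>(L, M)\<in>root_types k. 2 ^ M * root_integral L M (H s t)) \<partial>lborel \<partial>lborel)"
      proof (rule nn_integral_cong, rule nn_integral_cong)
        fix s t :: real
        show "(\<integral>\<^sup>+g. H s t g \<partial>leb {..<k}) = (\<Sum>(L, M)\<in>root_types k. 2 ^ M * root_integral L M (H s t))"
          by (rule less.IH[OF _ Hm]) (simp add: Suc \<open>n = Suc m\<close>)
      qed
      also have "\<dots> = (\<integral>\<^sup>+s. (\<Sum>(L, M)\<in>root_types k. 2 ^ M * (\<integral>\<^sup>+t. root_integral L M (H s t) \<partial>lborel)) \<partial>lborel)"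
      proof (rule nn_integral_cong)
        fix s :: real
        have "(\<integral>\<^sup>+t. (\<Sum>i\<in>root_types k. 2 ^ snd i * root_integral (fst i) (snd i) (H s t)) \<partial>lborel)
            = (\<Sum>i\<in>root_types k. \<integral>\<^sup>+t. 2 ^ snd i * root_integral (fst i) (snd i) (H s t) \<partial>lborel)"
          by (rule nn_integral_sum, rule borel_measurable_times_ennreal[OF borel_measurable_const m1']) simp
        also have "\<dots> = (\<Sum>i\<in>root_types k. 2 ^ snd i * (\<integral>\<^sup>+t. root_integral (fst i) (snd i) (H s t) \<partial>lborel))"
          by (rule sum.cong[OF refl], rule nn_integral_cmult, rule m1') simp
        finally show "(\<integral>\<^sup>+t. (\<Sum>(L, M)\<in>root_types k. 2 ^ M * root_integral L M (H s t)) \<partial>lborel)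
            = (\<Sum>(L, M)\<in>root_types k. 2 ^ M * (\<integral>\<^sup>+t. root_integral L M (H s t) \<partial>lborel))"
          unfolding case_prod_unfold .
      qed
      also have "\<dots> = (\<Sum>(L, M)\<in>root_types k. 2 ^ M * (\<integral>\<^sup>+s. \<integral>\<^sup>+t. root_integral L M (H s t) \<partial>lborel \<partial>lborel))"
      proof -
        have "(\<integral>\<^sup>+s. (\<Sum>i\<in>root_types k. 2 ^ snd i * (\<integral>\<^sup>+t. root_integral (fst i) (snd i) (H s t) \<partial>lborel)) \<partial>lborel)
            = (\<Sum>i\<in>root_types k. \<integral>\<^sup>+s. 2 ^ snd i * (\<integral>\<^sup>+t. root_integral (fst i) (snd i) (H s t) \<partial>lborel) \<partial>lborel)"
          by (rule nn_integral_sum, rule borel_measurable_times_ennreal[OF borel_measurable_const m2']) simp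
        also have "\<dots> = (\<Sum>i\<in>root_types k. 2 ^ snd i * (\<integral>\<^sup>+s. \<integral>\<^sup>+t. root_integral (fst i) (snd i) (H s t) \<partial>lborel \<partial>lborel))"
          by (rule sum.cong[OF refl], rule nn_integral_cmult, rule m2') simp
        finally show ?thesis unfolding case_prod_unfold .
      qed
      also have "\<dots> = (\<Sum>(L, M)\<in>root_types k. 2 ^ Suc M * root_integral L (Suc M) F)"
      proof (rule sum.cong[OF refl])
        fix i assume i: "i \<in> root_types k"
        obtain L M where LM: "i = (L, M)" by (cases i)
        show "(case i of (L, M) \<Rightarrow> 2 ^ M * (\<integral>\<^sup>+s. \<integral>\<^sup>+t. root_integral L M (H s t) \<partial>lborel \<partial>lborel))
          = (case i of (L, M) \<Rightarrow> 2 ^ Suc M * root_integral L (Suc M) F)"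
          unfolding LM case_prod_conv pair[OF i[unfolded LM], symmetric] power_Suc by (simp only: mult_ac)
      qed
      finally have "(\<integral>\<^sup>+c. F c * indicator {c. has_upper_root (Suc m) c} c \<partial>leb {..<Suc m})
          = (\<Sum>(L, M)\<in>root_types k. 2 ^ Suc M * root_integral L (Suc M) F)" .
      then show ?thesis
        using split real unfolding \<open>n = Suc m\<close> Suc sum_root_types_Suc_Suc by (simp add: add.commute)
    qed
  qed
qed

(* @@@ d3/D *)

definition rightmost_re :: "nat \<Rightarrow> (nat \<Rightarrow> real) \<Rightarrow> real" where
  "rightmost_re n a = (if has_upper_root n a then Max (Re ` {z. Im z > 0 \<and> monic_eval n a z = 0}) else 0)"

definition highest_im :: "nat \<Rightarrow> (nat \<Rightarrow> real) \<Rightarrow> real \<Rightarrow> real" where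
  "highest_im n a s = (if upper_root_above n a s then Max {y. y > 0 \<and> monic_eval n a (Complex s y) = 0} else 0)"

definition greatest_real :: "nat \<Rightarrow> (nat \<Rightarrow> real) \<Rightarrow> real" where
  "greatest_real n a = (if \<exists>x::real. monic_eval n a x = 0 then Max {x. monic_eval n a x = 0} else 0)"

fun root_tuple :: "nat \<Rightarrow> (nat \<Rightarrow> real) \<Rightarrow> nat \<Rightarrow> complex" where
  "root_tuple 0 a = (\<lambda>_. undefined)"
| "root_tuple (Suc 0) a = (\<lambda>_. undefined)(0 := of_real (greatest_real (Suc 0) a))"
| "root_tuple (Suc (Suc n)) a =
    (if has_upper_root (Suc (Suc n)) a
     then let s = rightmost_re (Suc (Suc n)) a; t = highest_im (Suc (Suc n)) a s
          in (root_tuple n (quadratic_quotient n a s t))(n := Complex s t, Suc n := Complex s (- t))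
     else let s = greatest_real (Suc (Suc n)) a
          in (root_tuple (Suc n) (linear_quotient (Suc n) a s))(Suc n := of_real s))"

lemma finite_upper: "finite {z::complex. Im z > 0 \<and> monic_eval n a z = 0}"
  by (rule finite_subset[OF _ finite_roots_monic_eval[of n a]]) auto

lemma finite_above: "finite {y. y > 0 \<and> monic_eval n a (Complex s y) = 0}"
proof -
  have "Complex s ` {y. y > 0 \<and> monic_eval n a (Complex s y) = 0} \<subseteq> {z. monic_eval n a z = 0}" by auto
  then have "finite (Complex s ` {y. y > 0 \<and> monic_eval n a (Complex s y) = 0})"
    using finite_roots_monic_eval finite_subset by blast
  then show ?thesis by (rule finite_imageD) (auto simp: inj_on_def)
qed

lemma rightmost_re_ge:
  "r \<le> rightmost_re n a \<longleftrightarrow> (if has_upper_root n a then \<not> upper_roots_left_of n a r else r \<le> 0)"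
proof (cases "has_upper_root n a")
  case True
  then have "{z::complex. Im z > 0 \<and> monic_eval n a z = 0} \<noteq> {}" by (auto simp: has_upper_root_def)
  then show ?thesis using True finite_upper[of n a]
    by (auto simp: rightmost_re_def upper_roots_left_of_def Max_ge_iff)
qed (simp add: rightmost_re_def)

lemma greatest_real_ge:
  "r \<le> greatest_real n a \<longleftrightarrow> (if \<exists>x::real. monic_eval n a x = 0 then \<not> real_roots_left_of n a r else r \<le> 0)"
proof (cases "\<exists>x::real. monic_eval n a x = 0")
  case True
  then have "{x::real. monic_eval n a x = 0} \<noteq> {}" by auto
  then show ?thesis using True finite_real_roots_monic_eval[of n a]
    by (auto simp: greatest_real_def real_roots_left_of_def Max_ge_iff)
qed (simp add: greatest_real_def)

lemma highest_im_ge: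
  "r \<le> highest_im n a s \<longleftrightarrow> (if upper_root_above n a s then \<exists>z::complex. Im z > 0 \<and> Re z = s \<and> r \<le> Im z \<and> monic_eval n a z = 0 else r \<le> 0)"
proof (cases "upper_root_above n a s")
  case True
  have e: "(\<exists>z::complex. Im z > 0 \<and> Re z = s \<and> P (Im z) \<and> monic_eval n a z = 0) \<longleftrightarrow> (\<exists>y>0. P y \<and> monic_eval n a (Complex s y) = 0)" for P
    by (metis complex.collapse complex.sel)
  have "{y. y > 0 \<and> monic_eval n a (Complex s y) = 0} \<noteq> {}"
    using True e[of "\<lambda>_. True"] by (auto simp: upper_root_above_def)
  then show ?thesis using True finite_above[of n a s] e[of "\<lambda>y. r \<le> y"]
    by (auto simp: highest_im_def Max_ge_iff)
qed (simp add: highest_im_def)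

lemma measurable_rightmost_re:
  assumes A: "A \<in> N \<rightarrow>\<^sub>M leb {..<n}"
  shows "(\<lambda>x. rightmost_re n (A x)) \<in> borel_measurable N"
  unfolding borel_measurable_iff_ge
proof
  fix r :: real
  note [measurable] = measurable_has_upper_root[OF A] measurable_upper_roots_left_of[OF A borel_measurable_const[of r]]
  show "{x \<in> space N. r \<le> rightmost_re n (A x)} \<in> sets N"
    unfolding rightmost_re_ge by measurable
qed

lemma measurable_greatest_real:
  assumes A: "A \<in> N \<rightarrow>\<^sub>M leb {..<n}"
  shows "(\<lambda>x. greatest_real n (A x)) \<in> borel_measurable N"
  unfolding borel_measurable_iff_ge
proof
  fix r :: real
  have ex: "(\<exists>x::real. monic_eval n a x = 0) \<longleftrightarrow> (\<exists>k::nat. \<not> real_roots_left_of n a (- real k))" for a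
  proof
    assume "\<exists>x::real. monic_eval n a x = 0"
    then obtain x :: real where x: "monic_eval n a x = 0" by blast
    obtain k :: nat where "- x \<le> real k" using real_arch_simple by blast
    then have "- real k \<le> x" by simp
    then show "\<exists>k::nat. \<not> real_roots_left_of n a (- real k)" using x by (auto simp: real_roots_left_of_def)
  qed (auto simp: real_roots_left_of_def)
  note [measurable] = measurable_real_roots_left_of[OF A borel_measurable_const]
  show "{x \<in> space N. r \<le> greatest_real n (A x)} \<in> sets N"
    unfolding greatest_real_ge ex by measurable
qed

lemma measurable_highest_im:
  assumes A: "A \<in> N \<rightarrow>\<^sub>M leb {..<n}" and S[measurable]: "S \<in> borel_measurable N"
  shows "(\<lambda>x. highest_im n (A x) (S x)) \<in> borel_measurable N"
  unfolding borel_measurable_iff_ge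
proof
  fix r :: real
  note [measurable] = measurable_upper_root_above[OF A S]
  have [measurable]: "(\<lambda>x. cmod (monic_eval n (A x) z)) \<in> borel_measurable N" for z
    by (rule measurable_compose[OF measurable_monic_eval_comp[OF A _ order_refl] borel_measurable_norm]) simp
  have "Measurable.pred N (\<lambda>x. \<exists>z::complex. Im z > 0 \<and> cmod (monic_eval n (A x) z) + \<bar>Re z - S x\<bar> + max 0 (r - Im z) = 0)"
    by (rule measurable_ex_upper) (auto intro!: continuous_intros continuous_monic_eval)
  moreover have "cmod c + \<bar>u - s\<bar> + max 0 (r - v) = 0 \<longleftrightarrow> u = s \<and> r \<le> v \<and> c = 0" for c u s v
    by (auto simp: add_nonneg_eq_0_iff)
  ultimately have [measurable]: "Measurable.pred N (\<lambda>x. \<exists>z::complex. Im z > 0 \<and> Re z = S x \<and> r \<le> Im z \<and> monic_eval n (A x) z = 0)"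
    by simp
  show "{x \<in> space N. r \<le> highest_im n (A x) (S x)} \<in> sets N"
    unfolding highest_im_ge by measurable
qed

lemma measurable_tuple_upd:
  assumes "f \<in> N \<rightarrow>\<^sub>M tuple_space n" "g \<in> borel_measurable N"
  shows "(\<lambda>x. (f x)(n := g x)) \<in> N \<rightarrow>\<^sub>M tuple_space (Suc n)"
  by (rule measurable_fun_upd[where J = "{..<n}"]) (use assms in \<open>auto simp: lessThan_Suc\<close>)

lemma measurable_root_tuple: "root_tuple n \<in> leb {..<n} \<rightarrow>\<^sub>M tuple_space n"
proof (induction n rule: less_induct)
  case (less n)
  have id: "\<And>k. (\<lambda>a. a) \<in> leb {..<k} \<rightarrow>\<^sub>M leb {..<k}" by simp
  have ofr: "(\<lambda>x. complex_of_real (f x)) \<in> borel_measurable N" if "f \<in> borel_measurable N" for f and N :: "(nat \<Rightarrow> real) measure"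
    using that by (rule measurable_compose) (intro borel_measurable_continuous_onI continuous_intros)
  consider "n = 0" | "n = Suc 0" | k where "n = Suc (Suc k)" by (metis nat.exhaust)
  then show ?case
  proof cases
    case 1
    have "root_tuple 0 = (\<lambda>a. \<lambda>_. undefined)" by (simp add: fun_eq_iff)
    then show ?thesis using 1 by (simp add: space_PiM)
  next
    case 2
    have e: "root_tuple (Suc 0) = (\<lambda>a. (\<lambda>_. undefined)(0 := of_real (greatest_real (Suc 0) a)))" by (intro ext) simp
    have "(\<lambda>a. (\<lambda>_. undefined)(0 := complex_of_real (greatest_real (Suc 0) a))) \<in> leb {..<Suc 0} \<rightarrow>\<^sub>M tuple_space (Suc 0)"
      by (intro measurable_tuple_upd[where f = "\<lambda>_ _. undefined"] ofr measurable_greatest_real[OF id]) (simp add: space_PiM)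
    then show ?thesis unfolding 2 e .
  next
    case (3 k)
    let ?N = "leb {..<Suc (Suc k)}"
    let ?s = "rightmost_re (Suc (Suc k))"
    let ?t = "\<lambda>a. highest_im (Suc (Suc k)) a (?s a)"
    let ?x = "greatest_real (Suc (Suc k))"
    have s: "(\<lambda>a. ?s a) \<in> borel_measurable ?N" by (rule measurable_rightmost_re[OF id])
    have t: "?t \<in> borel_measurable ?N" by (rule measurable_highest_im[OF id s])
    have t': "(\<lambda>a. - ?t a) \<in> borel_measurable ?N" by (rule borel_measurable_uminus[OF t])
    have x: "(\<lambda>a. ?x a) \<in> borel_measurable ?N" by (rule measurable_greatest_real[OF id])
    have q: "(\<lambda>a. quadratic_quotient k a (?s a) (?t a)) \<in> ?N \<rightarrow>\<^sub>M leb {..<k}"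
      by (rule measurable_quadratic_quotient[OF id s t]) simp
    have l: "(\<lambda>a. linear_quotient (Suc k) a (?x a)) \<in> ?N \<rightarrow>\<^sub>M leb {..<Suc k}"
      by (rule measurable_linear_quotient[OF id x]) simp
    have 1: "(\<lambda>a. (root_tuple k (quadratic_quotient k a (?s a) (?t a)))(k := Complex (?s a) (?t a), Suc k := Complex (?s a) (- ?t a))) \<in> ?N \<rightarrow>\<^sub>M tuple_space (Suc (Suc k))"
      by (rule measurable_tuple_upd[OF measurable_tuple_upd[OF measurable_compose[OF q less.IH] measurable_Complex[OF s t]] measurable_Complex[OF s t']]) (simp add: 3)
    have 2: "(\<lambda>a. (root_tuple (Suc k) (linear_quotient (Suc k) a (?x a)))(Suc k := of_real (?x a))) \<in> ?N \<rightarrow>\<^sub>M tuple_space (Suc (Suc k))"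
      by (rule measurable_tuple_upd[OF measurable_compose[OF l less.IH] ofr[OF x]]) (simp add: 3)
    have hu: "Measurable.pred ?N (has_upper_root (Suc (Suc k)))"
      using measurable_has_upper_root[OF id] by simp
    have e: "root_tuple (Suc (Suc k)) = (\<lambda>a. if has_upper_root (Suc (Suc k)) a
        then (root_tuple k (quadratic_quotient k a (?s a) (?t a)))(k := Complex (?s a) (?t a), Suc k := Complex (?s a) (- ?t a))
        else (root_tuple (Suc k) (linear_quotient (Suc k) a (?x a)))(Suc k := of_real (?x a)))"
      by (intro ext) (simp add: Let_def)
    show ?thesis unfolding 3 e
      by (rule measurable_If[OF 1 2]) (use hu in \<open>simp add: pred_def\<close>)
  qed
qed

lemma monic_eval_mult_linear_partial:
  "m \<le> n \<Longrightarrow> monic_eval (Suc m) (mult_linear n s g) s = shifted_coeffs n g (Suc m)"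
  by (induction m) (auto simp: mult_linear_def shifted_coeffs_def[of n g 0])

lemma linear_quotient_mult_linear:
  assumes "\<And>i. i \<ge> n \<Longrightarrow> g i = undefined"
  shows "linear_quotient n (mult_linear n s g) s = g"
  using assms monic_eval_mult_linear_partial[of _ n s g]
  by (auto simp: linear_quotient_def fun_eq_iff shifted_coeffs_def not_less simp del: monic_eval.simps)

lemma monic_eval_mult_quadratic_partial:
  fixes s t :: real
  assumes "m \<le> n"
  defines "w \<equiv> Complex s t"
  shows "monic_eval (Suc m) (mult_quadratic n s t g) w
    = (w - 2 * of_real s) * of_real (shifted_coeffs n g m) + of_real (shifted_coeffs n g (Suc m))"
  using assms(1)
proof (induction m)
  case 0
  then show ?case by (simp add: mult_quadratic_def shifted_coeffs_def[of n g 0])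
next
  case (Suc m)
  have w: "w * w = 2 * of_real s * w - of_real (s\<^sup>2 + t\<^sup>2)"
    by (simp add: w_def complex_eq_iff power2_eq_square)
  have mq: "mult_quadratic n s t g (Suc m) = shifted_coeffs n g (Suc (Suc m)) - 2 * s * shifted_coeffs n g (Suc m) + (s\<^sup>2 + t\<^sup>2) * shifted_coeffs n g m"
    using Suc.prems by (simp add: mult_quadratic_def)
  have "monic_eval (Suc (Suc m)) (mult_quadratic n s t g) w
      = w * ((w - 2 * of_real s) * of_real (shifted_coeffs n g m) + of_real (shifted_coeffs n g (Suc m)))
        + of_real (shifted_coeffs n g (Suc (Suc m)) - 2 * s * shifted_coeffs n g (Suc m) + (s\<^sup>2 + t\<^sup>2) * shifted_coeffs n g m)"
    unfolding monic_eval.simps(2)[of "Suc m"] mq Suc.IH[OF Suc_leD[OF Suc.prems]] ..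
  also have "\<dots> = (w * w - 2 * of_real s * w + of_real (s\<^sup>2 + t\<^sup>2)) * of_real (shifted_coeffs n g m)
        + (w - 2 * of_real s) * of_real (shifted_coeffs n g (Suc m)) + of_real (shifted_coeffs n g (Suc (Suc m)))"
    by (simp add: algebra_simps)
  finally show ?case unfolding w by simp
qed

lemma quadratic_quotient_mult_quadratic:
  assumes "\<And>i. i \<ge> n \<Longrightarrow> g i = undefined" "t \<noteq> 0"
  shows "quadratic_quotient n (mult_quadratic n s t g) s t = g"
proof
  fix i
  let ?w = "Complex s t"
  have w: "?w * (?w - 2 * of_real s) = - of_real (s\<^sup>2 + t\<^sup>2)"
    by (simp add: complex_eq_iff power2_eq_square)
  show "quadratic_quotient n (mult_quadratic n s t g) s t i = g i"
  proof (cases "i < n")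
    case True
    have "?w * monic_eval (Suc i) (mult_quadratic n s t g) ?w
      = (?w * (?w - 2 * of_real s)) * of_real (shifted_coeffs n g i) + ?w * of_real (shifted_coeffs n g (Suc i))"
      using True by (subst monic_eval_mult_quadratic_partial) (simp_all add: algebra_simps)
    then have "Im (?w * monic_eval (Suc i) (mult_quadratic n s t g) ?w) = t * g i"
      unfolding w using True by (simp add: shifted_coeffs_def)
    then show ?thesis using True assms(2) by (simp only: quadratic_quotient_def restrict_apply) simp
  qed (use assms in \<open>simp add: quadratic_quotient_def\<close>)
qed

lemma root_tuple_real:
  assumes "\<not> has_upper_root (Suc n) a"
  shows "root_tuple (Suc n) a = (root_tuple n (linear_quotient n a (greatest_real (Suc n) a)))(n := of_real (greatest_real (Suc n) a))"
  using assms by (cases n) (simp_all add: Let_def)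

lemma root_coeffs_undefined: "i \<ge> n \<Longrightarrow> root_coeffs n z i = undefined"
  by (simp add: root_coeffs_def)

lemma root_tuple_root_coeffs:
  "(x, y) \<in> ordered_params L M \<Longrightarrow>
    root_tuple (L + 2 * M) (root_coeffs (L + 2 * M) (param_tuple L M (x, y))) = param_tuple L M (x, y)"
proof (induction M arbitrary: x y)
  case 0
  then show ?case
  proof (induction L arbitrary: x y)
    case 0
    show ?case by (simp add: param_tuple_def fun_eq_iff)
  next
    case (Suc L)
    define x0 where "x0 = restrict x {..<L}"
    have x: "x = x0(L := x L)"
      using Suc.prems by (auto simp: ordered_params_def x0_def space_pair_measure space_PiM PiE_def extensional_def fun_eq_iff)
    have sp: "(x0, y) \<in> space (param_lebesgue L 0)"
      using Suc.prems by (auto simp: ordered_params_def x0_def space_pair_measure space_PiM)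
    have od: "(x0, y) \<in> ordered_params L 0" "\<forall>i<L. x0 i < x L"
      using Suc.prems ordered_params_Suc_real[OF sp, of "x L"] x by auto
    let ?g = "root_coeffs L (param_tuple L 0 (x0, y))"
    let ?c = "root_coeffs (Suc L) (param_tuple (Suc L) 0 (x, y))"
    have pt: "param_tuple L 0 (x, y) = param_tuple L 0 (x0, y)" by (rule param_tuple_cong) (auto simp: x0_def)
    have c: "?c = mult_linear L (x L) ?g" using root_coeffs_Suc_real[of L x y] pt by simp
    have nh: "\<not> has_upper_root (Suc L) ?c" using has_upper_root_param[OF Suc.prems] by simp
    have ev: "monic_eval (Suc L) ?c u = (u - x L) * monic_eval L ?g u" for u :: real
      unfolding c using monic_eval_mult_linear[of L "x L" ?g u] by simp
    have "real_roots_left_of L ?g (x L)" using od(2) real_roots_left_of_param by blast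
    then have gt: "monic_eval L ?g u \<noteq> 0" if "u \<ge> x L" for u :: real using that by (auto simp: real_roots_left_of_def)
    have "greatest_real (Suc L) ?c = x L"
    proof (rule antisym)
      show "x L \<le> greatest_real (Suc L) ?c"
        unfolding greatest_real_ge real_roots_left_of_def ev by auto
      show "greatest_real (Suc L) ?c \<le> x L"
      proof (rule ccontr)
        assume "\<not> greatest_real (Suc L) ?c \<le> x L"
        moreover have "\<exists>u::real. monic_eval (Suc L) ?c u = 0" unfolding ev by auto
        then have "\<not> real_roots_left_of (Suc L) ?c (greatest_real (Suc L) ?c)"
          using greatest_real_ge[of "greatest_real (Suc L) ?c" "Suc L" ?c] by (simp only: if_True order_refl)
        then obtain u where "u \<ge> greatest_real (Suc L) ?c" "(u - x L) * monic_eval L ?g u = 0"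
          unfolding real_roots_left_of_def ev by blast
        ultimately show False using gt[of u] by auto
      qed
    qed
    moreover have "linear_quotient L ?c (x L) = ?g"
      unfolding c by (rule linear_quotient_mult_linear) (simp add: root_coeffs_undefined)
    ultimately have "root_tuple (Suc L) ?c = (root_tuple L ?g)(L := of_real (x L))"
      using root_tuple_real[OF nh] by simp
    also have "root_tuple L ?g = param_tuple L 0 (x, y)"
      using Suc.IH[OF od(1)] pt by simp
    finally show ?case using param_tuple_Suc_real[of L x y] by simp
  qed
next
  case (Suc M)
  let ?n = "L + 2 * M" and ?k = "L + M"
  define x0 where "x0 = restrict x {..<?k}"
  define y0 where "y0 = restrict y {L..<?k}"
  define s t where "s = x ?k" and "t = y ?k"
  have x: "x = x0(?k := s)" "y = y0(?k := t)"
    using Suc.prems by (auto simp: ordered_params_def x0_def y0_def s_def t_def space_pair_measure space_PiM PiE_def extensional_def fun_eq_iff)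
  have sp: "(x0, y0) \<in> space (param_lebesgue L M)"
    by (auto simp: x0_def y0_def space_pair_measure space_PiM)
  have "(x0(?k := s), y0(?k := t)) \<in> ordered_params L (Suc M)"
    using Suc.prems unfolding x[symmetric] .
  then have od: "(x0, y0) \<in> ordered_params L M" "0 < t" "\<forall>i\<in>{L..<?k}. x0 i < s"
    using ordered_params_Suc_pair[OF sp, of s t] by blast+
  let ?g = "root_coeffs ?n (param_tuple L M (x0, y0))"
  let ?c = "root_coeffs (Suc (Suc ?n)) (param_tuple L (Suc M) (x, y))"
  have pt: "param_tuple L M (x, y) = param_tuple L M (x0, y0)" by (rule param_tuple_cong) (auto simp: x0_def y0_def)
  have c: "?c = mult_quadratic ?n s t ?g" using root_coeffs_Suc_pair[of L M x y] pt by (simp add: s_def t_def)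
  have hu: "has_upper_root (Suc (Suc ?n)) ?c" using has_upper_root_param[OF Suc.prems] by simp
  have "upper_roots_left_of ?n ?g s" using upper_roots_left_of_param[OF od(1)] od(3) by blast
  then have root: "u = Complex s t" if u: "Im u > 0" "Re u \<ge> s" "monic_eval (Suc (Suc ?n)) ?c u = 0" for u
  proof -
    consider "u = Complex s t" | "u = Complex s (- t)" | "monic_eval ?n ?g u = 0"
      using u(3) unfolding c monic_eval_mult_quadratic_complex by (simp only: mult_eq_0_iff right_minus_eq) blast
    then show ?thesis
    proof cases
      case 2
      then show ?thesis using u(1) od(2) by simp
    next
      case 3
      then show ?thesis using u(1,2) \<open>upper_roots_left_of ?n ?g s\<close> by (simp add: upper_roots_left_of_def)
    qed simp
  qed
  have rt: "monic_eval (Suc (Suc ?n)) ?c (Complex s t) = 0"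
    unfolding c monic_eval_mult_quadratic_complex by simp
  have s: "rightmost_re (Suc (Suc ?n)) ?c = s"
  proof (rule antisym)
    show "s \<le> rightmost_re (Suc (Suc ?n)) ?c"
      unfolding rightmost_re_ge upper_roots_left_of_def using hu rt od(2)
      by (auto intro!: exI[of _ "Complex s t"] simp del: monic_eval.simps)
    show "rightmost_re (Suc (Suc ?n)) ?c \<le> s"
    proof (rule ccontr)
      assume l: "\<not> rightmost_re (Suc (Suc ?n)) ?c \<le> s"
      have "\<not> upper_roots_left_of (Suc (Suc ?n)) ?c (rightmost_re (Suc (Suc ?n)) ?c)"
        using rightmost_re_ge[of "rightmost_re (Suc (Suc ?n)) ?c" "Suc (Suc ?n)" ?c] hu by (simp only: if_True order_refl)
      then obtain u where "Im u > 0" "Re u \<ge> rightmost_re (Suc (Suc ?n)) ?c" "monic_eval (Suc (Suc ?n)) ?c u = 0"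
        unfolding upper_roots_left_of_def by blast
      then show False using root[of u] l by simp
    qed
  qed
  have above: "upper_root_above (Suc (Suc ?n)) ?c s"
    unfolding upper_root_above_def using rt od(2) by (auto intro!: exI[of _ "Complex s t"] simp del: monic_eval.simps)
  have t: "highest_im (Suc (Suc ?n)) ?c s = t"
  proof (rule antisym)
    show "t \<le> highest_im (Suc (Suc ?n)) ?c s"
      unfolding highest_im_ge using above rt od(2) by (auto intro!: exI[of _ "Complex s t"] simp del: monic_eval.simps)
    have "\<exists>z::complex. Im z > 0 \<and> Re z = s \<and> highest_im (Suc (Suc ?n)) ?c s \<le> Im z \<and> monic_eval (Suc (Suc ?n)) ?c z = 0"
      using highest_im_ge[of "highest_im (Suc (Suc ?n)) ?c s" "Suc (Suc ?n)" ?c s] above by (simp only: if_True order_refl)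
    then obtain u where "Im u > 0" "Re u = s" "highest_im (Suc (Suc ?n)) ?c s \<le> Im u" "monic_eval (Suc (Suc ?n)) ?c u = 0"
      by blast
    then show "highest_im (Suc (Suc ?n)) ?c s \<le> t" using root[of u] by simp
  qed
  have q: "quadratic_quotient ?n ?c s t = ?g"
    unfolding c by (rule quadratic_quotient_mult_quadratic) (use od(2) in \<open>simp_all add: root_coeffs_undefined\<close>)
  have "root_tuple (Suc (Suc ?n)) ?c = (root_tuple ?n ?g)(?n := Complex s t, Suc ?n := Complex s (- t))"
    by (simp only: root_tuple.simps hu if_True Let_def s t q)
  also have "root_tuple ?n ?g = param_tuple L M (x, y)"
    using Suc.IH[OF od(1)] pt by simp
  finally have *: "root_tuple (Suc (Suc ?n)) ?c = (param_tuple L M (x, y))(?n := Complex s t, Suc ?n := Complex s (- t))" .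
  have e: "L + 2 * Suc M = Suc (Suc ?n)" by simp
  show ?case unfolding e * unfolding s_def t_def by (rule param_tuple_Suc_pair[symmetric])
qed

(* @@@ E *)

definition cmv_corner :: "(nat \<Rightarrow> real) \<Rightarrow> nat \<Rightarrow> real" where
  "cmv_corner \<alpha> i = (if i = 0 then 1 else - \<alpha> (i - 1))"

definition cmv_rho :: "(nat \<Rightarrow> real) \<Rightarrow> nat \<Rightarrow> real" where
  "cmv_rho \<alpha> i = sqrt (1 - (\<alpha> i)\<^sup>2)"

definition block_entry :: "(nat \<Rightarrow> bool) \<Rightarrow> (nat \<Rightarrow> real) \<Rightarrow> nat \<Rightarrow> nat \<Rightarrow> real" where
  "block_entry P \<alpha> i j =
     (if i = j then if P i then \<alpha> i else cmv_corner \<alpha> i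
      else if j = Suc i \<and> P i then cmv_rho \<alpha> i
      else if i = Suc j \<and> P j then cmv_rho \<alpha> j else 0)"

definition alternating :: "(nat \<Rightarrow> bool) \<Rightarrow> bool" where
  "alternating P \<longleftrightarrow> (\<forall>i. P (Suc i) \<longleftrightarrow> \<not> P i)"

lemma diag_block_mat_cmv_blocks:
  fixes \<alpha> :: "nat \<Rightarrow> real"
  assumes P: "alternating P" and "m \<le> n" "P m" "m > 0 \<or> P 0"
  shows "diag_block_mat (map (cmv_block n (\<lambda>k. complex_of_real (\<alpha> k))) (filter P [m..<n]))
    = mat (n - m) (n - m) (\<lambda>(i, j). of_real (block_entry P \<alpha> (m + i) (m + j)))"
  using assms(2-)
proof (induction "n - m" arbitrary: m rule: less_induct)
  case less
  let ?a = "\<lambda>k. complex_of_real (\<alpha> k)"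
  have alt: "P (Suc i) \<longleftrightarrow> \<not> P i" for i using P by (simp add: alternating_def)
  consider "m = n" | "Suc m = n" | "Suc (Suc m) \<le> n" using less.prems by linarith
  then show ?case
  proof cases
    case 1
    then show ?thesis by (auto intro!: eq_matI)
  next
    case 2
    then have "[m..<n] = [m]" using upt_conv_Cons[of m n] by simp
    then show ?thesis using 2 less.prems
      by (auto intro!: eq_matI simp: cmv_block_def mat_of_rows_list_def block_entry_def)
  next
    case 3
    have "[m..<n] = m # Suc m # [Suc (Suc m)..<n]" using 3 upt_conv_Cons by simp
    then have f: "filter P [m..<n] = m # filter P [Suc (Suc m)..<n]" using less.prems alt by simp
    have nm: "n - m = 2 + (n - Suc (Suc m))" using 3 by simp
    have D: "diag_block_mat (map (cmv_block n ?a) (filter P [Suc (Suc m)..<n]))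
      = mat (n - Suc (Suc m)) (n - Suc (Suc m)) (\<lambda>(i, j). of_real (block_entry P \<alpha> (Suc (Suc m) + i) (Suc (Suc m) + j)))"
      by (rule less.hyps) (use 3 less.prems alt in auto)
    have B: "cmv_block n ?a m = mat 2 2 (\<lambda>(i, j). of_real (block_entry P \<alpha> (m + i) (m + j)))"
    proof (rule eq_matI)
      have ne: "m \<noteq> n - 1" "m \<noteq> n - Suc 0" using 3 by simp_all
      have Pm: "P m" "\<not> P (Suc m)" using less.prems(2) alt by simp_all
      fix i j assume "i < dim_row (mat 2 2 (\<lambda>(i, j). complex_of_real (block_entry P \<alpha> (m + i) (m + j))))"
        "j < dim_col (mat 2 2 (\<lambda>(i, j). complex_of_real (block_entry P \<alpha> (m + i) (m + j))))"
      then have ij: "i < 2" "j < 2" by simp_all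
      have b: "block_entry P \<alpha> m m = \<alpha> m" "block_entry P \<alpha> m (Suc m) = cmv_rho \<alpha> m"
        "block_entry P \<alpha> (Suc m) m = cmv_rho \<alpha> m" "block_entry P \<alpha> (Suc m) (Suc m) = - \<alpha> m"
        using Pm by (simp_all add: block_entry_def cmv_corner_def)
      from ij consider "i = 0" "j = 0" | "i = 0" "j = 1" | "i = 1" "j = 0" | "i = 1" "j = 1" by linarith
      then show "cmv_block n ?a m $$ (i, j) = mat 2 2 (\<lambda>(i, j). complex_of_real (block_entry P \<alpha> (m + i) (m + j))) $$ (i, j)"
        by cases (simp_all add: b ne cmv_block_def mat_of_rows_list_def Let_def cmv_rho_def)
    qed (use 3 in \<open>simp_all add: cmv_block_def mat_of_rows_list_def Let_def\<close>)
    have Pm: "P m" "\<not> P (Suc m)" using less.prems(2) alt by simp_all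
    let ?B = "mat 2 2 (\<lambda>(i, j). complex_of_real (block_entry P \<alpha> (m + i) (m + j)))"
    let ?D = "mat (n - Suc (Suc m)) (n - Suc (Suc m)) (\<lambda>(i, j). complex_of_real (block_entry P \<alpha> (Suc (Suc m) + i) (Suc (Suc m) + j)))"
    let ?E = "mat (n - m) (n - m) (\<lambda>(i, j). complex_of_real (block_entry P \<alpha> (m + i) (m + j)))"
    have lhs: "diag_block_mat (map (cmv_block n ?a) (filter P [m..<n]))
      = four_block_mat ?B (0\<^sub>m 2 (n - Suc (Suc m))) (0\<^sub>m (n - Suc (Suc m)) 2) ?D"
      unfolding f list.map diag_block_mat.simps D B Let_def by simp
    show ?thesis
      unfolding lhs
    proof (rule eq_matI)
      fix i j assume "i < dim_row ?E" "j < dim_col ?E"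
      then have ij: "i < n - m" "j < n - m" by simp_all
      then have "four_block_mat ?B (0\<^sub>m 2 (n - Suc (Suc m))) (0\<^sub>m (n - Suc (Suc m)) 2) ?D $$ (i, j)
        = (if i < 2 then if j < 2 then ?B $$ (i, j) else 0 else if j < 2 then 0 else ?D $$ (i - 2, j - 2))"
        unfolding nm by (subst index_mat_four_block) auto
      also have "\<dots> = of_real (block_entry P \<alpha> (m + i) (m + j))"
      proof -
        consider "i < 2" "j < 2" | "i < 2" "\<not> j < 2" | "\<not> i < 2" "j < 2" | "\<not> i < 2" "\<not> j < 2" by blast
        then show ?thesis
        proof cases
          case 2
          then have "block_entry P \<alpha> (m + i) (m + j) = 0"
            using Pm by (cases "i = 0") (auto simp: block_entry_def less_2_cases_iff)
          then show ?thesis using 2 by simp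
        next
          case 3
          then have "block_entry P \<alpha> (m + i) (m + j) = 0"
            using Pm by (cases "j = 0") (auto simp: block_entry_def less_2_cases_iff)
          then show ?thesis using 3 by simp
        next
          case 4
          then have "Suc (Suc m) + (i - 2) = m + i" "Suc (Suc m) + (j - 2) = m + j"
            "i - 2 < n - Suc (Suc m)" "j - 2 < n - Suc (Suc m)" using ij nm by simp_all
          then show ?thesis using 4 by simp
        qed simp
      qed
      finally show "four_block_mat ?B (0\<^sub>m 2 (n - Suc (Suc m))) (0\<^sub>m (n - Suc (Suc m)) 2) ?D $$ (i, j) = ?E $$ (i, j)"
        using ij by simp
    qed (simp_all add: nm)
  qed
qed

lemma alternating_even: "alternating even" and alternating_odd: "alternating odd"
  by (auto simp: alternating_def)

lemma cmv_L_entries: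
  "cmv_L n (\<lambda>k. complex_of_real (\<alpha> k)) = mat n n (\<lambda>(i, j). of_real (block_entry even \<alpha> i j))"
  unfolding cmv_L_def using diag_block_mat_cmv_blocks[OF alternating_even, of 0 n \<alpha>] by simp

lemma cmv_M_entries:
  assumes "n \<ge> 1"
  shows "cmv_M n (\<lambda>k. complex_of_real (\<alpha> k)) = mat n n (\<lambda>(i, j). of_real (block_entry odd \<alpha> i j))"
proof -
  have "[0..<n] = 0 # [1..<n]" using assms upt_conv_Cons by simp
  then have f: "filter odd [0..<n] = filter odd [1..<n]" by simp
  have D: "diag_block_mat (map (cmv_block n (\<lambda>k. complex_of_real (\<alpha> k))) (filter odd [1..<n]))
    = mat (n - 1) (n - 1) (\<lambda>(i, j). of_real (block_entry odd \<alpha> (1 + i) (1 + j)))"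
    by (rule diag_block_mat_cmv_blocks[OF alternating_odd]) (use assms in auto)
  show ?thesis
    unfolding cmv_M_def f diag_block_mat.simps D Let_def
    using assms by (auto intro!: eq_matI simp: block_entry_def cmv_corner_def)
qed

lemma block_entry_square:
  assumes P: "alternating P" and last: "\<not> P (n - 1)" and a: "\<And>k. k < n \<Longrightarrow> (\<alpha> k)\<^sup>2 \<le> 1" and ij: "i < n" "j < n"
  shows "(\<Sum>k<n. block_entry P \<alpha> i k * block_entry P \<alpha> k j) = (if i = j then 1 else 0)"
proof -
  have alt: "P (Suc i) \<longleftrightarrow> \<not> P i" for i using P by (simp add: alternating_def)
  have rho: "cmv_rho \<alpha> k * cmv_rho \<alpha> k = 1 - \<alpha> k * \<alpha> k" if "k < n" for k
    using a[OF that] by (simp add: cmv_rho_def power2_eq_square)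
  have zero: "block_entry P \<alpha> k l = 0" if "P k" "l \<noteq> k" "l \<noteq> Suc k" for k l
    using that alt[of l] by (auto simp: block_entry_def)
  have zero': "block_entry P \<alpha> (Suc k) l = 0" if "P k" "l \<noteq> k" "l \<noteq> Suc k" for k l
    using that alt[of k] by (auto simp: block_entry_def)
  have b: "block_entry P \<alpha> k k = \<alpha> k" "block_entry P \<alpha> k (Suc k) = cmv_rho \<alpha> k"
    "block_entry P \<alpha> (Suc k) k = cmv_rho \<alpha> k" "block_entry P \<alpha> (Suc k) (Suc k) = - \<alpha> k" if "P k" for k
    using that alt[of k] by (simp_all add: block_entry_def cmv_corner_def)
  consider "P i" | "\<not> P i" "i = 0" | h where "i = Suc h" "P h" using alt by (metis not0_implies_Suc)
  then show ?thesis
  proof cases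
    case 1
    then have "Suc i < n" using last ij by (metis Suc_lessI diff_Suc_1)
    then have "(\<Sum>k<n. block_entry P \<alpha> i k * block_entry P \<alpha> k j) = (\<Sum>k\<in>{i, Suc i}. block_entry P \<alpha> i k * block_entry P \<alpha> k j)"
      using zero[OF 1] by (intro sum.mono_neutral_right) auto
    also have "\<dots> = \<alpha> i * block_entry P \<alpha> i j + cmv_rho \<alpha> i * block_entry P \<alpha> (Suc i) j"
      using b[OF 1] by simp
    also have "\<dots> = (if i = j then 1 else 0)"
    proof -
      consider "j = i" | "j = Suc i" | "j \<noteq> i" "j \<noteq> Suc i" by blast
      then show ?thesis
        by cases (simp_all add: b[OF 1] zero[OF 1] zero'[OF 1] rho[OF ij(1)])
    qed
    finally show ?thesis .
  next
    case 2
    have z0: "block_entry P \<alpha> 0 k = (if k = 0 then 1 else 0)" for k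
      using 2 by (simp add: block_entry_def cmv_corner_def)
    show ?thesis using ij 2 by (simp add: z0 if_distrib[of "\<lambda>x. x * _"] cong: if_cong)
  next
    case (3 h)
    then have "(\<Sum>k<n. block_entry P \<alpha> i k * block_entry P \<alpha> k j) = (\<Sum>k\<in>{h, Suc h}. block_entry P \<alpha> i k * block_entry P \<alpha> k j)"
      using zero'[OF 3(2)] ij by (intro sum.mono_neutral_right) auto
    also have "\<dots> = cmv_rho \<alpha> h * block_entry P \<alpha> h j - \<alpha> h * block_entry P \<alpha> (Suc h) j"
      using b[OF 3(2)] 3(1) by simp
    also have "\<dots> = (if i = j then 1 else 0)"
    proof -
      have r: "cmv_rho \<alpha> h * cmv_rho \<alpha> h = 1 - \<alpha> h * \<alpha> h" using rho[of h] 3 ij by simp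
      consider "j = h" | "j = Suc h" | "j \<noteq> h" "j \<noteq> Suc h" by blast
      then show ?thesis
        by cases (simp_all add: 3(1) b[OF 3(2)] zero[OF 3(2)] zero'[OF 3(2)] r)
    qed
    finally show ?thesis .
  qed
qed

lemma det_tridiagonal_Suc_Suc:
  fixes f :: "nat \<Rightarrow> nat \<Rightarrow> 'a::comm_ring_1"
  assumes tri: "\<And>i j. Suc i < j \<Longrightarrow> f i j = 0" "\<And>i j. Suc j < i \<Longrightarrow> f i j = 0"
  defines "D \<equiv> \<lambda>k. det (mat k k (\<lambda>(i, j). f i j))"
  shows "D (Suc (Suc n)) = f (Suc n) (Suc n) * D (Suc n) - f n (Suc n) * f (Suc n) n * D n"
proof -
  let ?A = "mat (Suc (Suc n)) (Suc (Suc n)) (\<lambda>(i, j). f i j)"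
  let ?C = "mat_delete ?A (Suc n) n"
  have d1: "mat_delete ?A (Suc n) (Suc n) = mat (Suc n) (Suc n) (\<lambda>(i, j). f i j)"
    by (rule eq_matI) (auto simp: mat_delete_def)
  have C: "?C = mat (Suc n) (Suc n) (\<lambda>(i, j). f i (if j < n then j else Suc j))"
    by (rule eq_matI) (auto simp: mat_delete_def)
  have d2: "mat_delete ?C n n = mat n n (\<lambda>(i, j). f i j)"
    unfolding C by (rule eq_matI) (auto simp: mat_delete_def)
  have "det ?C = (\<Sum>i<Suc n. ?C $$ (i, n) * cofactor ?C i n)"
    by (rule laplace_expansion_column) (auto simp: C)
  also have "\<dots> = ?C $$ (n, n) * cofactor ?C n n"
    using tri(1) by (simp add: C)
  finally have detC: "det ?C = f n (Suc n) * D n"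
    by (simp add: cofactor_def d2 D_def) (simp add: C)
  have "det ?A = (\<Sum>j<Suc (Suc n). ?A $$ (Suc n, j) * cofactor ?A (Suc n) j)"
    by (rule laplace_expansion_row) auto
  also have "\<dots> = ?A $$ (Suc n, n) * cofactor ?A (Suc n) n + ?A $$ (Suc n, Suc n) * cofactor ?A (Suc n) (Suc n)"
    using tri(2) by simp
  finally show ?thesis
    unfolding cofactor_def detC d1 D_def by simp
qed

lemma det_szego_continuant:
  fixes z :: complex
  assumes P: "alternating P" and a: "\<And>k. k < n \<Longrightarrow> (\<alpha> k)\<^sup>2 \<le> 1"
  defines "D \<equiv> \<lambda>k. det (mat k k (\<lambda>(i, j). z * of_real (block_entry P \<alpha> i j) - of_real (block_entry (\<lambda>i. \<not> P i) \<alpha> i j)))"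
    and "S \<equiv> \<lambda>k. if P k then monic_eval k (szego_coeffs k \<alpha>) z else reversed_eval k (szego_coeffs k \<alpha>) z"
  shows "\<exists>\<sigma>\<in>{1, -1}. D n = \<sigma> * S n"
proof -
  have alt: "P (Suc i) \<longleftrightarrow> \<not> P i" for i using P by (simp add: alternating_def)
  let ?f = "\<lambda>i j. z * of_real (block_entry P \<alpha> i j) - of_real (block_entry (\<lambda>i. \<not> P i) \<alpha> i j)"
  have rec: "D (Suc (Suc k)) = ?f (Suc k) (Suc k) * D (Suc k) - ?f k (Suc k) * ?f (Suc k) k * D k" for k
    unfolding D_def by (rule det_tridiagonal_Suc_Suc) (simp_all add: block_entry_def)
  have "\<exists>\<sigma>\<in>{1, -1}. D k = \<sigma> * S k \<and> (k < n \<longrightarrow> D (Suc k) = (if P k then - \<sigma> else \<sigma>) * S (Suc k))" if "k \<le> n" for k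
    using that
  proof (induction k)
    case 0
    have "D 0 = 1" by (simp add: D_def)
    moreover have "S 0 = 1" by (simp add: S_def)
    moreover have "D (Suc 0) = (if P 0 then z * of_real (\<alpha> 0) - 1 else z - of_real (\<alpha> 0))"
      unfolding D_def by (subst det_single) (auto simp: block_entry_def cmv_corner_def)
    moreover have "S (Suc 0) = (if P 0 then 1 - of_real (\<alpha> 0) * z else z - of_real (\<alpha> 0))"
      unfolding S_def szego_coeffs.simps monic_eval_szego_step reversed_eval_szego_step using alt[of 0] by simp
    ultimately show ?case
      by (intro bexI[of _ 1]) (simp_all add: mult.commute)
  next
    case (Suc k)
    from Suc.IH[OF Suc_leD[OF Suc.prems]] obtain \<sigma> where s: "\<sigma> \<in> {1, -1}"
      "D k = \<sigma> * S k \<and> (k < n \<longrightarrow> D (Suc k) = (if P k then - \<sigma> else \<sigma>) * S (Suc k))"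
      by blast
    have \<sigma>: "\<sigma> \<in> {1, -1}" "D k = \<sigma> * S k" "D (Suc k) = (if P k then - \<sigma> else \<sigma>) * S (Suc k)"
      using s Suc.prems by (blast, blast, simp only: Suc_le_eq)
    let ?\<Phi> = "\<lambda>k. monic_eval k (szego_coeffs k \<alpha>) z" and ?\<Psi> = "\<lambda>k. reversed_eval k (szego_coeffs k \<alpha>) z"
    have st: "?\<Phi> (Suc i) = z * ?\<Phi> i - of_real (\<alpha> i) * ?\<Psi> i" "?\<Psi> (Suc i) = ?\<Psi> i - of_real (\<alpha> i) * z * ?\<Phi> i" for i
      unfolding szego_coeffs.simps by (rule monic_eval_szego_step reversed_eval_szego_step)+
    have rho: "(complex_of_real (cmv_rho \<alpha> k)) * of_real (cmv_rho \<alpha> k) = 1 - of_real (\<alpha> k) * of_real (\<alpha> k)"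
    proof -
      have "cmv_rho \<alpha> k * cmv_rho \<alpha> k = 1 - \<alpha> k * \<alpha> k"
        using a[of k] Suc.prems by (simp add: cmv_rho_def power2_eq_square)
      from arg_cong[OF this, of complex_of_real] show ?thesis
        by (simp only: of_real_mult of_real_diff of_real_1)
    qed
    have step: "D (Suc (Suc k)) = (if P (Suc k) then - (if P k then - \<sigma> else \<sigma>) else (if P k then - \<sigma> else \<sigma>)) * S (Suc (Suc k))"
    proof (cases "P k")
      case True
      have f: "?f (Suc k) (Suc k) = - z * of_real (\<alpha> k) - of_real (\<alpha> (Suc k))"
        "?f k (Suc k) * ?f (Suc k) k = z * z * (1 - of_real (\<alpha> k) * of_real (\<alpha> k))"
        using True alt[of k] rho by (simp_all add: block_entry_def cmv_corner_def mult_ac)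
      have "D (Suc (Suc k)) = (- z * of_real (\<alpha> k) - of_real (\<alpha> (Suc k))) * (- \<sigma> * ?\<Psi> (Suc k))
          - z * z * (1 - of_real (\<alpha> k) * of_real (\<alpha> k)) * (\<sigma> * ?\<Phi> k)"
        unfolding rec f \<sigma>(2,3) using True alt[of k] by (simp add: S_def)
      also have "\<dots> = - \<sigma> * ?\<Phi> (Suc (Suc k))"
        unfolding st(1)[of "Suc k"] unfolding st by (simp add: algebra_simps)
      finally show ?thesis using True alt by (simp add: S_def)
    next
      case False
      have f: "?f (Suc k) (Suc k) = z * of_real (\<alpha> (Suc k)) + of_real (\<alpha> k)"
        "?f k (Suc k) * ?f (Suc k) k = 1 - of_real (\<alpha> k) * of_real (\<alpha> k)"
        using False alt[of k] rho by (simp_all add: block_entry_def cmv_corner_def mult_ac)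
      have "D (Suc (Suc k)) = (z * of_real (\<alpha> (Suc k)) + of_real (\<alpha> k)) * (\<sigma> * ?\<Phi> (Suc k))
          - (1 - of_real (\<alpha> k) * of_real (\<alpha> k)) * (\<sigma> * ?\<Psi> k)"
        unfolding rec f \<sigma>(2,3) using False alt[of k] by (simp add: S_def)
      also have "\<dots> = - \<sigma> * ?\<Psi> (Suc (Suc k))"
        unfolding st(2)[of "Suc k"] unfolding st by (simp add: algebra_simps)
      finally show ?thesis using False alt by (simp add: S_def)
    qed
    show ?case
    proof (rule bexI[of _ "if P k then - \<sigma> else \<sigma>"], intro conjI impI)
      show "D (Suc k) = (if P k then - \<sigma> else \<sigma>) * S (Suc k)" by (rule \<sigma>(3))
      show "D (Suc (Suc k)) = (if P (Suc k) then - (if P k then - \<sigma> else \<sigma>) else (if P k then - \<sigma> else \<sigma>)) * S (Suc (Suc k))"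
        by (rule step)
      show "(if P k then - \<sigma> else \<sigma>) \<in> {1, -1}" using \<sigma>(1) by auto
    qed
  qed
  from this[of n] show ?thesis by blast
qed

theorem char_poly_cmv:
  fixes \<alpha> :: "nat \<Rightarrow> real"
  assumes n: "n \<ge> 1" and a: "\<And>k. k < n \<Longrightarrow> \<bar>\<alpha> k\<bar> < 1"
  shows "char_poly (cmv n (\<lambda>k. complex_of_real (\<alpha> k))) = monic_poly n (szego_coeffs n \<alpha>)"
proof -
  have a2: "(\<alpha> k)\<^sup>2 \<le> 1" if "k < n" for k using a[OF that] by (simp add: abs_square_le_1)
  define P where "P = (\<lambda>i::nat. even i \<longleftrightarrow> even n)"
  have P: "alternating P" "P n" "\<not> P (n - 1)" using n by (auto simp: P_def alternating_def)
  let ?E = "\<lambda>Q. mat n n (\<lambda>(i, j). complex_of_real (block_entry Q \<alpha> i j))"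
  define Q where "Q = (\<lambda>i. \<not> P i)"
  have PQ: "P = even \<and> Q = odd \<or> P = odd \<and> Q = even" by (auto simp: P_def Q_def fun_eq_iff)
  let ?A = "cmv n (\<lambda>k. complex_of_real (\<alpha> k))"
  have A: "?A = ?E even * ?E odd" unfolding cmv_def cmv_L_entries cmv_M_entries[OF n] ..
  have cA: "?A \<in> carrier_mat n n" by (rule cmv_carrier(3)[OF n])
  have cE: "?E R \<in> carrier_mat n n" for R by simp
  have EE: "?E P * ?E P = 1\<^sub>m n"
  proof (rule eq_matI)
    fix i j assume "i < dim_row (1\<^sub>m n)" "j < dim_col (1\<^sub>m n)"
    then have ij: "i < n" "j < n" by simp_all
    have "(?E P * ?E P) $$ (i, j) = (\<Sum>k<n. of_real (block_entry P \<alpha> i k) * of_real (block_entry P \<alpha> k j))"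
      using ij by (simp add: scalar_prod_def atLeast0LessThan)
    also have "\<dots> = of_real (\<Sum>k<n. block_entry P \<alpha> i k * block_entry P \<alpha> k j)" by simp
    also have "\<dots> = of_real (if i = j then 1 else 0)" using block_entry_square[OF P(1,3) a2 ij] by simp
    finally show "(?E P * ?E P) $$ (i, j) = 1\<^sub>m n $$ (i, j)" using ij by simp
  qed simp_all
  define d where "d = det (?E P)"
  have "d * d = 1" unfolding d_def det_mult[OF cE cE, symmetric] EE by simp
  then have d: "d \<in> {1, -1}" by (simp add: square_eq_1_iff)
  have ev: "poly (char_poly ?A) z = monic_eval n (szego_coeffs n \<alpha>) z \<or> poly (char_poly ?A) z = - monic_eval n (szego_coeffs n \<alpha>) z" for z
  proof -
    let ?B = "z \<cdot>\<^sub>m ?E P - ?E Q"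
    have cB: "?B \<in> carrier_mat n n" unfolding carrier_mat_def by simp
    have Bm: "?B = mat n n (\<lambda>(i, j). z * of_real (block_entry P \<alpha> i j) - of_real (block_entry Q \<alpha> i j))"
      by (rule eq_matI) auto
    have cz: "- (char_matrix ?A z) = z \<cdot>\<^sub>m 1\<^sub>m n - ?A"
      unfolding char_matrix_def using cA by (intro eq_matI) auto
    have "z \<cdot>\<^sub>m 1\<^sub>m n - ?A = ?E P * ?B \<or> z \<cdot>\<^sub>m 1\<^sub>m n - ?A = ?B * ?E P"
      using PQ
    proof (elim disjE conjE)
      assume e: "P = even" "Q = odd"
      have "?E P * ?B = ?E P * (z \<cdot>\<^sub>m ?E P) - ?E P * ?E Q"
        by (rule mult_minus_distrib_mat[of _ n n _ n]) simp_all
      also have "?E P * (z \<cdot>\<^sub>m ?E P) = z \<cdot>\<^sub>m 1\<^sub>m n"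
        using mult_smult_distrib[OF cE cE, of P z P] EE by simp
      also have "?E P * ?E Q = ?A" unfolding A e ..
      finally show ?thesis by simp
    next
      assume e: "P = odd" "Q = even"
      have "?B * ?E P = (z \<cdot>\<^sub>m ?E P) * ?E P - ?E Q * ?E P"
        by (rule minus_mult_distrib_mat[of _ n n _ _ n]) simp_all
      also have "(z \<cdot>\<^sub>m ?E P) * ?E P = z \<cdot>\<^sub>m 1\<^sub>m n"
        using mult_smult_assoc_mat[OF cE cE, of z P P] EE by simp
      also have "?E Q * ?E P = ?A" unfolding A e ..
      finally show ?thesis by simp
    qed
    then have pd: "poly (char_poly ?A) z = d * det ?B"
      unfolding char_poly_matrix[OF cA] cz d_def using det_mult[OF cE cB] det_mult[OF cB cE] by (auto simp: mult.commute)
    have "\<exists>\<sigma>\<in>{1, -1}. det ?B = \<sigma> * monic_eval n (szego_coeffs n \<alpha>) z"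
    proof -
      have "\<exists>\<sigma>\<in>{1, -1}. det (mat n n (\<lambda>(i, j). z * of_real (block_entry P \<alpha> i j) - of_real (block_entry Q \<alpha> i j))) =
          \<sigma> * (if P n then monic_eval n (szego_coeffs n \<alpha>) z else reversed_eval n (szego_coeffs n \<alpha>) z)"
        unfolding Q_def by (rule det_szego_continuant[OF P(1)]) (rule a2)
      then show ?thesis unfolding Bm using P(2) by (simp only: if_True)
    qed
    then obtain \<sigma> where "\<sigma> \<in> {1, -1}" "det ?B = \<sigma> * monic_eval n (szego_coeffs n \<alpha>) z" by blast
    then show ?thesis using d pd by auto
  qed
  let ?p = "char_poly ?A" and ?q = "monic_poly n (szego_coeffs n \<alpha>)"
  have "poly ((?p - ?q) * (?p + ?q)) z = 0" for z
    using ev[of z] by auto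
  then have "(?p - ?q) * (?p + ?q) = 0" by (simp only: poly_all_0_iff_0[symmetric]) blast
  moreover have "?p + ?q \<noteq> 0"
  proof
    assume "?p + ?q = 0"
    then have "coeff (?p + ?q) n = 0" by simp
    then show False using degree_monic_char_poly[OF cA] by simp
  qed
  ultimately show ?thesis by simp
qed


lemma measurable_coeff_mult:
  fixes p q :: "'x \<Rightarrow> real poly"
  assumes "\<And>i. (\<lambda>x. coeff (p x) i) \<in> borel_measurable N" "\<And>i. (\<lambda>x. coeff (q x) i) \<in> borel_measurable N"
  shows "(\<lambda>x. coeff (p x * q x) i) \<in> borel_measurable N"
  unfolding coeff_mult using assms by (intro borel_measurable_sum borel_measurable_times)

lemma measurable_coeff_prod:
  fixes p :: "nat \<Rightarrow> 'x \<Rightarrow> real poly"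
  assumes "finite I" "\<And>k i. k \<in> I \<Longrightarrow> (\<lambda>x. coeff (p k x) i) \<in> borel_measurable N"
  shows "(\<lambda>x. coeff (\<Prod>k\<in>I. p k x) i) \<in> borel_measurable N"
  using assms
proof (induction I arbitrary: i rule: finite_induct)
  case (insert k I)
  then show ?case unfolding prod.insert[OF insert.hyps]
    by (intro measurable_coeff_mult) auto
qed simp

lemma measurable_coeff_char_poly:
  fixes e :: "nat \<Rightarrow> nat \<Rightarrow> 'x \<Rightarrow> real"
  assumes "\<And>i j. i < n \<Longrightarrow> j < n \<Longrightarrow> e i j \<in> borel_measurable N"
  shows "(\<lambda>x. coeff (char_poly (mat n n (\<lambda>(i, j). e i j x))) l) \<in> borel_measurable N"
proof -
  let ?p = "\<lambda>x i j. (if i = j then [:0, 1:] else 0) + [:- e i j x:]"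
  have M: "char_poly_matrix (mat n n (\<lambda>(i, j). e i j x)) = mat n n (\<lambda>(i, j). ?p x i j)" for x
    by (rule eq_matI) (auto simp: char_poly_matrix_def)
  have m: "(\<lambda>x. coeff (?p x i j) l) \<in> borel_measurable N" if "i < n" "j < n" for i j l
  proof -
    have [measurable]: "e i j \<in> borel_measurable N" by (rule assms[OF that])
    have "(\<lambda>x. coeff [:- e i j x:] l) \<in> borel_measurable N" by (cases l) simp_all
    then show ?thesis unfolding coeff_add by (intro borel_measurable_add) auto
  qed
  have det: "det (mat n n (\<lambda>(i, j). ?p x i j)) = (\<Sum>\<pi> | \<pi> permutes {0..<n}. signof \<pi> * (\<Prod>i = 0..<n. ?p x i (\<pi> i)))" for x
  proof -
    have "det (mat n n (\<lambda>(i, j). ?p x i j)) = (\<Sum>\<pi> | \<pi> permutes {0..<n}. signof \<pi> * (\<Prod>i = 0..<n. mat n n (\<lambda>(i, j). ?p x i j) $$ (i, \<pi> i)))"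
      by (rule det_def') simp
    also have "\<dots> = (\<Sum>\<pi> | \<pi> permutes {0..<n}. signof \<pi> * (\<Prod>i = 0..<n. ?p x i (\<pi> i)))"
      by (intro sum.cong refl arg_cong2[where f = "(*)"] prod.cong) (auto dest: permutes_in_image)
    finally show ?thesis .
  qed
  have "(\<lambda>x. coeff (signof \<pi> * (\<Prod>i = 0..<n. ?p x i (\<pi> i))) l) \<in> borel_measurable N" if "\<pi> permutes {0..<n}" for \<pi>
  proof (rule measurable_coeff_mult)
    show "(\<lambda>x. coeff (\<Prod>i = 0..<n. ?p x i (\<pi> i)) l) \<in> borel_measurable N" for l
    proof (rule measurable_coeff_prod)
      fix k i assume "k \<in> {0..<n}"
      then have "k < n" "\<pi> k < n" using permutes_in_image[OF that, of k] by auto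
      then show "(\<lambda>x. coeff (?p x k (\<pi> k)) i) \<in> borel_measurable N" by (rule m)
    qed simp
  qed simp
  then show ?thesis
    unfolding char_poly_def M det coeff_sum by (intro borel_measurable_sum) simp
qed

definition cmv_coeffs :: "nat \<Rightarrow> (nat \<Rightarrow> real) \<Rightarrow> nat \<Rightarrow> real" where
  "cmv_coeffs n \<alpha> = (\<lambda>i\<in>{..<n}. Re (coeff (char_poly (cmv n (\<lambda>k. complex_of_real (\<alpha> k)))) (n - 1 - i)))"

lemma cmv_real_entries:
  assumes "n \<ge> 1"
  shows "cmv n (\<lambda>k. complex_of_real (\<alpha> k)) =
    map_mat complex_of_real (mat n n (\<lambda>(i, j). \<Sum>k<n. block_entry even \<alpha> i k * block_entry odd \<alpha> k j))"
  unfolding cmv_def cmv_L_entries cmv_M_entries[OF assms]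
  by (rule eq_matI) (simp_all add: scalar_prod_def atLeast0LessThan)

lemma char_poly_cmv_coeffs:
  assumes n: "n \<ge> 1"
  shows "char_poly (cmv n (\<lambda>k. complex_of_real (\<alpha> k))) = monic_poly n (cmv_coeffs n \<alpha>)"
proof -
  let ?R = "mat n n (\<lambda>(i, j). \<Sum>k<n. block_entry even \<alpha> i k * block_entry odd \<alpha> k j)"
  let ?p = "char_poly (cmv n (\<lambda>k. complex_of_real (\<alpha> k)))"
  have "?p = map_poly of_real (char_poly ?R)"
    unfolding cmv_real_entries[OF n] by (rule of_real_hom.char_poly_hom[of _ n]) simp
  then have re: "coeff ?p i = of_real (Re (coeff ?p i))" for i
    by (simp add: coeff_map_poly)
  show ?thesis
  proof (rule poly_eqI)
    fix i
    have deg: "degree ?p = n" "coeff ?p n = 1" using degree_monic_char_poly[OF cmv_carrier(3)[OF n]] by auto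
    consider "i < n" | "i = n" | "i > n" by linarith
    then show "coeff ?p i = coeff (monic_poly n (cmv_coeffs n \<alpha>)) i"
    proof cases
      case 1
      then show ?thesis using re[of i] by (simp add: coeff_monic_poly cmv_coeffs_def)
    next
      case 2
      then show ?thesis using deg by simp
    next
      case 3
      then show ?thesis using deg coeff_eq_0[of ?p i] coeff_eq_0[of "monic_poly n (cmv_coeffs n \<alpha>)" i] by simp
    qed
  qed
qed

lemma measurable_cmv_coeffs:
  assumes n: "n \<ge> 1"
  shows "cmv_coeffs n \<in> leb {..<n} \<rightarrow>\<^sub>M leb {..<n}"
proof -
  let ?R = "\<lambda>\<alpha>. mat n n (\<lambda>(i, j). \<Sum>k<n. block_entry even \<alpha> i k * block_entry odd \<alpha> k j)"
  have comp: "(\<lambda>\<alpha>. \<alpha> i) \<in> borel_measurable (leb {..<n})" if "i < n" for i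
    using that by (intro component_measurable_leb) simp
  have c: "(\<lambda>\<alpha>. cmv_corner \<alpha> i) \<in> borel_measurable (leb {..<n})" if "i < n" for i
  proof (cases "i = 0")
    case False
    then show ?thesis using comp[of "i - 1"] that by (simp add: cmv_corner_def)
  qed (simp add: cmv_corner_def)
  have r: "(\<lambda>\<alpha>. cmv_rho \<alpha> i) \<in> borel_measurable (leb {..<n})" if "i < n" for i
  proof -
    note [measurable] = comp[OF that]
    show ?thesis unfolding cmv_rho_def by measurable
  qed
  have b: "(\<lambda>\<alpha>. block_entry P \<alpha> i j) \<in> borel_measurable (leb {..<n})" if "i < n" "j < n" for P i j
    using comp[OF that(1)] c[OF that(1)] r[OF that(1)] r[OF that(2)] by (simp add: block_entry_def)
  have "(\<lambda>\<alpha>. coeff (char_poly (?R \<alpha>)) l) \<in> borel_measurable (leb {..<n})" for l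
    by (rule measurable_coeff_char_poly) (auto intro!: borel_measurable_sum borel_measurable_times b)
  moreover have "Re (coeff (char_poly (cmv n (\<lambda>k. complex_of_real (\<alpha> k)))) l) = coeff (char_poly (?R \<alpha>)) l" for \<alpha> l
    unfolding cmv_real_entries[OF n] by (subst of_real_hom.char_poly_hom[of _ n]) (simp_all add: coeff_map_poly)
  ultimately show ?thesis
    unfolding cmv_coeffs_def by (intro measurable_restrict) simp
qed

(* @@@ F *)

lemma prod_even_odd:
  fixes f :: "nat \<Rightarrow> 'a::comm_monoid_mult"
  shows "(\<Prod>k<n. f k) = (\<Prod>j<(n + 1) div 2. f (2 * j)) * (\<Prod>j<n div 2. f (2 * j + 1))"
proof (induction n)
  case (Suc n)
  show ?case
  proof (cases "even n")
    case True
    then obtain m where "n = 2 * m" by (elim evenE)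
    then show ?thesis using Suc by (simp add: mult_ac)
  next
    case False
    then obtain m where "n = 2 * m + 1" by (elim oddE)
    then show ?thesis using Suc by (simp add: mult_ac)
  qed
qed simp

lemma schur_stable_szego_coeffs: "(\<And>k. k < n \<Longrightarrow> \<bar>\<alpha> k\<bar> < 1) \<Longrightarrow> schur_stable n (szego_coeffs n \<alpha>)"
proof (induction n)
  case 0
  show ?case by (simp add: schur_stable_def)
next
  case (Suc n)
  then show ?case by (simp add: schur_stable_szego_step)
qed

lemma prod_reversed_eval_szego:
  fixes z :: "nat \<Rightarrow> complex"
  assumes "monic_poly n (szego_coeffs n \<alpha>) = (\<Prod>j<n. [:- z j, 1:])"
  shows "(\<Prod>j<n. reversed_eval n (szego_coeffs n \<alpha>) (z j)) = of_real (\<Prod>k<n. (1 - (\<alpha> k)\<^sup>2) ^ Suc k)"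
  using assms
proof (induction n arbitrary: z)
  case (Suc m)
  let ?\<Phi> = "\<lambda>k z::complex. monic_eval k (szego_coeffs k \<alpha>) z" and ?\<Psi> = "\<lambda>k z::complex. reversed_eval k (szego_coeffs k \<alpha>) z"
  have st: "?\<Phi> (Suc m) w = w * ?\<Phi> m w - of_real (\<alpha> m) * ?\<Psi> m w" "?\<Psi> (Suc m) w = ?\<Psi> m w - of_real (\<alpha> m) * w * ?\<Phi> m w" for w
    unfolding szego_coeffs.simps by (rule monic_eval_szego_step reversed_eval_szego_step)+
  obtain w where w: "monic_poly m (szego_coeffs m \<alpha>) = (\<Prod>j<m. [:- w j, 1:])"
    by (rule monic_poly_factorization)
  have z: "?\<Psi> (Suc m) (z j) = of_real (1 - (\<alpha> m)\<^sup>2) * ?\<Psi> m (z j)" if "j < Suc m" for j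
  proof -
    have "?\<Phi> (Suc m) (z j) = 0"
      unfolding monic_eval_factorization[OF Suc.prems] using that by (simp del: prod.lessThan_Suc) blast
    then have "z j * ?\<Phi> m (z j) = of_real (\<alpha> m) * ?\<Psi> m (z j)" unfolding st by simp
    then show ?thesis unfolding st(2) mult.assoc by (simp add: power2_eq_square algebra_simps)
  qed
  have wk: "?\<Psi> (Suc m) (w k) = ?\<Psi> m (w k)" if "k < m" for k
  proof -
    have "?\<Phi> m (w k) = 0" unfolding monic_eval_factorization[OF w] using that by simp blast
    then show ?thesis unfolding st by simp
  qed
  have "(\<Prod>j<Suc m. ?\<Psi> (Suc m) (z j)) = (\<Prod>j<Suc m. of_real (1 - (\<alpha> m)\<^sup>2) * ?\<Psi> m (z j))"
    using z by (intro prod.cong) auto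
  also have "\<dots> = of_real (1 - (\<alpha> m)\<^sup>2) ^ Suc m * (\<Prod>j<Suc m. ?\<Psi> m (z j))"
    by (simp only: prod.distrib prod_constant card_lessThan)
  also have "(\<Prod>j<Suc m. ?\<Psi> m (z j)) = (\<Prod>k<m. \<Prod>j<Suc m. 1 - z j * w k)"
    unfolding reversed_eval_factorization[OF w] by (subst prod.swap) (simp only: mult.commute)
  also have "\<dots> = (\<Prod>k<m. ?\<Psi> (Suc m) (w k))"
    unfolding reversed_eval_factorization[OF Suc.prems] ..
  also have "\<dots> = (\<Prod>k<m. ?\<Psi> m (w k))" using wk by (intro prod.cong) auto
  also have "\<dots> = of_real (\<Prod>k<m. (1 - (\<alpha> k)\<^sup>2) ^ Suc k)" by (rule Suc.IH[OF w])
  finally show ?case by (simp only: prod.lessThan_Suc of_real_mult of_real_power mult.commute)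
qed simp

lemma
  fixes z :: "nat \<Rightarrow> complex"
  assumes "monic_poly n (szego_coeffs n \<alpha>) = (\<Prod>j<n. [:- z j, 1:])" and a: "\<And>k. k < n \<Longrightarrow> \<bar>\<alpha> k\<bar> < 1"
  shows prod_root_distances: "(\<Prod>j<n. \<Prod>k<n. cmod (1 - z j * cnj (z k))) = (\<Prod>k<n. (1 - (\<alpha> k)\<^sup>2) ^ Suc k)"
    and prod_one_minus_roots: "(\<Prod>j<n. cmod (1 - z j)) = (\<Prod>k<n. 1 - \<alpha> k)"
    and prod_one_plus_roots: "(\<Prod>j<n. cmod (1 + z j)) = (\<Prod>k<n. 1 + (-1) ^ k * \<alpha> k)"
proof -
  have pos: "(1 - (\<alpha> k)\<^sup>2) > 0" "1 - \<alpha> k > 0" "1 + (-1) ^ k * \<alpha> k > 0" if "k < n" for k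
    using a[OF that] abs_square_less_1[of "\<alpha> k"] by (auto simp: minus_one_power_iff abs_less_iff)
  have "(\<Prod>j<n. \<Prod>k<n. cmod (1 - z j * cnj (z k))) = (\<Prod>k<n. \<Prod>j<n. cmod (1 - z j * cnj (z k)))"
    by (rule prod.swap)
  also have "\<dots> = (\<Prod>k<n. cmod (reversed_eval n (szego_coeffs n \<alpha>) (z k)))"
  proof (rule prod.cong)
    fix k
    have "cmod (reversed_eval n (szego_coeffs n \<alpha>) (z k)) = cmod (reversed_eval n (szego_coeffs n \<alpha>) (cnj (z k)))"
      by (simp only: reversed_eval_cnj complex_mod_cnj)
    then show "(\<Prod>j<n. cmod (1 - z j * cnj (z k))) = cmod (reversed_eval n (szego_coeffs n \<alpha>) (z k))"
      unfolding reversed_eval_factorization[OF assms(1), of "cnj (z k)"] by (simp only: prod_norm)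
  qed simp
  also have "\<dots> = cmod (\<Prod>k<n. reversed_eval n (szego_coeffs n \<alpha>) (z k))" by (simp only: prod_norm)
  also have "\<dots> = (\<Prod>k<n. (1 - (\<alpha> k)\<^sup>2) ^ Suc k)"
    unfolding prod_reversed_eval_szego[OF assms(1)] norm_of_real
    using pos by (intro abs_of_nonneg prod_nonneg) (auto intro!: zero_le_power less_imp_le)
  finally show "(\<Prod>j<n. \<Prod>k<n. cmod (1 - z j * cnj (z k))) = (\<Prod>k<n. (1 - (\<alpha> k)\<^sup>2) ^ Suc k)" .
  let ?\<Phi> = "\<lambda>k z::complex. monic_eval k (szego_coeffs k \<alpha>) z" and ?\<Psi> = "\<lambda>k z::complex. reversed_eval k (szego_coeffs k \<alpha>) z"
  have st: "?\<Phi> (Suc m) w = w * ?\<Phi> m w - of_real (\<alpha> m) * ?\<Psi> m w" "?\<Psi> (Suc m) w = ?\<Psi> m w - of_real (\<alpha> m) * w * ?\<Phi> m w" for m w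
    unfolding szego_coeffs.simps by (rule monic_eval_szego_step reversed_eval_szego_step)+
  have "?\<Phi> m 1 = of_real (\<Prod>k<m. 1 - \<alpha> k) \<and> ?\<Psi> m 1 = of_real (\<Prod>k<m. 1 - \<alpha> k)" for m
  proof (induction m)
    case (Suc m)
    then show ?case unfolding st by (simp add: algebra_simps)
  qed simp
  then have "(\<Prod>j<n. 1 - z j) = of_real (\<Prod>k<n. 1 - \<alpha> k)"
    unfolding monic_eval_factorization[OF assms(1), symmetric] by blast
  then have "cmod (\<Prod>j<n. 1 - z j) = \<bar>\<Prod>k<n. 1 - \<alpha> k\<bar>" by (simp only: norm_of_real)
  then show "(\<Prod>j<n. cmod (1 - z j)) = (\<Prod>k<n. 1 - \<alpha> k)"
    using prod_pos[of "{..<n}" "\<lambda>k. 1 - \<alpha> k"] pos by (simp add: prod_norm)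
  have "?\<Phi> m (-1) = (-1) ^ m * of_real (\<Prod>k<m. 1 + (-1) ^ k * \<alpha> k) \<and> ?\<Psi> m (-1) = of_real (\<Prod>k<m. 1 + (-1) ^ k * \<alpha> k)" for m
  proof (induction m)
    case (Suc m)
    have sq: "(-1) ^ m * ((-1) ^ m * x) = x" for x :: complex by (simp add: minus_one_power_iff)
    show ?case unfolding st conjunct1[OF Suc] conjunct2[OF Suc] by (simp add: algebra_simps sq)
  qed simp
  then have "(\<Prod>j<n. - 1 - z j) = (-1) ^ n * of_real (\<Prod>k<n. 1 + (-1) ^ k * \<alpha> k)"
    unfolding monic_eval_factorization[OF assms(1), symmetric] by blast
  then have "cmod (\<Prod>j<n. - 1 - z j) = \<bar>\<Prod>k<n. 1 + (-1) ^ k * \<alpha> k\<bar>"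
    by (simp only: norm_mult norm_of_real norm_power norm_minus_cancel norm_one power_one mult_1)
  moreover have "cmod (\<Prod>j<n. - 1 - z j) = (\<Prod>j<n. cmod (1 + z j))"
  proof -
    have "cmod (- 1 - z j) = cmod (1 + z j)" for j using norm_minus_cancel[of "1 + z j"] by (simp add: algebra_simps)
    then show ?thesis by (simp only: prod_norm[symmetric])
  qed
  ultimately show "(\<Prod>j<n. cmod (1 + z j)) = (\<Prod>k<n. 1 + (-1) ^ k * \<alpha> k)"
    using prod_pos[of "{..<n}" "\<lambda>k. 1 + (-1) ^ k * \<alpha> k"] pos by simp
qed

definition root_weight :: "real \<Rightarrow> real \<Rightarrow> real \<Rightarrow> nat \<Rightarrow> (nat \<Rightarrow> complex) \<Rightarrow> real" where
  "root_weight \<beta> a b n z = 1 / P_const \<beta> a b n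
     * (\<Prod>j<n. \<Prod>k<n. cmod (1 - z j * cnj (z k))) powr (\<beta> / 4 - 1 / 2)
     * (\<Prod>j<n. cmod (1 - z j)) powr (a + 1 / 2 - \<beta> / 4)
     * (\<Prod>j<n. cmod (1 + z j)) powr (b + 1 / 2 - \<beta> / 4)"

definition verblunsky_density :: "real \<Rightarrow> real \<Rightarrow> real \<Rightarrow> nat \<Rightarrow> real \<Rightarrow> real" where
  "verblunsky_density \<beta> a b k =
     (if even k then beta_density (\<beta> * real k / 4 + a + 1) (\<beta> * real k / 4 + b + 1)
      else beta_density (\<beta> * (real k - 1) / 4 + a + b + 2) (\<beta> * (real k + 1) / 4))"

lemma P_const_beta_functions:
  fixes \<beta> a b :: real
  assumes "n \<ge> 1"
  defines "s \<equiv> \<lambda>k::nat. if even k then \<beta> * real k / 4 + a + 1 else \<beta> * (real k - 1) / 4 + a + b + 2"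
    and "t \<equiv> \<lambda>k::nat. if even k then \<beta> * real k / 4 + b + 1 else \<beta> * (real k + 1) / 4"
  assumes pos: "\<beta> > 0" "a > -1" "b > -1"
  shows "(\<Prod>k<n. 2 powr (1 - s k - t k) * Gamma (s k + t k) / (Gamma (s k) * Gamma (t k))) = 1 / P_const \<beta> a b n"
proof -
  let ?g = "\<lambda>k. Gamma (a + b + 2 + \<beta> / 2 * real k)"
  let ?A = "\<lambda>j::nat. Gamma (a + 1 + \<beta> / 2 * real j)" and ?B = "\<lambda>j::nat. Gamma (b + 1 + \<beta> / 2 * real j)"
  let ?C = "\<lambda>j::nat. Gamma (\<beta> / 2 * real (Suc j))"
  let ?N = "(n + 1) div 2" and ?M = "n div 2"
  have st: "s k + t k = a + b + 2 + \<beta> / 2 * real k" for k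
    by (simp add: s_def t_def field_simps)
  have two: "(\<Prod>k<m. 2 powr (1 - s k - t k)) = 2 powr - (real m * (a + b + 1) + \<beta> / 4 * real m * (real m - 1))" for m
  proof (induction m)
    case (Suc m)
    have "- (real m * (a + b + 1) + \<beta> / 4 * real m * (real m - 1)) + (1 - s m - t m)
        = - (real (Suc m) * (a + b + 1) + \<beta> / 4 * real (Suc m) * (real (Suc m) - 1))"
      using st[of m] by (simp add: field_simps)
    then show ?case unfolding prod.lessThan_Suc Suc powr_add[symmetric] by (simp only:)
  qed simp
  have even: "Gamma (s (2 * j)) * Gamma (t (2 * j)) = ?A j * ?B j" for j
  proof -
    have "s (2 * j) = a + 1 + \<beta> / 2 * real j" "t (2 * j) = b + 1 + \<beta> / 2 * real j"
      by (simp_all add: s_def t_def)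
    then show ?thesis by (simp only:)
  qed
  have odd: "Gamma (s (2 * j + 1)) * Gamma (t (2 * j + 1)) = ?g j * ?C j" for j
  proof -
    have "s (2 * j + 1) = a + b + 2 + \<beta> / 2 * real j" "t (2 * j + 1) = \<beta> / 2 * real (Suc j)"
      by (simp_all add: s_def t_def field_simps)
    then show ?thesis by (simp only:)
  qed
  have gs: "(\<Prod>k<n. ?g k) = (\<Prod>j<?M. ?g j) * (\<Prod>j<?N. ?g (?M + j))"
  proof -
    have "n = ?M + ?N" by presburger
    moreover have "(\<Prod>k<x + y. ?g k) = (\<Prod>j<x. ?g j) * (\<Prod>j<y. ?g (x + j))" for x y :: nat
      by (induction y) (simp_all add: mult_ac)
    ultimately show ?thesis by metis
  qed
  have nz: "?g k \<noteq> 0" "?A k \<noteq> 0" "?B k \<noteq> 0" "?C k \<noteq> 0" for k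
  proof -
    have "\<beta> / 2 * real k \<ge> 0" "\<beta> / 2 * real (Suc k) > 0" using pos by simp_all
    then have "a + b + 2 + \<beta> / 2 * real k > 0" "a + 1 + \<beta> / 2 * real k > 0" "b + 1 + \<beta> / 2 * real k > 0" "\<beta> / 2 * real (Suc k) > 0"
      using pos by linarith+
    then show "?g k \<noteq> 0" "?A k \<noteq> 0" "?B k \<noteq> 0" "?C k \<noteq> 0" by (metis Gamma_real_pos less_irrefl)+
  qed
  have "(\<Prod>k<n. 2 powr (1 - s k - t k) * Gamma (s k + t k) / (Gamma (s k) * Gamma (t k)))
      = (\<Prod>k<n. 2 powr (1 - s k - t k)) * (\<Prod>k<n. ?g k) / (\<Prod>k<n. Gamma (s k) * Gamma (t k))"
    unfolding st by (simp only: prod.distrib prod_dividef)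
  also have "(\<Prod>k<n. Gamma (s k) * Gamma (t k)) = (\<Prod>j<?N. ?A j * ?B j) * ((\<Prod>j<?M. ?g j) * (\<Prod>j<?M. ?C j))"
    unfolding prod_even_odd[of _ n] even odd by (simp only: prod.distrib)
  also have "(\<Prod>k<n. 2 powr (1 - s k - t k)) * (\<Prod>k<n. ?g k) / \<dots> =
      (\<Prod>k<n. 2 powr (1 - s k - t k)) * (\<Prod>j<?N. ?g (?M + j)) / ((\<Prod>j<?N. ?A j * ?B j) * (\<Prod>j<?M. ?C j))"
  proof -
    have cancel: "p * (g * h) / (x * (g * c)) = p * h / (x * c)" if "g \<noteq> 0" for p g h x c :: real
      using that by simp
    show ?thesis unfolding gs by (rule cancel) (use nz(1) in simp)
  qed
  also have "\<dots> = 1 / P_const \<beta> a b n"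
  proof -
    have 1: "{0..(n - 1) div 2} = {..<?N}" using assms(1) by auto
    have 2: "(\<Prod>j = 1..?M. Gamma (\<beta> / 2 * real j)) = (\<Prod>j<?M. ?C j)"
      by (rule prod.reindex_bij_witness[of _ Suc "\<lambda>j. j - 1"]) auto
    have invert: "inverse p * h / (x * c) = 1 / (p * (x / h) * c)" for p h x c :: real
      by (simp add: field_simps)
    show ?thesis
      unfolding P_const_def 1 2 two powr_minus of_nat_add[symmetric] prod_dividef by (rule invert)
  qed
  finally show ?thesis .
qed

lemma prod_verblunsky_density:
  fixes z :: "nat \<Rightarrow> complex"
  assumes z: "monic_poly n (szego_coeffs n \<alpha>) = (\<Prod>j<n. [:- z j, 1:])" and al: "\<And>k. k < n \<Longrightarrow> \<bar>\<alpha> k\<bar> < 1"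
    and pos: "\<beta> > 0" "a > -1" "b > -1" "n \<ge> 1"
  shows "(\<Prod>k<n. verblunsky_density \<beta> a b k (\<alpha> k)) = root_weight \<beta> a b n z * (\<Prod>k<n. shear_jacobian k (\<alpha> k))"
proof -
  define s where "s \<equiv> \<lambda>k::nat. if even k then \<beta> * real k / 4 + a + 1 else \<beta> * (real k - 1) / 4 + a + b + 2"
  define t where "t \<equiv> \<lambda>k::nat. if even k then \<beta> * real k / 4 + b + 1 else \<beta> * (real k + 1) / 4"
  let ?c = "\<beta> / 4 - 1 / 2" and ?p = "a + 1 / 2 - \<beta> / 4" and ?q = "b + 1 / 2 - \<beta> / 4"
  have ps: "1 - \<alpha> k > 0" "1 + \<alpha> k > 0" "1 + (-1) ^ k * \<alpha> k > 0" "1 - (\<alpha> k)\<^sup>2 = (1 - \<alpha> k) * (1 + \<alpha> k)" if "k < n" for k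
    using al[OF that] by (auto simp: minus_one_power_iff power2_eq_square algebra_simps abs_less_iff)
  have factor: "((1 - (\<alpha> k)\<^sup>2) ^ Suc k) powr ?c * (1 - \<alpha> k) powr ?p * (1 + (-1) ^ k * \<alpha> k) powr ?q * shear_jacobian k (\<alpha> k)
      = (1 - \<alpha> k) powr (s k - 1) * (1 + \<alpha> k) powr (t k - 1)" if k: "k < n" for k
  proof -
    note p = ps[OF k]
    let ?x = "1 - \<alpha> k" and ?y = "1 + \<alpha> k"
    have pw: "u ^ m = u powr real m" if "u > 0" for u :: real and m :: nat using that by (simp add: powr_realpow)
    have 1: "((1 - (\<alpha> k)\<^sup>2) ^ Suc k) powr ?c = ?x powr (real (Suc k) * ?c) * ?y powr (real (Suc k) * ?c)"
      unfolding p(4) using p(1,2) by (simp only: pw mult_pos_pos powr_powr powr_mult less_imp_le)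
    have 2: "shear_jacobian k (\<alpha> k) = ?x powr (real (k div 2) + real (k mod 2)) * ?y powr real (k div 2)"
      unfolding shear_jacobian_def p(4) power_mult_distrib using p(1,2) by (simp only: pw powr_add mult_ac)
    have rk: "real (k div 2) = (real k - real (k mod 2)) / 2"
    proof -
      have "d = (x - m) / 2" if "2 * d + m = x" for d m x :: real using that by simp
      then show ?thesis
        using arg_cong[OF mult_div_mod_eq[of 2 k], of real] unfolding of_nat_add of_nat_mult of_nat_numeral by blast
    qed
    show ?thesis
    proof (cases "even k")
      case True
      have e1: "real (Suc k) * ?c + ?p + (real (k div 2) + real (k mod 2)) = s k - 1"
        and e2: "real (Suc k) * ?c + ?q + real (k div 2) = t k - 1"
        using True unfolding rk by (simp_all add: s_def t_def field_simps)
      show ?thesis unfolding 1 2 e1[symmetric] e2[symmetric] powr_add using True by (simp add: mult_ac)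
    next
      case False
      have m: "k mod 2 = 1" using False by presburger
      have e1: "real (Suc k) * ?c + ?p + ?q + (real (k div 2) + real (k mod 2)) = s k - 1"
        and e2: "real (Suc k) * ?c + real (k div 2) = t k - 1"
        using False unfolding rk m by (simp_all add: s_def t_def field_simps)
      show ?thesis unfolding 1 2 e1[symmetric] e2[symmetric] powr_add using False by (simp add: mult_ac)
    qed
  qed
  have dens: "verblunsky_density \<beta> a b k (\<alpha> k) =
      2 powr (1 - s k - t k) * Gamma (s k + t k) / (Gamma (s k) * Gamma (t k)) * ((1 - \<alpha> k) powr (s k - 1) * (1 + \<alpha> k) powr (t k - 1))" if "k < n" for k
    using ps(1,2)[OF that] by (simp add: verblunsky_density_def beta_density_def s_def t_def)
  have "(\<Prod>k<n. verblunsky_density \<beta> a b k (\<alpha> k)) = (\<Prod>k<n. 2 powr (1 - s k - t k) * Gamma (s k + t k) / (Gamma (s k) * Gamma (t k)) *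
      (((1 - (\<alpha> k)\<^sup>2) ^ Suc k) powr ?c * (1 - \<alpha> k) powr ?p * (1 + (-1) ^ k * \<alpha> k) powr ?q * shear_jacobian k (\<alpha> k)))"
    using dens factor by (intro prod.cong refl) simp
  also have "\<dots> = 1 / P_const \<beta> a b n * ((\<Prod>k<n. ((1 - (\<alpha> k)\<^sup>2) ^ Suc k) powr ?c) * (\<Prod>k<n. (1 - \<alpha> k) powr ?p)
      * (\<Prod>k<n. (1 + (-1) ^ k * \<alpha> k) powr ?q) * (\<Prod>k<n. shear_jacobian k (\<alpha> k)))"
    unfolding prod.distrib[of "\<lambda>k. 2 powr (1 - s k - t k) * Gamma (s k + t k) / (Gamma (s k) * Gamma (t k))"]
    unfolding s_def t_def P_const_beta_functions[OF pos(4,1-3)] prod.distrib ..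
  also have "\<dots> = root_weight \<beta> a b n z * (\<Prod>k<n. shear_jacobian k (\<alpha> k))"
  proof -
    have "(\<Prod>j<n. \<Prod>k<n. cmod (1 - z j * cnj (z k))) = (\<Prod>k<n. (1 - (\<alpha> k)\<^sup>2) ^ Suc k)"
      "(\<Prod>j<n. cmod (1 - z j)) = (\<Prod>k<n. 1 - \<alpha> k)" "(\<Prod>j<n. cmod (1 + z j)) = (\<Prod>k<n. 1 + (-1) ^ k * \<alpha> k)"
      using prod_root_distances[OF z] prod_one_minus_roots[OF z] prod_one_plus_roots[OF z] al by blast+
    then show ?thesis unfolding root_weight_def by (simp only: prod_powr_distrib[of _ "{..<n}"] mult.assoc)
  qed
  finally show ?thesis .
qed


lemma prod_powr_conjugation_invariant:
  fixes w :: "'i \<Rightarrow> complex"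
  assumes I: "finite I" and w: "\<And>i. i \<in> I \<Longrightarrow> w i \<notin> \<real>\<^sub>\<le>\<^sub>0"
    and p: "bij_betw p I I" "\<And>i. i \<in> I \<Longrightarrow> w (p i) = cnj (w i)"
  shows "(\<Prod>i\<in>I. w i powr of_real c) = of_real ((\<Prod>i\<in>I. cmod (w i)) powr c)"
proof -
  have nz: "w i \<noteq> 0" if "i \<in> I" for i using w[OF that] by auto
  have "cnj (\<Sum>i\<in>I. Ln (w i)) = (\<Sum>i\<in>I. Ln (w (p i)))"
    unfolding cnj_sum using w p(2) by (intro sum.cong refl) (simp add: cnj_Ln)
  also have "\<dots> = (\<Sum>i\<in>I. Ln (w i))" by (rule sum.reindex_bij_betw[OF p(1)])
  finally have "(\<Sum>i\<in>I. Ln (w i)) \<in> \<real>" by (simp only: Reals_cnj_iff)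
  then have S: "(\<Sum>i\<in>I. Ln (w i)) = of_real (Re (\<Sum>i\<in>I. Ln (w i)))" by (simp only: of_real_Re)
  have pos: "(\<Prod>i\<in>I. cmod (w i)) > 0" using nz by (intro prod_pos) auto
  have R: "Re (\<Sum>i\<in>I. Ln (w i)) = ln (\<Prod>i\<in>I. cmod (w i))"
  proof -
    have "Re (\<Sum>i\<in>I. Ln (w i)) = (\<Sum>i\<in>I. ln (cmod (w i)))" unfolding Re_sum using nz by (intro sum.cong) auto
    also have "\<dots> = ln (\<Prod>i\<in>I. cmod (w i))" using nz I by (intro ln_prod[symmetric]) auto
    finally show ?thesis .
  qed
  have "(\<Prod>i\<in>I. w i powr of_real c) = (\<Prod>i\<in>I. exp (of_real c * Ln (w i)))"
    using nz by (intro prod.cong) (auto simp: powr_def)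
  also have "\<dots> = exp (of_real c * (\<Sum>i\<in>I. Ln (w i)))"
    using I by (simp only: exp_sum sum_distrib_left)
  also have "\<dots> = exp (of_real (c * ln (\<Prod>i\<in>I. cmod (w i))))"
    by (subst S) (simp only: R of_real_mult)
  also have "\<dots> = of_real ((\<Prod>i\<in>I. cmod (w i)) powr c)"
    using pos by (simp add: powr_def exp_of_real flip: of_real_mult)
  finally show ?thesis .
qed

lemma param_tuple_conjugation:
  obtains p where "bij_betw p {..<L + 2 * M} {..<L + 2 * M}"
    "\<And>i. i < L + 2 * M \<Longrightarrow> param_tuple L M v (p i) = cnj (param_tuple L M v i)"
proof
  define p where "p i = (if i < L then i else if even (i - L) then Suc i else i - 1)" for i
  have p_lt: "p i < L + 2 * M" if "i < L + 2 * M" for i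
  proof -
    have "even (i - L) \<Longrightarrow> \<not> i < L \<Longrightarrow> Suc i < L + 2 * M" using that by presburger
    then show ?thesis using that by (auto simp: p_def)
  qed
  have p_p: "p (p i) = i" for i
  proof (cases "i < L")
    case False
    then obtain d where d: "i = L + d" by (metis le_iff_add not_less)
    have "odd d \<Longrightarrow> L + d - 1 = L + (d - 1)" "odd d \<Longrightarrow> even (d - 1)" "odd d \<Longrightarrow> Suc (d - 1) = d" by presburger+
    then show ?thesis unfolding d p_def by (cases "even d") simp_all
  qed (simp add: p_def)
  show "bij_betw p {..<L + 2 * M} {..<L + 2 * M}"
    by (rule bij_betwI[of _ _ _ p]) (use p_lt p_p in auto)
  show "param_tuple L M v (p i) = cnj (param_tuple L M v i)" if i: "i < L + 2 * M" for i
  proof (cases "i < L")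
    case True
    then show ?thesis using i by (cases v) (simp add: p_def param_tuple_def)
  next
    case False
    then obtain d where d: "i = L + d" by (metis le_iff_add not_less)
    have e: "odd d \<Longrightarrow> (d - Suc 0) div 2 = d div 2" by presburger
    have o: "odd d \<Longrightarrow> \<not> L + d - Suc 0 < L" "odd d \<Longrightarrow> L + d - Suc 0 - L = d - Suc 0" by presburger+
    show ?thesis using p_lt[OF i] i False
      unfolding d by (cases v) (auto simp: p_def param_tuple_def Let_def complex_eq_iff e o even_Suc_div_two)
  qed
qed

lemma joint_density_on_D:
  assumes v: "v \<in> param_domain L M" and n: "n = L + 2 * M"
    and unit: "\<And>i. i < n \<Longrightarrow> cmod (z i) < 1" and z: "z = param_tuple L M v"
  shows "joint_density \<beta> a b n z = of_real (root_weight \<beta> a b n z * vandermonde n z)"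
proof -
  obtain p where p: "bij_betw p {..<n} {..<n}" "\<And>i. i \<in> {..<n} \<Longrightarrow> z (p i) = cnj (z i)"
    using param_tuple_conjugation[of L M v] unfolding n z by auto
  have half_plane: "w \<notin> \<real>\<^sub>\<le>\<^sub>0" if "cmod (1 - w) < 1" for w
  proof -
    have "Re (1 - w) \<le> cmod (1 - w)" by (rule complex_Re_le_cmod)
    then have "Re w > 0" using that by simp
    then show ?thesis by (auto simp: complex_nonpos_Reals_iff)
  qed
  have nonpos: "1 - z i \<notin> \<real>\<^sub>\<le>\<^sub>0" "1 + z i \<notin> \<real>\<^sub>\<le>\<^sub>0" if "i \<in> {..<n}" for i
    using unit that by (auto intro!: half_plane)
  have pair: "1 - z (fst x) * cnj (z (snd x)) \<notin> \<real>\<^sub>\<le>\<^sub>0" if x: "x \<in> {..<n} \<times> {..<n}" for x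
  proof (rule half_plane)
    have "cmod (z (fst x)) * cmod (z (snd x)) < 1 * 1"
      using unit x by (intro mult_strict_mono') auto
    then show "cmod (1 - (1 - z (fst x) * cnj (z (snd x)))) < 1" by (simp add: norm_mult)
  qed
  have A: "(\<Prod>j<n. \<Prod>k<n. (1 - z j * cnj (z k)) powr of_real c) = of_real ((\<Prod>j<n. \<Prod>k<n. cmod (1 - z j * cnj (z k))) powr c)" for c
  proof -
    have "bij_betw prod.swap ({..<n} \<times> {..<n}) ({..<n} \<times> {..<n})"
      by (rule bij_betwI[of _ _ _ prod.swap]) auto
    from prod_powr_conjugation_invariant[OF _ pair this, where c = c]
    show ?thesis unfolding prod.cartesian_product case_prod_beta by (simp add: mult.commute)
  qed
  have B: "(\<Prod>j<n. (1 - z j) powr of_real c) = of_real ((\<Prod>j<n. cmod (1 - z j)) powr c)" for c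
    by (rule prod_powr_conjugation_invariant[OF _ nonpos(1) p(1)]) (simp_all add: p(2))
  have C: "(\<Prod>j<n. (1 + z j) powr of_real c) = of_real ((\<Prod>j<n. cmod (1 + z j)) powr c)" for c
    by (rule prod_powr_conjugation_invariant[OF _ nonpos(2) p(1)]) (simp_all add: p(2))
  show ?thesis
    unfolding joint_density_def prod.distrib A B C root_weight_def vandermonde_def
    by (simp only: of_real_mult of_real_divide of_real_1 mult.assoc)
qed

lemma P_const_pos:
  assumes "\<beta> > 0" "a > -1" "b > -1"
  shows "P_const \<beta> a b n > 0"
proof -
  have 1: "Gamma (a + 1 + \<beta> / 2 * real j) > 0" "Gamma (b + 1 + \<beta> / 2 * real j) > 0"
     "Gamma (a + b + 2 + \<beta> / 2 * (real (n div 2) + real j)) > 0" for j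
  proof -
    have "\<beta> / 2 * real j \<ge> 0" "\<beta> / 2 * (real (n div 2) + real j) \<ge> 0" using assms by simp_all
    then have "a + 1 + \<beta> / 2 * real j > 0" "b + 1 + \<beta> / 2 * real j > 0" "a + b + 2 + \<beta> / 2 * (real (n div 2) + real j) > 0"
      using assms by linarith+
    then show "Gamma (a + 1 + \<beta> / 2 * real j) > 0" "Gamma (b + 1 + \<beta> / 2 * real j) > 0"
     "Gamma (a + b + 2 + \<beta> / 2 * (real (n div 2) + real j)) > 0" by (blast intro: Gamma_real_pos)+
  qed
  have 2: "Gamma (\<beta> / 2 * real j) > 0" if "j \<in> {1..n div 2}" for j
    using assms that by (intro Gamma_real_pos) auto
  show ?thesis unfolding P_const_def
    by (intro mult_pos_pos prod_pos divide_pos_pos 1 2) auto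
qed

lemma root_weight_nonneg:
  assumes "\<beta> > 0" "a > -1" "b > -1"
  shows "root_weight \<beta> a b n z \<ge> 0"
  unfolding root_weight_def using P_const_pos[OF assms, of n] by simp

lemma measurable_joint_density: "joint_density \<beta> a b n \<in> borel_measurable (tuple_space n)"
proof -
  have c [measurable]: "(\<lambda>z. z j) \<in> borel_measurable (tuple_space n)" if "j < n" for j
    using measurable_component_singleton[of j "{..<n}" "\<lambda>_. borel"] that by simp
  have pw: "(\<lambda>z. f z powr complex_of_real e) \<in> borel_measurable (tuple_space n)"
    if [measurable]: "f \<in> borel_measurable (tuple_space n)" for f e
    unfolding powr_def by measurable
  have cj: "(\<lambda>z. cnj (z j)) \<in> borel_measurable (tuple_space n)" if "j < n" for j
    using measurable_compose[OF c[OF that] borel_measurable_continuous_onI[of cnj]] by (simp add: continuous_on_cnj)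
  have 1: "(\<lambda>z. (1 - z j * cnj (z k)) powr complex_of_real e) \<in> borel_measurable (tuple_space n)" if "j < n" "k < n" for j k e
    by (rule pw) (use c[OF that(1)] cj[OF that(2)] in measurable)
  have 2: "(\<lambda>z. (1 - z j) powr complex_of_real e) \<in> borel_measurable (tuple_space n)"
    "(\<lambda>z. (1 + z j) powr complex_of_real e) \<in> borel_measurable (tuple_space n)" if "j < n" for j e
    by (rule pw; use c[OF that] in measurable)+
  have 3: "(\<lambda>z. complex_of_real (vandermonde n z)) \<in> borel_measurable (tuple_space n)"
    by (rule measurable_compose[OF measurable_vandermonde borel_measurable_of_real])
  show ?thesis
    unfolding joint_density_def vandermonde_def[symmetric]
    by (intro borel_measurable_times borel_measurable_const borel_measurable_prod 1 2 3) auto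
qed

(* @@@ G *)

lemma param_domain_iff:
  assumes "v \<in> ordered_params L M"
  shows "v \<in> param_domain L M \<longleftrightarrow> (\<forall>i<L + 2 * M. cmod (param_tuple L M v i) < 1)"
proof -
  obtain x y where v: "v = (x, y)" by (cases v)
  have real: "cmod (param_tuple L M v i) = \<bar>x i\<bar>" if "i < L" for i
    using that by (simp add: param_tuple_def v)
  have pair: "cmod (param_tuple L M v (L + d)) = cmod (Complex (x (L + d div 2)) (y (L + d div 2)))" if "d < 2 * M" for d
    using that by (simp add: param_tuple_def v Let_def cmod_def)
  have e1: "(\<forall>i<L + 2 * M. cmod (param_tuple L M v i) < 1) \<longleftrightarrow>
      (\<forall>i<L. \<bar>x i\<bar> < 1) \<and> (\<forall>d<2 * M. cmod (param_tuple L M v (L + d)) < 1)"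
  proof (intro iffI conjI allI impI, goal_cases)
    case (1 i)
    then show ?case using real[of i] by (metis trans_less_add1)
  next
    case (2 d)
    then show ?case by simp
  next
    case (3 i)
    show ?case
    proof (cases "i < L")
      case False
      then obtain d where d: "i = L + d" by (metis le_iff_add not_less)
      with 3 show ?thesis by simp
    qed (use 3 in \<open>simp add: real\<close>)
  qed
  have e2: "(\<forall>d<2 * M. cmod (param_tuple L M v (L + d)) < 1) \<longleftrightarrow> (\<forall>p\<in>{L..<L + M}. cmod (Complex (x p) (y p)) < 1)"
  proof (intro iffI ballI allI impI, goal_cases)
    case (1 p)
    have "2 * (p - L) < 2 * M" using 1 by auto
    moreover have "L + (p - L) = p" using 1 by simp
    ultimately show ?case using 1(1) pair[of "2 * (p - L)"] \<open>2 * (p - L) < 2 * M\<close>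
      by (metis nonzero_mult_div_cancel_left zero_neq_numeral)
  next
    case (2 d)
    then have "d div 2 < M" by simp
    with 2 show ?case by (simp add: pair)
  qed
  have eq: "(\<forall>i<L + 2 * M. cmod (param_tuple L M v i) < 1) \<longleftrightarrow>
      (\<forall>i<L. \<bar>x i\<bar> < 1) \<and> (\<forall>p\<in>{L..<L + M}. cmod (Complex (x p) (y p)) < 1)"
    unfolding e1 e2 ..
  have *: "\<bar>x p\<bar> < 1" if "p \<in> {L..<L + M}" "\<forall>p\<in>{L..<L + M}. cmod (Complex (x p) (y p)) < 1" for p
    using that abs_Re_le_cmod[of "Complex (x p) (y p)"] by force
  have q: "(\<forall>i<L + M. -1 < x i \<and> x i < 1) \<longleftrightarrow> (\<forall>i<L. \<bar>x i\<bar> < 1)" if q: "\<forall>p\<in>{L..<L + M}. cmod (Complex (x p) (y p)) < 1"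
  proof -
    have 1: "-1 < x i \<and> x i < 1" if h: "\<forall>i<L. \<bar>x i\<bar> < 1" "i < L + M" for i
    proof -
      have "\<bar>x i\<bar> < 1"
      proof (cases "i < L")
        case True
        then show ?thesis using h(1) by blast
      next
        case False
        then show ?thesis using *[OF _ q, of i] h(2) by simp
      qed
      then show ?thesis by linarith
    qed
    have 2: "\<bar>x i\<bar> < 1" if h: "\<forall>i<L + M. -1 < x i \<and> x i < 1" "i < L" for i
    proof -
      have "-1 < x i \<and> x i < 1" using h by (meson trans_less_add1)
      then show ?thesis by linarith
    qed
    show ?thesis using 1 2 by iprover
  qed
  have o: "(x, y) \<in> space (param_lebesgue L M)" "strict_mono_on {..<L} x" "strict_mono_on {L..<L+M} x" "\<forall>p\<in>{L..<L+M}. y p > 0"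
    using assms unfolding v ordered_params_def mem_Collect_eq prod.case by (iprover+)
  have "v \<in> param_domain L M \<longleftrightarrow> (\<forall>i<L + M. -1 < x i \<and> x i < 1) \<and> (\<forall>p\<in>{L..<L + M}. cmod (Complex (x p) (y p)) < 1)"
    unfolding v param_domain_def mem_Collect_eq prod.case ball_conj_distrib using o by iprover
  then show ?thesis unfolding eq using q by iprover
qed

lemma param_domain_subset: "param_domain L M \<subseteq> ordered_params L M"
  by (auto simp: param_domain_def ordered_params_def)

lemma D_domain_cases:
  assumes "z \<in> D_domain n"
  obtains L M v where "L + 2 * M = n" "v \<in> param_domain L M" "z = param_tuple L M v"
  using assms by (auto simp: D_domain_def D_component_def)

lemma
  assumes "z \<in> D_domain n"
  shows root_tuple_root_coeffs_D: "root_tuple n (root_coeffs n z) = z"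
    and monic_poly_root_coeffs_D: "monic_poly n (root_coeffs n z) = (\<Prod>j<n. [:- z j, 1:])"
    and D_domain_unit_disc: "i < n \<Longrightarrow> cmod (z i) < 1"
    and joint_density_D: "joint_density \<beta> a b n z = of_real (root_weight \<beta> a b n z * vandermonde n z)"
proof -
  from assms obtain L M v where n: "L + 2 * M = n" and v: "v \<in> param_domain L M" and z: "z = param_tuple L M v"
    by (rule D_domain_cases)
  obtain x y where xy: "v = (x, y)" by (cases v)
  have o: "v \<in> ordered_params L M" using v param_domain_subset by blast
  show "root_tuple n (root_coeffs n z) = z"
    using root_tuple_root_coeffs[of x y L M] o unfolding z xy n[symmetric] by blast
  show "monic_poly n (root_coeffs n z) = (\<Prod>j<n. [:- z j, 1:])"
    unfolding z xy n[symmetric] by (rule monic_poly_root_coeffs_param)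
  have unit: "cmod (z i) < 1" if "i < n" for i
    using v param_domain_iff[OF o] that unfolding z n[symmetric] by blast
  then show "i < n \<Longrightarrow> cmod (z i) < 1" .
  show "joint_density \<beta> a b n z = of_real (root_weight \<beta> a b n z * vandermonde n z)"
    by (rule joint_density_on_D[OF v n[symmetric] unit z])
qed

lemma image_sets_retraction:
  assumes g: "g \<in> N \<rightarrow>\<^sub>M T" and h: "h \<in> T \<rightarrow>\<^sub>M N" and inv: "\<And>v. v \<in> space N \<Longrightarrow> h (g v) = v"
    and X: "X \<in> sets N" and fixed: "{z \<in> space T. g (h z) = z} \<in> sets T"
  shows "g ` X \<in> sets T"
proof -
  have "X \<subseteq> space N" by (rule sets.sets_into_space[OF X])
  then have "g ` X = (h -` X \<inter> space T) \<inter> {z \<in> space T. g (h z) = z}"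
    using measurable_space[OF g] inv by (force simp: image_iff)
  then show ?thesis using sets.Int[OF measurable_sets[OF h X] fixed] by simp
qed

lemma D_domain_sets: "D_domain n \<in> sets (tuple_space n)"
proof -
  have "D_component L M \<in> sets (tuple_space (L + 2 * M))" for L M
  proof -
    let ?n = "L + 2 * M" and ?N = "param_lebesgue L M"
    define proj where "proj z = (\<lambda>i\<in>{..<L + M}. if i < L then Re (z i) else Re (z (L + 2 * (i - L))),
      \<lambda>p\<in>{L..<L + M}. Im (z (L + 2 * (p - L))))" for z :: "nat \<Rightarrow> complex"
    have c: "(\<lambda>z. z i) \<in> borel_measurable (tuple_space ?n)" if "i < ?n" for i
      using measurable_component_singleton[of i "{..<?n}" "\<lambda>_. borel"] that by simp
    have re: "(\<lambda>z. Re (z i)) \<in> borel_measurable (tuple_space ?n)" and im: "(\<lambda>z. Im (z i)) \<in> borel_measurable (tuple_space ?n)"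
      if "i < ?n" for i
      using measurable_compose[OF c[OF that] borel_measurable_Re] measurable_compose[OF c[OF that] borel_measurable_Im] .
    have proj: "proj \<in> tuple_space ?n \<rightarrow>\<^sub>M ?N"
      unfolding proj_def
    proof (rule measurable_Pair)
      show "(\<lambda>z. \<lambda>i\<in>{..<L + M}. if i < L then Re (z i) else Re (z (L + 2 * (i - L)))) \<in> tuple_space ?n \<rightarrow>\<^sub>M Pi\<^sub>M {..<L + M} (\<lambda>_. lborel)"
      proof (rule measurable_restrict)
        fix i assume "i \<in> {..<L + M}"
        then show "(\<lambda>z. if i < L then Re (z i) else Re (z (L + 2 * (i - L)))) \<in> tuple_space ?n \<rightarrow>\<^sub>M lborel"
          using re[of i] re[of "L + 2 * (i - L)"] by (cases "i < L") auto
      qed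
      show "(\<lambda>z. \<lambda>p\<in>{L..<L + M}. Im (z (L + 2 * (p - L)))) \<in> tuple_space ?n \<rightarrow>\<^sub>M Pi\<^sub>M {L..<L + M} (\<lambda>_. lborel)"
      proof (rule measurable_restrict)
        fix p assume "p \<in> {L..<L + M}"
        then have "L + 2 * (p - L) < ?n" by auto
        then show "(\<lambda>z. Im (z (L + 2 * (p - L)))) \<in> tuple_space ?n \<rightarrow>\<^sub>M lborel"
          using im[of "L + 2 * (p - L)"] by simp
      qed
    qed
    have inv: "proj (param_tuple L M v) = v" if "v \<in> space ?N" for v
    proof -
      obtain x y where xy: "v = (x, y)" by (cases v)
      have u: "i \<ge> L + M \<Longrightarrow> x i = undefined" "i \<notin> {L..<L + M} \<Longrightarrow> y i = undefined" for i
        using that by (auto simp: xy space_pair_measure space_PiM PiE_def extensional_def)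
      show ?thesis
      proof (unfold xy proj_def, intro prod_eqI ext)
        fix i
        show "fst (\<lambda>i\<in>{..<L + M}. if i < L then Re (param_tuple L M (x, y) i) else Re (param_tuple L M (x, y) (L + 2 * (i - L))),
            \<lambda>p\<in>{L..<L + M}. Im (param_tuple L M (x, y) (L + 2 * (p - L)))) i = fst (x, y) i"
          using u(1)[of i] by (auto simp: param_tuple_def Let_def)
        show "snd (\<lambda>i\<in>{..<L + M}. if i < L then Re (param_tuple L M (x, y) i) else Re (param_tuple L M (x, y) (L + 2 * (i - L))),
            \<lambda>p\<in>{L..<L + M}. Im (param_tuple L M (x, y) (L + 2 * (p - L)))) i = snd (x, y) i"
          using u(2)[of i] by (auto simp: param_tuple_def Let_def)
      qed
    qed
    have undef: "z i = undefined" if "z \<in> space (tuple_space ?n)" "\<not> i < ?n" for z i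
      using that by (auto simp: space_PiM PiE_def extensional_def)
    have cmp: "(\<lambda>z. param_tuple L M (proj z) i) \<in> borel_measurable (tuple_space ?n)" if "i < ?n" for i
      using measurable_compose[OF measurable_compose[OF proj param_tuple_measurable] c[OF that]] .
    have fixed: "param_tuple L M (proj z) = z \<longleftrightarrow> (\<forall>i\<in>{..<?n}. param_tuple L M (proj z) i = z i)" if z: "z \<in> space (tuple_space ?n)" for z
    proof
      assume h: "\<forall>i\<in>{..<?n}. param_tuple L M (proj z) i = z i"
      show "param_tuple L M (proj z) = z"
      proof
        fix i show "param_tuple L M (proj z) i = z i"
        proof (cases "i < ?n")
          case True
          then show ?thesis using h by simp
        next
          case False
          then show ?thesis using undef[OF z False] param_tuple_undefined[of L M i "proj z"] by simp
        qed
      qed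
    qed simp
    have e: "{z \<in> space (tuple_space ?n). param_tuple L M (proj z) i = z i} \<in> sets (tuple_space ?n)" if "i \<in> {..<?n}" for i
    proof -
      have i: "i < ?n" using that by simp
      have "(\<lambda>z. param_tuple L M (proj z) i - z i) -` {0} \<inter> space (tuple_space ?n) \<in> sets (tuple_space ?n)"
        by (rule measurable_sets[OF borel_measurable_diff[OF cmp[OF i] c[OF i]]]) simp
      then show ?thesis by (rule back_subst[where P = "\<lambda>X. X \<in> sets (tuple_space ?n)"]) auto
    qed
    have "{z \<in> space (tuple_space ?n). \<forall>i\<in>{..<?n}. param_tuple L M (proj z) i = z i} \<in> sets (tuple_space ?n)"
      by (rule sets.sets_Collect_finite_All[OF e]) (assumption, rule finite_lessThan)
    moreover have "{z \<in> space (tuple_space ?n). \<forall>i\<in>{..<?n}. param_tuple L M (proj z) i = z i}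
        = {z \<in> space (tuple_space ?n). param_tuple L M (proj z) = z}"
      by (rule Collect_cong) (use fixed in blast)
    ultimately show ?thesis
      unfolding D_component_def using image_sets_retraction[where g = "param_tuple L M" and h = proj, OF param_tuple_measurable proj _ param_domain_sets] inv by simp
  qed
  then have "D_component (fst p) (snd p) \<in> sets (tuple_space n)" if "p \<in> root_types n" for p using that by auto
  then have "(\<Union>p\<in>root_types n. D_component (fst p) (snd p)) \<in> sets (tuple_space n)"
    by (rule sets.finite_UN[OF finite_root_types])
  then show ?thesis unfolding D_domain_def by (simp only: case_prod_unfold)
qed

lemma nn_integral_wedge_measure:
  assumes "f \<in> borel_measurable (tuple_space n)"
  shows "(\<integral>\<^sup>+z. f z \<partial>wedge_measure n) = (\<Sum>(L, M)\<in>root_types n.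
    2 ^ M * (\<integral>\<^sup>+v. f (param_tuple L M v) * indicator (param_domain L M) v \<partial>param_lebesgue L M))"
proof -
  define J where "J f p = (\<integral>\<^sup>+v. f (param_tuple (fst p) (snd p) v) * indicator (param_domain (fst p) (snd p)) v
    \<partial>param_lebesgue (fst p) (snd p))" for f :: "(nat \<Rightarrow> complex) \<Rightarrow> ennreal" and p
  have mw: "f \<in> borel_measurable (wedge_measure n) \<longleftrightarrow> f \<in> borel_measurable (tuple_space n)" for f :: "_ \<Rightarrow> ennreal"
    by (simp only: measurable_cong_sets[OF sets_wedge_measure refl])
  have m: "(\<lambda>v. f (param_tuple L M v) * indicator (param_domain L M) v) \<in> borel_measurable (param_lebesgue L M)"
    if "f \<in> borel_measurable (tuple_space n)" "L + 2 * M = n" for f :: "_ \<Rightarrow> ennreal" and L M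
    using borel_measurable_times_ennreal[OF measurable_compose[OF param_tuple_measurable[of L M], of f borel]
        borel_measurable_indicator[OF param_domain_sets[of L M]]] that by blast
  have J_cong: "J f p = J g p" if "\<And>z. z \<in> space (tuple_space n) \<Longrightarrow> f z = g z" "p \<in> root_types n" for f g p
    unfolding J_def
  proof (rule nn_integral_cong)
    fix v assume "v \<in> space (param_lebesgue (fst p) (snd p))"
    then have "param_tuple (fst p) (snd p) v \<in> space (tuple_space (fst p + 2 * snd p))"
      by (rule measurable_space[OF param_tuple_measurable])
    moreover have "fst p + 2 * snd p = n" using that(2) by (simp add: split_beta)
    ultimately have "param_tuple (fst p) (snd p) v \<in> space (tuple_space n)" by (simp only:)
    then show "f (param_tuple (fst p) (snd p) v) * indicator (param_domain (fst p) (snd p)) v =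
        g (param_tuple (fst p) (snd p) v) * indicator (param_domain (fst p) (snd p)) v"
      by (simp only: that(1))
  qed
  have J_indicator: "J (indicator A) p = emeasure (param_lebesgue (fst p) (snd p)) {v \<in> param_domain (fst p) (snd p). param_tuple (fst p) (snd p) v \<in> A}"
    if A: "A \<in> sets (tuple_space n)" and p: "p \<in> root_types n" for A p
  proof -
    obtain L M where LM: "p = (L, M)" "L + 2 * M = n" using p by blast
    have dom: "param_domain L M \<subseteq> space (param_lebesgue L M)" by (rule sets.sets_into_space[OF param_domain_sets])
    have "param_tuple L M -` A \<inter> space (param_lebesgue L M) \<in> sets (param_lebesgue L M)"
      by (rule measurable_sets[OF param_tuple_measurable]) (use A LM in simp)
    from sets.Int[OF this param_domain_sets]
    have X: "{v \<in> param_domain L M. param_tuple L M v \<in> A} \<in> sets (param_lebesgue L M)"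
      by (rule back_subst[where P = "\<lambda>X. X \<in> sets (param_lebesgue L M)"]) (use dom in blast)
    have "(indicator A (param_tuple L M v) * indicator (param_domain L M) v :: ennreal)
        = indicator {v \<in> param_domain L M. param_tuple L M v \<in> A} v" for v by (auto simp: indicator_def)
    then show ?thesis using X unfolding J_def LM fst_conv snd_conv by (simp only: nn_integral_indicator)
  qed
  have J_mult: "J (\<lambda>z. c * u z) p = c * J u p" if "u \<in> borel_measurable (tuple_space n)" "p \<in> root_types n" for u c p
    unfolding J_def mult.assoc by (rule nn_integral_cmult[OF m[OF that(1)]]) (use that(2) in auto)
  have J_add: "J (\<lambda>z. w z + u z) p = J w p + J u p"
    if "u \<in> borel_measurable (tuple_space n)" "w \<in> borel_measurable (tuple_space n)" "p \<in> root_types n" for u w p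
    unfolding J_def distrib_right by (rule nn_integral_add[OF m[OF that(2)] m[OF that(1)]]) (use that(3) in auto)
  have J_mono: "J u p \<le> J w p" if "u \<le> w" for u w p
    unfolding J_def using that by (intro nn_integral_mono mult_right_mono) (auto simp: le_fun_def)
  have J_SUP: "J (SUP i. U i) p = (SUP i. J (U i) p)"
    if U: "\<And>i. U i \<in> borel_measurable (tuple_space n)" "incseq U" and p: "p \<in> root_types n" for U :: "nat \<Rightarrow> _" and p
  proof -
    have "J (SUP i. U i) p = (\<integral>\<^sup>+v. (SUP i. U i (param_tuple (fst p) (snd p) v) * indicator (param_domain (fst p) (snd p)) v)
        \<partial>param_lebesgue (fst p) (snd p))"
      unfolding J_def SUP_apply by (intro nn_integral_cong SUP_mult_right_ennreal)
    also have "\<dots> = (SUP i. J (U i) p)"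
      unfolding J_def
    proof (rule nn_integral_monotone_convergence_SUP)
      show "incseq (\<lambda>i v. U i (param_tuple (fst p) (snd p) v) * indicator (param_domain (fst p) (snd p)) v)"
        using U(2) by (auto simp: incseq_def le_fun_def intro!: mult_right_mono)
      show "(\<lambda>v. U i (param_tuple (fst p) (snd p) v) * indicator (param_domain (fst p) (snd p)) v)
          \<in> borel_measurable (param_lebesgue (fst p) (snd p))" for i
        by (rule m[OF U(1)]) (use p in auto)
    qed
    finally show ?thesis .
  qed
  have "(\<integral>\<^sup>+z. f z \<partial>wedge_measure n) = (\<Sum>p\<in>root_types n. 2 ^ snd p * J f p)"
    using assms
  proof (induction rule: borel_measurable_induct)
    case (cong f g)
    have "(\<integral>\<^sup>+z. f z \<partial>wedge_measure n) = (\<integral>\<^sup>+z. g z \<partial>wedge_measure n)"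
      by (rule nn_integral_cong) (simp only: space_wedge_measure cong(3))
    then show ?case unfolding cong(4)
      by (auto intro!: sum.cong arg_cong2[where f = "(*)"] J_cong[symmetric] cong(3) simp del: mem_Collect_eq)
  next
    case (set A)
    then have "(\<integral>\<^sup>+z. indicator A z \<partial>wedge_measure n) = emeasure (wedge_measure n) A"
      by (intro nn_integral_indicator) (simp only: sets_wedge_measure)
    also have "\<dots> = (\<Sum>p\<in>root_types n. 2 ^ snd p * J (indicator A) p)"
      unfolding emeasure_wedge_measure[OF set]
    proof (rule sum.cong[OF refl])
      fix p assume p: "p \<in> root_types n"
      show "(case p of (L, M) \<Rightarrow> 2 ^ M * emeasure (param_lebesgue L M) {v \<in> param_domain L M. param_tuple L M v \<in> A})
          = 2 ^ snd p * J (indicator A) p"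
        unfolding J_indicator[OF set p] by (simp only: split_beta)
    qed
    finally show ?case .
  next
    case (mult u c)
    have "(\<integral>\<^sup>+z. c * u z \<partial>wedge_measure n) = c * (\<Sum>p\<in>root_types n. 2 ^ snd p * J u p)"
      using mult(2) unfolding mult(4)[symmetric] by (intro nn_integral_cmult) (simp only: mw)
    also have "\<dots> = (\<Sum>p\<in>root_types n. 2 ^ snd p * J (\<lambda>z. c * u z) p)"
      unfolding sum_distrib_left by (intro sum.cong refl) (simp only: J_mult[OF mult(2)] mult_ac)
    finally show ?case .
  next
    case (add u w)
    have "(\<integral>\<^sup>+z. w z + u z \<partial>wedge_measure n) = (\<integral>\<^sup>+z. w z \<partial>wedge_measure n) + (\<integral>\<^sup>+z. u z \<partial>wedge_measure n)"
      by (rule nn_integral_add) (simp_all only: mw add)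
    also have "\<dots> = (\<Sum>p\<in>root_types n. 2 ^ snd p * J (\<lambda>z. w z + u z) p)"
      unfolding add.IH sum.distrib[symmetric] by (intro sum.cong refl) (simp only: J_add[OF add(1,3)] distrib_left)
    finally show ?case .
  next
    case (seq U)
    have "(\<integral>\<^sup>+z. (SUP i. U i) z \<partial>wedge_measure n) = (SUP i. \<integral>\<^sup>+z. U i z \<partial>wedge_measure n)"
      unfolding SUP_apply by (rule nn_integral_monotone_convergence_SUP) (simp_all only: mw seq)
    also have "\<dots> = (\<Sum>p\<in>root_types n. SUP i. 2 ^ snd p * J (U i) p)"
      unfolding seq.IH
    proof (rule ennreal_SUP_sum)
      show "incseq (\<lambda>i. 2 ^ snd p * J (U i) p)" for p
        using seq(3) by (intro monoI mult_left_mono J_mono) (auto simp: incseq_def)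
    qed
    also have "\<dots> = (\<Sum>p\<in>root_types n. 2 ^ snd p * J (SUP i. U i) p)"
      by (intro sum.cong refl) (simp only: J_SUP[OF seq(1,3)] SUP_mult_left_ennreal)
    finally show ?case .
  qed
  then show ?thesis unfolding J_def by (simp only: case_prod_unfold)
qed

(* @@@ H *)

lemma nn_integral_wedge_measure_cong:
  assumes "f \<in> borel_measurable (tuple_space n)" "g \<in> borel_measurable (tuple_space n)"
    and "\<And>z. z \<in> D_domain n \<Longrightarrow> f z = g z"
  shows "(\<integral>\<^sup>+z. f z \<partial>wedge_measure n) = (\<integral>\<^sup>+z. g z \<partial>wedge_measure n)"
  unfolding nn_integral_wedge_measure[OF assms(1)] nn_integral_wedge_measure[OF assms(2)]
proof (rule sum.cong[OF refl], clarify)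
  fix L M assume n: "n = L + 2 * M"
  have "f (param_tuple L M v) * indicator (param_domain L M) v = g (param_tuple L M v) * indicator (param_domain L M) v" for v
  proof (cases "v \<in> param_domain L M")
    case True
    then have "param_tuple L M v \<in> D_domain n" unfolding D_domain_def D_component_def n by blast
    then show ?thesis by (simp only: assms(3))
  qed simp
  then show "2 ^ M * (\<integral>\<^sup>+v. f (param_tuple L M v) * indicator (param_domain L M) v \<partial>param_lebesgue L M) =
      2 ^ M * (\<integral>\<^sup>+v. g (param_tuple L M v) * indicator (param_domain L M) v \<partial>param_lebesgue L M)"
    by (simp only:)
qed

theorem nn_integral_szego_coeffs_wedge:
  assumes G: "G \<in> borel_measurable (leb {..<n})"
  shows "(\<integral>\<^sup>+\<alpha>. G (szego_coeffs n \<alpha>) * ennreal (\<Prod>k<n. shear_jacobian k (\<alpha> k))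
            * indicator {\<alpha>. \<forall>k<n. \<bar>\<alpha> k\<bar> < 1} \<alpha> \<partial>leb {..<n})
       = (\<integral>\<^sup>+z. G (root_coeffs n z) * ennreal (vandermonde n z) \<partial>wedge_measure n)"
proof -
  let ?F = "\<lambda>a. G a * indicator {a. schur_stable n a} a"
  have stable: "{a \<in> space (leb {..<n}). schur_stable n a} \<in> sets (leb {..<n})"
    using measurable_schur_stable[of n] unfolding pred_def .
  have "(\<lambda>a. G a * indicator {a \<in> space (leb {..<n}). schur_stable n a} a) \<in> borel_measurable (leb {..<n})"
    by (rule borel_measurable_times_ennreal[OF G borel_measurable_indicator[OF stable]])
  then have F: "?F \<in> borel_measurable (leb {..<n})"
    by (rule measurable_cong[THEN iffD1, rotated]) (simp add: indicator_def)
  have GV: "(\<lambda>z. G (root_coeffs n z) * ennreal (vandermonde n z)) \<in> borel_measurable (tuple_space n)"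
    using borel_measurable_times_ennreal[OF measurable_compose[OF measurable_root_coeffs G]
        measurable_compose[OF measurable_vandermonde measurable_ennreal]] .
  have "root_integral L M ?F = (\<integral>\<^sup>+v. G (root_coeffs n (param_tuple L M v)) * ennreal (vandermonde n (param_tuple L M v))
      * indicator (param_domain L M) v \<partial>param_lebesgue L M)" if n: "L + 2 * M = n" for L M
    unfolding root_integral_def n
  proof (rule nn_integral_cong)
    fix v
    show "?F (root_coeffs n (param_tuple L M v)) * ennreal (vandermonde n (param_tuple L M v)) * indicator (ordered_params L M) v
      = G (root_coeffs n (param_tuple L M v)) * ennreal (vandermonde n (param_tuple L M v)) * indicator (param_domain L M) v"
    proof (cases "v \<in> ordered_params L M")
      case False
      then show ?thesis using param_domain_subset[of L M] by (auto simp: indicator_def)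
    next
      case True
      obtain x y where v: "v = (x, y)" by (cases v)
      have "schur_stable n (root_coeffs n (param_tuple L M v)) \<longleftrightarrow> (\<forall>i<n. cmod (param_tuple L M v i) < 1)"
        unfolding schur_stable_def monic_eval_factorization[OF monic_poly_root_coeffs_param[of L M x y], folded v, unfolded n]
        by auto
      also have "\<dots> \<longleftrightarrow> v \<in> param_domain L M" using param_domain_iff[OF True] unfolding n by blast
      finally show ?thesis using True by (cases "v \<in> param_domain L M") (simp_all add: indicator_def)
    qed
  qed
  then show ?thesis
    unfolding nn_integral_szego_coeffs[OF G] nn_integral_coeffs_eq_roots[OF F] nn_integral_wedge_measure[OF GV]
    by (intro sum.cong refl) (auto simp only: split_beta mem_Collect_eq)
qed

definition sortable :: "nat \<Rightarrow> (nat \<Rightarrow> real) \<Rightarrow> bool" where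
  "sortable n a \<longleftrightarrow> root_tuple n a \<in> D_domain n \<and> root_coeffs n (root_tuple n a) = a"

lemma measurable_sortable: "{a \<in> space (leb {..<n}). sortable n a} \<in> sets (leb {..<n})"
proof -
  have D: "{a \<in> space (leb {..<n}). root_tuple n a \<in> D_domain n} \<in> sets (leb {..<n})"
    using measurable_sets[OF measurable_root_tuple D_domain_sets[of n]] unfolding vimage_def
    by (rule back_subst[where P = "\<lambda>X. X \<in> sets (leb {..<n})"]) auto
  have c: "(\<lambda>a. root_coeffs n (root_tuple n a) i) \<in> borel_measurable (leb {..<n})" if "i \<in> {..<n}" for i
    using measurable_compose[OF measurable_compose[OF measurable_root_tuple measurable_root_coeffs] component_measurable_leb[OF that]] .
  have "{a \<in> space (leb {..<n}). root_coeffs n (root_tuple n a) i = a i} \<in> sets (leb {..<n})" if "i \<in> {..<n}" for i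
    by (rule borel_measurable_eq[OF c[OF that] component_measurable_leb[OF that]])
  then have "{a \<in> space (leb {..<n}). \<forall>i\<in>{..<n}. root_coeffs n (root_tuple n a) i = a i} \<in> sets (leb {..<n})"
    by (rule sets.sets_Collect_finite_All) (assumption, rule finite_lessThan)
  moreover have "(\<forall>i\<in>{..<n}. root_coeffs n (root_tuple n a) i = a i) \<longleftrightarrow> root_coeffs n (root_tuple n a) = a"
    if "a \<in> space (leb {..<n})" for a
  proof
    assume h: "\<forall>i\<in>{..<n}. root_coeffs n (root_tuple n a) i = a i"
    show "root_coeffs n (root_tuple n a) = a"
    proof
      fix i show "root_coeffs n (root_tuple n a) i = a i"
        using h space_leb_undefined[OF that, of i] root_coeffs_undefined[of n i] by (cases "i < n") auto
    qed
  qed simp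
  then have "{a \<in> space (leb {..<n}). sortable n a} = {a \<in> space (leb {..<n}). root_tuple n a \<in> D_domain n} \<inter>
      {a \<in> space (leb {..<n}). \<forall>i\<in>{..<n}. root_coeffs n (root_tuple n a) i = a i}"
    unfolding sortable_def by blast
  ultimately show ?thesis using D by (simp only: sets.Int)
qed

lemma sortable_root_coeffs: "z \<in> D_domain n \<Longrightarrow> sortable n (root_coeffs n z)"
  unfolding sortable_def by (simp add: root_tuple_root_coeffs_D)

lemma
  assumes p: "char_poly A = monic_poly n a" and a: "\<And>i. i \<ge> n \<Longrightarrow> a i = undefined"
  shows eigenvalue_tuple_sortable: "eigenvalue_tuple n A = (if sortable n a then root_tuple n a else (\<lambda>i\<in>{..<n}. 0))"
    and lists_eigenvalues_sortable: "sortable n a \<Longrightarrow> lists_eigenvalues n A (root_tuple n a)"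
proof -
  have uniq: "z = root_tuple n a \<and> sortable n a" if "z \<in> D_domain n" "lists_eigenvalues n A z" for z
  proof -
    have "root_coeffs n z = a"
      using that(2) unfolding lists_eigenvalues_def p by (rule root_coeffs_eqI) (rule a)
    then show ?thesis using root_tuple_root_coeffs_D[OF that(1)] sortable_root_coeffs[OF that(1)] by simp
  qed
  show ls: "sortable n a \<Longrightarrow> lists_eigenvalues n A (root_tuple n a)"
    using monic_poly_root_coeffs_D[of "root_tuple n a" n] unfolding lists_eigenvalues_def p sortable_def by simp
  show "eigenvalue_tuple n A = (if sortable n a then root_tuple n a else (\<lambda>i\<in>{..<n}. 0))"
  proof (cases "sortable n a")
    case True
    then have "root_tuple n a \<in> D_domain n \<and> lists_eigenvalues n A (root_tuple n a)" using ls by (simp add: sortable_def)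
    then show ?thesis unfolding eigenvalue_tuple_def using True uniq
      by (auto intro!: the_equality)
  next
    case False
    then show ?thesis unfolding eigenvalue_tuple_def using uniq by auto
  qed
qed

definition cmv_eigenvalues :: "nat \<Rightarrow> (nat \<Rightarrow> real) \<Rightarrow> nat \<Rightarrow> complex" where
  "cmv_eigenvalues n \<alpha> = eigenvalue_tuple n (cmv n (\<lambda>k. complex_of_real (\<alpha> k)))"

lemma cmv_cong:
  assumes "\<And>k. k < n \<Longrightarrow> \<alpha> k = \<alpha>' k"
  shows "cmv n \<alpha> = cmv n \<alpha>'"
proof -
  have "cmv_block n \<alpha> k = cmv_block n \<alpha>' k" if "k < n" for k
    unfolding cmv_block_def assms[OF that] ..
  then have "map (cmv_block n \<alpha>) (filter P [0..<n]) = map (cmv_block n \<alpha>') (filter P [0..<n])" for P by simp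
  then show ?thesis unfolding cmv_def cmv_L_def cmv_M_def by (simp only:)
qed

lemma measurable_cmv_eigenvalues:
  assumes n: "n \<ge> 1"
  shows "cmv_eigenvalues n \<in> leb {..<n} \<rightarrow>\<^sub>M tuple_space n"
proof -
  have e: "cmv_eigenvalues n = (\<lambda>\<alpha>. if sortable n (cmv_coeffs n \<alpha>) then root_tuple n (cmv_coeffs n \<alpha>) else (\<lambda>i\<in>{..<n}. 0))"
  proof
    fix \<alpha>
    show "cmv_eigenvalues n \<alpha> = (if sortable n (cmv_coeffs n \<alpha>) then root_tuple n (cmv_coeffs n \<alpha>) else (\<lambda>i\<in>{..<n}. 0))"
      unfolding cmv_eigenvalues_def by (rule eigenvalue_tuple_sortable[OF char_poly_cmv_coeffs[OF n]]) (simp add: cmv_coeffs_def)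
  qed
  have s: "{\<alpha> \<in> space (leb {..<n}). sortable n (cmv_coeffs n \<alpha>)} \<in> sets (leb {..<n})"
    by (rule measurable_sets_Collect[OF measurable_cmv_coeffs[OF n] measurable_sortable])
  show ?thesis unfolding e
    by (rule measurable_If[OF measurable_compose[OF measurable_cmv_coeffs[OF n] measurable_root_tuple] _ s])
      (simp add: space_PiM)
qed

lemma
  assumes n: "n \<ge> 1" and al: "\<And>k. k < n \<Longrightarrow> \<bar>\<alpha> k\<bar> < 1" and s: "sortable n (szego_coeffs n \<alpha>)"
  shows cmv_eigenvalues_sortable: "cmv_eigenvalues n \<alpha> = root_tuple n (szego_coeffs n \<alpha>)"
    and cmv_eigenvalues_in_D: "cmv_eigenvalues n \<alpha> \<in> D_domain n"
    and lists_cmv_eigenvalues: "lists_eigenvalues n (cmv n (\<lambda>k. complex_of_real (\<alpha> k))) (cmv_eigenvalues n \<alpha>)"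
proof -
  have u: "szego_coeffs m \<alpha> i = undefined" if "i \<ge> m" for m i
    using that by (induction m) (simp_all add: szego_step_def)
  have p: "char_poly (cmv n (\<lambda>k. complex_of_real (\<alpha> k))) = monic_poly n (szego_coeffs n \<alpha>)"
    by (rule char_poly_cmv[OF n al])
  show e: "cmv_eigenvalues n \<alpha> = root_tuple n (szego_coeffs n \<alpha>)"
    unfolding cmv_eigenvalues_def using eigenvalue_tuple_sortable[OF p u] s by simp
  show "cmv_eigenvalues n \<alpha> \<in> D_domain n" using s unfolding e sortable_def by blast
  show "lists_eigenvalues n (cmv n (\<lambda>k. complex_of_real (\<alpha> k))) (cmv_eigenvalues n \<alpha>)"
    unfolding e by (rule lists_eigenvalues_sortable[OF p u s])
qed


lemma PiM_density:
  fixes f :: "nat \<Rightarrow> real \<Rightarrow> ennreal"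
  assumes I: "finite I" and f: "\<And>i. i \<in> I \<Longrightarrow> f i \<in> borel_measurable borel" and fin: "\<And>i. i \<in> I \<Longrightarrow> (\<integral>\<^sup>+x. f i x \<partial>lborel) = 1"
  shows "Pi\<^sub>M I (\<lambda>i. density lborel (f i)) = density (leb I) (\<lambda>x. \<Prod>i\<in>I. f i (x i))"
proof -
  define D where "D i = (if i \<in> I then density lborel (f i) else lborel)" for i
  have sD: "sets (D i) = sets lborel" for i by (simp add: D_def)
  have "sigma_finite_measure (D i)" for i
  proof (cases "i \<in> I")
    case True
    have "emeasure (density lborel (f i)) (space (density lborel (f i))) = 1"
      using fin[OF True] f[OF True] by (simp add: emeasure_density)
    then have "prob_space (density lborel (f i))" by (rule prob_spaceI)
    then show ?thesis using True by (simp add: D_def prob_space_imp_sigma_finite)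
  qed (simp add: D_def sigma_finite_lborel)
  then interpret D: product_sigma_finite D unfolding product_sigma_finite_def by blast
  have fm: "(\<lambda>x. f i (x i)) \<in> borel_measurable (leb I)" if "i \<in> I" for i
    using measurable_compose[OF component_measurable_leb[OF that] f[OF that]] .
  have prod: "(\<lambda>x. \<Prod>i\<in>I. f i (x i)) \<in> borel_measurable (leb I)"
    by (rule borel_measurable_prod_ennreal) (rule fm)
  have "density (leb I) (\<lambda>x. \<Prod>i\<in>I. f i (x i)) = Pi\<^sub>M I D"
  proof (rule D.PiM_eqI[OF I])
    show "sets (density (leb I) (\<lambda>x. \<Prod>i\<in>I. f i (x i))) = sets (Pi\<^sub>M I D)"
      unfolding sets_density by (rule sets_PiM_cong) (simp_all add: sD)
    fix A assume A: "\<And>i. i \<in> I \<Longrightarrow> A i \<in> sets (D i)"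
    then have A': "A i \<in> sets lborel" if "i \<in> I" for i using that by (simp add: sD)
    have box: "Pi\<^sub>E I A \<in> sets (leb I)" using A' I by (intro sets_PiM_I_finite) auto
    have ind: "indicator (Pi\<^sub>E I A) x = (\<Prod>i\<in>I. indicator (A i) (x i) :: ennreal)" if "x \<in> space (leb I)" for x
    proof (cases "x \<in> Pi\<^sub>E I A")
      case True
      then have "x i \<in> A i" if "i \<in> I" for i using that by (rule PiE_mem)
      then have "(\<Prod>i\<in>I. indicator (A i) (x i) :: ennreal) = 1" by (intro prod.neutral ballI) simp
      then show ?thesis using True by simp
    next
      case False
      have "x \<in> extensional I" using that by (simp add: space_PiM PiE_def)
      then obtain i where i: "i \<in> I" "x i \<notin> A i" using False by (auto simp: PiE_def)
      then have "(\<Prod>i\<in>I. indicator (A i) (x i) :: ennreal) = 0" using I by (intro prod_zero bexI[of _ i]) simp_all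
      then show ?thesis using False by simp
    qed
    have "emeasure (density (leb I) (\<lambda>x. \<Prod>i\<in>I. f i (x i))) (Pi\<^sub>E I A) = (\<integral>\<^sup>+x. (\<Prod>i\<in>I. f i (x i)) * indicator (Pi\<^sub>E I A) x \<partial>leb I)"
      by (rule emeasure_density[OF prod box])
    also have "\<dots> = (\<integral>\<^sup>+x. (\<Prod>i\<in>I. f i (x i) * indicator (A i) (x i)) \<partial>leb I)"
      by (rule nn_integral_cong) (simp only: ind prod.distrib)
    also have "\<dots> = (\<Prod>i\<in>I. \<integral>\<^sup>+x. f i x * indicator (A i) x \<partial>lborel)"
      using I f A' by (intro lebesgue_product.product_nn_integral_prod) auto
    also have "\<dots> = (\<Prod>i\<in>I. emeasure (D i) (A i))"
      using f A' by (intro prod.cong refl) (simp add: D_def emeasure_density)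
    finally show "emeasure (density (leb I) (\<lambda>x. \<Prod>i\<in>I. f i (x i))) (Pi\<^sub>E I A) = (\<Prod>i\<in>I. emeasure (D i) (A i))" .
  qed
  also have "Pi\<^sub>M I D = Pi\<^sub>M I (\<lambda>i. density lborel (f i))"
    by (rule PiM_cong) (simp_all add: D_def)
  finally show ?thesis ..
qed

lemma (in prob_space) distr_indep_densities:
  fixes X :: "nat \<Rightarrow> 'a \<Rightarrow> real"
  assumes I: "finite I" "I \<noteq> {}" and ind: "indep_vars (\<lambda>_. borel) X I"
    and d: "\<And>i. i \<in> I \<Longrightarrow> distributed M lborel (X i) (f i)"
  shows "distr M (leb I) (\<lambda>\<omega>. \<lambda>i\<in>I. X i \<omega>) = density (leb I) (\<lambda>x. \<Prod>i\<in>I. f i (x i))"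
proof -
  have f: "f i \<in> borel_measurable borel" and law: "distr M lborel (X i) = density lborel (f i)"
    and X: "X i \<in> borel_measurable M" if "i \<in> I" for i
    using d[OF that] by (simp_all add: distributed_def)
  have one: "(\<integral>\<^sup>+x. f i x \<partial>lborel) = 1" if "i \<in> I" for i
  proof -
    have "emeasure (distr M lborel (X i)) (space lborel) = 1"
      using X[OF that] emeasure_space_1 by (simp add: emeasure_distr)
    then show ?thesis unfolding law[OF that] using f[OF that] by (simp add: emeasure_density)
  qed
  have "distr M (Pi\<^sub>M I (\<lambda>_. borel)) (\<lambda>\<omega>. \<lambda>i\<in>I. X i \<omega>) = Pi\<^sub>M I (\<lambda>i. distr M borel (X i))"
    using indep_vars_iff_distr_eq_PiM'[OF I(2), where M' = "\<lambda>_. borel" and X = X] ind X by simp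
  also have "\<dots> = Pi\<^sub>M I (\<lambda>i. density lborel (f i))"
  proof (rule PiM_cong[OF refl])
    fix i assume "i \<in> I"
    have "distr M borel (X i) = distr M lborel (X i)" by (rule distr_cong) simp_all
    then show "distr M borel (X i) = density lborel (f i)" using law[OF \<open>i \<in> I\<close>] by simp
  qed
  also have "\<dots> = density (leb I) (\<lambda>x. \<Prod>i\<in>I. f i (x i))" by (rule PiM_density[OF I(1) f one])
  also have "distr M (Pi\<^sub>M I (\<lambda>_. borel)) (\<lambda>\<omega>. \<lambda>i\<in>I. X i \<omega>) = distr M (leb I) (\<lambda>\<omega>. \<lambda>i\<in>I. X i \<omega>)"
    by (rule distr_cong) (auto intro!: sets_PiM_cong)
  finally show ?thesis .
qed

lemma measurable_root_weight: "root_weight \<beta> a b n \<in> borel_measurable (tuple_space n)"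
proof -
  have c: "(\<lambda>z. z j) \<in> borel_measurable (tuple_space n)" if "j < n" for j
    using measurable_component_singleton[of j "{..<n}" "\<lambda>_. borel"] that by simp
  have cj: "(\<lambda>z. cnj (z j)) \<in> borel_measurable (tuple_space n)" if "j < n" for j
    using measurable_compose[OF c[OF that] borel_measurable_continuous_onI[of cnj]] by (simp add: continuous_on_cnj)
  have 1: "(\<lambda>z. cmod (1 - z j * cnj (z k))) \<in> borel_measurable (tuple_space n)" if "j < n" "k < n" for j k
    using measurable_compose[OF borel_measurable_diff[OF borel_measurable_const borel_measurable_times[OF c[OF that(1)] cj[OF that(2)]]] borel_measurable_norm] .
  have 2: "(\<lambda>z. cmod (1 - z j)) \<in> borel_measurable (tuple_space n)" "(\<lambda>z. cmod (1 + z j)) \<in> borel_measurable (tuple_space n)" if "j < n" for j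
    using measurable_compose[OF borel_measurable_diff[OF borel_measurable_const c[OF that]] borel_measurable_norm]
      measurable_compose[OF borel_measurable_add[OF borel_measurable_const c[OF that]] borel_measurable_norm] by blast+
  have pw: "(\<lambda>z. g z powr e) \<in> borel_measurable (tuple_space n)" if "g \<in> borel_measurable (tuple_space n)" for g :: "_ \<Rightarrow> real" and e
    using that by measurable
  show ?thesis unfolding root_weight_def
    by (intro borel_measurable_times borel_measurable_const pw borel_measurable_prod 1 2) auto
qed

lemma measurable_verblunsky_density: "verblunsky_density \<beta> a b k \<in> borel_measurable borel"
  unfolding verblunsky_density_def beta_density_def by (cases "even k") simp_all

lemma verblunsky_density_nonneg:
  assumes "\<beta> > 0" "a > -1" "b > -1"
  shows "verblunsky_density \<beta> a b k x \<ge> 0"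
proof -
  have nn: "beta_density s t x \<ge> 0" if "s > 0" "t > 0" for s t
    using that by (simp add: beta_density_def Gamma_real_pos less_imp_le)
  have "\<beta> * real k / 4 \<ge> 0" "odd k \<Longrightarrow> \<beta> * (real k - 1) / 4 \<ge> 0" "\<beta> * (real k + 1) / 4 > 0"
    using assms(1) odd_pos[of k] by (auto simp: divide_simps mult_le_0_iff zero_le_mult_iff)
  then show ?thesis using assms(2,3) unfolding verblunsky_density_def by (auto intro!: nn)
qed

(* @@@ K *)

lemma verblunsky_density_outside: "\<bar>x\<bar> \<ge> 1 \<Longrightarrow> verblunsky_density \<beta> a b k x = 0"
  by (auto simp: verblunsky_density_def beta_density_def abs_less_iff)

lemma prod_ennreal_verblunsky_density:
  assumes "\<beta> > 0" "a > -1" "b > -1"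
  shows "(\<Prod>k<n. ennreal (verblunsky_density \<beta> a b k (\<alpha> k))) = ennreal (\<Prod>k<n. verblunsky_density \<beta> a b k (\<alpha> k))"
  by (rule prod_ennreal) (rule verblunsky_density_nonneg[OF assms])

lemma AE_sortable_szego_coeffs:
  "AE \<alpha> in leb {..<n}. (\<forall>k<n. \<bar>\<alpha> k\<bar> < 1) \<longrightarrow> sortable n (szego_coeffs n \<alpha>)"
proof -
  let ?B = "{a \<in> space (leb {..<n}). \<not> sortable n a}" and ?C = "{\<alpha>. \<forall>k<n. \<bar>\<alpha> k\<bar> < 1}"
  let ?f = "\<lambda>\<alpha>. indicator ?B (szego_coeffs n \<alpha>) * ennreal (\<Prod>k<n. shear_jacobian k (\<alpha> k)) * indicator ?C \<alpha>"
  have "?B = space (leb {..<n}) - {a \<in> space (leb {..<n}). sortable n a}" by blast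
  then have B: "?B \<in> sets (leb {..<n})" using measurable_sortable[of n] by (simp only: sets.compl_sets)
  have iB: "(\<lambda>a. indicator ?B a :: ennreal) \<in> borel_measurable (leb {..<n})"
    by (rule borel_measurable_indicator[OF B])
  have "(\<integral>\<^sup>+\<alpha>. ?f \<alpha> \<partial>leb {..<n}) = (\<integral>\<^sup>+z. indicator ?B (root_coeffs n z) * ennreal (vandermonde n z) \<partial>wedge_measure n)"
    by (rule nn_integral_szego_coeffs_wedge[OF iB])
  also have "\<dots> = (\<integral>\<^sup>+z. 0 \<partial>wedge_measure n)"
  proof (rule nn_integral_wedge_measure_cong)
    show "(\<lambda>z. indicator ?B (root_coeffs n z) * ennreal (vandermonde n z)) \<in> borel_measurable (tuple_space n)"
      using borel_measurable_times_ennreal[OF measurable_compose[OF measurable_root_coeffs iB]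
        measurable_compose[OF measurable_vandermonde measurable_ennreal]] .
    show "indicator ?B (root_coeffs n z) * ennreal (vandermonde n z) = 0" if "z \<in> D_domain n" for z
      using sortable_root_coeffs[OF that] by simp
  qed simp
  finally have zero: "(\<integral>\<^sup>+\<alpha>. ?f \<alpha> \<partial>leb {..<n}) = 0" by simp
  have comp: "(\<lambda>\<alpha>. \<alpha> k) \<in> borel_measurable (leb {..<n})" if "k \<in> {..<n}" for k
    by (rule component_measurable_leb[OF that])
  have C: "{\<alpha> \<in> space (leb {..<n}). \<forall>k\<in>{..<n}. \<bar>\<alpha> k\<bar> < 1} \<in> sets (leb {..<n})"
  proof (rule sets.sets_Collect_finite_All)
    fix k assume "k \<in> {..<n}"
    then have [measurable]: "(\<lambda>\<alpha>. \<alpha> k) \<in> borel_measurable (leb {..<n})" by (rule comp)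
    show "{\<alpha> \<in> space (leb {..<n}). \<bar>\<alpha> k\<bar> < 1} \<in> sets (leb {..<n})" by measurable
  qed simp
  have iC: "(\<lambda>\<alpha>. indicator ?C \<alpha> :: ennreal) \<in> borel_measurable (leb {..<n})"
    by (rule measurable_cong[THEN iffD1, OF _ borel_measurable_indicator[OF C]]) (simp add: indicator_def Ball_def)
  have J: "(\<lambda>\<alpha>. ennreal (\<Prod>k<n. shear_jacobian k (\<alpha> k))) \<in> borel_measurable (leb {..<n})"
  proof -
    have "(\<lambda>\<alpha>. shear_jacobian k (\<alpha> k)) \<in> borel_measurable (leb {..<n})" if "k \<in> {..<n}" for k
      using comp[OF that] unfolding shear_jacobian_def by measurable
    then have P: "(\<lambda>\<alpha>. \<Prod>k<n. shear_jacobian k (\<alpha> k)) \<in> borel_measurable (leb {..<n})"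
      by (rule borel_measurable_prod)
    show ?thesis using measurable_compose[OF P measurable_ennreal] .
  qed
  have f: "?f \<in> borel_measurable (leb {..<n})"
    using borel_measurable_times_ennreal[OF borel_measurable_times_ennreal[OF measurable_compose[OF measurable_szego_coeffs iB] J] iC] .
  have "AE \<alpha> in leb {..<n}. ?f \<alpha> = 0" using zero nn_integral_0_iff_AE[OF f] by blast
  then show ?thesis
  proof (rule AE_mp, intro AE_I2 impI)
    fix \<alpha> assume sp: "\<alpha> \<in> space (leb {..<n})" and z: "?f \<alpha> = 0" and cube: "\<forall>k<n. \<bar>\<alpha> k\<bar> < 1"
    have "shear_jacobian k (\<alpha> k) > 0" if "k < n" for k
    proof -
      have "\<bar>\<alpha> k\<bar> < 1" using cube that by blast
      then have "0 < 1 - (\<alpha> k)\<^sup>2" "0 < 1 - \<alpha> k" by (simp_all add: abs_square_less_1)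
      then show ?thesis by (simp add: shear_jacobian_def)
    qed
    then have "(\<Prod>k<n. shear_jacobian k (\<alpha> k)) > 0" by (intro prod_pos) simp
    then have ne: "ennreal (\<Prod>k<n. shear_jacobian k (\<alpha> k)) \<noteq> 0" by (simp only: ennreal_eq_0_iff not_le)
    have C1: "indicator ?C \<alpha> = (1 :: ennreal)" using cube by simp
    have "szego_coeffs n \<alpha> \<notin> ?B"
    proof
      assume "szego_coeffs n \<alpha> \<in> ?B"
      then have B1: "indicator ?B (szego_coeffs n \<alpha>) = (1 :: ennreal)" by (rule indicator_simps(1))
      show False using z ne unfolding B1 C1 by (simp only: mult_1_left mult_1_right)
    qed
    then show "sortable n (szego_coeffs n \<alpha>)" using measurable_space[OF measurable_szego_coeffs sp] by blast
  qed
qed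

lemma nn_integral_verblunsky_density:
  assumes n: "n \<ge> 1" and pos: "\<beta> > 0" "a > -1" "b > -1" and A: "A \<in> sets (tuple_space n)"
  shows "(\<integral>\<^sup>+\<alpha>. ennreal (\<Prod>k<n. verblunsky_density \<beta> a b k (\<alpha> k)) * indicator A (cmv_eigenvalues n \<alpha>) \<partial>leb {..<n})
    = (\<integral>\<^sup>+z. ennreal (Re (joint_density \<beta> a b n z)) * indicator A z \<partial>wedge_measure n)"
proof -
  let ?G = "\<lambda>a'. ennreal (root_weight \<beta> a b n (root_tuple n a')) * indicator A (root_tuple n a')"
  have iA: "(\<lambda>z. indicator A z :: ennreal) \<in> borel_measurable (tuple_space n)"
    by (rule borel_measurable_indicator[OF A])
  have WA: "(\<lambda>z. ennreal (root_weight \<beta> a b n z) * indicator A z) \<in> borel_measurable (tuple_space n)"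
    using borel_measurable_times_ennreal[OF measurable_compose[OF measurable_root_weight measurable_ennreal] iA] .
  have G: "?G \<in> borel_measurable (leb {..<n})" using measurable_compose[OF measurable_root_tuple WA] .
  have "(\<integral>\<^sup>+\<alpha>. ennreal (\<Prod>k<n. verblunsky_density \<beta> a b k (\<alpha> k)) * indicator A (cmv_eigenvalues n \<alpha>) \<partial>leb {..<n})
      = (\<integral>\<^sup>+\<alpha>. ?G (szego_coeffs n \<alpha>) * ennreal (\<Prod>k<n. shear_jacobian k (\<alpha> k)) * indicator {\<alpha>. \<forall>k<n. \<bar>\<alpha> k\<bar> < 1} \<alpha> \<partial>leb {..<n})"
  proof (rule nn_integral_cong_AE, rule AE_mp[OF AE_sortable_szego_coeffs], intro AE_I2 impI)
    fix \<alpha> :: "nat \<Rightarrow> real"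
    assume s: "(\<forall>k<n. \<bar>\<alpha> k\<bar> < 1) \<longrightarrow> sortable n (szego_coeffs n \<alpha>)"
    show "ennreal (\<Prod>k<n. verblunsky_density \<beta> a b k (\<alpha> k)) * indicator A (cmv_eigenvalues n \<alpha>) =
      ?G (szego_coeffs n \<alpha>) * ennreal (\<Prod>k<n. shear_jacobian k (\<alpha> k)) * indicator {\<alpha>. \<forall>k<n. \<bar>\<alpha> k\<bar> < 1} \<alpha>"
    proof (cases "\<forall>k<n. \<bar>\<alpha> k\<bar> < 1")
      case True
      then have al: "\<And>k. k < n \<Longrightarrow> \<bar>\<alpha> k\<bar> < 1" and so: "sortable n (szego_coeffs n \<alpha>)" using s by blast+
      let ?z = "root_tuple n (szego_coeffs n \<alpha>)"
      have z: "monic_poly n (szego_coeffs n \<alpha>) = (\<Prod>j<n. [:- ?z j, 1:])"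
        using monic_poly_root_coeffs_D[of ?z n] so unfolding sortable_def by simp
      have d: "(\<Prod>k<n. verblunsky_density \<beta> a b k (\<alpha> k)) = root_weight \<beta> a b n ?z * (\<Prod>k<n. shear_jacobian k (\<alpha> k))"
        by (rule prod_verblunsky_density[OF z al pos n])
      have ind: "indicator {\<alpha>. \<forall>k<n. \<bar>\<alpha> k\<bar> < 1} \<alpha> = (1 :: ennreal)" using True by simp
      have ev: "cmv_eigenvalues n \<alpha> = ?z" by (rule cmv_eigenvalues_sortable[OF n _ so]) (rule al)
      show ?thesis
        unfolding d ennreal_mult'[OF root_weight_nonneg[OF pos]] ev ind by (simp only: mult_ac mult_1_left)
    next
      case False
      then obtain k where k: "k < n" "\<bar>\<alpha> k\<bar> \<ge> 1" by force
      then have p0: "(\<Prod>k<n. verblunsky_density \<beta> a b k (\<alpha> k)) = 0"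
        by (intro prod_zero bexI[of _ k]) (simp_all add: verblunsky_density_outside)
      have ind: "indicator {\<alpha>. \<forall>k<n. \<bar>\<alpha> k\<bar> < 1} \<alpha> = (0 :: ennreal)" using False by simp
      show ?thesis unfolding p0 ind by simp
    qed
  qed
  also have "\<dots> = (\<integral>\<^sup>+z. ?G (root_coeffs n z) * ennreal (vandermonde n z) \<partial>wedge_measure n)"
    by (rule nn_integral_szego_coeffs_wedge[OF G])
  also have "\<dots> = (\<integral>\<^sup>+z. ennreal (Re (joint_density \<beta> a b n z)) * indicator A z \<partial>wedge_measure n)"
  proof (rule nn_integral_wedge_measure_cong)
    show "(\<lambda>z. ?G (root_coeffs n z) * ennreal (vandermonde n z)) \<in> borel_measurable (tuple_space n)"
      using borel_measurable_times_ennreal[OF measurable_compose[OF measurable_root_coeffs G]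
        measurable_compose[OF measurable_vandermonde measurable_ennreal]] .
    show "(\<lambda>z. ennreal (Re (joint_density \<beta> a b n z)) * indicator A z) \<in> borel_measurable (tuple_space n)"
      using borel_measurable_times_ennreal[OF measurable_compose[OF measurable_compose[OF measurable_joint_density borel_measurable_Re] measurable_ennreal] iA] .
    show "?G (root_coeffs n z) * ennreal (vandermonde n z) = ennreal (Re (joint_density \<beta> a b n z)) * indicator A z"
      if "z \<in> D_domain n" for z
      unfolding root_tuple_root_coeffs_D[OF that] joint_density_D[OF that] Re_complex_of_real
        ennreal_mult'[OF root_weight_nonneg[OF pos]] by (simp only: mult_ac)
  qed
  finally show ?thesis .
qed

theorem theorem6p4:
  fixes \<Omega> :: "'w measure" and \<alpha> :: "nat \<Rightarrow> 'w \<Rightarrow> real"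
    and \<beta> a b :: real and n :: nat
    and Z :: "'w \<Rightarrow> nat \<Rightarrow> complex"
  assumes "prob_space \<Omega>"
    and "\<beta> > 0" and "a > -1" and "b > -1" and "n \<ge> 1"
    and "prob_space.indep_vars \<Omega> (\<lambda>_. borel) \<alpha> {..<n}"
    and "\<And>k. k < n \<Longrightarrow> even k \<Longrightarrow>
           has_beta_distribution \<Omega> (\<alpha> k) (\<beta> * real k / 4 + a + 1) (\<beta> * real k / 4 + b + 1)"
    and "\<And>k. k < n \<Longrightarrow> odd k \<Longrightarrow>
           has_beta_distribution \<Omega> (\<alpha> k) (\<beta> * (real k - 1) / 4 + a + b + 2) (\<beta> * (real k + 1) / 4)"
  defines "Z \<equiv> (\<lambda>\<omega>. eigenvalue_tuple n (cmv n (\<lambda>k. complex_of_real (\<alpha> k \<omega>))))"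
  shows "(AE \<omega> in \<Omega>. Z \<omega> \<in> D_domain n \<and>
            lists_eigenvalues n (cmv n (\<lambda>k. complex_of_real (\<alpha> k \<omega>))) (Z \<omega>)) \<and>
         (\<forall>z\<in>D_domain n. joint_density \<beta> a b n z \<in> \<real>\<^sub>\<ge>\<^sub>0) \<and>
         distributed \<Omega> (wedge_measure n) Z (\<lambda>z. ennreal (Re (joint_density \<beta> a b n z)))"
proof -
  interpret prob_space \<Omega> by fact
  note pos = assms(2-4) and n = assms(5)
  let ?d = "\<lambda>\<alpha>. \<Prod>k<n. verblunsky_density \<beta> a b k (\<alpha> k)"
  define X where "X \<omega> = (\<lambda>k\<in>{..<n}. \<alpha> k \<omega>)" for \<omega>
  have dist: "distributed \<Omega> lborel (\<alpha> k) (\<lambda>x. ennreal (verblunsky_density \<beta> a b k x))" if "k \<in> {..<n}" for k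
    using assms(7,8)[of k] that unfolding has_beta_distribution_def verblunsky_density_def by (cases "even k") simp_all
  have X: "X \<in> \<Omega> \<rightarrow>\<^sub>M leb {..<n}"
    unfolding X_def by (rule measurable_restrict) (use dist in \<open>simp add: distributed_def\<close>)
  have law: "distr \<Omega> (leb {..<n}) X = density (leb {..<n}) (\<lambda>\<alpha>. ennreal (?d \<alpha>))"
    unfolding X_def prod_ennreal_verblunsky_density[OF pos, symmetric]
  proof (rule distr_indep_densities)
    show "{..<n} \<noteq> {}" using n by (simp add: lessThan_empty_iff)
  qed (use assms(6) dist in auto)
  have d_meas: "(\<lambda>\<alpha>. ennreal (?d \<alpha>)) \<in> borel_measurable (leb {..<n})"
  proof -
    have "(\<lambda>\<alpha>. verblunsky_density \<beta> a b k (\<alpha> k)) \<in> borel_measurable (leb {..<n})" if "k \<in> {..<n}" for k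
      using measurable_compose[OF component_measurable_leb[OF that] measurable_verblunsky_density] .
    then have P: "(\<lambda>\<alpha>. ?d \<alpha>) \<in> borel_measurable (leb {..<n})" by (rule borel_measurable_prod)
    show ?thesis using measurable_compose[OF P measurable_ennreal] .
  qed
  have cmv: "cmv n (\<lambda>k. complex_of_real (\<alpha> k \<omega>)) = cmv n (\<lambda>k. complex_of_real (X \<omega> k))" for \<omega>
    by (rule cmv_cong) (simp add: X_def)
  have Z: "Z \<omega> = cmv_eigenvalues n (X \<omega>)" for \<omega>
    unfolding Z_def cmv_eigenvalues_def cmv ..
  have "AE x in leb {..<n}. 0 < ennreal (?d x) \<longrightarrow> (\<forall>k<n. \<bar>x k\<bar> < 1) \<and> sortable n (szego_coeffs n x)"
  proof (rule AE_mp[OF AE_sortable_szego_coeffs], intro AE_I2 impI)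
    fix x :: "nat \<Rightarrow> real"
    assume s: "(\<forall>k<n. \<bar>x k\<bar> < 1) \<longrightarrow> sortable n (szego_coeffs n x)" and p: "0 < ennreal (?d x)"
    have "\<bar>x k\<bar> < 1" if "k < n" for k
    proof (rule ccontr)
      assume "\<not> \<bar>x k\<bar> < 1"
      then have p0: "?d x = 0" using that by (intro prod_zero bexI[of _ k]) (simp_all add: verblunsky_density_outside)
      show False using p unfolding p0 by simp
    qed
    then show "(\<forall>k<n. \<bar>x k\<bar> < 1) \<and> sortable n (szego_coeffs n x)" using s by blast
  qed
  then have "AE x in distr \<Omega> (leb {..<n}) X. (\<forall>k<n. \<bar>x k\<bar> < 1) \<and> sortable n (szego_coeffs n x)"
    unfolding law by (simp only: AE_density[OF d_meas])
  then have good: "AE \<omega> in \<Omega>. (\<forall>k<n. \<bar>X \<omega> k\<bar> < 1) \<and> sortable n (szego_coeffs n (X \<omega>))"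
    by (rule AE_distrD[OF X])
  have 1: "AE \<omega> in \<Omega>. Z \<omega> \<in> D_domain n \<and> lists_eigenvalues n (cmv n (\<lambda>k. complex_of_real (\<alpha> k \<omega>))) (Z \<omega>)"
  proof (rule AE_mp[OF good], intro AE_I2 impI)
    fix \<omega> assume h: "(\<forall>k<n. \<bar>X \<omega> k\<bar> < 1) \<and> sortable n (szego_coeffs n (X \<omega>))"
    then show "Z \<omega> \<in> D_domain n \<and> lists_eigenvalues n (cmv n (\<lambda>k. complex_of_real (\<alpha> k \<omega>))) (Z \<omega>)"
      unfolding Z cmv using cmv_eigenvalues_in_D[OF n, of "X \<omega>"] lists_cmv_eigenvalues[OF n, of "X \<omega>"] by blast
  qed
  have 2: "joint_density \<beta> a b n z \<in> \<real>\<^sub>\<ge>\<^sub>0" if "z \<in> D_domain n" for z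
    unfolding joint_density_D[OF that] nonneg_Reals_of_real_iff
    by (intro mult_nonneg_nonneg root_weight_nonneg[OF pos] vandermonde_nonneg)
  have ms: "N \<rightarrow>\<^sub>M wedge_measure n = N \<rightarrow>\<^sub>M tuple_space n" for N :: "'x measure"
    by (rule measurable_cong_sets[OF refl sets_wedge_measure])
  have E: "cmv_eigenvalues n \<in> leb {..<n} \<rightarrow>\<^sub>M wedge_measure n"
    unfolding ms by (rule measurable_cmv_eigenvalues[OF n])
  have Zm: "Z \<in> \<Omega> \<rightarrow>\<^sub>M wedge_measure n"
    using measurable_compose[OF X E] unfolding Z[abs_def] .
  have jd: "(\<lambda>z. ennreal (Re (joint_density \<beta> a b n z))) \<in> borel_measurable (wedge_measure n)"
    unfolding measurable_cong_sets[OF sets_wedge_measure refl]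
    using measurable_compose[OF measurable_compose[OF measurable_joint_density borel_measurable_Re] measurable_ennreal] .
  have "distr \<Omega> (wedge_measure n) Z = density (wedge_measure n) (\<lambda>z. ennreal (Re (joint_density \<beta> a b n z)))"
  proof (rule measure_eqI)
    fix A assume "A \<in> sets (distr \<Omega> (wedge_measure n) Z)"
    then have A: "A \<in> sets (wedge_measure n)" by simp
    have pre: "cmv_eigenvalues n -` A \<inter> space (leb {..<n}) \<in> sets (leb {..<n})" by (rule measurable_sets[OF E A])
    have "distr \<Omega> (wedge_measure n) Z = distr (distr \<Omega> (leb {..<n}) X) (wedge_measure n) (cmv_eigenvalues n)"
      unfolding distr_distr[OF E X] Z[abs_def] comp_def ..
    then have "emeasure (distr \<Omega> (wedge_measure n) Z) A
        = emeasure (density (leb {..<n}) (\<lambda>\<alpha>. ennreal (?d \<alpha>))) (cmv_eigenvalues n -` A \<inter> space (leb {..<n}))"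
      unfolding law using emeasure_distr[of "cmv_eigenvalues n" "density (leb {..<n}) (\<lambda>\<alpha>. ennreal (?d \<alpha>))", OF _ A] E
      by (simp add: measurable_def)
    also have "\<dots> = (\<integral>\<^sup>+\<alpha>. ennreal (?d \<alpha>) * indicator (cmv_eigenvalues n -` A \<inter> space (leb {..<n})) \<alpha> \<partial>leb {..<n})"
      by (rule emeasure_density[OF d_meas pre])
    also have "\<dots> = (\<integral>\<^sup>+\<alpha>. ennreal (?d \<alpha>) * indicator A (cmv_eigenvalues n \<alpha>) \<partial>leb {..<n})"
      by (rule nn_integral_cong) (simp add: indicator_def)
    also have "\<dots> = (\<integral>\<^sup>+z. ennreal (Re (joint_density \<beta> a b n z)) * indicator A z \<partial>wedge_measure n)"
      by (rule nn_integral_verblunsky_density[OF n pos]) (use A in \<open>simp only: sets_wedge_measure\<close>)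
    also have "\<dots> = emeasure (density (wedge_measure n) (\<lambda>z. ennreal (Re (joint_density \<beta> a b n z)))) A"
      by (rule emeasure_density[OF jd A, symmetric])
    finally show "emeasure (distr \<Omega> (wedge_measure n) Z) A = emeasure (density (wedge_measure n) (\<lambda>z. ennreal (Re (joint_density \<beta> a b n z)))) A" .
  qed simp
  then have 3: "distributed \<Omega> (wedge_measure n) Z (\<lambda>z. ennreal (Re (joint_density \<beta> a b n z)))"
    unfolding distributed_def using jd Zm by blast
  show ?thesis using 1 2 3 by blast
qed

end
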